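(* Let $\Omega\subset\mathbb{R}^2$ be a curved planar strip of width $d$ along a curve $\Gamma$ whose signed curvature $\gamma$ satisfies, for some constant $\beta>0$, $$|\gamma(s)|,\ |\dot\gamma(s)|,\ |\ddot\gamma(s)|,\ |\dddot\gamma(s)|\le\frac{\beta}{1+s^2},\qquad s\in\mathbb{R}.$$ Suppose that the real-valued magnetic vector potential $A=(a_1,a_2)$ is such that for $j=1,2$ the functions $a_j,\ \frac{\partial a_j}{\partial x},\ \frac{\partial a_j}{\partial y}$ vanish at infinity in the waveguide, i.e. tend to $0$ as $|(x,y)|\to\infty$, $(x,y)\in\Omega$. Then the essential spectrum of the operator $H_\Omega(A)=(i\nabla+A)^2$ (with Dirichlet boundary conditions on $\partial\Omega$) coincides with the half-line $\left[\frac{\pi^2}{d^2},\infty\right)$.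
   Context: **The curved strip.** Let $d>0$ and let $a,b:\mathbb{R}\to\mathbb{R}$ be smooth functions with $\dot a(s)^2+\dot b(s)^2=1$ for all $s$ (dot denotes $d/ds$), so that $s$ is the arc length of the reference curve $\Gamma=\{(a(s),b(s)):s\in\mathbb{R}\}$. The signed curvature of $\Gamma$ is $\gamma(s)=\dot b(s)\ddot a(s)-\dot a(s)\ddot b(s)$. The curved strip of width $d$ along $\Gamma$ is $$\Omega=\{(x(s,u),y(s,u)):\ s\in\mathbb{R},\ u\in(0,d)\},\qquad x(s,u)=a(s)-u\,\dot b(s),\quad y(s,u)=b(s)+u\,\dot a(s).$$ It is assumed throughout that $d|\gamma(s)|<1$ for every $s\in\mathbb{R}$ and that $\Omega$ does not intersect itself, i.e. $(s,u)\mapsto(x(s,u),y(s,u))$ is injective on $\mathbb{R}\times(0,d)$. **The operator.** $A=(a_1,a_2):\mathbb{R}^2\to\mathbb{R}^2$ is a continuously differentiable vector potential. The magnetic Dirichlet Laplacian $H_\Omega(A)=(i\nabla+A)^2$ is the self-adjoint operator in $L^2(\Omega)$ associated with the quadratic form $$q(\varphi)=\int_\Omega\left(\left|i\frac{\partial\varphi}{\partial x}+a_1\varphi\right|^2+\left|i\frac{\partial\varphi}{\partial y}+a_2\varphi\right|^2\right)dx\,dy,\qquad \varphi\in\mathcal{H}_0^1(\Omega).$$ *)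

theory Defs
  imports "HOL-Analysis.Analysis"
begin

definition partial_deriv :: "'a::euclidean_space \<Rightarrow> ('a \<Rightarrow> 'b::real_normed_vector) \<Rightarrow> 'a \<Rightarrow> 'b"
  where "partial_deriv e f p = frechet_derivative f (at p) e"

fun C_k :: "nat \<Rightarrow> ('a::euclidean_space \<Rightarrow> 'b::real_normed_vector) \<Rightarrow> bool" where
  "C_k 0 f \<longleftrightarrow> continuous_on UNIV f"
| "C_k (Suc k) f \<longleftrightarrow> (\<forall>p. f differentiable (at p)) \<and> (\<forall>e\<in>Basis. C_k k (partial_deriv e f))"

definition smooth :: "('a::euclidean_space \<Rightarrow> 'b::real_normed_vector) \<Rightarrow> bool"
  where "smooth f \<longleftrightarrow> (\<forall>k. C_k k f)"

definition test_functions :: "'a::euclidean_space set \<Rightarrow> ('a \<Rightarrow> complex) set"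
  where "test_functions \<Omega> =
    {\<psi>. smooth \<psi> \<and> compact (closure {p. \<psi> p \<noteq> 0}) \<and> closure {p. \<psi> p \<noteq> 0} \<subseteq> \<Omega>}"

text \<open>
  Elements of $L^2(M)$ are represented by square-integrable functions, and equality in $L^2(M)$
  is equality almost everywhere. An operator in $L^2(M)$ is given by its graph, a set of pairs
  of representatives.
\<close>

definition L2 :: "'a measure \<Rightarrow> ('a \<Rightarrow> complex) set"
  where "L2 M = {f. f \<in> borel_measurable M \<and> integrable M (\<lambda>p. (norm (f p))\<^sup>2)}"

definition L2_inner :: "'a measure \<Rightarrow> ('a \<Rightarrow> complex) \<Rightarrow> ('a \<Rightarrow> complex) \<Rightarrow> complex"
  where "L2_inner M f g = (\<integral>p. f p * cnj (g p) \<partial>M)"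

definition L2_norm :: "'a measure \<Rightarrow> ('a \<Rightarrow> complex) \<Rightarrow> real"
  where "L2_norm M f = sqrt (\<integral>p. (norm (f p))\<^sup>2 \<partial>M)"

type_synonym 'a operator = "(('a \<Rightarrow> complex) \<times> ('a \<Rightarrow> complex)) set"

text \<open>
  The estimate in the second conjunct says both that \<open>T - z\<close> is injective (up to null sets) and
  that its inverse is bounded.
\<close>

definition resolvent_set :: "'a measure \<Rightarrow> 'a operator \<Rightarrow> complex set"
  where "resolvent_set M T =
    {z. (\<forall>f\<in>L2 M. \<exists>(\<phi>, g)\<in>T. AE p in M. g p - z * \<phi> p = f p) \<and>
        (\<exists>C. \<forall>(\<phi>, g)\<in>T. L2_norm M \<phi> \<le> C * L2_norm M (\<lambda>p. g p - z * \<phi> p))}"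

definition spectrum :: "'a measure \<Rightarrow> 'a operator \<Rightarrow> complex set"
  where "spectrum M T = - resolvent_set M T"

definition eigenspace :: "'a measure \<Rightarrow> 'a operator \<Rightarrow> complex \<Rightarrow> ('a \<Rightarrow> complex) set"
  where "eigenspace M T z = {\<phi>. \<exists>g. (\<phi>, g) \<in> T \<and> (AE p in M. g p = z * \<phi> p)}"

definition is_eigenvalue :: "'a measure \<Rightarrow> 'a operator \<Rightarrow> complex \<Rightarrow> bool"
  where "is_eigenvalue M T z \<longleftrightarrow> (\<exists>\<phi>\<in>eigenspace M T z. \<not> (AE p in M. \<phi> p = 0))"

text \<open>
  Geometric multiplicity, which equals the algebraic one for the self-adjoint operators considered.
\<close>

definition finite_multiplicity :: "'a measure \<Rightarrow> 'a operator \<Rightarrow> complex \<Rightarrow> bool"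
  where "finite_multiplicity M T z \<longleftrightarrow>
    (\<exists>B. finite B \<and> B \<subseteq> eigenspace M T z \<and>
      (\<forall>\<phi>\<in>eigenspace M T z. \<exists>c. AE p in M. \<phi> p = (\<Sum>b\<in>B. c b * b p)))"

definition discrete_spectrum :: "'a measure \<Rightarrow> 'a operator \<Rightarrow> complex set"
  where "discrete_spectrum M T =
    {z. z isolated_in spectrum M T \<and> is_eigenvalue M T z \<and> finite_multiplicity M T z}"

definition essential_spectrum :: "'a measure \<Rightarrow> 'a operator \<Rightarrow> complex set"
  where "essential_spectrum M T = spectrum M T - discrete_spectrum M T"

text \<open>
  The operator associated with a sesquilinear form \<open>h\<close> (linear in the first argument) with form
  domain \<open>D\<close>, in the sense of the representation theorem for closed semibounded forms.
\<close>

definition form_operator ::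
    "'a measure \<Rightarrow> ('a \<Rightarrow> complex) set \<Rightarrow> (('a \<Rightarrow> complex) \<Rightarrow> ('a \<Rightarrow> complex) \<Rightarrow> complex) \<Rightarrow> 'a operator"
  where "form_operator M D h =
    {(\<phi>, f). \<phi> \<in> D \<and> f \<in> L2 M \<and> (\<forall>\<psi>\<in>D. h \<phi> \<psi> = L2_inner M f \<psi>)}"

abbreviation lborel_on :: "'a::euclidean_space set \<Rightarrow> 'a measure"
  where "lborel_on \<Omega> \<equiv> restrict_space lborel \<Omega>"

definition is_weak_partial ::
    "'a::euclidean_space set \<Rightarrow> 'a \<Rightarrow> ('a \<Rightarrow> complex) \<Rightarrow> ('a \<Rightarrow> complex) \<Rightarrow> bool"
  where "is_weak_partial \<Omega> e \<phi> g \<longleftrightarrow> g \<in> L2 (lborel_on \<Omega>) \<and>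
    (\<forall>\<psi>\<in>test_functions \<Omega>.
      (\<integral>p. \<phi> p * partial_deriv e \<psi> p \<partial>lborel_on \<Omega>) = - (\<integral>p. g p * \<psi> p \<partial>lborel_on \<Omega>))"

text \<open>The weak derivative is unique up to null sets, so all integrals below are independent of the
  chosen representative.\<close>

definition weak_partial ::
    "'a::euclidean_space set \<Rightarrow> 'a \<Rightarrow> ('a \<Rightarrow> complex) \<Rightarrow> 'a \<Rightarrow> complex"
  where "weak_partial \<Omega> e \<phi> = (SOME g. is_weak_partial \<Omega> e \<phi> g)"

definition H1 :: "'a::euclidean_space set \<Rightarrow> ('a \<Rightarrow> complex) set"
  where "H1 \<Omega> = {\<phi>\<in>L2 (lborel_on \<Omega>). \<forall>e\<in>Basis. \<exists>g. is_weak_partial \<Omega> e \<phi> g}"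

definition H1_norm :: "'a::euclidean_space set \<Rightarrow> ('a \<Rightarrow> complex) \<Rightarrow> real"
  where "H1_norm \<Omega> \<phi> = sqrt ((L2_norm (lborel_on \<Omega>) \<phi>)\<^sup>2 +
    (\<Sum>e\<in>Basis. (L2_norm (lborel_on \<Omega>) (weak_partial \<Omega> e \<phi>))\<^sup>2))"

definition H1_0 :: "'a::euclidean_space set \<Rightarrow> ('a \<Rightarrow> complex) set"
  where "H1_0 \<Omega> = {\<phi>\<in>H1 \<Omega>. \<exists>\<psi>. (\<forall>n. \<psi> n \<in> test_functions \<Omega>) \<and>
    (\<lambda>n. H1_norm \<Omega> (\<lambda>p. \<psi> n p - \<phi> p)) \<longlonglongrightarrow> 0}"

definition magnetic_partial ::
    "'a::euclidean_space set \<Rightarrow> ('a \<Rightarrow> 'a) \<Rightarrow> 'a \<Rightarrow> ('a \<Rightarrow> complex) \<Rightarrow> 'a \<Rightarrow> complex"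
  where "magnetic_partial \<Omega> A e \<phi> p = \<i> * weak_partial \<Omega> e \<phi> p + of_real (A p \<bullet> e) * \<phi> p"

definition magnetic_quadratic_form ::
    "'a::euclidean_space set \<Rightarrow> ('a \<Rightarrow> 'a) \<Rightarrow> ('a \<Rightarrow> complex) \<Rightarrow> real"
  where "magnetic_quadratic_form \<Omega> A \<phi> =
    (\<integral>p. (\<Sum>e\<in>Basis. (norm (magnetic_partial \<Omega> A e \<phi> p))\<^sup>2) \<partial>lborel_on \<Omega>)"

definition magnetic_form ::
    "'a::euclidean_space set \<Rightarrow> ('a \<Rightarrow> 'a) \<Rightarrow> ('a \<Rightarrow> complex) \<Rightarrow> ('a \<Rightarrow> complex) \<Rightarrow> complex"
  where "magnetic_form \<Omega> A \<phi> \<psi> =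
    (\<integral>p. (\<Sum>e\<in>Basis. magnetic_partial \<Omega> A e \<phi> p * cnj (magnetic_partial \<Omega> A e \<psi> p)) \<partial>lborel_on \<Omega>)"

lemma magnetic_form_diagonal:
  "magnetic_form \<Omega> A \<phi> \<phi> = of_real (magnetic_quadratic_form \<Omega> A \<phi>)"
  unfolding magnetic_form_def magnetic_quadratic_form_def
  by (simp add: complex_norm_square[symmetric] flip: integral_complex_of_real of_real_power of_real_sum)

definition magnetic_laplacian :: "'a::euclidean_space set \<Rightarrow> ('a \<Rightarrow> 'a) \<Rightarrow> 'a operator"
  where "magnetic_laplacian \<Omega> A = form_operator (lborel_on \<Omega>) (H1_0 \<Omega>) (magnetic_form \<Omega> A)"

definition curvature :: "(real \<Rightarrow> real) \<Rightarrow> (real \<Rightarrow> real) \<Rightarrow> real \<Rightarrow> real"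
  where "curvature a b s = deriv b s * deriv (deriv a) s - deriv a s * deriv (deriv b) s"

definition strip_map :: "(real \<Rightarrow> real) \<Rightarrow> (real \<Rightarrow> real) \<Rightarrow> real \<times> real \<Rightarrow> real \<times> real"
  where "strip_map a b = (\<lambda>(s, u). (a s - u * deriv b s, b s + u * deriv a s))"

definition curved_strip :: "(real \<Rightarrow> real) \<Rightarrow> (real \<Rightarrow> real) \<Rightarrow> real \<Rightarrow> (real \<times> real) set"
  where "curved_strip a b d = strip_map a b ` (UNIV \<times> {0<..<d})"

end

theory Submission
  imports Defs "HOL-Library.Function_Algebras"
begin

text \<open>
  Two estimates on the form decide the theorem, because the coordinates \<open>(s, u)\<close> turn the Laplacian into
  \<open>\<integral> (|w\<^sub>s|\<^sup>2 / J + J |w\<^sub>u|\<^sup>2) ds du\<close> with \<open>J = 1 + u \<gamma>(s)\<close>, and both \<open>J - 1\<close> and \<open>A\<close> are small for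
  large \<open>|s|\<close>. The latter holds because a curve of integrable curvature runs off to infinity
  (\<open>curve_to_infinity\<close>), so that decay of \<open>A\<close> in the plane is decay in \<open>s\<close>.

  Below \<open>(\<pi> / d)\<^sup>2\<close>. On every fibre far out, the one-dimensional Dirichlet inequality gives the form at least
  almost \<open>(\<pi> / d)\<^sup>2 \<parallel>w\<parallel>\<^sup>2\<close>. On the remaining bounded rectangle, the Poincare inequality on small cells bounds
  the \<open>L\<^sup>2\<close> norm by a small multiple of the Dirichlet integral and finitely many cell means. Hence for each
  \<open>\<mu> < (\<pi> / d)\<^sup>2\<close> the form plus a finite-rank term is at least \<open>\<mu>\<close> (\<open>finite_rank_bound_below_threshold\<close>), and
  by abstract Hilbert space theory the spectrum below \<open>\<mu>\<close> consists of finitely many eigenvalues of finite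
  multiplicity (locale \<open>finite_rank_bound\<close>).

  Above \<open>(\<pi> / d)\<^sup>2\<close>. Wave packets \<open>e\<^sup>i\<^sup>k\<^sup>s \<theta>(s) sin(\<pi> u / d)\<close>, supported far out and spread over long
  intervals, are approximate eigenfunctions for \<open>k\<^sup>2 + (\<pi> / d)\<^sup>2\<close>; the sine is trimmed near the boundary to
  make them compactly supported. They are only controlled in the form sense, so Weyl's criterion is used in
  a form version (\<open>not_regularI\<close>). The whole half-line thus lies in the spectrum, and a half-line
  has no isolated points.

  The operator is defined by its form on \<open>H\<^sup>1\<^sub>0\<close>, with functions as representatives. So the abstract part works
  with positive semidefinite inner products, where null vectors play the part of functions vanishing almost
  everywhere; completeness of \<open>L\<^sup>2\<close> and of \<open>H\<^sup>1\<^sub>0\<close>, mollification and the change of variables complete it.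
\<close>

section \<open>Spaces with a semidefinite inner product\<close>

lemma mult_cnj_self: "z * cnj z = (complex_of_real (cmod z))\<^sup>2"
  by (metis complex_norm_square of_real_power)

lemma quadratic_nonneg_imp_le:
  fixes X P Y :: real
  assumes "!!t. 0 <= X - 2 * t * P + t\<^sup>2 * P * Y" "0 <= P" "0 <= Y"
  shows "P <= X * Y"
proof (cases "Y = 0")
  case True
  show ?thesis
  proof (rule ccontr)
    assume "\<not> ?thesis"
    then have "P > 0" using True by simp
    then show False using assms(1)[of "(X + 1) / (2 * P)"] True by (simp add: field_simps)
  qed
next
  case False
  then have "Y > 0" using assms by simp
  have "0 <= X - 2 * (1/Y) * P + (1/Y)\<^sup>2 * P * Y" by (rule assms)
  also have "... = X - P / Y" using \<open>Y > 0\<close> by (simp add: power2_eq_square field_simps)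
  finally show ?thesis using \<open>Y > 0\<close> by (simp add: field_simps)
qed

text \<open>The form is only semidefinite, and \<open>V\<close> is a subset of the ambient vector space: elements of \<open>L\<^sup>2\<close> are
  functions, and norm zero means vanishing almost everywhere.\<close>

locale semi_inner = vector_space scale
  for scale :: "complex => 'v::ab_group_add => 'v" (infixr \<open>*c\<close> 75) +
  fixes V :: "'v set" and ip :: "'v => 'v => complex"
  assumes V_zero [simp]: "0 \<in> V"
    and V_add [simp]: "x \<in> V ==> y \<in> V ==> x + y \<in> V"
    and V_scale [simp]: "x \<in> V ==> c *c x \<in> V"
    and ip_add_left: "x \<in> V ==> y \<in> V ==> z \<in> V ==> ip (x + y) z = ip x z + ip y z"
    and ip_scale_left: "x \<in> V ==> y \<in> V ==> ip (c *c x) y = c * ip x y"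
    and ip_commute: "x \<in> V ==> y \<in> V ==> ip x y = cnj (ip y x)"
    and ip_nonneg [simp]: "0 <= Re (ip x x)"
begin

definition nrm :: "'v => real" where "nrm x = sqrt (Re (ip x x))"

definition complete_space :: bool where
  "complete_space \<longleftrightarrow> (\<forall>X. (\<forall>n. X n \<in> V) \<and> (\<forall>e>0. \<exists>N. \<forall>m\<ge>N. \<forall>n\<ge>N. nrm (X m - X n) < e) -->
     (\<exists>l\<in>V. (\<lambda>n::nat. nrm (X n - l)) \<longlonglongrightarrow> 0))"

lemma V_minus [simp]: "x \<in> V ==> - x \<in> V"
  using V_scale[of x "-1"] by simp

lemma V_diff [simp]: "x \<in> V ==> y \<in> V ==> x - y \<in> V"
  using V_add[of x "-y"] by simp

lemma V_sum: "(!!i. i \<in> I ==> f i \<in> V) ==> sum f I \<in> V"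
  by (induction I rule: infinite_finite_induct) auto

lemma ip_minus_left: "x \<in> V ==> y \<in> V ==> ip (- x) y = - ip x y"
  using ip_scale_left[of x y "-1"] by simp

lemma ip_diff_left: "x \<in> V ==> y \<in> V ==> z \<in> V ==> ip (x - y) z = ip x z - ip y z"
  using ip_add_left[of x "-y" z] by (simp add: ip_minus_left)

lemma ip_add_right: "x \<in> V ==> y \<in> V ==> z \<in> V ==> ip z (x + y) = ip z x + ip z y"
  by (metis (no_types) V_add complex_cnj_add ip_add_left ip_commute)

lemma ip_scale_right: "x \<in> V ==> y \<in> V ==> ip x (c *c y) = cnj c * ip x y"
  by (metis (no_types) V_scale complex_cnj_mult ip_scale_left ip_commute)

lemma ip_minus_right: "x \<in> V ==> y \<in> V ==> ip x (- y) = - ip x y"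
  using ip_scale_right[of x y "-1"] by simp

lemma ip_diff_right: "x \<in> V ==> y \<in> V ==> z \<in> V ==> ip z (x - y) = ip z x - ip z y"
  using ip_add_right[of x "-y" z] by (simp add: ip_minus_right)

lemma ip_zero_left [simp]: "y \<in> V ==> ip 0 y = 0"
  using ip_scale_left[of 0 y 0] by simp

lemma ip_sum_left: "(!!i. i \<in> I ==> f i \<in> V) ==> y \<in> V ==> ip (sum f I) y = (\<Sum>i\<in>I. ip (f i) y)"
  by (induction I rule: infinite_finite_induct) (auto simp: ip_add_left V_sum)

lemma ip_sum_right: "(!!i. i \<in> I ==> f i \<in> V) ==> y \<in> V ==> ip y (sum f I) = (\<Sum>i\<in>I. ip y (f i))"
  using ip_sum_left[of I f y] ip_commute[of y "sum f I"] ip_commute[of y]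
  by (simp add: V_sum)

lemma ip_self: "x \<in> V ==> ip x x = of_real ((nrm x)\<^sup>2)"
proof -
  assume x: "x \<in> V"
  have "Im (ip x x) = 0" using ip_commute[OF x x] by (metis add.inverse_neutral cnj.simps(2) equal_neg_zero)
  then show ?thesis using ip_nonneg by (simp add: nrm_def complex_eq_iff)
qed

lemma nrm_nonneg [simp]: "0 <= nrm x"
  by (simp add: nrm_def)

lemma nrm_sq: "(nrm x)\<^sup>2 = Re (ip x x)"
  by (simp add: nrm_def)

lemma nrm_zero [simp]: "nrm 0 = 0"
  by (simp add: nrm_def)

lemma nrm_sq_diff_scale:
  assumes "x \<in> V" "y \<in> V"
  shows "(nrm (x - c *c y))\<^sup>2 = (nrm x)\<^sup>2 - 2 * Re (cnj c * ip x y) + (cmod c)\<^sup>2 * (nrm y)\<^sup>2"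
proof -
  have "ip (x - c *c y) (x - c *c y) = ip x x - cnj c * ip x y - c * ip y x + c * cnj c * ip y y"
    using assms by (simp add: ip_diff_left ip_diff_right ip_scale_left ip_scale_right algebra_simps)
  also have "c * ip y x = cnj (cnj c * ip x y)"
    using ip_commute[OF assms] by simp
  also have "c * cnj c = of_real ((cmod c)\<^sup>2)" by (simp only: complex_norm_square)
  also have "ip x x - cnj c * ip x y - cnj (cnj c * ip x y) + of_real ((cmod c)\<^sup>2) * ip y y
    = of_real ((nrm x)\<^sup>2 - 2 * Re (cnj c * ip x y) + (cmod c)\<^sup>2 * (nrm y)\<^sup>2)"
    using assms complex_add_cnj[of "cnj c * ip x y"]
    by (simp add: ip_self algebra_simps del: complex_cnj_mult)
  finally show ?thesis by (metis nrm_sq Re_complex_of_real)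
qed

lemma Cauchy_Schwarz:
  assumes "x \<in> V" "y \<in> V"
  shows "cmod (ip x y) <= nrm x * nrm y"
proof -
  have "(cmod (ip x y))\<^sup>2 <= (nrm x)\<^sup>2 * (nrm y)\<^sup>2"
  proof (rule quadratic_nonneg_imp_le)
    fix t :: real
    let ?c = "of_real t * ip x y"
    have "cnj ?c * ip x y = of_real (t * (cmod (ip x y))\<^sup>2)"
      by (simp add: mult_cnj_self mult_ac)
    moreover have "(cmod ?c)\<^sup>2 = t\<^sup>2 * (cmod (ip x y))\<^sup>2" by (simp add: norm_mult power_mult_distrib)
    ultimately show "0 <= (nrm x)\<^sup>2 - 2 * t * (cmod (ip x y))\<^sup>2 + t\<^sup>2 * (cmod (ip x y))\<^sup>2 * (nrm y)\<^sup>2"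
      using nrm_sq_diff_scale[OF assms, of ?c] zero_le_power2[of "nrm (x - ?c *c y)"]
      by (simp add: mult_ac del: of_real_mult of_real_power)
  qed auto
  then show ?thesis by (metis nrm_nonneg mult_nonneg_nonneg power2_le_imp_le power_mult_distrib)
qed

lemma nrm_scale: "x \<in> V ==> nrm (c *c x) = cmod c * nrm x"
  using nrm_sq_diff_scale[of 0 x "-c"]
  by (simp add: power_mult_distrib[symmetric] power2_eq_iff_nonneg)

lemma nrm_minus_commute: "x \<in> V ==> y \<in> V ==> nrm (x - y) = nrm (y - x)"
  using nrm_scale[of "x - y" "-1"] by simp

lemma nrm_triangle:
  assumes "x \<in> V" "y \<in> V"
  shows "nrm (x + y) <= nrm x + nrm y"
proof -
  have "(nrm (x + y))\<^sup>2 = (nrm x)\<^sup>2 + 2 * Re (ip x y) + (nrm y)\<^sup>2"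
    using nrm_sq_diff_scale[OF assms, of "-1"] by simp
  also have "... <= (nrm x)\<^sup>2 + 2 * (nrm x * nrm y) + (nrm y)\<^sup>2"
    using Cauchy_Schwarz[OF assms] complex_Re_le_cmod[of "ip x y"] by simp
  also have "... = (nrm x + nrm y)\<^sup>2" by (simp add: power2_eq_square algebra_simps)
  finally show ?thesis by (meson nrm_nonneg add_nonneg_nonneg power2_le_imp_le)
qed

lemma nrm_triangle_diff: "x \<in> V ==> y \<in> V ==> nrm (x - y) <= nrm x + nrm y"
  using nrm_triangle[of x "-y"] nrm_scale[of y "-1"] by simp

lemma nrm_triangle_sub: "x \<in> V ==> y \<in> V ==> nrm x <= nrm y + nrm (x - y)"
  using nrm_triangle[of y "x-y"] by simp

lemma nrm_triangle3: "x \<in> V ==> y \<in> V ==> z \<in> V ==> nrm (x - z) <= nrm (x - y) + nrm (y - z)"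
  using nrm_triangle[of "x-y" "y-z"] by simp

lemma ip_null: "x \<in> V ==> y \<in> V ==> nrm x = 0 ==> ip x y = 0"
  using Cauchy_Schwarz[of x y] by simp

lemma tendsto_nrm:
  assumes "!!n. X n \<in> V" "l \<in> V" "(\<lambda>n::nat. nrm (X n - l)) \<longlonglongrightarrow> 0"
  shows "(\<lambda>n. nrm (X n)) \<longlonglongrightarrow> nrm l"
proof -
  have "(\<lambda>n. nrm (X n) - nrm l) \<longlonglongrightarrow> 0"
  proof (rule Lim_null_comparison[OF _ assms(3)], rule always_eventually, rule allI)
    fix n
    show "norm (nrm (X n) - nrm l) <= nrm (X n - l)"
      using nrm_triangle_sub[OF assms(1) assms(2), of n] nrm_triangle_sub[OF assms(2) assms(1), of n]
        nrm_minus_commute[OF assms(1) assms(2), of n] by (simp add: abs_le_iff)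
  qed
  then show ?thesis by (simp add: LIM_zero_iff)
qed

lemma tendsto_ip:
  assumes "!!n. X n \<in> V" "l \<in> V" "(\<lambda>n::nat. nrm (X n - l)) \<longlonglongrightarrow> 0" "y \<in> V"
  shows "(\<lambda>n. ip (X n) y) \<longlonglongrightarrow> ip l y"
proof -
  have "(\<lambda>n. ip (X n) y - ip l y) \<longlonglongrightarrow> 0"
  proof (rule Lim_null_comparison)
    show "\<forall>\<^sub>F n in sequentially. norm (ip (X n) y - ip l y) <= nrm (X n - l) * nrm y"
      using assms Cauchy_Schwarz[OF _ \<open>y \<in> V\<close>] by (auto simp flip: ip_diff_left)
    show "(\<lambda>n. nrm (X n - l) * nrm y) \<longlonglongrightarrow> 0"
      using tendsto_mult_right[OF assms(3), of "nrm y"] by simp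
  qed
  then show ?thesis by (simp add: LIM_zero_iff)
qed

lemma nrm_limit_unique:
  assumes "!!n. X n \<in> V" "l \<in> V" "l' \<in> V"
    "(\<lambda>n::nat. nrm (X n - l)) \<longlonglongrightarrow> 0" "(\<lambda>n. nrm (X n - l')) \<longlonglongrightarrow> 0"
  shows "nrm (l - l') = 0"
proof -
  have "(\<lambda>n. nrm (X n - l) + nrm (X n - l')) \<longlonglongrightarrow> 0" using tendsto_add[OF assms(4,5)] by simp
  moreover have "\<exists>N. \<forall>n\<ge>N. nrm (l - l') <= nrm (X n - l) + nrm (X n - l')"
    using nrm_triangle3[OF assms(2) assms(1) assms(3)] nrm_minus_commute[OF assms(1,2)] by simp
  ultimately have "nrm (l - l') <= 0" by (rule LIMSEQ_le_const)
  then show ?thesis using nrm_nonneg[of "l-l'"] by linarith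
qed

text \<open>The representing vector minimizes \<open>\<parallel>v\<parallel>\<^sup>2 - 2 Re (F v)\<close>; by the parallelogram law, minimizing sequences are
  Cauchy sequences.\<close>

theorem Riesz_representation:
  assumes "complete_space"
    and F_add: "!!x y. x \<in> V ==> y \<in> V ==> F (x + y) = F x + F y"
    and F_scale: "!!c x. x \<in> V ==> F (c *c x) = c * F x"
    and F_bound: "!!x. x \<in> V ==> cmod (F x) <= K * nrm x"
  shows "\<exists>v\<in>V. \<forall>w\<in>V. F w = ip w v"
proof -
  define J where "J v = (nrm v)\<^sup>2 - 2 * Re (F v)" for v
  have J_lower: "- K\<^sup>2 <= J v" if "v \<in> V" for v
  proof -
    have "Re (F v) <= K * nrm v" using F_bound[OF that] complex_Re_le_cmod order_trans by blast
    moreover have "0 <= (nrm v - K)\<^sup>2" by simp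
    ultimately show ?thesis by (simp add: J_def power2_eq_square algebra_simps)
  qed
  define m where "m = (INF v\<in>V. J v)"
  have bdd: "bdd_below (J ` V)" using J_lower by (rule bdd_belowI2)
  have ne: "V ~= {}" using V_zero by blast
  have m_le: "m <= J v" if "v \<in> V" for v unfolding m_def by (rule cINF_lower[OF bdd that])
  have "\<exists>v\<in>V. J v < m + 1 / real (Suc n)" for n
    using cINF_less_iff[OF ne bdd, of "m + 1 / real (Suc n)"] unfolding m_def by simp
  then obtain X where X: "X n \<in> V" "J (X n) < m + 1 / real (Suc n)" for n by metis
  have par: "(nrm (X n - X k))\<^sup>2 <= 2 / real (Suc n) + 2 / real (Suc k)" for n k
  proof -
    let ?a = "X n" and ?b = "X k" and ?h = "(1/2) *c (X n + X k)"
    have V: "?a \<in> V" "?b \<in> V" "?h \<in> V" using X by auto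
    have 1: "F ?h = (F ?a + F ?b) / 2" using V F_scale[of "?a + ?b" "1/2"] by (simp add: F_add)
    have R: "Re (F ?h) = (Re (F ?a) + Re (F ?b)) / 2" unfolding 1 by simp
    have 2: "(nrm ?h)\<^sup>2 = (nrm (?a + ?b))\<^sup>2 / 4"
      using V nrm_scale[of "?a + ?b" "1/2"] by (simp only: V_add power_mult_distrib) (simp add: power2_eq_square)
    have 3: "(nrm (?a + ?b))\<^sup>2 + (nrm (?a - ?b))\<^sup>2 = 2 * (nrm ?a)\<^sup>2 + 2 * (nrm ?b)\<^sup>2"
      using nrm_sq_diff_scale[OF V(1,2), of 1] nrm_sq_diff_scale[OF V(1,2), of "-1"] by simp
    have "(nrm (?a - ?b))\<^sup>2 = 2 * J ?a + 2 * J ?b - 4 * J ?h"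
      using 2 3 R unfolding J_def by argo
    also have "... <= 2 * (m + 1 / real (Suc n)) + 2 * (m + 1 / real (Suc k)) - 4 * m"
      using X(2)[of n] X(2)[of k] m_le[OF V(3)] by argo
    finally show ?thesis by argo
  qed
  have "\<exists>l\<in>V. (\<lambda>n::nat. nrm (X n - l)) \<longlonglongrightarrow> 0"
  proof (rule assms(1)[unfolded complete_space_def, rule_format], intro conjI allI impI X)
    fix e :: real assume "e > 0"
    obtain N where N: "4 / e\<^sup>2 < real N" using reals_Archimedean2 by blast
    have "nrm (X i - X k) < e" if "i \<ge> N" "k \<ge> N" for i k
    proof (rule power_less_imp_less_base[of _ 2])
      have "0 < 4 / e\<^sup>2" using \<open>e > 0\<close> by simp
      then have "0 < real N" using N by linarith
      then have "2 / real (Suc i) <= 2 / real N" "2 / real (Suc k) <= 2 / real N"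
        using that by (auto intro!: divide_left_mono)
      then have "2 / real (Suc i) + 2 / real (Suc k) <= 4 / real N" by simp
      also have "... < e\<^sup>2" using N \<open>e > 0\<close> \<open>0 < real N\<close> by (simp add: field_simps)
      finally show "(nrm (X i - X k))\<^sup>2 < e\<^sup>2" using par[of i k] by linarith
    qed (use \<open>e > 0\<close> in auto)
    then show "\<exists>N. \<forall>m\<ge>N. \<forall>n\<ge>N. nrm (X m - X n) < e" by blast
  qed
  then obtain v where v: "v \<in> V" "(\<lambda>n. nrm (X n - v)) \<longlonglongrightarrow> 0" by blast
  have F_diff: "F (x - y) = F x - F y" if "x \<in> V" "y \<in> V" for x y
    using F_add[of x "-1 *c y"] F_scale[of y "-1"] that by simp
  have F_tends: "(\<lambda>n. F (X n)) \<longlonglongrightarrow> F v"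
  proof -
    have "(\<lambda>n. F (X n) - F v) \<longlonglongrightarrow> 0"
    proof (rule Lim_null_comparison)
      show "\<forall>\<^sub>F n in sequentially. norm (F (X n) - F v) <= K * nrm (X n - v)"
        using F_bound[of "X _ - v"] X v by (simp add: F_diff)
      show "(\<lambda>n. K * nrm (X n - v)) \<longlonglongrightarrow> 0" using tendsto_mult_left[OF v(2), of K] by simp
    qed
    then show ?thesis by (simp add: LIM_zero_iff)
  qed
  have "(\<lambda>n. J (X n)) \<longlonglongrightarrow> J v" unfolding J_def
    by (intro tendsto_intros tendsto_nrm F_tends X v)
  moreover have "(\<lambda>n. m + 1 / real (Suc n)) \<longlonglongrightarrow> m"
    using tendsto_add[OF tendsto_const[of m] LIMSEQ_inverse_real_of_nat] by (simp add: inverse_eq_divide)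
  ultimately have Jv: "J v <= m"
    by (rule LIMSEQ_le) (use X in \<open>auto intro: less_imp_le\<close>)
  show ?thesis
  proof (intro bexI[OF _ v(1)] ballI)
    fix w assume w: "w \<in> V"
    define e where "e = ip v w - cnj (F w)"
    have "(cmod e)\<^sup>2 <= 0 * (nrm w)\<^sup>2"
    proof (rule quadratic_nonneg_imp_le)
      fix t :: real
      let ?c = "of_real t * e"
      have 1: "J v <= J (v - ?c *c w)" using Jv m_le[of "v - ?c *c w"] v w by simp
      have 2: "F (v - ?c *c w) = F v - ?c * F w" using v w by (simp add: F_diff F_scale)
      have 3: "Re (cnj ?c * ip v w) - Re (?c * F w) = t * (cmod e)\<^sup>2"
      proof -
        have "Re (?c * F w) = Re (cnj (?c * F w))" by (rule cnj.simps(1)[symmetric])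
        then have "Re (cnj ?c * ip v w) - Re (?c * F w) = Re (cnj ?c * ip v w - cnj (?c * F w))"
          by simp
        also have "cnj ?c * ip v w - cnj (?c * F w) = cnj ?c * e"
          by (simp add: e_def algebra_simps)
        also have "cnj ?c * e = of_real (t * (cmod e)\<^sup>2)" by (simp add: mult_cnj_self mult_ac)
        finally show ?thesis by simp
      qed
      have 4: "(cmod ?c)\<^sup>2 = t\<^sup>2 * (cmod e)\<^sup>2" by (simp add: norm_mult power_mult_distrib)
      show "0 <= 0 - 2 * t * (cmod e)\<^sup>2 + t\<^sup>2 * (cmod e)\<^sup>2 * (nrm w)\<^sup>2"
        using 1 3 unfolding J_def nrm_sq_diff_scale[OF v(1) w, of ?c] 2 4 minus_complex.sel by argo
    qed auto
    then have "ip v w = cnj (F w)" by (simp add: e_def)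
    then show "F w = ip w v" using ip_commute[OF w v(1)] by simp
  qed
qed

text \<open>Applied to a complete subspace \<open>W\<close> and the functional \<open>\<langle>\<cdot>, f\<rangle>\<close>, the representing
  vector is the orthogonal projection of \<open>f\<close>; so a subspace with trivial orthogonal complement is everything.\<close>

lemma complete_subspace_dense_imp_all:
  assumes W: "semi_inner (*c) W ip" "W \<subseteq> V" "semi_inner.complete_space W ip"
    and dense: "!!x. x \<in> V ==> (!!w. w \<in> W ==> ip w x = 0) ==> nrm x = 0"
    and f: "f \<in> V"
  shows "\<exists>w\<in>W. nrm (w - f) = 0"
proof -
  interpret W: semi_inner "(*c)" W ip by (rule W)
  have WV: "w \<in> V" if "w \<in> W" for w using W(2) that by (rule subsetD)
  have "\<exists>v\<in>W. \<forall>w\<in>W. ip w f = ip w v"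
  proof (rule W.Riesz_representation[OF W(3), where F = "\<lambda>w. ip w f" and K = "nrm f"])
    show "cmod (ip x f) <= nrm f * nrm x" if "x \<in> W" for x
      using Cauchy_Schwarz[OF WV[OF that] f] by (simp add: mult.commute)
    show "ip (x + y) f = ip x f + ip y f" if "x \<in> W" "y \<in> W" for x y
      using that WV f by (intro ip_add_left)
    show "ip (c *c x) f = c * ip x f" if "x \<in> W" for c x
      using that WV f by (intro ip_scale_left)
  qed
  then obtain v where v: "v \<in> W" "!!w. w \<in> W ==> ip w f = ip w v" by blast
  have "nrm (v - f) = 0"
  proof (rule dense)
    show "v - f \<in> V" using WV[OF v(1)] f by simp
    show "ip w (v - f) = 0" if "w \<in> W" for w
      using ip_diff_right[OF WV[OF v(1)] f WV[OF that]] v(2)[OF that] by simp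
  qed
  then show ?thesis using v(1) by blast
qed

end

section \<open>Operators associated with closed forms\<close>

text \<open>The bounded-below form \<open>q\<close> is closed exactly when its domain is complete for \<open>g = q + c\<close>. The constant \<open>c\<close>
  is taken so large that \<open>g\<close> dominates the norm of the ambient space.\<close>

locale closed_form =
  H: semi_inner scale Hs ip + D: semi_inner scale D g
  for scale :: "complex => 'v::ab_group_add => 'v" (infixr \<open>*c\<close> 75)
    and Hs ip D g +
  fixes q :: "'v => 'v => complex" and c :: real
  assumes H_complete: "H.complete_space" and D_complete: "D.complete_space"
    and D_subset: "D \<subseteq> Hs"
    and H_le_D: "x \<in> D ==> H.nrm x <= D.nrm x"
    and g_eq: "x \<in> D ==> y \<in> D ==> g x y = q x y + of_real c * ip x y"
begin

definition T :: "('v \<times> 'v) set" where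
  "T = {(\<phi>, f). \<phi> \<in> D \<and> f \<in> Hs \<and> (\<forall>\<psi>\<in>D. q \<phi> \<psi> = ip f \<psi>)}"

text \<open>Membership in the resolvent set, with null vectors in place of zero.\<close>

definition regular :: "complex => bool" where
  "regular z \<longleftrightarrow> (\<forall>f\<in>Hs. \<exists>(\<phi>, g)\<in>T. H.nrm (g - z *c \<phi> - f) = 0) \<and>
    (\<exists>C. \<forall>(\<phi>, g)\<in>T. H.nrm \<phi> <= C * H.nrm (g - z *c \<phi>))"

lemma D_Hs [simp]: "x \<in> D ==> x \<in> Hs"
  using D_subset by blast

lemma T_D: "(\<phi>, f) \<in> T ==> \<phi> \<in> D" and T_H: "(\<phi>, f) \<in> T ==> f \<in> Hs"
  and T_q: "(\<phi>, f) \<in> T ==> \<psi> \<in> D ==> q \<phi> \<psi> = ip f \<psi>"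
  by (auto simp: T_def)

lemma q_eq: "x \<in> D ==> y \<in> D ==> q x y = g x y - of_real c * ip x y"
  using g_eq by simp

lemma q_add_left: "x \<in> D ==> y \<in> D ==> z \<in> D ==> q (x + y) z = q x z + q y z"
  by (simp add: q_eq D.ip_add_left H.ip_add_left algebra_simps)

lemma q_scale_left: "x \<in> D ==> y \<in> D ==> q (a *c x) y = a * q x y"
  by (simp add: q_eq D.ip_scale_left H.ip_scale_left algebra_simps)

lemma q_diff_left: "x \<in> D ==> y \<in> D ==> z \<in> D ==> q (x - y) z = q x z - q y z"
  by (simp add: q_eq D.ip_diff_left H.ip_diff_left algebra_simps)

lemma q_commute: "x \<in> D ==> y \<in> D ==> q x y = cnj (q y x)"
  using D.ip_commute[of x y] H.ip_commute[of x y] by (simp add: q_eq)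

lemma T_zero: "(0, 0) \<in> T"
  by (auto simp: T_def q_eq)

lemma T_add: "(x, f) \<in> T ==> (y, h) \<in> T ==> (x + y, f + h) \<in> T"
  by (auto simp: T_def q_add_left H.ip_add_left)

lemma T_diff: "(x, f) \<in> T ==> (y, h) \<in> T ==> (x - y, f - h) \<in> T"
  by (auto simp: T_def q_diff_left H.ip_diff_left)

lemma T_scale: "(x, f) \<in> T ==> (a *c x, a *c f) \<in> T"
  by (auto simp: T_def q_scale_left H.ip_scale_left)

lemma T_sum: "(!!i. i \<in> I ==> (x i, f i) \<in> T) ==> (sum x I, sum f I) \<in> T"
  by (induction I rule: infinite_finite_induct) (auto simp: T_zero T_add)

lemma T_change_value: "(x, f) \<in> T ==> h \<in> Hs ==> H.nrm (f - h) = 0 ==> (x, h) \<in> T"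
  using H.ip_null[of "f - h"] by (auto simp: T_def H.ip_diff_left)

text \<open>By Riesz representation in the complete space \<open>D\<close>, the operator \<open>T + c\<close> is onto.\<close>

lemma ex_resolvent:
  assumes f: "f \<in> Hs"
  obtains \<phi> where "\<phi> \<in> D" "(\<phi>, f - of_real c *c \<phi>) \<in> T" "!!\<psi>. \<psi> \<in> D ==> g \<phi> \<psi> = ip f \<psi>"
proof -
  have "\<exists>v\<in>D. \<forall>w\<in>D. ip w f = g w v"
  proof (rule D.Riesz_representation[OF D_complete, where F = "\<lambda>w. ip w f" and K = "H.nrm f"])
    show "cmod (ip x f) <= H.nrm f * D.nrm x" if "x \<in> D" for x
    proof -
      have "cmod (ip x f) <= H.nrm x * H.nrm f" using H.Cauchy_Schwarz that f by simp
      also have "... <= D.nrm x * H.nrm f" using H_le_D[OF that] by (intro mult_right_mono) auto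
      finally show ?thesis by (simp add: mult.commute)
    qed
  qed (use f in \<open>simp_all add: H.ip_add_left H.ip_scale_left\<close>)
  then obtain v where v: "v \<in> D" "!!w. w \<in> D ==> ip w f = g w v" by blast
  have g: "g v w = ip f w" if "w \<in> D" for w
    using v(2)[OF that] D.ip_commute[OF v(1) that] H.ip_commute[of f w] f that by simp
  then have "(v, f - of_real c *c v) \<in> T"
    using v f by (auto simp: T_def q_eq H.ip_diff_left H.ip_scale_left)
  then show ?thesis using that v g by blast
qed

text \<open>Both limits exist in the ambient space; \<open>ex_resolvent\<close> gives a candidate in the domain, and coercivity of \<open>g\<close>
  forces the sequence to converge to it.\<close>

lemma T_closed:
  assumes T: "!!n. (X n, F n) \<in> T"
    and X: "\<forall>e>0. \<exists>N. \<forall>m\<ge>N. \<forall>n\<ge>N. H.nrm (X m - X n) < e"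
    and F: "\<forall>e>0. \<exists>N. \<forall>m\<ge>N. \<forall>n\<ge>N. H.nrm (F m - F n) < e"
  obtains \<phi> f where "(\<phi>, f) \<in> T" "(\<lambda>n. H.nrm (X n - \<phi>)) \<longlonglongrightarrow> 0" "(\<lambda>n. H.nrm (F n - f)) \<longlonglongrightarrow> 0"
proof -
  have XD: "X n \<in> D" and XH: "X n \<in> Hs" and FH: "F n \<in> Hs" for n using T[of n] T_D T_H by auto
  obtain x where x: "x \<in> Hs" "(\<lambda>n. H.nrm (X n - x)) \<longlonglongrightarrow> 0"
    using H_complete X XH unfolding H.complete_space_def by blast
  obtain f where f: "f \<in> Hs" "(\<lambda>n. H.nrm (F n - f)) \<longlonglongrightarrow> 0"
    using H_complete F FH unfolding H.complete_space_def by blast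
  let ?c = "complex_of_real c"
  obtain \<phi> where \<phi>: "\<phi> \<in> D" "(\<phi>, f + ?c *c x - ?c *c \<phi>) \<in> T" "!!\<psi>. \<psi> \<in> D ==> g \<phi> \<psi> = ip (f + ?c *c x) \<psi>"
    using ex_resolvent[of "f + ?c *c x"] f x by auto
  have bound: "H.nrm (X n - \<phi>) <= H.nrm (F n - f) + \<bar>c\<bar> * H.nrm (X n - x)" for n
  proof -
    let ?d = "X n - \<phi>" and ?r = "(F n - f) + ?c *c (X n - x)"
    have d: "?d \<in> D" using XD \<phi> by simp
    have "g ?d ?d = ip ?r ?d"
    proof -
      have "g ?d ?d = q (X n) ?d + ?c * ip (X n) ?d - g \<phi> ?d"
        using XD \<phi>(1) d by (simp add: D.ip_diff_left[of "X n" \<phi> ?d] g_eq[of "X n" ?d])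
      also have "... = ip (F n) ?d + ?c * ip (X n) ?d - ip (f + ?c *c x) ?d"
        using T_q[OF T d] \<phi>(3)[OF d] by simp
      also have "... = ip ?r ?d"
        using d FH[of n] XH[of n] f(1) x(1)
        by (simp add: H.ip_diff_left H.ip_add_left H.ip_scale_left algebra_simps)
      finally show ?thesis .
    qed
    then have "(D.nrm ?d)\<^sup>2 <= H.nrm ?r * H.nrm ?d"
      unfolding D.nrm_sq using H.Cauchy_Schwarz[of ?r ?d] complex_Re_le_cmod[of "ip ?r ?d"] d XH FH f x by simp
    moreover have "(H.nrm ?d)\<^sup>2 <= (D.nrm ?d)\<^sup>2" using H_le_D[OF d] by (intro power_mono) auto
    ultimately have "H.nrm ?d * H.nrm ?d <= H.nrm ?r * H.nrm ?d" by (simp add: power2_eq_square)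
    then have "H.nrm ?d <= H.nrm ?r"
      by (metis H.nrm_nonneg mult_le_cancel_right_pos order_le_less)
    also have "... <= H.nrm (F n - f) + H.nrm (?c *c (X n - x))" using FH XH f x by (intro H.nrm_triangle) auto
    also have "H.nrm (?c *c (X n - x)) = \<bar>c\<bar> * H.nrm (X n - x)" using XH x by (simp add: H.nrm_scale)
    finally show ?thesis .
  qed
  have lim: "(\<lambda>n. H.nrm (X n - \<phi>)) \<longlonglongrightarrow> 0"
  proof (rule Lim_null_comparison)
    show "\<forall>\<^sub>F n in sequentially. norm (H.nrm (X n - \<phi>)) <= H.nrm (F n - f) + \<bar>c\<bar> * H.nrm (X n - x)"
      using bound by simp
    show "(\<lambda>n. H.nrm (F n - f) + \<bar>c\<bar> * H.nrm (X n - x)) \<longlonglongrightarrow> 0"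
      using tendsto_add[OF f(2) tendsto_mult_left[OF x(2), of "\<bar>c\<bar>"]] by simp
  qed
  have null: "H.nrm (x - \<phi>) = 0" using H.nrm_limit_unique[OF XH x(1) _ x(2) lim] \<phi> by simp
  have "(\<phi>, f) \<in> T"
  proof (rule T_change_value[OF \<phi>(2) f(1)])
    have "f + ?c *c x - ?c *c \<phi> - f = ?c *c (x - \<phi>)" by (simp add: H.scale_right_diff_distrib)
    then show "H.nrm (f + ?c *c x - ?c *c \<phi> - f) = 0" using null x \<phi>(1) by (simp add: H.nrm_scale)
  qed
  then show ?thesis using that lim f by blast
qed

text \<open>The orthogonal complement of the range of \<open>T - z\<close> is the kernel of \<open>T - cnj z\<close>: this is where
  self-adjointness enters.\<close>

lemma regularI:
  assumes C: "!!\<phi> f. (\<phi>, f) \<in> T ==> H.nrm \<phi> <= C * H.nrm (f - z *c \<phi>)"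
    and ker: "!!\<phi> f. (\<phi>, f) \<in> T ==> H.nrm (f - cnj z *c \<phi>) = 0 ==> H.nrm \<phi> = 0"
  shows "regular z"
proof -
  define W where "W = {f - z *c \<phi> |\<phi> f. (\<phi>, f) \<in> T}"
  have WH: "W \<subseteq> Hs" using T_D T_H by (auto simp: W_def)
  have WI: "f - z *c \<phi> \<in> W" if "(\<phi>, f) \<in> T" for \<phi> f using that by (auto simp: W_def)
  have W: "semi_inner (*c) W ip"
  proof (unfold_locales)
    show "0 \<in> W" using WI[OF T_zero] by simp
    fix x y assume "x \<in> W" "y \<in> W"
    then obtain \<phi> f \<psi> h where *: "(\<phi>, f) \<in> T" "(\<psi>, h) \<in> T" "x = f - z *c \<phi>" "y = h - z *c \<psi>"
      by (auto simp: W_def)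
    have "x + y = (f + h) - z *c (\<phi> + \<psi>)" by (simp add: * H.scale_right_distrib)
    then show "x + y \<in> W" using WI[OF T_add[OF *(1,2)]] by simp
  next
    fix x a assume "x \<in> W"
    then obtain \<phi> f where "(\<phi>, f) \<in> T" "x = f - z *c \<phi>" by (auto simp: W_def)
    then show "a *c x \<in> W" using WI[OF T_scale, of \<phi> f a]
      by (simp add: H.scale_right_diff_distrib mult.commute)
  next
    show "ip x y = cnj (ip y x)" if "x \<in> W" "y \<in> W" for x y
      using that WH H.ip_commute by blast
  qed (use WH in \<open>auto simp: H.ip_add_left H.ip_scale_left subset_iff\<close>)
  have "semi_inner.complete_space W ip"
    unfolding semi_inner.complete_space_def[OF W]
  proof (intro allI impI, elim conjE)
    fix Y assume Y: "\<forall>n::nat. Y n \<in> W"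
      and Cau: "\<forall>e>0. \<exists>N. \<forall>m\<ge>N. \<forall>n\<ge>N. H.nrm (Y m - Y n) < e"
    from Y obtain X F where XF: "(X n, F n) \<in> T" "Y n = F n - z *c X n" for n
      unfolding W_def by (simp add: set_eq_iff) metis
    have H: "X n \<in> Hs" "F n \<in> Hs" "Y n \<in> Hs" for n using XF(1)[of n] XF(2)[of n] T_D T_H by auto
    have XY: "H.nrm (X m - X n) <= C * H.nrm (Y m - Y n)" for m n
    proof -
      have "(F m - F n) - z *c (X m - X n) = Y m - Y n" by (simp add: XF(2) H.scale_right_diff_distrib)
      then show ?thesis using C[OF T_diff[OF XF(1) XF(1)], of m n] by simp
    qed
    have FY: "H.nrm (F m - F n) <= (1 + cmod z * C) * H.nrm (Y m - Y n)" for m n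
    proof -
      have "F m - F n = (Y m - Y n) + z *c (X m - X n)"
        using XF(2) by (simp add: H.scale_right_diff_distrib)
      then have "H.nrm (F m - F n) <= H.nrm (Y m - Y n) + cmod z * H.nrm (X m - X n)"
        using H.nrm_triangle[of "Y m - Y n" "z *c (X m - X n)"] H by (simp add: H.nrm_scale)
      also have "... <= H.nrm (Y m - Y n) + cmod z * (C * H.nrm (Y m - Y n))"
        using XY[of m n] by (intro add_left_mono mult_left_mono) auto
      finally show ?thesis by (simp add: algebra_simps)
    qed
    have Cauchy_bound: "\<forall>e>0. \<exists>N. \<forall>m\<ge>N. \<forall>n\<ge>N. H.nrm (G m - G n) < e"
      if K: "!!m n. H.nrm (G m - G n) <= K * H.nrm (Y m - Y n)" for G :: "nat => _" and K
    proof (intro allI impI)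
      fix e :: real assume "e > 0"
      then obtain N where N: "\<forall>m\<ge>N. \<forall>n\<ge>N. H.nrm (Y m - Y n) < e / (\<bar>K\<bar> + 1)"
        using Cau[rule_format, of "e / (\<bar>K\<bar> + 1)"] by auto
      have "H.nrm (G m - G n) < e" if "m \<ge> N" "n \<ge> N" for m n
      proof -
        have "H.nrm (G m - G n) <= (\<bar>K\<bar> + 1) * H.nrm (Y m - Y n)"
          using K[of m n] mult_right_mono[of K "\<bar>K\<bar> + 1" "H.nrm (Y m - Y n)"] abs_ge_self[of K] H.nrm_nonneg[of "Y m - Y n"] by linarith
        also have "... < (\<bar>K\<bar> + 1) * (e / (\<bar>K\<bar> + 1))"
          using N that by (intro mult_strict_left_mono) auto
        also have "... = e" by (simp add: field_simps)
        finally show ?thesis .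
      qed
      then show "\<exists>N. \<forall>m\<ge>N. \<forall>n\<ge>N. H.nrm (G m - G n) < e" by blast
    qed
    obtain \<phi> f where \<phi>f: "(\<phi>, f) \<in> T" "(\<lambda>n. H.nrm (X n - \<phi>)) \<longlonglongrightarrow> 0" "(\<lambda>n. H.nrm (F n - f)) \<longlonglongrightarrow> 0"
      using T_closed[OF XF(1) Cauchy_bound[OF XY] Cauchy_bound[OF FY]] by blast
    have l: "\<phi> \<in> Hs" "f \<in> Hs" using T_D[OF \<phi>f(1)] T_H[OF \<phi>f(1)] by auto
    have "(\<lambda>n. H.nrm (Y n - (f - z *c \<phi>))) \<longlonglongrightarrow> 0"
    proof (rule Lim_null_comparison)
      show "\<forall>\<^sub>F n in sequentially. norm (H.nrm (Y n - (f - z *c \<phi>)))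
        <= H.nrm (F n - f) + cmod z * H.nrm (X n - \<phi>)"
      proof (rule always_eventually, rule allI)
        fix n
        have eq: "Y n - (f - z *c \<phi>) = (F n - f) - z *c (X n - \<phi>)"
          by (simp add: XF(2) H.scale_right_diff_distrib)
        show "norm (H.nrm (Y n - (f - z *c \<phi>))) <= H.nrm (F n - f) + cmod z * H.nrm (X n - \<phi>)"
          unfolding eq using H.nrm_triangle_diff[of "F n - f" "z *c (X n - \<phi>)"] H l by (simp add: H.nrm_scale)
      qed
      show "(\<lambda>n. H.nrm (F n - f) + cmod z * H.nrm (X n - \<phi>)) \<longlonglongrightarrow> 0"
        using tendsto_add[OF \<phi>f(3) tendsto_mult_left[OF \<phi>f(2), of "cmod z"]] by simp
    qed
    then show "\<exists>l\<in>W. (\<lambda>n. H.nrm (Y n - l)) \<longlonglongrightarrow> 0" using WI[OF \<phi>f(1)] by blast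
  qed
  moreover have "H.nrm x = 0" if x: "x \<in> Hs" and perp: "!!w. w \<in> W ==> ip w x = 0" for x
  proof -
    let ?c = "complex_of_real c"
    obtain \<xi> where \<xi>: "\<xi> \<in> D" "(\<xi>, x - ?c *c \<xi>) \<in> T" "!!\<psi>. \<psi> \<in> D ==> g \<xi> \<psi> = ip x \<psi>"
      using ex_resolvent[OF x] by blast
    let ?y = "x - (?c + cnj z) *c \<xi>"
    have y: "?y \<in> Hs" using x \<xi> by simp
    have "ip h ?y = 0" if h: "h \<in> Hs" for h
    proof -
      obtain \<phi> where \<phi>: "\<phi> \<in> D" "(\<phi>, h - ?c *c \<phi>) \<in> T" "!!\<psi>. \<psi> \<in> D ==> g \<phi> \<psi> = ip h \<psi>"
        using ex_resolvent[OF h] by blast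
      have 0: "ip (h - ?c *c \<phi> - z *c \<phi>) x = 0" using perp WI[OF \<phi>(2)] by blast
      have "ip \<phi> x = cnj (g \<xi> \<phi>)" using \<xi>(3)[OF \<phi>(1)] H.ip_commute[of \<phi> x] \<phi>(1) x by simp
      also have "... = g \<phi> \<xi>" using D.ip_commute[OF \<phi>(1) \<xi>(1)] by simp
      also have "... = ip h \<xi>" using \<phi>(3) \<xi>(1) by simp
      finally have "ip \<phi> x = ip h \<xi>" .
      then show ?thesis using 0 h x \<phi>(1) \<xi>(1)
        by (simp add: H.ip_diff_left H.ip_scale_left H.ip_diff_right H.ip_scale_right H.ip_add_right
            H.scale_left_distrib distrib_right diff_eq_eq add.commute)
    qed
    then have "ip ?y ?y = 0" using y by blast
    then have null: "H.nrm ?y = 0" using H.nrm_sq[of ?y] by simp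
    have eq: "x - ?c *c \<xi> - cnj z *c \<xi> = ?y" by (simp add: H.scale_left_distrib)
    have "H.nrm \<xi> = 0" using ker[OF \<xi>(2)] null unfolding eq by simp
    then have "H.nrm ((?c + cnj z) *c \<xi>) = 0" using \<xi>(1) by (simp add: H.nrm_scale)
    then show ?thesis using H.nrm_triangle_sub[of x "(?c + cnj z) *c \<xi>"] null x \<xi>(1) H.nrm_nonneg[of x] by simp
  qed
  ultimately have "\<exists>w\<in>W. H.nrm (w - f) = 0" if "f \<in> Hs" for f
    using H.complete_subspace_dense_imp_all[OF W WH] that by blast
  then show ?thesis using C unfolding regular_def W_def by fastforce
qed

text \<open>The identity \<open>Im \<langle>(T - z) x, x\<rangle> = - Im z \<parallel>x\<parallel>\<^sup>2\<close> bounds \<open>T - z\<close> below.\<close>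

lemma regular_nonreal:
  assumes "Im z ~= 0"
  shows "regular z"
proof -
  have *: "\<bar>Im w\<bar> * H.nrm \<phi> <= H.nrm (f - w *c \<phi>)" if T: "(\<phi>, f) \<in> T" for \<phi> f w
  proof -
    have H: "\<phi> \<in> D" "f \<in> Hs" using T_D[OF T] T_H[OF T] by auto
    have "Im (q \<phi> \<phi>) = 0" using q_commute[OF H(1) H(1)] by (metis cnj.simps(2) equal_neg_zero)
    then have "Im (ip (f - w *c \<phi>) \<phi>) = - Im w * (H.nrm \<phi>)\<^sup>2"
      using H T_q[OF T H(1)] by (simp add: H.ip_diff_left H.ip_scale_left H.ip_self flip: of_real_power)
    then have "\<bar>Im w\<bar> * (H.nrm \<phi>)\<^sup>2 <= H.nrm (f - w *c \<phi>) * H.nrm \<phi>"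
      using abs_Im_le_cmod[of "ip (f - w *c \<phi>) \<phi>"] H.Cauchy_Schwarz[of "f - w *c \<phi>" \<phi>] H
      by (simp add: abs_mult)
    then show ?thesis using H.nrm_nonneg[of \<phi>] H.nrm_nonneg[of "f - w *c \<phi>"]
      by (cases "H.nrm \<phi> = 0") (auto simp: power2_eq_square mult.assoc[symmetric])
  qed
  show ?thesis
  proof (rule regularI)
    show "H.nrm \<phi> <= 1 / \<bar>Im z\<bar> * H.nrm (f - z *c \<phi>)" if "(\<phi>, f) \<in> T" for \<phi> f
      using *[OF that, of z] assms by (simp add: field_simps)
    show "H.nrm \<phi> = 0" if "(\<phi>, f) \<in> T" "H.nrm (f - cnj z *c \<phi>) = 0" for \<phi> f
      using *[OF that(1), of "cnj z"] that(2) assms H.nrm_nonneg[of \<phi>] by (simp add: mult_le_0_iff)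
  qed
qed

text \<open>A form version of Weyl's criterion: the approximate eigenvectors need only lie in the form
  domain, and are tested against the form norm. If \<open>\<psi> = (T - \<kappa>)\<^sup>-\<^sup>1 \<phi>\<close>, then
  \<open>q \<phi> \<psi> - \<kappa> \<langle>\<phi>, \<psi>\<rangle> = \<parallel>\<phi>\<parallel>\<^sup>2\<close>, whereas the form norm of \<open>\<psi>\<close> is bounded by a multiple of \<open>\<parallel>\<phi>\<parallel>\<close>.\<close>

lemma not_regularI:
  fixes \<kappa> :: real
  assumes approx: "!!\<epsilon>. \<epsilon> > 0 ==> \<exists>\<phi>\<in>D. H.nrm \<phi> > 0 \<and>
    (\<forall>\<psi>\<in>D. cmod (q \<phi> \<psi> - of_real \<kappa> * ip \<phi> \<psi>) <= \<epsilon> * H.nrm \<phi> * D.nrm \<psi>)"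
  shows "\<not> regular (of_real \<kappa>)"
proof
  assume reg: "regular (of_real \<kappa>)"
  then obtain C0 where C0: "!!\<phi> f. (\<phi>, f) \<in> T ==> H.nrm \<phi> <= C0 * H.nrm (f - of_real \<kappa> *c \<phi>)"
    unfolding regular_def by fast
  define C where "C = \<bar>C0\<bar>"
  have C: "H.nrm \<phi> <= C * H.nrm (f - of_real \<kappa> *c \<phi>)" if "(\<phi>, f) \<in> T" for \<phi> f
    using C0[OF that] mult_right_mono[OF abs_ge_self H.nrm_nonneg[of "f - of_real \<kappa> *c \<phi>"], of C0]
    unfolding C_def by linarith
  have C_nonneg: "C \<ge> 0" by (simp add: C_def)
  define K where "K = 1 + (1 + \<bar>\<kappa>\<bar> * C + \<bar>c\<bar> * C) + C"
  have K: "K > 0" unfolding K_def using C_nonneg by (intro add_pos_nonneg) auto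
  obtain \<phi> where \<phi>: "\<phi> \<in> D" "H.nrm \<phi> > 0" and
    small: "!!\<psi>. \<psi> \<in> D ==> cmod (q \<phi> \<psi> - of_real \<kappa> * ip \<phi> \<psi>) <= 1 / (2 * K) * H.nrm \<phi> * D.nrm \<psi>"
    using approx[of "1 / (2 * K)"] K by auto
  obtain \<psi> f where T: "(\<psi>, f) \<in> T" and null: "H.nrm (f - of_real \<kappa> *c \<psi> - \<phi>) = 0"
    using reg \<phi>(1) unfolding regular_def by force
  have H: "\<psi> \<in> D" "f \<in> Hs" using T_D[OF T] T_H[OF T] by auto
  let ?r = "f - of_real \<kappa> *c \<psi>"
  have r: "H.nrm ?r <= H.nrm \<phi>" using H.nrm_triangle_sub[of ?r \<phi>] null \<phi> H by simp
  have \<psi>: "H.nrm \<psi> <= C * H.nrm \<phi>" using C[OF T] mult_left_mono[OF r C_nonneg] by linarith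
  have fb: "H.nrm f <= (1 + \<bar>\<kappa>\<bar> * C) * H.nrm \<phi>"
  proof -
    have "H.nrm f <= H.nrm ?r + H.nrm (of_real \<kappa> *c \<psi>)"
      using H.nrm_triangle[of ?r "of_real \<kappa> *c \<psi>"] H by simp
    also have "... <= H.nrm \<phi> + \<bar>\<kappa>\<bar> * (C * H.nrm \<phi>)"
      using r mult_left_mono[OF \<psi>, of "\<bar>\<kappa>\<bar>"] H by (simp add: H.nrm_scale)
    finally show ?thesis by (simp add: algebra_simps)
  qed
  have "(D.nrm \<psi>)\<^sup>2 = Re (ip (f + of_real c *c \<psi>) \<psi>)"
    unfolding D.nrm_sq using T_q[OF T H(1)] H by (simp add: g_eq H.ip_add_left H.ip_scale_left)
  also have "... <= H.nrm (f + of_real c *c \<psi>) * H.nrm \<psi>"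
    using H.Cauchy_Schwarz[of "f + of_real c *c \<psi>" \<psi>] H
      complex_Re_le_cmod[of "ip (f + of_real c *c \<psi>) \<psi>"] by simp
  also have "... <= ((1 + \<bar>\<kappa>\<bar> * C + \<bar>c\<bar> * C) * H.nrm \<phi>) * (C * H.nrm \<phi>)"
  proof (rule mult_mono)
    have "H.nrm (f + of_real c *c \<psi>) <= H.nrm f + \<bar>c\<bar> * H.nrm \<psi>"
      using H.nrm_triangle[of f "of_real c *c \<psi>"] H by (simp add: H.nrm_scale)
    also have "... <= (1 + \<bar>\<kappa>\<bar> * C) * H.nrm \<phi> + \<bar>c\<bar> * (C * H.nrm \<phi>)"
      using fb mult_left_mono[OF \<psi>, of "\<bar>c\<bar>"] by simp
    finally show "H.nrm (f + of_real c *c \<psi>) <= (1 + \<bar>\<kappa>\<bar> * C + \<bar>c\<bar> * C) * H.nrm \<phi>"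
      by (simp add: algebra_simps)
  qed (use \<psi> C_nonneg in auto)
  also have "... <= (K * H.nrm \<phi>) * (K * H.nrm \<phi>)"
  proof -
    have "0 <= \<bar>\<kappa>\<bar> * C" "0 <= \<bar>c\<bar> * C" using C_nonneg by auto
    then have "0 <= K" "0 <= C" "1 + \<bar>\<kappa>\<bar> * C + \<bar>c\<bar> * C <= K" "C <= K"
      using C_nonneg K unfolding K_def by linarith+
    then show ?thesis
      using mult_mono[of "(1 + \<bar>\<kappa>\<bar> * C + \<bar>c\<bar> * C) * H.nrm \<phi>" "K * H.nrm \<phi>" "C * H.nrm \<phi>" "K * H.nrm \<phi>"]
        mult_right_mono[of _ K "H.nrm \<phi>"] by simp
  qed
  finally have "(D.nrm \<psi>)\<^sup>2 <= (K * H.nrm \<phi>)\<^sup>2" unfolding power2_eq_square[of "K * H.nrm \<phi>"] .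
  then have D\<psi>: "D.nrm \<psi> <= K * H.nrm \<phi>" by (rule power2_le_imp_le) (use K in simp)
  have "q \<phi> \<psi> - of_real \<kappa> * ip \<phi> \<psi> = cnj (q \<psi> \<phi> - of_real \<kappa> * ip \<psi> \<phi>)"
    using q_commute[OF \<phi>(1) H(1)] H.ip_commute[of \<phi> \<psi>] \<phi> H by simp
  also have "q \<psi> \<phi> - of_real \<kappa> * ip \<psi> \<phi> = ip (?r - \<phi>) \<phi> + ip \<phi> \<phi>"
    using T_q[OF T \<phi>(1)] H \<phi>(1) by (simp add: H.ip_diff_left H.ip_scale_left)
  also have "ip (?r - \<phi>) \<phi> = 0" using H.ip_null[OF _ _ null] H \<phi> by simp
  finally have "cmod (q \<phi> \<psi> - of_real \<kappa> * ip \<phi> \<psi>) = (H.nrm \<phi>)\<^sup>2"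
    using \<phi>(1) by (simp add: H.ip_self norm_power)
  then have "(H.nrm \<phi>)\<^sup>2 <= 1 / (2 * K) * H.nrm \<phi> * (K * H.nrm \<phi>)"
    using small[OF H(1)] mult_left_mono[OF D\<psi>, of "1 / (2 * K) * H.nrm \<phi>"] K by simp
  also have "... = (H.nrm \<phi>)\<^sup>2 / 2" using K by (simp add: power2_eq_square)
  finally show False using \<phi>(2) by simp
qed

end

section \<open>Finite-rank lower bounds and discrete spectrum\<close>

text \<open>More unknowns than equations; Gaussian elimination, by induction on the set of equations.\<close>

lemma homogeneous_system_nontrivial:
  fixes M :: "'i => 'j => 'f::field"
  assumes "finite J" "finite I" "card J < card I"
  shows "\<exists>c. (\<exists>i\<in>I. c i ~= 0) \<and> (\<forall>j\<in>J. (\<Sum>i\<in>I. c i * M i j) = 0)"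
  using assms
proof (induction J arbitrary: I M rule: finite_induct)
  case empty
  then show ?case by (intro exI[of _ "\<lambda>_. 1"]) (auto simp: card_gt_0_iff)
next
  case (insert j J)
  show ?case
  proof (cases "\<forall>i\<in>I. M i j = 0")
    case True
    then show ?thesis using insert.IH[of I M] insert.prems insert.hyps by auto
  next
    case False
    then obtain k where k: "k \<in> I" "M k j ~= 0" by blast
    \<comment> \<open>Eliminate the unknown \<open>k\<close> with the equation \<open>j\<close>.\<close>
    define M' where "M' i l = M i l - M i j / M k j * M k l" for i l
    obtain c where c: "\<exists>i\<in>I - {k}. c i ~= 0" "\<forall>l\<in>J. (\<Sum>i\<in>I - {k}. c i * M' i l) = 0"
    proof -
      have "card J < card (I - {k})" using insert.prems insert.hyps k(1) by simp
      then show ?thesis using insert.IH[of "I - {k}" M'] insert.prems that by blast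
    qed
    define s where "s = - (\<Sum>i\<in>I - {k}. c i * M i j) / M k j"
    define c' where "c' = c(k := s)"
    have split: "(\<Sum>i\<in>I. c' i * M i l) = s * M k l + (\<Sum>i\<in>I - {k}. c i * M i l)" for l
      using k(1) insert.prems by (subst sum.remove[of I k]) (auto simp: c'_def intro!: sum.cong)
    have "(\<Sum>i\<in>I. c' i * M i l) = 0" if "l \<in> insert j J" for l
    proof (cases "l = j")
      case True
      then show ?thesis using k(2) by (simp add: split s_def)
    next
      case False
      then have "(\<Sum>i\<in>I - {k}. c i * M' i l) = 0" using c(2) that by simp
      moreover have "(\<Sum>i\<in>I - {k}. c i * M' i l)
          = (\<Sum>i\<in>I - {k}. c i * M i l) - (\<Sum>i\<in>I - {k}. c i * M i j) / M k j * M k l"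
        by (simp add: M'_def right_diff_distrib sum_subtractf sum_distrib_right sum_divide_distrib mult.assoc)
      ultimately show ?thesis by (simp add: split s_def)
    qed
    then show ?thesis using c(1) by (intro exI[of _ c']) (auto simp: c'_def)
  qed
qed

lemma common_convergent_subsequence:
  fixes x :: "'j => nat => complex"
  assumes "finite J" "!!j. j \<in> J ==> bounded (range (x j))"
  shows "\<exists>r. strict_mono r \<and> (\<forall>j\<in>J. convergent (x j \<circ> r))"
  using assms
proof (induction J rule: finite_induct)
  case empty
  then show ?case by (intro exI[of _ id]) (auto simp: strict_mono_def)
next
  case (insert j J)
  then obtain r where r: "strict_mono r" "\<forall>j\<in>J. convergent (x j \<circ> r)" by (metis insertCI)
  have "bounded (range (x j \<circ> r))"
    using bounded_subset[OF insert.prems[of j], of "range (x j \<circ> r)"] by auto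
  then obtain l r' where r': "strict_mono r'" "(x j \<circ> r \<circ> r') \<longlonglongrightarrow> l"
    using bounded_imp_convergent_subsequence by blast
  have "convergent (x i \<circ> (r \<circ> r'))" if "i \<in> insert j J" for i
  proof (cases "i = j")
    case True
    then show ?thesis using r'(2) by (auto simp: convergent_def o_assoc)
  next
    case False
    then have "convergent (x i \<circ> r)" using r that by blast
    then show ?thesis using LIMSEQ_subseq_LIMSEQ[OF _ r'(1)] unfolding convergent_def
      by (metis o_assoc)
  qed
  then show ?case using strict_mono_o[OF r(1) r'(1)] by blast
qed

context closed_form
begin

definition eigenvector :: "real => 'v => bool" where
  "eigenvector \<kappa> \<phi> \<longleftrightarrow> (\<exists>f. (\<phi>, f) \<in> T \<and> H.nrm (f - of_real \<kappa> *c \<phi>) = 0)"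

lemma eigenvector_iff: "eigenvector \<kappa> \<phi> \<longleftrightarrow> (\<phi>, of_real \<kappa> *c \<phi>) \<in> T"
proof
  assume "eigenvector \<kappa> \<phi>"
  then obtain f where f: "(\<phi>, f) \<in> T" "H.nrm (f - of_real \<kappa> *c \<phi>) = 0" by (auto simp: eigenvector_def)
  show "(\<phi>, of_real \<kappa> *c \<phi>) \<in> T" by (rule T_change_value[OF f(1) _ f(2)]) (use T_D[OF f(1)] in simp)
qed (auto simp: eigenvector_def)

lemma eigenvector_sum:
  assumes "!!i. i \<in> I ==> eigenvector \<kappa> (x i)"
  shows "eigenvector \<kappa> (\<Sum>i\<in>I. a i *c x i)"
proof -
  have "(\<Sum>i\<in>I. a i *c x i, \<Sum>i\<in>I. a i *c (of_real \<kappa> *c x i)) \<in> T"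
    using assms by (intro T_sum T_scale) (auto simp: eigenvector_iff)
  also have "(\<Sum>i\<in>I. a i *c (of_real \<kappa> *c x i)) = of_real \<kappa> *c (\<Sum>i\<in>I. a i *c x i)"
    by (simp add: H.scale_sum_right mult.commute)
  finally show ?thesis by (simp add: eigenvector_iff)
qed

lemma eigenvector_orthogonal:
  assumes "eigenvector \<kappa> \<phi>" "eigenvector \<kappa>' \<psi>" "\<kappa> ~= \<kappa>'"
  shows "ip \<phi> \<psi> = 0"
proof -
  have T: "(\<phi>, of_real \<kappa> *c \<phi>) \<in> T" "(\<psi>, of_real \<kappa>' *c \<psi>) \<in> T" using assms by (auto simp: eigenvector_iff)
  have D: "\<phi> \<in> D" "\<psi> \<in> D" using T T_D by auto
  have "of_real \<kappa> * ip \<phi> \<psi> = cnj (of_real \<kappa>' * ip \<psi> \<phi>)"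
    using T_q[OF T(1) D(2)] T_q[OF T(2) D(1)] q_commute[OF D] D by (simp add: H.ip_scale_left)
  also have "... = of_real \<kappa>' * ip \<phi> \<psi>" using H.ip_commute[of \<phi> \<psi>] D by simp
  finally show ?thesis using assms(3) by simp
qed

end

text \<open>A finite-rank perturbation \<open>\<Sum>\<^sub>j |\<langle>\<cdot>, b j\<rangle>|\<^sup>2\<close> lifts the form above \<open>\<mu>\<close>: below \<open>\<mu>\<close> the operator then has at
  most \<open>card J\<close> eigenvalues with multiplicity, and no other spectrum.\<close>

locale finite_rank_bound = closed_form +
  fixes \<mu> :: real and J :: "'j set" and b :: "'j => 'a"
  assumes finite_J: "finite J" and b_H: "j \<in> J ==> b j \<in> Hs"
    and lower: "x \<in> D ==> \<mu> * (H.nrm x)\<^sup>2 <= Re (q x x) + (\<Sum>j\<in>J. (cmod (ip x (b j)))\<^sup>2)"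
begin

text \<open>More than \<open>card J\<close> vectors have a nontrivial combination orthogonal to all \<open>b j\<close>. On that combination the
  lower bound holds without the finite-rank term.\<close>

lemma ex_combination_orthogonal:
  assumes "finite I" "card J < card I" "!!i. i \<in> I ==> x i \<in> Hs"
  obtains a where "\<exists>i\<in>I. a i ~= 0" "!!j. j \<in> J ==> ip (\<Sum>i\<in>I. scale (a i) (x i)) (b j) = 0"
proof -
  obtain a where a: "\<exists>i\<in>I. a i ~= 0" "\<forall>j\<in>J. (\<Sum>i\<in>I. a i * ip (x i) (b j)) = 0"
    using homogeneous_system_nontrivial[OF finite_J assms(1,2), of "\<lambda>i j. ip (x i) (b j)"] by blast
  show ?thesis
  proof (rule that[OF a(1)])
    fix j assume "j \<in> J"
    then show "ip (\<Sum>i\<in>I. scale (a i) (x i)) (b j) = 0"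
      using assms(3) b_H a(2) by (simp add: H.ip_sum_left H.ip_scale_left)
  qed
qed

lemma dependent_below:
  assumes "\<kappa> < \<mu>" "finite I" "card J < card I" "!!i. i \<in> I ==> eigenvector \<kappa> (x i)"
  shows "\<exists>a. (\<exists>i\<in>I. a i ~= 0) \<and> H.nrm (\<Sum>i\<in>I. scale (a i) (x i)) = 0"
proof -
  have "x i \<in> Hs" if "i \<in> I" for i using assms(4)[OF that] T_D by (auto simp: eigenvector_iff)
  then obtain a where a: "\<exists>i\<in>I. a i ~= 0" "!!j. j \<in> J ==> ip (\<Sum>i\<in>I. scale (a i) (x i)) (b j) = 0"
    using ex_combination_orthogonal[OF assms(2,3)] by blast
  let ?x = "\<Sum>i\<in>I. scale (a i) (x i)"
  have ev: "(?x, scale (of_real \<kappa>) ?x) \<in> T" using eigenvector_sum[OF assms(4)] by (simp add: eigenvector_iff)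
  then have D: "?x \<in> D" by (rule T_D)
  have "q ?x ?x = of_real \<kappa> * ip ?x ?x" using T_q[OF ev D] D by (simp add: H.ip_scale_left)
  then have "Re (q ?x ?x) = \<kappa> * (H.nrm ?x)\<^sup>2" by (simp add: H.nrm_sq)
  then have "(\<mu> - \<kappa>) * (H.nrm ?x)\<^sup>2 <= 0" using lower[OF D] a(2) by (simp add: left_diff_distrib)
  then have "H.nrm ?x = 0" using assms(1) by (simp add: mult_le_0_iff)
  then show ?thesis using a(1) by blast
qed

text \<open>A maximal independent family of eigenvectors has at most \<open>card J\<close> members.\<close>

lemma finite_multiplicity_below:
  assumes "\<kappa> < \<mu>"
  shows "\<exists>B. finite B \<and> (\<forall>x\<in>B. eigenvector \<kappa> x) \<and>
    (\<forall>\<phi>. eigenvector \<kappa> \<phi> --> (\<exists>a. H.nrm (\<phi> - (\<Sum>x\<in>B. scale (a x) x)) = 0))"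
proof -
  define P where "P n \<longleftrightarrow> (\<exists>B. finite B \<and> card B = n \<and> (\<forall>x\<in>B. eigenvector \<kappa> x) \<and>
    \<not> (\<exists>a. (\<exists>x\<in>B. a x ~= 0) \<and> H.nrm (\<Sum>x\<in>B. scale (a x) x) = 0))" for n
  have "P 0" unfolding P_def by (intro exI[of _ "{}"]) auto
  moreover have "\<forall>n. P n --> n <= card J"
    using dependent_below[OF assms, of _ "\<lambda>x. x"] unfolding P_def by (meson not_le)
  ultimately obtain n where n: "P n" "\<forall>m. P m --> m <= n" using Nat.ex_has_greatest_nat[of P 0 "card J"] by blast
  then obtain B where B: "finite B" "card B = n" "\<forall>x\<in>B. eigenvector \<kappa> x"
    and indep: "!!a. H.nrm (\<Sum>x\<in>B. scale (a x) x) = 0 ==> \<forall>x\<in>B. a x = 0"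
    unfolding P_def by blast
  have BH: "x \<in> Hs" if "x \<in> B" for x using B(3) that T_D by (auto simp: eigenvector_iff)
  have "\<exists>a. H.nrm (\<phi> - (\<Sum>x\<in>B. scale (a x) x)) = 0" if \<phi>: "eigenvector \<kappa> \<phi>" for \<phi>
  proof (cases "\<phi> \<in> B")
    case True
    have "(\<Sum>x\<in>B. scale (if x = \<phi> then 1 else 0) x) = \<phi>"
      using B(1) True by (subst sum.remove[OF B(1) True]) (auto intro!: sum.neutral)
    then show ?thesis by (intro exI[of _ "\<lambda>x. if x = \<phi> then 1 else 0"]) simp
  next
    case False
    have "\<not> P (Suc n)" using n(2) by fastforce
    moreover have "finite (insert \<phi> B) \<and> card (insert \<phi> B) = Suc n \<and> (\<forall>x\<in>insert \<phi> B. eigenvector \<kappa> x)"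
      using B False \<phi> by simp
    ultimately have "\<exists>a. (\<exists>x\<in>insert \<phi> B. a x ~= 0) \<and> H.nrm (\<Sum>x\<in>insert \<phi> B. scale (a x) x) = 0"
      unfolding P_def by blast
    then obtain a where a: "\<exists>x\<in>insert \<phi> B. a x ~= 0" "H.nrm (\<Sum>x\<in>insert \<phi> B. scale (a x) x) = 0" by blast
    let ?s = "\<Sum>x\<in>B. scale (a x) x"
    have sum: "(\<Sum>x\<in>insert \<phi> B. scale (a x) x) = scale (a \<phi>) \<phi> + ?s" using B False by simp
    have "a \<phi> ~= 0"
    proof
      assume 0: "a \<phi> = 0"
      then have "H.nrm ?s = 0" using a(2) sum by simp
      then show False using indep[of a] a(1) 0 by auto
    qed
    have \<phi>H: "\<phi> \<in> Hs" using \<phi> T_D by (auto simp: eigenvector_iff)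
    have sH: "?s \<in> Hs" using BH by (intro H.V_sum) auto
    have "\<phi> - (\<Sum>x\<in>B. scale (- a x / a \<phi>) x) = scale (1 / a \<phi>) (scale (a \<phi>) \<phi> + ?s)"
      using \<open>a \<phi> ~= 0\<close> by (simp add: H.scale_right_distrib H.scale_sum_right sum_negf)
    then have "H.nrm (\<phi> - (\<Sum>x\<in>B. scale (- a x / a \<phi>) x)) = 0"
      using a(2) sum \<phi>H sH by (simp add: H.nrm_scale)
    then show ?thesis by (intro exI[of _ "\<lambda>x. - a x / a \<phi>"])
  qed
  then show ?thesis using B by blast
qed

lemma finite_eigenvalues_below:
  "finite {\<kappa>. \<kappa> < \<mu> \<and> (\<exists>\<phi>. eigenvector \<kappa> \<phi> \<and> H.nrm \<phi> ~= 0)}" (is "finite ?E")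
proof (rule ccontr)
  assume "infinite ?E"
  then obtain I where I: "I \<subseteq> ?E" "finite I" "card I = Suc (card J)"
    using infinite_arbitrarily_large by blast
  then have "\<forall>\<kappa>\<in>I. \<exists>\<phi>. eigenvector \<kappa> \<phi> \<and> H.nrm \<phi> ~= 0" by blast
  then obtain x where x: "!!\<kappa>. \<kappa> \<in> I ==> eigenvector \<kappa> (x \<kappa>)" "!!\<kappa>. \<kappa> \<in> I ==> H.nrm (x \<kappa>) ~= 0" by metis
  have xT: "(x \<kappa>, scale (of_real \<kappa>) (x \<kappa>)) \<in> T" if "\<kappa> \<in> I" for \<kappa> using x(1)[OF that] by (simp add: eigenvector_iff)
  have xD: "x \<kappa> \<in> D" if "\<kappa> \<in> I" for \<kappa> using xT[OF that] by (rule T_D)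
  obtain a where a: "\<exists>\<kappa>\<in>I. a \<kappa> ~= 0" "!!j. j \<in> J ==> ip (\<Sum>\<kappa>\<in>I. scale (a \<kappa>) (x \<kappa>)) (b j) = 0"
    using ex_combination_orthogonal[OF I(2), of x] xD I(3) by auto
  let ?v = "\<Sum>\<kappa>\<in>I. scale (a \<kappa>) (x \<kappa>)" and ?f = "\<Sum>\<kappa>\<in>I. scale (a \<kappa>) (scale (of_real \<kappa>) (x \<kappa>))"
  have T: "(?v, ?f) \<in> T" by (intro T_sum T_scale xT)
  have D: "?v \<in> D" using T by (rule T_D)
  have diag: "ip (\<Sum>\<kappa>\<in>I. scale (d \<kappa>) (x \<kappa>)) ?v = (\<Sum>\<kappa>\<in>I. d \<kappa> * cnj (a \<kappa>) * of_real ((H.nrm (x \<kappa>))\<^sup>2))" for d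
  proof -
    have "ip (\<Sum>\<kappa>\<in>I. scale (d \<kappa>) (x \<kappa>)) ?v = (\<Sum>\<kappa>\<in>I. \<Sum>\<kappa>'\<in>I. d \<kappa> * cnj (a \<kappa>') * ip (x \<kappa>) (x \<kappa>'))"
    proof -
      have "ip (x \<kappa>) ?v = (\<Sum>\<kappa>'\<in>I. cnj (a \<kappa>') * ip (x \<kappa>) (x \<kappa>'))" if "\<kappa> \<in> I" for \<kappa>
        using xD that by (subst H.ip_sum_right) (simp_all add: H.ip_scale_right)
      then show ?thesis
        using xD D by (subst H.ip_sum_left) (simp_all add: H.ip_scale_left sum_distrib_left mult.assoc)
    qed
    also have "... = (\<Sum>\<kappa>\<in>I. d \<kappa> * cnj (a \<kappa>) * ip (x \<kappa>) (x \<kappa>))"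
    proof (rule sum.cong[OF refl])
      fix \<kappa> assume \<kappa>: "\<kappa> \<in> I"
      show "(\<Sum>\<kappa>'\<in>I. d \<kappa> * cnj (a \<kappa>') * ip (x \<kappa>) (x \<kappa>')) = d \<kappa> * cnj (a \<kappa>) * ip (x \<kappa>) (x \<kappa>)"
        using eigenvector_orthogonal[OF x(1)[OF \<kappa>] x(1)]
        by (subst sum.remove[OF I(2) \<kappa>]) (auto intro!: sum.neutral)
    qed
    finally show ?thesis using xD by (simp add: H.ip_self)
  qed
  have n: "(H.nrm ?v)\<^sup>2 = (\<Sum>\<kappa>\<in>I. (cmod (a \<kappa>))\<^sup>2 * (H.nrm (x \<kappa>))\<^sup>2)"
    unfolding H.nrm_sq diag by (simp add: mult_cnj_self flip: of_real_power of_real_mult)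
  have "Re (q ?v ?v) = Re (ip (\<Sum>\<kappa>\<in>I. scale (a \<kappa> * of_real \<kappa>) (x \<kappa>)) ?v)"
    using T_q[OF T D] by simp
  also have "... = (\<Sum>\<kappa>\<in>I. \<kappa> * ((cmod (a \<kappa>))\<^sup>2 * (H.nrm (x \<kappa>))\<^sup>2))"
  proof -
    have "a \<kappa> * of_real \<kappa> * cnj (a \<kappa>) * of_real ((H.nrm (x \<kappa>))\<^sup>2)
      = of_real (\<kappa> * ((cmod (a \<kappa>))\<^sup>2 * (H.nrm (x \<kappa>))\<^sup>2))" for \<kappa>
      using mult_cnj_self[of "a \<kappa>"] by (simp add: mult_ac)
    then show ?thesis unfolding diag by (simp only: Re_sum Re_complex_of_real)
  qed
  finally have "(\<Sum>\<kappa>\<in>I. \<mu> * ((cmod (a \<kappa>))\<^sup>2 * (H.nrm (x \<kappa>))\<^sup>2)) <= (\<Sum>\<kappa>\<in>I. \<kappa> * ((cmod (a \<kappa>))\<^sup>2 * (H.nrm (x \<kappa>))\<^sup>2))"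
    using lower[OF D] a(2) n by (simp add: sum_distrib_left)
  moreover have "(\<Sum>\<kappa>\<in>I. \<kappa> * ((cmod (a \<kappa>))\<^sup>2 * (H.nrm (x \<kappa>))\<^sup>2)) < (\<Sum>\<kappa>\<in>I. \<mu> * ((cmod (a \<kappa>))\<^sup>2 * (H.nrm (x \<kappa>))\<^sup>2))"
  proof (rule sum_strict_mono_ex1[OF I(2)])
    show "\<forall>\<kappa>\<in>I. \<kappa> * ((cmod (a \<kappa>))\<^sup>2 * (H.nrm (x \<kappa>))\<^sup>2) <= \<mu> * ((cmod (a \<kappa>))\<^sup>2 * (H.nrm (x \<kappa>))\<^sup>2)"
      using I(1) by (auto intro!: mult_right_mono)
    obtain \<kappa> where \<kappa>: "\<kappa> \<in> I" "a \<kappa> ~= 0" using a(1) by blast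
    moreover have "\<kappa> < \<mu>" "H.nrm (x \<kappa>) ~= 0" using I(1) \<kappa>(1) x(2) by auto
    ultimately show "\<exists>\<kappa>\<in>I. \<kappa> * ((cmod (a \<kappa>))\<^sup>2 * (H.nrm (x \<kappa>))\<^sup>2) < \<mu> * ((cmod (a \<kappa>))\<^sup>2 * (H.nrm (x \<kappa>))\<^sup>2)"
      by (intro bexI[OF _ \<kappa>(1)] mult_strict_right_mono) auto
  qed
  ultimately show False by simp
qed

text \<open>If \<open>T - \<kappa>\<close> were not bounded below, take unit vectors \<open>x n\<close> with \<open>(T - \<kappa>) x n\<close> tending to zero. Along a
  subsequence all products with the \<open>b j\<close> converge, and the lower bound for differences, with \<open>\<kappa> < \<mu>\<close>, makes the
  subsequence Cauchy. Its limit would be an eigenvector of norm one. So \<open>T - \<kappa>\<close> is bounded below, which suffices by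
  self-adjointness.\<close>

lemma regular_below:
  assumes "\<kappa> < \<mu>" and ker: "!!\<phi>. eigenvector \<kappa> \<phi> ==> H.nrm \<phi> = 0"
  shows "regular (of_real \<kappa>)"
proof -
  let ?k = "complex_of_real \<kappa>"
  have "\<exists>C. \<forall>(\<phi>, f)\<in>T. H.nrm \<phi> <= C * H.nrm (f - scale ?k \<phi>)"
  proof (rule ccontr)
    assume "\<not> ?thesis"
    then have "\<exists>p\<in>T. \<not> (case p of (\<phi>, f) => H.nrm \<phi> <= real (Suc n) * H.nrm (f - scale ?k \<phi>))" for n
      by blast
    then have "\<exists>\<phi> f. (\<phi>, f) \<in> T \<and> H.nrm \<phi> > real (Suc n) * H.nrm (f - scale ?k \<phi>)" for n
      by (fastforce simp: not_le simp del: of_nat_Suc)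
    then obtain Y G where YG: "!!n. (Y n, G n) \<in> T" "!!n. H.nrm (Y n) > real (Suc n) * H.nrm (G n - scale ?k (Y n))" by metis
    have Y: "H.nrm (Y n) > 0" "Y n \<in> D" "G n \<in> Hs" for n
      using T_D[OF YG(1)] T_H[OF YG(1)] le_less_trans[OF mult_nonneg_nonneg[OF of_nat_0_le_iff H.nrm_nonneg] YG(2)[of n]]
      by auto
    define X where "X n = scale (of_real (1 / H.nrm (Y n))) (Y n)" for n
    define F where "F n = scale (of_real (1 / H.nrm (Y n))) (G n)" for n
    define R where "R n = F n - scale ?k (X n)" for n
    have XF: "(X n, F n) \<in> T" for n unfolding X_def F_def by (intro T_scale YG)
    have XD: "X n \<in> D" and FH: "F n \<in> Hs" and RH: "R n \<in> Hs" for n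
      using T_D[OF XF] T_H[OF XF] by (auto simp: R_def)
    have X1: "H.nrm (X n) = 1" for n using Y[of n] by (simp add: X_def H.nrm_scale norm_divide)
    have R_eq: "R n = scale (of_real (1 / H.nrm (Y n))) (G n - scale ?k (Y n))" for n
      by (simp add: R_def X_def F_def H.scale_right_diff_distrib)
    have R_small: "H.nrm (R n) < 1 / real (Suc n)" for n
    proof -
      have "H.nrm (R n) = H.nrm (G n - scale ?k (Y n)) / H.nrm (Y n)"
        unfolding R_eq using Y[of n] by (subst H.nrm_scale) (auto simp: norm_divide)
      moreover have "H.nrm (G n - scale ?k (Y n)) < H.nrm (Y n) / real (Suc n)"
        using YG(2)[of n] by (simp add: pos_less_divide_eq mult.commute del: of_nat_Suc)
      ultimately show ?thesis using Y(1)[of n] by (simp add: pos_divide_less_eq del: of_nat_Suc)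
    qed
    have "\<exists>r. strict_mono r \<and> (\<forall>j\<in>J. convergent ((\<lambda>n. ip (X n) (b j)) \<circ> r))"
    proof (rule common_convergent_subsequence[OF finite_J])
      fix j assume "j \<in> J"
      then have "cmod (ip (X n) (b j)) <= H.nrm (b j)" for n
        using H.Cauchy_Schwarz[of "X n" "b j"] XD b_H by (simp add: X1)
      then show "bounded (range (\<lambda>n. ip (X n) (b j)))" by (auto simp: bounded_iff)
    qed
    then obtain r where r: "strict_mono r" "!!j. j \<in> J ==> convergent (\<lambda>n. ip (X (r n)) (b j))"
      by (auto simp: o_def)
    have key: "(\<mu> - \<kappa>) * (H.nrm (X m - X n))\<^sup>2
        <= 2 * (H.nrm (R m) + H.nrm (R n)) + (\<Sum>j\<in>J. (cmod (ip (X m) (b j) - ip (X n) (b j)))\<^sup>2)" for m n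
    proof -
      let ?x = "X m - X n"
      have D: "?x \<in> D" using XD by simp
      have "R m - R n = (F m - F n) - scale ?k ?x" by (simp add: R_def H.scale_right_diff_distrib)
      then have "ip (R m - R n) ?x = q ?x ?x - ?k * ip ?x ?x"
        using T_q[OF T_diff[OF XF XF] D] D FH by (simp add: H.ip_diff_left[of "F m - F n"] H.ip_scale_left)
      then have "Re (q ?x ?x) - \<kappa> * (H.nrm ?x)\<^sup>2 = Re (ip (R m - R n) ?x)" by (simp add: H.nrm_sq)
      also have "... <= H.nrm (R m - R n) * H.nrm ?x"
        using H.Cauchy_Schwarz[of "R m - R n" ?x] complex_Re_le_cmod[of "ip (R m - R n) ?x"] D RH by simp
      also have "... <= (H.nrm (R m) + H.nrm (R n)) * 2"
        using H.nrm_triangle_diff[of "R m" "R n"] H.nrm_triangle_diff[of "X m" "X n"] RH XD X1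
        by (intro mult_mono) auto
      finally show ?thesis using lower[OF D] b_H XD by (simp add: H.ip_diff_left algebra_simps)
    qed
    have Cau_X: "\<forall>e>0. \<exists>N. \<forall>m\<ge>N. \<forall>n\<ge>N. H.nrm ((X \<circ> r) m - (X \<circ> r) n) < e"
    proof (intro allI impI)
      fix e :: real assume e: "e > 0"
      define \<delta> where "\<delta> = (\<mu> - \<kappa>) * e\<^sup>2 / (2 * (1 + real (card J)))"
      have \<delta>: "\<delta> > 0" using assms(1) e by (simp add: \<delta>_def)
      have "(\<lambda>n. 1 / real (Suc n)) \<longlonglongrightarrow> 0" using LIMSEQ_inverse_real_of_nat by (simp add: inverse_eq_divide)
      then have ev1: "\<forall>\<^sub>F n in sequentially. 1 / real (Suc n) < \<delta> / 4"
        using \<delta> by (intro order_tendstoD) auto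
      have "\<forall>j\<in>J. \<forall>\<^sub>F m in sequentially. \<forall>n\<ge>m. (cmod (ip (X (r m)) (b j) - ip (X (r n)) (b j))) < sqrt \<delta> / 2"
      proof
        fix j assume "j \<in> J"
        then have "Cauchy (\<lambda>n. ip (X (r n)) (b j))" using r(2) convergent_Cauchy by blast
        then obtain M where "\<forall>m\<ge>M. \<forall>n\<ge>M. norm (ip (X (r m)) (b j) - ip (X (r n)) (b j)) < sqrt \<delta> / 2"
          using CauchyD[of "\<lambda>n. ip (X (r n)) (b j)" "sqrt \<delta> / 2"] \<delta> by auto
        then show "\<forall>\<^sub>F m in sequentially. \<forall>n\<ge>m. (cmod (ip (X (r m)) (b j) - ip (X (r n)) (b j))) < sqrt \<delta> / 2"
          by (intro eventually_sequentiallyI[of M]) simp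
      qed
      then have "\<forall>\<^sub>F m in sequentially. \<forall>j\<in>J. \<forall>n\<ge>m. (cmod (ip (X (r m)) (b j) - ip (X (r n)) (b j))) < sqrt \<delta> / 2"
        using finite_J by (simp add: eventually_ball_finite_distrib)
      with ev1 have "\<forall>\<^sub>F m in sequentially. 1 / real (Suc m) < \<delta> / 4 \<and>
          (\<forall>j\<in>J. \<forall>n\<ge>m. cmod (ip (X (r m)) (b j) - ip (X (r n)) (b j)) < sqrt \<delta> / 2)"
        by (rule eventually_conj)
      then obtain N where "\<forall>m\<ge>N. 1 / real (Suc m) < \<delta> / 4 \<and>
          (\<forall>j\<in>J. \<forall>n\<ge>m. cmod (ip (X (r m)) (b j) - ip (X (r n)) (b j)) < sqrt \<delta> / 2)"
        unfolding eventually_sequentially ..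
      then have N: "!!m. m \<ge> N ==> 1 / real (Suc m) < \<delta> / 4"
          "!!m j n. m \<ge> N ==> j \<in> J ==> n \<ge> m ==> cmod (ip (X (r m)) (b j) - ip (X (r n)) (b j)) < sqrt \<delta> / 2"
        by simp_all
      have "H.nrm (X (r m) - X (r n)) < e" if "m \<ge> N" "n \<ge> N" for m n
      proof -
        have R: "H.nrm (R (r k)) < \<delta> / 4" if "k \<ge> N" for k
          using R_small[of "r k"] N(1)[of "r k"] seq_suble[OF r(1), of k] that by linarith
        have "(cmod (ip (X (r m)) (b j) - ip (X (r n)) (b j)))\<^sup>2 <= \<delta>" if "j \<in> J" for j
        proof -
          let ?u = "\<lambda>n. ip (X (r n)) (b j)"
          have "cmod (?u m - ?u n) <= cmod (?u N - ?u m) + cmod (?u N - ?u n)"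
            using norm_triangle_ineq4[of "?u N - ?u n" "?u N - ?u m"] by simp
          also have "... <= sqrt \<delta>"
            using N(2)[of N j m] N(2)[of N j n] that \<open>m \<ge> N\<close> \<open>n \<ge> N\<close> by simp
          finally have "(cmod (?u m - ?u n))\<^sup>2 <= (sqrt \<delta>)\<^sup>2" by (rule power_mono) simp
          then show ?thesis using \<delta> by simp
        qed
        then have "(\<Sum>j\<in>J. (cmod (ip (X (r m)) (b j) - ip (X (r n)) (b j)))\<^sup>2) <= real (card J) * \<delta>"
          using sum_bounded_above[of J _ \<delta>] by simp
        then have "(\<mu> - \<kappa>) * (H.nrm (X (r m) - X (r n)))\<^sup>2 < \<delta> + real (card J) * \<delta>"
        proof -
          assume S: "(\<Sum>j\<in>J. (cmod (ip (X (r m)) (b j) - ip (X (r n)) (b j)))\<^sup>2) <= real (card J) * \<delta>"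
          have "2 * (H.nrm (R (r m)) + H.nrm (R (r n))) < \<delta>" using R[OF \<open>m \<ge> N\<close>] R[OF \<open>n \<ge> N\<close>] by simp
          then show ?thesis by (rule le_less_trans[OF key add_less_le_mono[OF _ S]])
        qed
        also have "... < (\<mu> - \<kappa>) * e\<^sup>2"
        proof -
          have "\<delta> + real (card J) * \<delta> = (\<mu> - \<kappa>) * e\<^sup>2 / 2"
            by (simp add: \<delta>_def divide_simps) (simp add: algebra_simps)
          also have "... < (\<mu> - \<kappa>) * e\<^sup>2" using assms(1) e by simp
          finally show ?thesis .
        qed
        finally have "(H.nrm (X (r m) - X (r n)))\<^sup>2 < e\<^sup>2" using assms(1) by simp
        then show ?thesis by (rule power_less_imp_less_base) (use e in simp)
      qed
      then show "\<exists>N. \<forall>m\<ge>N. \<forall>n\<ge>N. H.nrm ((X \<circ> r) m - (X \<circ> r) n) < e" by auto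
    qed
    have R0: "(\<lambda>n. H.nrm (R (r n))) \<longlonglongrightarrow> 0"
    proof (rule Lim_null_comparison)
      show "\<forall>\<^sub>F n in sequentially. norm (H.nrm (R (r n))) <= 1 / real (Suc n)"
      proof (rule always_eventually, rule allI)
        fix n
        have "1 / real (Suc (r n)) <= 1 / real (Suc n)" using seq_suble[OF r(1), of n] by (intro divide_left_mono) auto
        then show "norm (H.nrm (R (r n))) <= 1 / real (Suc n)" using R_small[of "r n"] by simp
      qed
      show "(\<lambda>n. 1 / real (Suc n)) \<longlonglongrightarrow> 0" using LIMSEQ_inverse_real_of_nat by (simp add: inverse_eq_divide)
    qed
    have Cau_F: "\<forall>e>0. \<exists>N. \<forall>m\<ge>N. \<forall>n\<ge>N. H.nrm ((F \<circ> r) m - (F \<circ> r) n) < e"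
    proof (intro allI impI)
      fix e :: real assume e: "e > 0"
      have "e / (2 * (\<bar>\<kappa>\<bar> + 1)) > 0" using e by simp
      then obtain N1 where N1: "\<forall>m\<ge>N1. \<forall>n\<ge>N1. H.nrm ((X \<circ> r) m - (X \<circ> r) n) < e / (2 * (\<bar>\<kappa>\<bar> + 1))"
        using Cau_X by blast
      have "\<forall>\<^sub>F n in sequentially. H.nrm (R (r n)) < e / 4" using R0 e by (intro order_tendstoD) auto
      then obtain N2 where N2: "\<forall>n\<ge>N2. H.nrm (R (r n)) < e / 4" unfolding eventually_sequentially by blast
      have "H.nrm (F (r m) - F (r n)) < e" if "m \<ge> max N1 N2" "n \<ge> max N1 N2" for m n
      proof -
        let ?x = "X (r m) - X (r n)"
        have eq: "F (r m) - F (r n) = (R (r m) - R (r n)) + scale ?k ?x"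
          by (simp add: R_def H.scale_right_diff_distrib)
        have "H.nrm (F (r m) - F (r n)) <= H.nrm (R (r m) - R (r n)) + \<bar>\<kappa>\<bar> * H.nrm ?x"
          unfolding eq using H.nrm_triangle[of "R (r m) - R (r n)" "scale ?k ?x"] RH XD by (simp add: H.nrm_scale)
        also have "... <= (H.nrm (R (r m)) + H.nrm (R (r n))) + (\<bar>\<kappa>\<bar> + 1) * H.nrm ?x"
          using H.nrm_triangle_diff[OF RH RH, of "r m" "r n"] H.nrm_nonneg[of ?x] unfolding distrib_right by linarith
        also have "... < (e/4 + e/4) + (\<bar>\<kappa>\<bar> + 1) * (e / (2 * (\<bar>\<kappa>\<bar> + 1)))"
        proof (rule add_strict_mono[OF add_strict_mono mult_strict_left_mono])
          show "H.nrm ?x < e / (2 * (\<bar>\<kappa>\<bar> + 1))" using N1 that by simp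
        qed (use N2 that in auto)
        also have "(\<bar>\<kappa>\<bar> + 1) * (e / (2 * (\<bar>\<kappa>\<bar> + 1))) = e / 2"
        proof -
          have "\<bar>\<kappa>\<bar> + 1 ~= 0" by linarith
          then show ?thesis by (simp add: divide_simps)
        qed
        finally show ?thesis by simp
      qed
      then show "\<exists>N. \<forall>m\<ge>N. \<forall>n\<ge>N. H.nrm ((F \<circ> r) m - (F \<circ> r) n) < e" by (metis comp_apply)
    qed
    have "((X \<circ> r) n, (F \<circ> r) n) \<in> T" for n using XF by simp
    then obtain \<phi> f where \<phi>f: "(\<phi>, f) \<in> T" "(\<lambda>n. H.nrm ((X \<circ> r) n - \<phi>)) \<longlonglongrightarrow> 0"
        "(\<lambda>n. H.nrm ((F \<circ> r) n - f)) \<longlonglongrightarrow> 0"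
      using T_closed[OF _ Cau_X Cau_F] by blast
    have l: "\<phi> \<in> Hs" "f \<in> Hs" using T_D[OF \<phi>f(1)] T_H[OF \<phi>f(1)] by auto
    have "(\<lambda>n. H.nrm ((X \<circ> r) n)) \<longlonglongrightarrow> H.nrm \<phi>" using XD l by (intro H.tendsto_nrm \<phi>f(2)) auto
    then have "H.nrm \<phi> = 1" using LIMSEQ_unique[OF _ tendsto_const] by (simp add: X1)
    moreover have "H.nrm (f - scale ?k \<phi>) = 0"
    proof -
      have "(\<lambda>n. H.nrm ((F \<circ> r) n - scale ?k \<phi>)) \<longlonglongrightarrow> 0"
      proof (rule Lim_null_comparison)
        show "\<forall>\<^sub>F n in sequentially. norm (H.nrm ((F \<circ> r) n - scale ?k \<phi>)) <= H.nrm (R (r n)) + \<bar>\<kappa>\<bar> * H.nrm ((X \<circ> r) n - \<phi>)"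
        proof (rule always_eventually, rule allI)
          fix n
          have eq: "(F \<circ> r) n - scale ?k \<phi> = R (r n) + scale ?k ((X \<circ> r) n - \<phi>)"
            by (simp add: R_def H.scale_right_diff_distrib)
          show "norm (H.nrm ((F \<circ> r) n - scale ?k \<phi>)) <= H.nrm (R (r n)) + \<bar>\<kappa>\<bar> * H.nrm ((X \<circ> r) n - \<phi>)"
            unfolding eq using H.nrm_triangle[of "R (r n)" "scale ?k ((X \<circ> r) n - \<phi>)"] RH XD l
            by (simp add: H.nrm_scale)
        qed
        show "(\<lambda>n. H.nrm (R (r n)) + \<bar>\<kappa>\<bar> * H.nrm ((X \<circ> r) n - \<phi>)) \<longlonglongrightarrow> 0"
          using tendsto_add[OF R0 tendsto_mult_left[OF \<phi>f(2), of "\<bar>\<kappa>\<bar>"]] by simp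
      qed
      then show ?thesis using H.nrm_limit_unique[OF _ _ _ \<phi>f(3)] FH l by simp
    qed
    moreover have "eigenvector \<kappa> \<phi>" unfolding eigenvector_def using \<phi>f(1) calculation(2) by (intro exI[of _ f]) simp
    ultimately show False using ker[of \<phi>] by simp
  qed
  then obtain C where C: "\<forall>(\<phi>, f)\<in>T. H.nrm \<phi> <= C * H.nrm (f - scale ?k \<phi>)" ..
  show ?thesis
  proof (rule regularI)
    show "H.nrm \<phi> <= C * H.nrm (f - scale ?k \<phi>)" if "(\<phi>, f) \<in> T" for \<phi> f
      using bspec[OF C that] by simp
    show "H.nrm \<phi> = 0" if "(\<phi>, f) \<in> T" "H.nrm (f - scale (cnj ?k) \<phi>) = 0" for \<phi> f
    proof (rule ker)
      show "eigenvector \<kappa> \<phi>" unfolding eigenvector_def using that by (intro exI[of _ f]) simp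
    qed
  qed
qed

end

section \<open>The Hilbert space \<open>L\<^sup>2\<close>\<close>

definition cscale :: "complex => ('a => complex) => 'a => complex" where
  "cscale c f = (\<lambda>p. c * f p)"

lemma cscale_apply [simp]: "cscale c f p = c * f p"
  by (simp add: cscale_def)

lemma vector_space_cscale: "vector_space (cscale :: complex => ('a => complex) => _)"
  by unfold_locales (auto simp: fun_eq_iff algebra_simps)

lemma L2_measurable: "f \<in> L2 M ==> f \<in> borel_measurable M"
  and L2_integrable: "f \<in> L2 M ==> integrable M (\<lambda>p. (cmod (f p))\<^sup>2)"
  by (auto simp: L2_def)

lemma L2_bound:
  assumes "f \<in> borel_measurable M" "integrable M g" "!!p. p \<in> space M ==> (cmod (f p))\<^sup>2 <= g p"
  shows "f \<in> L2 M"
proof -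
  have "integrable M (\<lambda>p. (cmod (f p))\<^sup>2)"
  proof (rule Bochner_Integration.integrable_bound[OF assms(2)])
    show "AE p in M. norm ((cmod (f p))\<^sup>2) <= norm (g p)"
    proof (rule AE_I2)
      fix p assume "p \<in> space M"
      from assms(3)[OF this] show "norm ((cmod (f p))\<^sup>2) <= norm (g p)"
        by (simp add: abs_of_nonneg order_trans[OF _ abs_ge_self])
    qed
  qed (use assms(1) in measurable)
  then show ?thesis using assms(1) by (simp add: L2_def)
qed

lemma L2_zero [simp]: "(\<lambda>p. 0) \<in> L2 M"
  by (simp add: L2_def)

lemma norm_add_sq_le: "(norm (x + y))\<^sup>2 <= 2 * (norm x)\<^sup>2 + 2 * (norm (y::'b::real_normed_vector))\<^sup>2"
proof -
  have "(norm (x + y))\<^sup>2 <= (norm x + norm y)\<^sup>2" by (intro power_mono norm_triangle_ineq) auto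
  also have "... <= 2 * (norm x)\<^sup>2 + 2 * (norm y)\<^sup>2"
    using zero_le_power2[of "norm x - norm y"] by (simp add: power2_eq_square algebra_simps)
  finally show ?thesis .
qed

lemma L2_add: "f \<in> L2 M ==> g \<in> L2 M ==> (\<lambda>p. f p + g p) \<in> L2 M"
  by (rule L2_bound[where g = "\<lambda>p. 2 * (cmod (f p))\<^sup>2 + 2 * (cmod (g p))\<^sup>2"])
     (auto intro!: borel_measurable_add norm_add_sq_le simp: L2_measurable L2_integrable)

lemma L2_cmult: "f \<in> L2 M ==> (\<lambda>p. c * f p) \<in> L2 M"
  by (rule L2_bound[where g = "\<lambda>p. (cmod c)\<^sup>2 * (cmod (f p))\<^sup>2"])
     (auto intro!: borel_measurable_times simp: L2_measurable L2_integrable norm_mult power_mult_distrib)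

lemma L2_diff: "f \<in> L2 M ==> g \<in> L2 M ==> (\<lambda>p. f p - g p) \<in> L2 M"
  using L2_add[of f M "\<lambda>p. - 1 * g p"] L2_cmult[of g M "-1"] by simp

lemma L2_cnj: "f \<in> L2 M ==> (\<lambda>p. cnj (f p)) \<in> L2 M"
proof -
  have "cnj \<in> borel_measurable borel" by (intro borel_measurable_continuous_onI continuous_intros)
  then show "f \<in> L2 M ==> (\<lambda>p. cnj (f p)) \<in> L2 M"
    using measurable_compose[of f M borel cnj borel] by (auto simp: L2_def)
qed

lemma L2_mult_integrable:
  assumes "f \<in> L2 M" "g \<in> L2 M"
  shows "integrable M (\<lambda>p. f p * g p)"
proof (rule Bochner_Integration.integrable_bound)
  show "integrable M (\<lambda>p. (cmod (f p))\<^sup>2 + (cmod (g p))\<^sup>2)" using assms by (simp add: L2_integrable)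
  show "(\<lambda>p. f p * g p) \<in> borel_measurable M" using assms by (intro borel_measurable_times L2_measurable)
  have "norm (f p * g p) <= norm ((cmod (f p))\<^sup>2 + (cmod (g p))\<^sup>2)" for p
  proof -
    have "0 <= (cmod (f p) - cmod (g p))\<^sup>2" "0 <= cmod (f p) * cmod (g p)" by simp_all
    then have "cmod (f p) * cmod (g p) <= (cmod (f p))\<^sup>2 + (cmod (g p))\<^sup>2"
      unfolding power2_diff by linarith
    then show ?thesis by (simp add: norm_mult)
  qed
  then show "AE p in M. norm (f p * g p) <= norm ((cmod (f p))\<^sup>2 + (cmod (g p))\<^sup>2)" by simp
qed

lemma L2_inner_integrable: "f \<in> L2 M ==> g \<in> L2 M ==> integrable M (\<lambda>p. f p * cnj (g p))"
  by (intro L2_mult_integrable L2_cnj)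

lemma L2_inner_self: "L2_inner M f f = of_real (\<integral>p. (cmod (f p))\<^sup>2 \<partial>M)"
  unfolding L2_inner_def by (simp add: mult_cnj_self flip: of_real_power)

lemma semi_inner_L2: "semi_inner cscale (L2 M) (L2_inner M)"
proof -
  interpret vector_space "cscale :: complex => ('a => complex) => _" by (rule vector_space_cscale)
  show ?thesis
  proof unfold_locales
    show "0 \<in> L2 M" by (simp add: zero_fun_def)
    show "f + g \<in> L2 M" if "f \<in> L2 M" "g \<in> L2 M" for f g
      using L2_add[OF that] by (simp add: plus_fun_def)
    show "cscale c f \<in> L2 M" if "f \<in> L2 M" for c f
      using L2_cmult[OF that] by (simp add: cscale_def)
    show "L2_inner M (f + g) h = L2_inner M f h + L2_inner M g h"
      if "f \<in> L2 M" "g \<in> L2 M" "h \<in> L2 M" for f g h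
      using that by (simp add: L2_inner_def distrib_right L2_inner_integrable)
    show "L2_inner M (cscale c f) g = c * L2_inner M f g" if "f \<in> L2 M" "g \<in> L2 M" for c f g
      by (simp add: L2_inner_def mult.assoc)
    show "L2_inner M f g = cnj (L2_inner M g f)" for f g
    proof -
      have "cnj (L2_inner M g f) = (\<integral>p. cnj (g p * cnj (f p)) \<partial>M)"
        unfolding L2_inner_def by (rule Bochner_Integration.integral_cnj[symmetric])
      then show ?thesis by (simp add: L2_inner_def mult.commute del: Bochner_Integration.integral_cnj)
    qed
    show "0 <= Re (L2_inner M f f)" for f by (simp add: L2_inner_self)
  qed
qed

interpretation L2: semi_inner cscale "L2 M" "L2_inner M" for M
  by (rule semi_inner_L2)

lemma nrm_L2_inner: "semi_inner.nrm (L2_inner M) f = L2_norm M f"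
  by (simp add: L2.nrm_def L2_norm_def L2_inner_self)

lemma L2_norm_nonneg [simp]: "0 <= L2_norm M f"
  by (simp add: L2_norm_def)

lemma L2_norm_sq: "(L2_norm M f)\<^sup>2 = (\<integral>p. (cmod (f p))\<^sup>2 \<partial>M)"
  by (simp add: L2_norm_def)

lemma L2_norm_eq_0_iff: "f \<in> L2 M ==> L2_norm M f = 0 \<longleftrightarrow> (AE p in M. f p = 0)"
  by (simp add: L2_norm_def integral_nonneg_eq_0_iff_AE L2_integrable)

lemma nn_integral_L2_norm: "f \<in> L2 M ==> (\<integral>\<^sup>+p. ennreal ((cmod (f p))\<^sup>2) \<partial>M) = ennreal ((L2_norm M f)\<^sup>2)"
  by (simp add: L2_norm_sq nn_integral_eq_integral L2_integrable)

text \<open>Riesz--Fischer. A subsequence \<open>Y\<close> with \<open>\<parallel>Y (k + 1) - Y k\<parallel> <= 2\<^sup>-\<^sup>k\<close> has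
  \<open>\<integral> \<Sum>\<^sub>k 2\<^sup>k |Y (k + 1) - Y k|\<^sup>2 < \<infinity>\<close>, so its increments are almost everywhere summable;
  Fatou's lemma then turns the pointwise limit into a limit in norm.\<close>

lemma L2_complete:
  assumes X: "!!n. X n \<in> L2 M"
    and Cau: "\<forall>e>0. \<exists>N. \<forall>m\<ge>N. \<forall>n\<ge>N. L2_norm M (X m - X n) < e"
  shows "\<exists>f\<in>L2 M. (\<lambda>n. L2_norm M (X n - f)) \<longlonglongrightarrow> 0"
proof -
  have [simp]: "X m - X n \<in> L2 M" for m n using L2_diff[OF X X] by (simp add: fun_diff_def)
  have "\<exists>N. \<forall>m\<ge>N. \<forall>n\<ge>N. L2_norm M (X m - X n) < (1/2)^k" for k using Cau by simp
  then obtain N where N: "!!k m n. m \<ge> N k ==> n \<ge> N k ==> L2_norm M (X m - X n) < (1/2)^k" by metis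
  define r where "r k = (\<Sum>i\<le>k. N i)" for k
  have rN: "r k \<ge> N i" if "i <= k" for i k
    unfolding r_def using that by (intro member_le_sum) auto
  define Y where "Y k = X (r k)" for k
  have YL: "Y k \<in> L2 M" for k by (simp add: Y_def X)
  have Ym [measurable]: "Y k \<in> borel_measurable M" for k using YL L2_measurable by blast
  have Yd: "L2_norm M (Y l - Y k) < (1/2)^k" if "k <= l" for k l
    unfolding Y_def by (rule N) (use rN that in auto)
  have ae: "AE p in M. convergent (\<lambda>k. Y k p)"
  proof -
    let ?h = "\<lambda>k p. ennreal (2^k * (cmod (Y (Suc k) p - Y k p))\<^sup>2)"
    have "(\<integral>\<^sup>+p. ?h k p \<partial>M) <= ennreal ((1/2)^k)" for k
    proof -
      have "(\<integral>\<^sup>+p. ?h k p \<partial>M) = ennreal (2^k) * (\<integral>\<^sup>+p. ennreal ((cmod ((Y (Suc k) - Y k) p))\<^sup>2) \<partial>M)"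
        by (subst nn_integral_cmult[symmetric]) (auto simp: ennreal_mult intro!: nn_integral_cong)
      also have "... = ennreal (2^k * (L2_norm M (Y (Suc k) - Y k))\<^sup>2)"
        by (subst nn_integral_L2_norm) (auto simp: Y_def ennreal_mult)
      also have "... <= ennreal (2^k * ((1/2)^k)\<^sup>2)"
        using Yd[of k "Suc k"] by (intro ennreal_leI mult_left_mono power_mono) auto
      also have "2^k * ((1/2)^k)\<^sup>2 = (1/2::real)^k"
        by (simp add: power2_eq_square power_divide)
      finally show ?thesis .
    qed
    then have "(\<Sum>k. \<integral>\<^sup>+p. ?h k p \<partial>M) <= (\<Sum>k. ennreal ((1/2)^k))" by (intro suminf_le) auto
    also have "... = ennreal (\<Sum>k. (1/2)^k)" by (intro suminf_ennreal2) auto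
    finally have "(\<integral>\<^sup>+p. (\<Sum>k. ?h k p) \<partial>M) ~= \<infinity>"
      by (subst nn_integral_suminf) (auto simp: top_unique)
    then have "AE p in M. (\<Sum>k. ?h k p) ~= \<infinity>"
      by (intro nn_integral_PInf_AE) auto
    then show ?thesis
    proof (rule AE_mp, intro AE_I2 impI)
      fix p assume "(\<Sum>k. ?h k p) ~= \<infinity>"
      then have s: "summable (\<lambda>k. 2^k * (cmod (Y (Suc k) p - Y k p))\<^sup>2)"
        by (intro summable_suminf_not_top) auto
      have "summable (\<lambda>k. (2^k * (cmod (Y (Suc k) p - Y k p))\<^sup>2 + (1/2)^k))"
        using s by (intro summable_add) auto
      then have "summable (\<lambda>k. Y (Suc k) p - Y k p)"
      proof (rule summable_comparison_test'[of _ 0])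
        fix k
        let ?a = "cmod (Y (Suc k) p - Y k p)"
        \<comment> \<open>Arithmetic--geometric mean, scaled by \<open>2\<^sup>k\<close>.\<close>
        have "0 <= (2^k * ?a - 1)\<^sup>2 / 2^k" by simp
        also have "... = 2^k * ?a\<^sup>2 + (1/2)^k - 2 * ?a"
          by (simp add: power2_eq_square field_simps power_divide)
        finally show "norm (Y (Suc k) p - Y k p) <= 2^k * ?a\<^sup>2 + (1/2)^k" using norm_ge_zero[of "Y (Suc k) p - Y k p"] by linarith
      qed
      then have "convergent (\<lambda>n. Y n p - Y 0 p)"
        unfolding summable_iff_convergent sum_lessThan_telescope[of "\<lambda>n. Y n p"] .
      then show "convergent (\<lambda>n. Y n p)" by (simp add: convergent_diff_const_right_iff)
    qed
  qed
  define f where "f p = lim (\<lambda>k. Y k p)" for p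
  have fm [measurable]: "f \<in> borel_measurable M" unfolding f_def by measurable
  have fatou: "(\<integral>\<^sup>+p. ennreal ((cmod (f p - Y k p))\<^sup>2) \<partial>M) <= ennreal (((1/2)^k)\<^sup>2)" for k
  proof -
    have "(\<integral>\<^sup>+p. ennreal ((cmod (f p - Y k p))\<^sup>2) \<partial>M)
        = (\<integral>\<^sup>+p. liminf (\<lambda>l. ennreal ((cmod (Y l p - Y k p))\<^sup>2)) \<partial>M)"
    proof (rule nn_integral_cong_AE, use ae in \<open>rule AE_mp\<close>, intro AE_I2 impI)
      fix p assume "convergent (\<lambda>k. Y k p)"
      then have "(\<lambda>l. Y l p) \<longlonglongrightarrow> f p" by (simp add: f_def convergent_LIMSEQ_iff)
      then have "(\<lambda>l. ennreal ((cmod (Y l p - Y k p))\<^sup>2)) \<longlonglongrightarrow> ennreal ((cmod (f p - Y k p))\<^sup>2)"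
        by (intro tendsto_intros)
      then show "ennreal ((cmod (f p - Y k p))\<^sup>2) = liminf (\<lambda>l. ennreal ((cmod (Y l p - Y k p))\<^sup>2))"
        using lim_imp_Liminf[OF sequentially_bot] by metis
    qed
    also have "... <= liminf (\<lambda>l. \<integral>\<^sup>+p. ennreal ((cmod (Y l p - Y k p))\<^sup>2) \<partial>M)"
      by (intro nn_integral_liminf) auto
    also have "... <= ennreal (((1/2)^k)\<^sup>2)"
    proof (rule Liminf_le)
      show "\<forall>\<^sub>F l in sequentially. (\<integral>\<^sup>+p. ennreal ((cmod (Y l p - Y k p))\<^sup>2) \<partial>M) <= ennreal (((1/2)^k)\<^sup>2)"
      proof (rule eventually_sequentiallyI)
        fix l assume "l \<ge> k"
        have "(\<integral>\<^sup>+p. ennreal ((cmod (Y l p - Y k p))\<^sup>2) \<partial>M) = ennreal ((L2_norm M (Y l - Y k))\<^sup>2)"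
          using nn_integral_L2_norm[of "Y l - Y k" M] by (simp add: Y_def)
        also have "... <= ennreal (((1/2)^k)\<^sup>2)"
          using Yd[OF \<open>l \<ge> k\<close>] by (intro ennreal_leI power_mono) auto
        finally show "(\<integral>\<^sup>+p. ennreal ((cmod (Y l p - Y k p))\<^sup>2) \<partial>M) <= ennreal (((1/2)^k)\<^sup>2)" .
      qed
    qed simp
    finally show ?thesis .
  qed
  have fY: "(\<lambda>p. f p - Y k p) \<in> L2 M" for k
    unfolding L2_def
  proof (intro CollectI conjI)
    show "integrable M (\<lambda>p. (cmod (f p - Y k p))\<^sup>2)"
      using fatou[of k] by (intro integrableI_bounded) (auto simp: top_unique intro: le_less_trans)
  qed simp
  have fL: "f \<in> L2 M" using L2_add[OF fY[of 0] YL[of 0]] by simp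
  have fY_norm: "L2_norm M (Y k - f) <= (1/2)^k" for k
  proof -
    have "ennreal ((L2_norm M (\<lambda>p. f p - Y k p))\<^sup>2) <= ennreal (((1/2)^k)\<^sup>2)"
      using fatou[of k] nn_integral_L2_norm[OF fY] by simp
    then have "L2_norm M (\<lambda>p. f p - Y k p) <= (1/2)^k"
      by (simp add: ennreal_le_iff power_mono_iff del: power_divide)
    also have "L2_norm M (\<lambda>p. f p - Y k p) = L2_norm M (Y k - f)"
      by (simp add: L2_norm_def norm_minus_commute)
    finally show ?thesis .
  qed
  have "(\<lambda>n. L2_norm M (X n - f)) \<longlonglongrightarrow> 0"
  proof (rule LIMSEQ_I)
    fix e :: real assume "e > 0"
    then obtain k where k: "(1/2)^k < e / 2" using real_arch_pow_inv[of "e/2" "1/2"] by auto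
    have "norm (L2_norm M (X n - f) - 0) < e" if "n \<ge> N k" for n
    proof -
      have "L2_norm M (X n - f) <= L2_norm M (X n - Y k) + L2_norm M (Y k - f)"
        using L2.nrm_triangle3[OF X[of n] YL[of k] fL] by (simp add: nrm_L2_inner)
      also have "... < e / 2 + e / 2"
        using N[of k n "r k"] rN[of k k] that fY_norm[of k] k by (simp add: Y_def)
      finally show ?thesis by simp
    qed
    then show "\<exists>N. \<forall>n\<ge>N. norm (L2_norm M (X n - f) - 0) < e" by blast
  qed
  then show ?thesis using fL by blast
qed

lemma complete_space_L2: "semi_inner.complete_space (L2 M) (L2_inner M)"
  unfolding L2.complete_space_def nrm_L2_inner using L2_complete by blast

section \<open>Smooth bump functions and mollification\<close>

lemma partial_deriv_eq: "(f has_derivative f') (at p) ==> partial_deriv e f p = f' e"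
  unfolding partial_deriv_def using frechet_derivative_at by metis

lemma C_k_SucD: "C_k (Suc k) f ==> C_k k f"
proof (induction k arbitrary: f)
  case 0
  then show ?case by (auto simp: continuous_on_eq_continuous_at intro: differentiable_imp_continuous_within)
qed auto

lemma C_k_Suc_imp_C1: "C_k (Suc k) f ==> C_k 1 f"
proof (induction k)
  case (Suc k)
  then show ?case using C_k_SucD by blast
qed simp

lemma smooth_imp_C1: "smooth f ==> C_k 1 f"
  by (simp add: smooth_def)

lemma C1_iff: "C_k 1 f \<longleftrightarrow> (\<forall>p. f differentiable (at p)) \<and> (\<forall>e\<in>Basis. continuous_on UNIV (partial_deriv e f))"
  by (simp add: One_nat_def)

lemma C1_continuous: "C_k 1 f ==> continuous_on UNIV f"
  using C_k_SucD[of 0 f] by simp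

lemma C_k_const: "C_k k (\<lambda>p. c)"
proof (induction k arbitrary: c)
  case (Suc k)
  have "partial_deriv e (\<lambda>p::'a. c) = (\<lambda>p. 0)" for e
    by (intro ext partial_deriv_eq has_derivative_const)
  then show ?case using Suc by simp
qed simp

lemma C_k_add: "C_k k f ==> C_k k g ==> C_k k (\<lambda>p. f p + g p)"
proof (induction k arbitrary: f g)
  case 0
  then show ?case by (auto intro: continuous_intros)
next
  case (Suc k)
  have "partial_deriv e (\<lambda>p. f p + g p) = (\<lambda>p. partial_deriv e f p + partial_deriv e g p)" for e
    unfolding partial_deriv_def[of e f] partial_deriv_def[of e g] using Suc.prems
    by (intro ext partial_deriv_eq has_derivative_add) (auto simp: frechet_derivative_works[symmetric])
  then show ?case using Suc by auto
qed

lemma partial_deriv_mult: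
  fixes f g :: "'a::euclidean_space => 'b::real_normed_algebra"
  assumes "f differentiable (at p)" "g differentiable (at p)"
  shows "partial_deriv e (\<lambda>p. f p * g p) p = f p * partial_deriv e g p + partial_deriv e f p * g p"
  unfolding partial_deriv_def[of e f] partial_deriv_def[of e g] using assms
  by (intro partial_deriv_eq has_derivative_mult) (auto simp: frechet_derivative_works[symmetric])

lemma C_k_mult:
  fixes f g :: "'a::euclidean_space => 'b::real_normed_algebra"
  shows "C_k k f ==> C_k k g ==> C_k k (\<lambda>p. f p * g p)"
proof (induction k arbitrary: f g)
  case 0
  then show ?case by (auto intro: continuous_intros)
next
  case (Suc k)
  have "partial_deriv e (\<lambda>p. f p * g p) = (\<lambda>p. f p * partial_deriv e g p + partial_deriv e f p * g p)" for e
    using Suc.prems by (intro ext partial_deriv_mult) auto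
  moreover have "C_k k f" "C_k k g" using Suc.prems C_k_SucD by auto
  ultimately show ?case using Suc.prems Suc.IH by (auto intro!: C_k_add)
qed

lemma C_k_prod:
  fixes f :: "'i => 'a::euclidean_space => 'b::{real_normed_algebra,comm_ring_1}"
  shows "(!!i. i \<in> I ==> C_k k (f i)) ==> C_k k (\<lambda>p. \<Prod>i\<in>I. f i p)"
  by (induction I rule: infinite_finite_induct) (auto intro: C_k_const C_k_mult)

text \<open>The functions \<open>p(1/t) e\<^sup>-\<^sup>1\<^sup>/\<^sup>t\<close> on the positive half-line, extended by zero, are closed under
  differentiation.\<close>

definition flat :: "real poly => real => real" where
  "flat p t = (if t > 0 then poly p (1/t) * exp (- 1/t) else 0)"

lemma poly_times_exp_tendsto_0: "((\<lambda>x. poly p x * exp (- x)) \<longlongrightarrow> (0::real)) at_top"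
proof -
  have "((\<lambda>x. \<Sum>i\<le>degree p. coeff p i * (x ^ i / exp x)) \<longlongrightarrow> (\<Sum>i\<le>degree p. coeff p i * 0)) at_top"
    by (intro tendsto_sum tendsto_mult_left tendsto_power_div_exp_0)
  then show ?thesis by (simp add: poly_altdef sum_distrib_right exp_minus divide_inverse mult.assoc)
qed

lemma flat_deriv: "(flat p has_real_derivative flat ([:0, 0, 1:] * (p - pderiv p)) t) (at t)"
proof -
  consider "t < 0" | "t > 0" | "t = 0" by linarith
  then show ?thesis
  proof cases
    case 1
    have "((\<lambda>t. 0) has_real_derivative 0) (at t)" by simp
    then have "(flat p has_real_derivative 0) (at t)"
      by (rule has_field_derivative_transform_within_open[of _ _ _ "{..<0}"]) (use 1 in \<open>auto simp: flat_def\<close>)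
    then show ?thesis using 1 by (simp add: flat_def)
  next
    case 2
    have "((\<lambda>t. poly p (1/t) * exp (- 1/t)) has_real_derivative
        poly (pderiv p) (1/t) * (- 1 / t^2) * exp (- 1/t) + exp (- 1/t) * (1/t^2) * poly p (1/t)) (at t)"
      using 2 by (auto intro!: derivative_eq_intros DERIV_chain2[OF poly_DERIV] simp: power2_eq_square divide_simps)
    then have "(flat p has_real_derivative
        poly (pderiv p) (1/t) * (- 1 / t^2) * exp (- 1/t) + exp (- 1/t) * (1/t^2) * poly p (1/t)) (at t)"
      by (rule has_field_derivative_transform_within_open[of _ _ _ "{0<..}"]) (use 2 in \<open>auto simp: flat_def\<close>)
    then show ?thesis using 2 by (simp add: flat_def power2_eq_square algebra_simps)
  next
    case 3
    have "((\<lambda>h. flat p h / h) \<longlongrightarrow> 0) (at_right 0)"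
    proof (rule Lim_transform_eventually)
      have "((\<lambda>x. poly ([:0,1:] * p) x * exp (- x)) \<longlongrightarrow> 0) at_top" by (rule poly_times_exp_tendsto_0)
      then show "((\<lambda>h. poly ([:0,1:] * p) (inverse h) * exp (- inverse h)) \<longlongrightarrow> (0::real)) (at_right 0)"
        by (rule filterlim_compose[OF _ filterlim_inverse_at_top_right])
      show "\<forall>\<^sub>F h in at_right 0. poly ([:0,1:] * p) (inverse h) * exp (- inverse h) = flat p h / h"
        by (auto simp: eventually_at_right_field flat_def field_simps intro!: exI[of _ 1])
    qed
    moreover have "((\<lambda>h. flat p h / h) \<longlongrightarrow> 0) (at_left 0)"
      by (rule Lim_transform_eventually[OF tendsto_const])
         (auto simp: eventually_at_left_field flat_def intro!: exI[of _ "-1"])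
    ultimately have "((\<lambda>h. flat p h / h) \<longlongrightarrow> 0) (at 0)" by (simp add: filterlim_split_at)
    then show ?thesis using 3 by (simp add: DERIV_def flat_def)
  qed
qed

lemma C_k_flat_affine:
  "C_k k (\<lambda>x::'a::euclidean_space. complex_of_real (flat p (c + x \<bullet> v)))"
proof (induction k arbitrary: p)
  case 0
  have "continuous_on UNIV (flat p)" using DERIV_continuous[OF flat_deriv]
    by (simp only: continuous_on_eq_continuous_at[OF open_UNIV]) blast
  then show ?case by (auto intro!: continuous_intros continuous_on_compose2[of UNIV "flat p"])
next
  case (Suc k)
  let ?q = "[:0, 0, 1:] * (p - pderiv p)"
  have der: "((\<lambda>x. complex_of_real (flat p (c + x \<bullet> v))) has_derivative
      (\<lambda>h. complex_of_real (flat ?q (c + x \<bullet> v) * (h \<bullet> v)))) (at x)" for x :: 'a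
  proof -
    have "((\<lambda>x. flat p (c + x \<bullet> v)) has_derivative (\<lambda>h. flat ?q (c + x \<bullet> v) * (h \<bullet> v))) (at x)"
      using flat_deriv[of p "c + x \<bullet> v", unfolded has_field_derivative_def]
      by (rule has_derivative_compose[rotated]) (auto intro!: derivative_eq_intros)
    then show ?thesis by (rule has_derivative_of_real)
  qed
  have "partial_deriv e (\<lambda>x. complex_of_real (flat p (c + x \<bullet> v)))
      = (\<lambda>x. complex_of_real (e \<bullet> v) * complex_of_real (flat ?q (c + x \<bullet> v)))" for e
    by (intro ext) (simp add: partial_deriv_eq[OF der] mult.commute)
  then show ?case using der Suc.IH by (auto simp: differentiable_def intro!: C_k_mult C_k_const)
qed

definition bump :: "real => 'a::euclidean_space => real" where
  "bump \<epsilon> x = (\<Prod>e\<in>Basis. flat 1 (\<epsilon> + x \<bullet> e) * flat 1 (\<epsilon> - x \<bullet> e))"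

lemma smooth_bump: "smooth (\<lambda>x::'a::euclidean_space. complex_of_real (bump \<epsilon> x))"
  unfolding smooth_def bump_def of_real_prod of_real_mult
proof (intro allI C_k_prod C_k_mult)
  show "C_k k (\<lambda>x::'a. complex_of_real (flat 1 (\<epsilon> + x \<bullet> e)))" for k e by (rule C_k_flat_affine)
  show "C_k k (\<lambda>x::'a. complex_of_real (flat 1 (\<epsilon> - x \<bullet> e)))" for k e
    using C_k_flat_affine[of k 1 \<epsilon> "-e"] by simp
qed

lemma flat_1: "flat 1 t \<ge> 0" "flat 1 t > 0 \<longleftrightarrow> t > 0" "t <= 0 ==> flat 1 t = 0"
  by (auto simp: flat_def)

lemma bump_nonneg: "0 <= bump \<epsilon> x"
  unfolding bump_def by (intro prod_nonneg mult_nonneg_nonneg ballI flat_1)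

lemma bump_pos: "\<epsilon> > 0 ==> bump \<epsilon> 0 > 0"
  unfolding bump_def by (intro prod_pos) (auto simp: flat_1)

lemma bump_minus: "bump \<epsilon> (- x) = bump \<epsilon> x"
  by (simp add: bump_def mult.commute)

lemma bump_nonzeroD: "bump \<epsilon> x ~= 0 ==> e \<in> Basis ==> \<bar>x \<bullet> e\<bar> < \<epsilon>"
proof (rule ccontr)
  assume "bump \<epsilon> x ~= 0" "e \<in> Basis" "\<not> \<bar>x \<bullet> e\<bar> < \<epsilon>"
  then have "flat 1 (\<epsilon> + x \<bullet> e) * flat 1 (\<epsilon> - x \<bullet> e) = 0"
    using flat_1(3)[of "\<epsilon> + x \<bullet> e"] flat_1(3)[of "\<epsilon> - x \<bullet> e"] by (auto simp: not_less abs_if split: if_splits)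
  then show False using \<open>bump \<epsilon> x ~= 0\<close> \<open>e \<in> Basis\<close> by (auto simp: bump_def)
qed

lemma bump_nonzero_norm: "bump \<epsilon> (x::'a::euclidean_space) ~= 0 ==> norm x <= real DIM('a) * \<epsilon>"
proof -
  assume *: "bump \<epsilon> x ~= 0"
  have "norm x <= (\<Sum>e\<in>Basis. \<bar>x \<bullet> e\<bar>)" by (rule norm_le_l1)
  also have "... <= of_nat DIM('a) * \<epsilon>" using bump_nonzeroD[OF *] by (intro sum_bounded_above) (auto intro: less_imp_le)
  finally show ?thesis .
qed

lemma continuous_bump: "continuous_on S (bump \<epsilon>)"
proof -
  have "continuous_on UNIV (\<lambda>x::'a. complex_of_real (bump \<epsilon> x))" using smooth_bump[of \<epsilon>] by (auto simp: smooth_def dest: spec[of _ 0])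
  then have "continuous_on UNIV (\<lambda>x::'a. Re (complex_of_real (bump \<epsilon> x)))" by (rule continuous_on_Re)
  then show ?thesis by (auto intro: continuous_on_subset)
qed

subsection \<open>Continuous functions with compact support\<close>

lemma integrable_compact_support:
  fixes f :: "'a::euclidean_space => 'b::{banach, second_countable_topology}"
  assumes "continuous_on UNIV f" "compact K" "!!x. x \<notin> K ==> f x = 0"
  shows "integrable lborel f"
proof -
  have "integrable lborel (\<lambda>x. indicator K x *\<^sub>R f x)"
    using assms by (intro borel_integrable_compact) (auto intro: continuous_on_subset)
  also have "(\<lambda>x. indicator K x *\<^sub>R f x) = f" using assms(3) by (auto simp: indicator_def fun_eq_iff)
  finally show ?thesis .
qed

lemma integral_cbox_eq_lborel:
  fixes f :: "'a::euclidean_space => 'b::euclidean_space"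
  assumes "continuous_on UNIV f" "!!x. x \<notin> cbox a b ==> f x = 0"
  shows "integral (cbox a b) f = (\<integral>x. f x \<partial>lborel)"
proof -
  have eq: "(\<lambda>x. indicator (cbox a b) x *\<^sub>R f x) = f" using assms(2) by (auto simp: indicator_def fun_eq_iff)
  have "set_integrable lborel (cbox a b) f"
    unfolding set_integrable_def eq by (rule integrable_compact_support[OF assms(1) compact_cbox assms(2)])
  from set_borel_integral_eq_integral(2)[OF this] show ?thesis unfolding set_lebesgue_integral_def eq by simp
qed

lemma integral_shift_lborel:
  fixes f :: "'a::euclidean_space => 'b::{banach, second_countable_topology}"
  assumes "f \<in> borel_measurable borel"
  shows "(\<integral>x. f (c + x) \<partial>lborel) = (\<integral>x. f x \<partial>lborel)"
  using assms by (subst lborel_distr_plus[of c, symmetric], subst integral_distr) auto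

lemma partial_deriv_eq_0_outside:
  assumes "closed K" "!!x. x \<notin> K ==> F x = 0" "x \<notin> K"
  shows "partial_deriv e F x = 0"
proof -
  have "(F has_derivative (\<lambda>h. 0)) (at x)"
    by (rule has_derivative_transform_within_open[of "\<lambda>_. 0" _ _ _ "- K"]) (use assms in auto)
  then show ?thesis by (simp add: partial_deriv_eq)
qed

text \<open>Translation invariance of the integral, differentiated in the direction \<open>e\<close>.\<close>

lemma integral_partial_deriv_eq_0:
  fixes F :: "'a::euclidean_space => complex"
  assumes diff: "!!p. F differentiable (at p)" and cont: "continuous_on UNIV (partial_deriv e F)"
    and K: "compact K" "!!x. x \<notin> K ==> F x = 0"
  shows "(\<integral>x. partial_deriv e F x \<partial>lborel) = 0"
proof -
  obtain r where r: "r > 0" "K \<subseteq> ball 0 r" using compact_imp_bounded[OF K(1)] by (meson bounded_subset_ballD)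
  define R where "R = r + norm e"
  obtain a where a: "cball (0::'a) R \<subseteq> cbox (-a) a" using bounded_subset_cbox_symmetric[OF bounded_cball] by blast
  have out: "F (x + h *\<^sub>R e) = 0" if "x \<notin> cbox (-a) a" "h \<in> {-1..1}" for x h
  proof (rule K(2), rule notI)
    assume "x + h *\<^sub>R e \<in> K"
    then have "norm (x + h *\<^sub>R e) < r" using r(2) by auto
    moreover have "norm x <= norm (x + h *\<^sub>R e) + norm (h *\<^sub>R e)"
      using norm_triangle_ineq4[of "x + h *\<^sub>R e" "h *\<^sub>R e"] by simp
    moreover have "norm (h *\<^sub>R e) <= norm e" using that(2) by (auto simp: abs_le_iff intro!: mult_left_le_one_le)
    ultimately show False using that(1) a by (auto simp: R_def subset_iff)
  qed
  have contF: "continuous_on UNIV F" using diff differentiable_imp_continuous_within continuous_at_imp_continuous_on by blast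
  have der: "((\<lambda>h. F (x + h *\<^sub>R e)) has_vector_derivative partial_deriv e F (x + h *\<^sub>R e)) (at h within {-1..1})" for x h
  proof -
    have "(F has_derivative frechet_derivative F (at (x + h *\<^sub>R e))) (at (x + h *\<^sub>R e))"
      using diff frechet_derivative_works by blast
    then have "((\<lambda>h. F (x + h *\<^sub>R e)) has_derivative (\<lambda>k. frechet_derivative F (at (x + h *\<^sub>R e)) (k *\<^sub>R e))) (at h)"
      by (rule has_derivative_compose[rotated]) (auto intro!: derivative_eq_intros)
    moreover have "linear (frechet_derivative F (at (x + h *\<^sub>R e)))" using diff linear_frechet_derivative by blast
    ultimately show ?thesis
      unfolding has_vector_derivative_def partial_deriv_def by (auto simp: linear_scale intro: has_derivative_at_withinI)
  qed
  let ?B = "cbox (-a) a"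
  have "((\<lambda>h. integral ?B (\<lambda>x. F (x + h *\<^sub>R e))) has_vector_derivative
      integral ?B (\<lambda>x. partial_deriv e F (x + 0 *\<^sub>R e))) (at 0 within {-1..1})"
  proof (rule leibniz_rule_vector_derivative[where U="{-1..1}"])
    show "(\<lambda>x. F (x + h *\<^sub>R e)) integrable_on ?B" for h
      by (intro integrable_continuous continuous_on_compose2[OF contF]) (auto intro!: continuous_intros)
    show "continuous_on ({- 1..1} \<times> ?B) (\<lambda>(h, x). partial_deriv e F (x + h *\<^sub>R e))"
      unfolding split_beta by (intro continuous_on_compose2[OF cont]) (auto intro!: continuous_intros)
  qed (use der in auto)
  moreover have "integral ?B (\<lambda>x. F (x + h *\<^sub>R e)) = (\<integral>x. F x \<partial>lborel)" if "h \<in> {-1..1}" for h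
  proof -
    have "integral ?B (\<lambda>x. F (x + h *\<^sub>R e)) = (\<integral>x. F (x + h *\<^sub>R e) \<partial>lborel)"
      using out that by (intro integral_cbox_eq_lborel continuous_on_compose2[OF contF]) (auto intro!: continuous_intros)
    also have "... = (\<integral>x. F (h *\<^sub>R e + x) \<partial>lborel)" by (simp add: add.commute)
    also have "... = (\<integral>x. F x \<partial>lborel)"
      using borel_measurable_continuous_onI[OF contF] by (rule integral_shift_lborel)
    finally show ?thesis .
  qed
  then have "((\<lambda>h. integral ?B (\<lambda>x. F (x + h *\<^sub>R e))) has_vector_derivative 0) (at 0 within {-1..1})"
    by (intro has_vector_derivative_transform[OF _ _ has_vector_derivative_const[of "\<integral>x. F x \<partial>lborel"]]) auto
  ultimately have "integral ?B (partial_deriv e F) = 0"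
    using vector_derivative_unique_within[of 0 "{-1..1::real}"] by (auto simp: trivial_limit_within)
  moreover have "partial_deriv e F x = 0" if "x \<notin> ?B" for x
    using partial_deriv_eq_0_outside[OF closed_cbox _ that, of F] out[of _ 0] by simp
  ultimately show ?thesis using integral_cbox_eq_lborel[OF cont] by metis
qed

subsection \<open>Mollification\<close>

definition convolve :: "'a::euclidean_space => ('a => complex) => ('a => complex) => 'a => complex" where
  "convolve b f g x = integral (cbox (-b) b) (\<lambda>t. f t * g (x - t))"

lemma continuous_on_difference_mult:
  fixes f g :: "'a::real_normed_vector => complex"
  assumes "continuous_on UNIV f" "continuous_on UNIV g"
  shows "continuous_on S (\<lambda>p. f (snd p) * g (fst p - snd p))"
proof (rule continuous_on_mult)
  show "continuous_on S (\<lambda>p. f (snd p))"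
    by (rule continuous_on_compose2[OF assms(1)]) (auto intro!: continuous_intros)
  show "continuous_on S (\<lambda>p. g (fst p - snd p))"
    by (rule continuous_on_compose2[OF assms(2)]) (auto intro!: continuous_intros)
qed

lemma convolve_derivative:
  assumes f: "continuous_on UNIV f" and g: "C_k 1 g"
  shows "convolve b f g differentiable (at x)"
    and "e \<in> Basis ==> partial_deriv e (convolve b f g) x = convolve b f (partial_deriv e g) x"
proof -
  have gc: "continuous_on UNIV g" using C1_continuous[OF g] .
  have gd: "g differentiable (at p)" for p using g by (simp add: C1_iff)
  define D where "D x t = Blinfun (\<lambda>h. f t * frechet_derivative g (at (x - t)) h)" for x t
  have bl: "bounded_linear (\<lambda>h. f t * frechet_derivative g (at (x - t)) h)" for x t
    using bounded_linear_const_mult gd frechet_derivative_works has_derivative_bounded_linear by blast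
  have D: "blinfun_apply (D x t) = (\<lambda>h. f t * frechet_derivative g (at (x - t)) h)" for x t
    unfolding D_def by (rule bounded_linear_Blinfun_apply[OF bl])
  have contD: "continuous_on (UNIV \<times> cbox (-b) b) (\<lambda>(x, t). D x t)"
  proof (rule continuous_on_blinfun_componentwise)
    fix i :: 'a assume "i \<in> Basis"
    then have i: "continuous_on UNIV (partial_deriv i g)" using g by (simp add: C1_iff)
    have "continuous_on (UNIV \<times> cbox (-b) b) (\<lambda>p. f (snd p) * partial_deriv i g (fst p - snd p))"
      by (rule continuous_on_difference_mult[OF f i])
    then show "continuous_on (UNIV \<times> cbox (-b) b) (\<lambda>p. blinfun_apply (case p of (x, t) => D x t) i)"
      by (simp add: split_beta D partial_deriv_def)
  qed
  have der: "(convolve b f g has_derivative integral (cbox (-b) b) (D x)) (at x)"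
    unfolding convolve_def[abs_def]
  proof (rule leibniz_rule[where U = UNIV])
    fix x t
    have "((\<lambda>x. g (x - t)) has_derivative (\<lambda>h. frechet_derivative g (at (x - t)) h)) (at x)"
      using gd[of "x - t"] unfolding frechet_derivative_works
      by (rule has_derivative_compose[rotated]) (auto intro!: derivative_eq_intros)
    then show "((\<lambda>x. f t * g (x - t)) has_derivative blinfun_apply (D x t)) (at x within UNIV)"
      unfolding D by (intro has_derivative_mult_right)
  next
    show "(\<lambda>t. f t * g (x - t)) integrable_on cbox (-b) b" for x
    proof (intro integrable_continuous continuous_on_mult)
      show "continuous_on (cbox (-b) b) f" by (rule continuous_on_subset[OF f]) simp
      show "continuous_on (cbox (-b) b) (\<lambda>t. g (x - t))"
        by (rule continuous_on_compose2[OF gc]) (auto intro!: continuous_intros)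
    qed
  qed (use contD in auto)
  then show "convolve b f g differentiable (at x)" by (auto simp: differentiable_def)
  show "partial_deriv e (convolve b f g) x = convolve b f (partial_deriv e g) x" if "e \<in> Basis"
  proof -
    have "D x integrable_on cbox (-b) b"
    proof (rule integrable_continuous)
      have "continuous_on (cbox (-b) b) (\<lambda>t. (x, t))" by (intro continuous_intros)
      then show "continuous_on (cbox (-b) b) (D x)"
        using continuous_on_compose2[OF contD, of "cbox (-b) b" "\<lambda>t. (x, t)"] by (simp add: image_subset_iff)
    qed
    then show ?thesis
      unfolding partial_deriv_eq[OF der] by (simp add: blinfun_apply_integral D convolve_def partial_deriv_def)
  qed
qed

lemma C_k_convolve:
  assumes f: "continuous_on UNIV f"
  shows "C_k k g ==> C_k k (convolve b f g)"
proof (induction k arbitrary: g)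
  case 0
  then have g: "continuous_on UNIV g" by simp
  have "continuous_on (UNIV \<times> cbox (-b) b) (\<lambda>(x, t). f t * g (x - t))"
    unfolding split_beta by (rule continuous_on_difference_mult[OF f g])
  then show ?case unfolding C_k.simps convolve_def[abs_def] by (rule integral_continuous_on_param)
next
  case (Suc k)
  have g: "C_k 1 g" using C_k_Suc_imp_C1[OF Suc.prems] .
  have "partial_deriv e (convolve b f g) = convolve b f (partial_deriv e g)" if "e \<in> Basis" for e
    using convolve_derivative(2)[OF f g that] by (intro ext)
  then show ?case using convolve_derivative(1)[OF f g] Suc by auto
qed

lemma integral_bump_pos:
  assumes "\<epsilon> > 0"
  shows "integrable lborel (bump \<epsilon> :: 'a::euclidean_space => real)" and "(\<integral>x. bump \<epsilon> (x::'a) \<partial>lborel) > 0"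
proof -
  let ?b = "bump \<epsilon> :: 'a => real"
  show int: "integrable lborel ?b"
    by (rule integrable_compact_support[OF continuous_bump compact_cball[of 0 "real DIM('a) * \<epsilon>"]])
       (use bump_nonzero_norm in auto)
  have "(\<integral>x. ?b x \<partial>lborel) ~= 0"
  proof
    assume "(\<integral>x. ?b x \<partial>lborel) = 0"
    then have "AE x in lborel. ?b x = 0"
      using integral_nonneg_eq_0_iff_AE[OF int] by (simp add: bump_nonneg)
    then have "{x. ?b x ~= 0} \<in> null_sets lborel"
      using AE_iff_null[of lborel "\<lambda>x. ?b x = 0"] borel_open[OF open_Collect_neq[OF continuous_bump continuous_on_const, of \<epsilon> 0]]
      by simp
    then have "negligible {x. ?b x ~= 0}" by (simp add: negligible_iff_null_sets null_sets_completionI)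
    moreover have "open {x. ?b x ~= 0}" by (rule open_Collect_neq[OF continuous_bump continuous_on_const])
    moreover have "{x. ?b x ~= 0} ~= {}" using bump_pos[OF assms, where 'a='a] by force
    ultimately show False using open_not_negligible by blast
  qed
  moreover have "(\<integral>x. ?b x \<partial>lborel) \<ge> 0" by (intro integral_nonneg_AE) (simp add: bump_nonneg)
  ultimately show "(\<integral>x. ?b x \<partial>lborel) > 0" by simp
qed

lemma uniformly_continuous_compact_support:
  fixes f :: "'a::euclidean_space => complex"
  assumes f: "continuous_on UNIV f" and K: "compact K" "!!x. x \<notin> K ==> f x = 0" and \<eta>: "\<eta> > 0"
  shows "\<exists>\<delta>>0. \<forall>x y. dist x y < \<delta> --> cmod (f x - f y) < \<eta>"
proof -
  obtain r where r: "K \<subseteq> ball 0 r" using compact_imp_bounded[OF K(1)] by (meson bounded_subset_ballD)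
  have "uniformly_continuous_on (cball 0 (r + 1)) f"
    by (intro compact_uniformly_continuous continuous_on_subset[OF f]) auto
  then obtain \<delta> where \<delta>: "\<delta> > 0" "!!x y. x \<in> cball 0 (r+1) ==> y \<in> cball 0 (r+1) ==> dist y x < \<delta> ==> dist (f y) (f x) < \<eta>"
    unfolding uniformly_continuous_on_def using \<eta> by metis
  have "cmod (f x - f y) < \<eta>" if d: "dist x y < min \<delta> 1" for x y
  proof (cases "x \<in> cball 0 (r+1) \<and> y \<in> cball 0 (r+1)")
    case True
    then show ?thesis using \<delta>(2)[of y x] d by (simp add: dist_norm)
  next
    case False
    have "norm x <= norm y + dist x y" "norm y <= norm x + dist x y"
      using norm_triangle_ineq[of y "x - y"] norm_triangle_ineq[of x "y - x"] by (auto simp: dist_norm norm_minus_commute)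
    then have "x \<notin> K \<and> y \<notin> K" using False d r by (fastforce simp: subset_iff)
    then show ?thesis using K(2) \<eta> by simp
  qed
  then show ?thesis using \<delta>(1) by (intro exI[of _ "min \<delta> 1"]) auto
qed

definition mollify :: "real => 'a::euclidean_space => ('a => complex) => 'a => complex" where
  "mollify \<epsilon> b f x = convolve b f (\<lambda>x. of_real (bump \<epsilon> x)) x * of_real (1 / (\<integral>x. bump \<epsilon> (x::'a) \<partial>lborel))"

lemma convolve_eq_lborel:
  fixes f :: "'a::euclidean_space => complex"
  assumes f: "continuous_on UNIV f" and K: "compact K" "!!x. x \<notin> K ==> f x = 0" and b: "K \<subseteq> cbox (-b) b"
    and g: "continuous_on UNIV g"
  shows "convolve b f g x = (\<integral>t. f t * g (x - t) \<partial>lborel)"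
    and "integrable lborel (\<lambda>t. f t * g (x - t))"
proof -
  have c: "continuous_on UNIV (\<lambda>t. f t * g (x - t))"
    by (rule continuous_on_mult[OF f continuous_on_compose2[OF g]]) (auto intro!: continuous_intros)
  show "convolve b f g x = (\<integral>t. f t * g (x - t) \<partial>lborel)"
    unfolding convolve_def by (rule integral_cbox_eq_lborel[OF c]) (use K b in auto)
  show "integrable lborel (\<lambda>t. f t * g (x - t))"
    by (rule integrable_compact_support[OF c K(1)]) (simp add: K(2))
qed

context
  fixes f :: "'a::euclidean_space => complex" and K :: "'a set" and b :: 'a
  assumes f: "continuous_on UNIV f" and K: "compact K" "!!x. x \<notin> K ==> f x = 0" and b: "K \<subseteq> cbox (-b) b"
begin

lemma convolve_integral:
  assumes "continuous_on UNIV g"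
  shows "convolve b f g x = (\<integral>t. f t * g (x - t) \<partial>lborel)" and "integrable lborel (\<lambda>t. f t * g (x - t))"
  using convolve_eq_lborel[OF f K(1) _ b assms] K(2) by auto

lemma smooth_mollify: "smooth (mollify \<epsilon> b f)"
  unfolding smooth_def mollify_def[abs_def]
proof (intro allI C_k_mult C_k_const C_k_convolve[OF f])
  show "C_k k (\<lambda>x::'a. complex_of_real (bump \<epsilon> x))" for k
    using smooth_bump[where 'a='a, of \<epsilon>] by (simp add: smooth_def)
qed

lemma bump_continuous_complex: "continuous_on UNIV (\<lambda>x::'a. complex_of_real (bump \<epsilon> x))"
  by (intro continuous_on_of_real continuous_bump)

lemma mollify_zero:
  assumes "!!t. t \<in> K ==> real DIM('a) * \<epsilon> < dist x t"
  shows "mollify \<epsilon> b f x = 0"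
proof -
  have "f t * complex_of_real (bump \<epsilon> (x - t)) = 0" for t
    using assms[of t] K(2)[of t] bump_nonzero_norm[of \<epsilon> "x - t"] by (force simp: dist_norm)
  then have "(\<integral>t. f t * complex_of_real (bump \<epsilon> (x - t)) \<partial>lborel) = (\<integral>t. 0 \<partial>(lborel :: 'a measure))"
    by (intro Bochner_Integration.integral_cong refl)
  then show ?thesis by (simp add: mollify_def convolve_integral(1)[OF bump_continuous_complex])
qed

lemma mollify_close:
  assumes \<epsilon>: "\<epsilon> > 0" and close: "!!t. dist x t <= real DIM('a) * \<epsilon> ==> cmod (f t - f x) <= \<eta>"
  shows "cmod (mollify \<epsilon> b f x - f x) <= \<eta>"
proof -
  let ?I = "\<integral>x. bump \<epsilon> (x::'a) \<partial>lborel"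
  have I: "?I > 0" by (rule integral_bump_pos[OF \<epsilon>])
  have "bump \<epsilon> (x - t) = bump \<epsilon> (- x + t)" for t :: 'a using bump_minus[of \<epsilon> "x - t"] by (simp add: algebra_simps)
  then have shift: "(\<integral>t. bump \<epsilon> (x - t) \<partial>lborel) = ?I"
    using integral_shift_lborel[of "bump \<epsilon>" "-x"] continuous_bump[of UNIV \<epsilon>, THEN borel_measurable_continuous_onI]
    by simp
  have int: "integrable lborel (\<lambda>t. bump \<epsilon> (x - t))"
    using not_integrable_integral_eq[of lborel "\<lambda>t. bump \<epsilon> (x - t)"] I shift by fastforce
  have "mollify \<epsilon> b f x - f x = (\<integral>t. (f t - f x) * of_real (bump \<epsilon> (x - t)) \<partial>lborel) * of_real (1 / ?I)"
  proof -
    define X where "X = (\<integral>t. (f t - f x) * of_real (bump \<epsilon> (x - t)) \<partial>lborel)"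
    have X: "X
        = convolve b f (\<lambda>x. of_real (bump \<epsilon> x)) x - f x * of_real (\<integral>t. bump \<epsilon> (x - t) \<partial>lborel)"
      unfolding X_def left_diff_distrib convolve_integral(1)[OF bump_continuous_complex]
      using int by (subst Bochner_Integration.integral_diff) (auto intro!: convolve_integral(2)[OF bump_continuous_complex])
    show ?thesis unfolding X_def[symmetric] X mollify_def shift using I by (simp add: field_simps)
  qed
  then have "cmod (mollify \<epsilon> b f x - f x) = cmod (\<integral>t. (f t - f x) * of_real (bump \<epsilon> (x - t)) \<partial>lborel) / ?I"
    using I by (simp add: norm_mult norm_divide)
  also have "cmod (\<integral>t. (f t - f x) * of_real (bump \<epsilon> (x - t)) \<partial>lborel) <= (\<integral>t. \<eta> * bump \<epsilon> (x - t) \<partial>lborel)"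
  proof (rule order_trans[OF integral_norm_bound integral_mono])
    show "integrable lborel (\<lambda>t. norm ((f t - f x) * complex_of_real (bump \<epsilon> (x - t))))"
      by (rule integrable_norm) (use int in \<open>auto simp: left_diff_distrib intro!: convolve_integral(2)[OF bump_continuous_complex]\<close>)
    show "norm ((f t - f x) * complex_of_real (bump \<epsilon> (x - t))) <= \<eta> * bump \<epsilon> (x - t)" for t
    proof (cases "bump \<epsilon> (x - t) = 0")
      case False
      then have "dist x t <= real DIM('a) * \<epsilon>" using bump_nonzero_norm by (auto simp: dist_norm)
      then show ?thesis using close[of t] bump_nonneg[of \<epsilon> "x - t"] by (simp add: norm_mult mult_right_mono)
    qed simp
  qed (use int in simp)
  finally show ?thesis using I by (simp add: shift divide_right_mono)
qed

lemma partial_deriv_mollify: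
  assumes C1: "C_k 1 f" and e: "e \<in> Basis"
  shows "partial_deriv e (mollify \<epsilon> b f) = mollify \<epsilon> b (partial_deriv e f)"
proof
  fix x
  let ?g = "\<lambda>x::'a. complex_of_real (bump \<epsilon> x)"
  have g: "C_k 1 ?g" by (rule smooth_imp_C1[OF smooth_bump])
  have g': "continuous_on UNIV (partial_deriv e ?g)" using g e by (simp add: C1_iff)
  have gd: "?g differentiable (at p)" for p using g by (simp add: C1_iff)
  have fd: "f differentiable (at p)" for p using C1 by (simp add: C1_iff)
  have f': "continuous_on UNIV (partial_deriv e f)" using C1 e by (simp add: C1_iff)
  have f'0: "partial_deriv e f t = 0" if "t \<notin> K" for t
    by (rule partial_deriv_eq_0_outside[OF compact_imp_closed[OF K(1)] _ that]) (rule K(2))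
  let ?F = "\<lambda>t. f t * ?g (x - t)"
  have gx: "((\<lambda>t. ?g (x - t)) has_derivative (\<lambda>h. frechet_derivative ?g (at (x - t)) (- h))) (at t)" for t
    using gd[of "x - t"] unfolding frechet_derivative_works
    by (rule has_derivative_compose[rotated]) (auto intro!: derivative_eq_intros)
  have gx': "partial_deriv e (\<lambda>t. ?g (x - t)) t = - partial_deriv e ?g (x - t)" for t
    using linear_neg[OF linear_frechet_derivative[OF gd[of "x - t"]]]
    by (simp add: partial_deriv_eq[OF gx]) (simp add: partial_deriv_def)
  have F': "partial_deriv e ?F = (\<lambda>t. partial_deriv e f t * ?g (x - t) - f t * partial_deriv e ?g (x - t))"
    using gx by (intro ext, subst partial_deriv_mult[OF fd]) (auto simp: differentiable_def gx')
  have "(\<integral>t. partial_deriv e ?F t \<partial>lborel) = 0"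
  proof (rule integral_partial_deriv_eq_0[OF _ _ K(1)])
    show "?F differentiable at p" for p using fd gx by (intro differentiable_mult) (auto simp: differentiable_def)
    show "continuous_on UNIV (partial_deriv e ?F)"
    proof -
      have "continuous_on UNIV (\<lambda>t. ?g (x - t))"
        by (rule continuous_on_compose2[OF bump_continuous_complex]) (auto intro!: continuous_intros)
      moreover have "continuous_on UNIV (\<lambda>t. partial_deriv e ?g (x - t))"
        by (rule continuous_on_compose2[OF g']) (auto intro!: continuous_intros)
      ultimately show ?thesis unfolding F' by (intro continuous_on_diff continuous_on_mult f f')
    qed
  qed (simp add: K(2))
  moreover have "convolve b (partial_deriv e f) ?g x = (\<integral>t. partial_deriv e f t * ?g (x - t) \<partial>lborel)"
      "integrable lborel (\<lambda>t. partial_deriv e f t * ?g (x - t))"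
    using convolve_eq_lborel[OF f' K(1) f'0 b bump_continuous_complex] by simp_all
  ultimately have "convolve b f (partial_deriv e ?g) x = convolve b (partial_deriv e f) ?g x"
    unfolding F' by (simp add: convolve_integral[OF g'])
  moreover have "partial_deriv e (mollify \<epsilon> b f) x
      = convolve b f (partial_deriv e ?g) x * of_real (1 / (\<integral>x. bump \<epsilon> (x::'a) \<partial>lborel))"
    unfolding mollify_def[abs_def]
    by (subst partial_deriv_mult) (auto simp: convolve_derivative[OF f g] e partial_deriv_eq[OF has_derivative_const])
  ultimately show "partial_deriv e (mollify \<epsilon> b f) x = mollify \<epsilon> b (partial_deriv e f) x"
    by (simp add: mollify_def)
qed

end

definition supported_in :: "'a::topological_space set => ('a => complex) => bool" where
  "supported_in \<Omega> f \<longleftrightarrow> (\<exists>K. compact K \<and> K \<subseteq> \<Omega> \<and> (\<forall>x. x \<notin> K --> f x = 0))"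

lemma test_functionsI:
  assumes "smooth \<psi>" "supported_in \<Omega> \<psi>"
  shows "\<psi> \<in> test_functions \<Omega>"
proof -
  obtain K where K: "compact K" "K \<subseteq> \<Omega>" "\<forall>x. x \<notin> K --> \<psi> x = 0" using assms(2) unfolding supported_in_def by blast
  have "closure {p. \<psi> p ~= 0} \<subseteq> K" using K by (intro closure_minimal compact_imp_closed) auto
  moreover from this have "closure {p. \<psi> p ~= 0} \<inter> K = closure {p. \<psi> p ~= 0}" by blast
  then have "compact (closure {p. \<psi> p ~= 0})"
    using closed_Int_compact[OF closed_closure K(1), of "{p. \<psi> p ~= 0}"] by metis
  ultimately show ?thesis using assms(1) K(2) by (auto simp: test_functions_def)
qed

text \<open>For mollifiers \<open>\<psi> n\<close> of shrinking radius, supports stay in a fixed compact neighbourhood of the support of \<open>f\<close>.\<close>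

lemma ex_test_function_approx:
  fixes f :: "'a::euclidean_space => complex"
  assumes \<Omega>: "open \<Omega>" and K: "compact K" "K \<subseteq> \<Omega>" "!!x. x \<notin> K ==> f x = 0" and f: "continuous_on UNIV f"
  obtains K' \<psi> where "compact K'" "K' \<subseteq> \<Omega>" "K \<subseteq> K'" "!!n::nat. \<psi> n \<in> test_functions \<Omega>"
    "!!n x. x \<notin> K' ==> \<psi> n x = 0"
    "!!\<eta>. \<eta> > 0 ==> \<forall>\<^sub>F n in sequentially. \<forall>x. cmod (\<psi> n x - f x) <= \<eta>"
    "!!\<eta> e. C_k 1 f ==> e \<in> Basis ==> \<eta> > 0 ==>
      \<forall>\<^sub>F n in sequentially. \<forall>x. cmod (partial_deriv e (\<psi> n) x - partial_deriv e f x) <= \<eta>"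
proof -
  obtain r where r: "r > 0" "(\<Union>x\<in>K. cball x r) \<subseteq> \<Omega>"
    using compact_subset_open_imp_cball_epsilon_subset[OF K(1) \<Omega> K(2)] by blast
  define K' where "K' = {x + y | x y. x \<in> K \<and> y \<in> cball 0 r}"
  have K': "compact K'" unfolding K'_def by (rule compact_sums[OF K(1) compact_cball])
  have K'_dist: "\<exists>t\<in>K. dist x t <= r" if x: "x \<in> K'" for x
  proof -
    obtain t y where "x = t + y" "t \<in> K" "y \<in> cball 0 r" using x unfolding K'_def by blast
    then show ?thesis by (intro bexI[of _ t]) (auto simp: dist_norm)
  qed
  have K'I: "x \<in> K'" if "t \<in> K" "dist x t <= r" for x t
    unfolding K'_def by (rule CollectI, rule exI[of _ t], rule exI[of _ "x - t"]) (use that in \<open>auto simp: dist_norm norm_minus_commute\<close>)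
  have K'\<Omega>: "K' \<subseteq> \<Omega>" using K'_dist r(2) by (force simp: dist_commute)
  obtain b where b: "K \<subseteq> cbox (-b) b" using bounded_subset_cbox_symmetric[OF compact_imp_bounded[OF K(1)]] by blast
  define \<epsilon> where "\<epsilon> n = r / real DIM('a) * (1 / real (Suc n))" for n
  have \<epsilon>: "\<epsilon> n > 0" for n using r(1) by (simp add: \<epsilon>_def)
  have D\<epsilon>: "real DIM('a) * \<epsilon> n = r / real (Suc n)" for n by (simp add: \<epsilon>_def)
  have D\<epsilon>r: "real DIM('a) * \<epsilon> n <= r" for n using r(1) unfolding D\<epsilon> by (simp add: divide_le_eq)
  have conv: "\<forall>\<^sub>F n in sequentially. \<forall>x. cmod (mollify (\<epsilon> n) b h x - h x) <= \<eta>"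
    if h: "continuous_on UNIV h" "!!x. x \<notin> K ==> h x = 0" and \<eta>: "\<eta> > 0" for h \<eta>
  proof -
    obtain \<delta> where \<delta>: "\<delta> > 0" "!!x y. dist x y < \<delta> ==> cmod (h x - h y) < \<eta>"
      using uniformly_continuous_compact_support[OF h(1) K(1) h(2) \<eta>] by blast
    have "(\<lambda>n. r * (1 / real (Suc n))) \<longlonglongrightarrow> r * 0"
      using LIMSEQ_inverse_real_of_nat by (intro tendsto_mult_left) (simp add: inverse_eq_divide)
    then have "\<forall>\<^sub>F n in sequentially. r / real (Suc n) < \<delta>" using \<delta>(1) by (intro order_tendstoD) auto
    then show ?thesis
    proof eventually_elim
      case (elim n)
      show ?case
      proof
        fix x
        show "cmod (mollify (\<epsilon> n) b h x - h x) <= \<eta>"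
        proof (rule mollify_close[OF h(1) K(1) h(2) b \<epsilon>])
          fix t assume "dist x t <= real DIM('a) * \<epsilon> n"
          then have "dist t x < \<delta>" using elim by (simp add: D\<epsilon> dist_commute)
          then show "cmod (h t - h x) <= \<eta>" using \<delta>(2) less_imp_le by blast
        qed
      qed
    qed
  qed
  have out: "mollify (\<epsilon> n) b f x = 0" if "x \<notin> K'" for n x
  proof (rule mollify_zero[OF f K(1,3) b])
    fix t assume "t \<in> K"
    then show "real DIM('a) * \<epsilon> n < dist x t" using K'I[of t x] that D\<epsilon>r[of n] by force
  qed
  show ?thesis
  proof (rule that[OF K' K'\<Omega>])
    show "K \<subseteq> K'" using K'I r(1) by auto
    show "mollify (\<epsilon> n) b f \<in> test_functions \<Omega>" for n
    proof -
      have "supported_in \<Omega> (mollify (\<epsilon> n) b f)" unfolding supported_in_def using out K' K'\<Omega> by blast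
      moreover have "smooth (mollify (\<epsilon> n) b f)" by (rule smooth_mollify[OF f K(1,3) b])
      ultimately show ?thesis by (intro test_functionsI)
    qed
    show "\<forall>\<^sub>F n in sequentially. \<forall>x. cmod (mollify (\<epsilon> n) b f x - f x) <= \<eta>" if "\<eta> > 0" for \<eta>
      by (rule conv[OF f K(3) that])
    show "\<forall>\<^sub>F n in sequentially. \<forall>x. cmod (partial_deriv e (mollify (\<epsilon> n) b f) x - partial_deriv e f x) <= \<eta>"
      if "C_k 1 f" "e \<in> Basis" "\<eta> > 0" for \<eta> e
    proof -
      have eq: "partial_deriv e (mollify (\<epsilon> n) b f) = mollify (\<epsilon> n) b (partial_deriv e f)" for n
        by (rule partial_deriv_mollify[OF f K(1) _ b that(1,2)]) (rule K(3))
      show ?thesis unfolding eq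
    proof (rule conv[OF _ _ that(3)])
      show "continuous_on UNIV (partial_deriv e f)" using that by (simp add: C1_iff)
      show "partial_deriv e f x = 0" if "x \<notin> K" for x
        by (rule partial_deriv_eq_0_outside[OF compact_imp_closed[OF K(1)] _ that]) (rule K(3))
    qed
    qed
  qed (use out in auto)
qed

section \<open>Sobolev spaces\<close>

lemma supported_in_outside: "supported_in \<Omega> f ==> x \<notin> \<Omega> ==> f x = 0"
  by (auto simp: supported_in_def)

lemma supported_in_UNIV: "supported_in \<Omega> f ==> supported_in UNIV f"
  by (auto simp: supported_in_def)

lemma supported_in_mult: "supported_in \<Omega> f ==> supported_in \<Omega> (\<lambda>x. f x * g x)"
  by (auto simp: supported_in_def)

lemma supported_in_partial_deriv:
  fixes f :: "'a::euclidean_space => complex"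
  shows "supported_in \<Omega> f ==> supported_in \<Omega> (partial_deriv e f)"
  unfolding supported_in_def using partial_deriv_eq_0_outside[OF compact_imp_closed] by meson

lemma test_functionsD:
  assumes "\<psi> \<in> test_functions \<Omega>"
  shows "smooth \<psi>" "C_k 1 \<psi>" "supported_in \<Omega> \<psi>"
proof -
  show "smooth \<psi>" "C_k 1 \<psi>" using assms by (auto simp: test_functions_def smooth_def)
  show "supported_in \<Omega> \<psi>" unfolding supported_in_def
    using assms closure_subset[of "{p. \<psi> p ~= 0}"] by (intro exI[of _ "closure {p. \<psi> p ~= 0}"]) (auto simp: test_functions_def)
qed

lemma test_functions_add: "\<psi> \<in> test_functions \<Omega> ==> \<theta> \<in> test_functions \<Omega> ==> (\<lambda>p. \<psi> p + \<theta> p) \<in> test_functions \<Omega>"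
proof (rule test_functionsI)
  assume *: "\<psi> \<in> test_functions \<Omega>" "\<theta> \<in> test_functions \<Omega>"
  show "smooth (\<lambda>p. \<psi> p + \<theta> p)" using test_functionsD(1)[OF *(1)] test_functionsD(1)[OF *(2)]
    by (simp add: smooth_def C_k_add)
  obtain K L where "compact K" "K \<subseteq> \<Omega>" "\<forall>x. x \<notin> K --> \<psi> x = 0" "compact L" "L \<subseteq> \<Omega>" "\<forall>x. x \<notin> L --> \<theta> x = 0"
    using test_functionsD(3)[OF *(1)] test_functionsD(3)[OF *(2)] unfolding supported_in_def by blast
  then show "supported_in \<Omega> (\<lambda>p. \<psi> p + \<theta> p)"
    unfolding supported_in_def by (intro exI[of _ "K \<union> L"]) (auto intro: compact_Un)
qed

lemma test_functions_cmult: "\<psi> \<in> test_functions \<Omega> ==> (\<lambda>p. c * \<psi> p) \<in> test_functions \<Omega>"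
proof (rule test_functionsI)
  assume *: "\<psi> \<in> test_functions \<Omega>"
  show "smooth (\<lambda>p. c * \<psi> p)" using test_functionsD(1)[OF *] by (simp add: smooth_def C_k_mult C_k_const)
  show "supported_in \<Omega> (\<lambda>p. c * \<psi> p)" using supported_in_mult[OF test_functionsD(3)[OF *], of "\<lambda>_. c"] by (simp add: mult.commute)
qed

lemma integral_norm_mult_le:
  assumes "f \<in> L2 M" "g \<in> L2 M"
  shows "cmod (\<integral>p. f p * g p \<partial>M) <= L2_norm M f * L2_norm M g"
proof -
  have "cmod (L2_inner M f (\<lambda>p. cnj (g p))) <= L2_norm M f * L2_norm M (\<lambda>p. cnj (g p))"
    using L2.Cauchy_Schwarz[OF assms(1) L2_cnj[OF assms(2)]] by (simp add: nrm_L2_inner)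
  then show ?thesis by (simp add: L2_inner_def L2_norm_def)
qed

lemma tendsto_integral_mult:
  assumes "!!n. X n \<in> L2 M" "f \<in> L2 M" "g \<in> L2 M" "(\<lambda>n. L2_norm M (\<lambda>p. X n p - f p)) \<longlonglongrightarrow> 0"
  shows "(\<lambda>n. \<integral>p. X n p * g p \<partial>M) \<longlonglongrightarrow> (\<integral>p. f p * g p \<partial>M)"
  using L2.tendsto_ip[OF assms(1,2) _ L2_cnj[OF assms(3)]] assms(4)
  by (simp add: nrm_L2_inner L2_inner_def fun_diff_def)

lemma L2_norm_cong_AE:
  assumes "f \<in> borel_measurable M" "g \<in> borel_measurable M" "AE p in M. f p = g p"
  shows "L2_norm M f = L2_norm M g"
  unfolding L2_norm_def using assms by (intro arg_cong[of _ _ sqrt] integral_cong_AE) auto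

lemma L2_norm_triangle:
  assumes "f \<in> L2 M" "g \<in> L2 M"
  shows "L2_norm M (\<lambda>p. f p + g p) <= L2_norm M f + L2_norm M g"
  using L2.nrm_triangle[OF assms] by (simp add: nrm_L2_inner plus_fun_def)

lemma L2_norm_triangle_diff3:
  assumes "f \<in> L2 M" "g \<in> L2 M" "h \<in> L2 M"
  shows "L2_norm M (\<lambda>p. f p - h p) <= L2_norm M (\<lambda>p. f p - g p) + L2_norm M (\<lambda>p. g p - h p)"
  using L2.nrm_triangle3[OF assms] by (simp add: nrm_L2_inner fun_diff_def)

context
  fixes \<Omega> :: "'a::euclidean_space set"
  assumes \<Omega>: "open \<Omega>"
begin

lemma \<Omega>_borel [measurable, simp]: "\<Omega> \<in> sets borel"
  using \<Omega> by simp

lemma integral_on_supported: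
  fixes f :: "'a => 'b::{banach, second_countable_topology}"
  assumes "!!x. x \<notin> \<Omega> ==> f x = 0"
  shows "(\<integral>x. f x \<partial>lborel_on \<Omega>) = (\<integral>x. f x \<partial>lborel)"
  using assms by (subst integral_restrict_space) (auto intro!: Bochner_Integration.integral_cong simp: indicator_def)

lemma supported_L2:
  assumes f: "continuous_on UNIV f" and supp: "supported_in UNIV f"
  shows "f \<in> L2 (lborel_on \<Omega>)"
proof -
  obtain K where K: "compact K" "\<forall>x. x \<notin> K --> f x = 0" using supp unfolding supported_in_def by blast
  have "integrable lborel (\<lambda>x. (cmod (f x))\<^sup>2)"
    using K by (intro integrable_compact_support[of _ K] continuous_intros f) auto
  then have "integrable lborel (\<lambda>x. indicator \<Omega> x *\<^sub>R (cmod (f x))\<^sup>2)"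
    by (intro integrable_mult_indicator) auto
  then have "integrable (lborel_on \<Omega>) (\<lambda>x. (cmod (f x))\<^sup>2)" by (subst integrable_restrict_space) auto
  moreover have "f \<in> borel_measurable (lborel_on \<Omega>)"
    using borel_measurable_continuous_onI[OF f] by (intro measurable_restrict_space1) simp
  ultimately show ?thesis by (simp add: L2_def)
qed

lemma L2_norm_le_uniform:
  assumes f: "continuous_on UNIV f" and K: "compact K" "!!x. x \<notin> K ==> f x = 0"
    and \<eta>: "!!x. cmod (f x) <= \<eta>"
  shows "L2_norm (lborel_on \<Omega>) f <= \<eta> * sqrt (measure lborel K)"
proof -
  have "0 <= \<eta>" using \<eta>[of 0] norm_ge_zero[of "f 0"] by linarith
  have fin: "emeasure lborel K < \<infinity>" using emeasure_bounded_finite[OF compact_imp_bounded[OF K(1)]] .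
  have int: "integrable lborel (\<lambda>x. (cmod (f x))\<^sup>2)"
    using K by (intro integrable_compact_support[of _ K] continuous_intros f) auto
  have "(\<integral>x. (cmod (f x))\<^sup>2 \<partial>lborel_on \<Omega>) = (\<integral>x. indicator \<Omega> x * (cmod (f x))\<^sup>2 \<partial>lborel)"
    by (subst integral_restrict_space) auto
  also have "... <= (\<integral>x. \<eta>\<^sup>2 * indicator K x \<partial>lborel)"
  proof (rule integral_mono)
    show "integrable lborel (\<lambda>x. indicator \<Omega> x * (cmod (f x))\<^sup>2)"
      using integrable_mult_indicator[OF _ int, of \<Omega>] by simp
    show "integrable lborel (\<lambda>x. \<eta>\<^sup>2 * indicator K x)"
      using fin K(1) by (intro integrable_mult_right) (auto simp: compact_imp_closed)
    show "indicator \<Omega> x * (cmod (f x))\<^sup>2 <= \<eta>\<^sup>2 * indicator K x" for x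
      using \<eta>[of x] K(2)[of x] \<open>0 <= \<eta>\<close> by (cases "x \<in> K") (auto simp: indicator_def intro!: power_mono)
  qed
  also have "... = \<eta>\<^sup>2 * measure lborel K" using K(1) by (simp add: compact_imp_closed)
  finally show ?thesis
    unfolding L2_norm_def using \<open>0 <= \<eta>\<close> by (intro real_le_lsqrt) (auto simp: power_mult_distrib)
qed

lemma L2_tendsto_of_uniform:
  assumes "!!n. continuous_on UNIV (X n)" "continuous_on UNIV f" "compact K"
    "!!n x. x \<notin> K ==> X n x = 0" "!!x. x \<notin> K ==> f x = 0"
    and unif: "!!\<eta>. \<eta> > 0 ==> \<forall>\<^sub>F n in sequentially. \<forall>x. cmod (X n x - f x) <= \<eta>"
  shows "(\<lambda>n. L2_norm (lborel_on \<Omega>) (\<lambda>x. X n x - f x)) \<longlonglongrightarrow> 0"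
proof (rule order_tendstoI)
  define m where "m = sqrt (measure lborel K) + 1"
  have m: "m > 0" unfolding m_def by (intro add_nonneg_pos real_sqrt_ge_zero measure_nonneg) simp
  fix e :: real assume "0 < e"
  then have "\<forall>\<^sub>F n in sequentially. \<forall>x. cmod (X n x - f x) <= e / (2 * m)" using m by (intro unif) auto
  then show "\<forall>\<^sub>F n in sequentially. L2_norm (lborel_on \<Omega>) (\<lambda>x. X n x - f x) < e"
  proof eventually_elim
    case (elim n)
    have "L2_norm (lborel_on \<Omega>) (\<lambda>x. X n x - f x) <= e / (2 * m) * sqrt (measure lborel K)"
      using assms elim by (intro L2_norm_le_uniform[where K = K] continuous_on_diff) auto
    also have "... <= e / (2 * m) * m" using \<open>0 < e\<close> m by (intro mult_left_mono) (auto simp: m_def)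
    also have "... < e" using \<open>0 < e\<close> m by simp
    finally show ?case .
  qed
qed (auto intro!: always_eventually less_le_trans[OF _ L2_norm_nonneg])

text \<open>Mollification: functions of class \<open>C\<^sup>1\<close> with compact support are limits of test functions.\<close>

lemma C1_approx:
  assumes C1: "C_k 1 f" and supp: "supported_in \<Omega> f"
  obtains \<psi> where "!!n::nat. \<psi> n \<in> test_functions \<Omega>"
    "(\<lambda>n. L2_norm (lborel_on \<Omega>) (\<lambda>x. \<psi> n x - f x)) \<longlonglongrightarrow> 0"
    "!!e. e \<in> Basis ==> (\<lambda>n. L2_norm (lborel_on \<Omega>) (\<lambda>x. partial_deriv e (\<psi> n) x - partial_deriv e f x)) \<longlonglongrightarrow> 0"
proof -
  obtain K where K: "compact K" "K \<subseteq> \<Omega>" "!!x. x \<notin> K ==> f x = 0" using supp unfolding supported_in_def by blast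
  have f: "continuous_on UNIV f" by (rule C1_continuous[OF C1])
  obtain K' \<psi> where K': "compact K'" "K' \<subseteq> \<Omega>" "K \<subseteq> K'" "!!n::nat. \<psi> n \<in> test_functions \<Omega>"
    "!!n x. x \<notin> K' ==> \<psi> n x = 0"
    "!!\<eta>. \<eta> > 0 ==> \<forall>\<^sub>F n in sequentially. \<forall>x. cmod (\<psi> n x - f x) <= \<eta>"
    "!!\<eta> e. C_k 1 f ==> e \<in> Basis ==> \<eta> > 0 ==>
      \<forall>\<^sub>F n in sequentially. \<forall>x. cmod (partial_deriv e (\<psi> n) x - partial_deriv e f x) <= \<eta>"
    by (rule ex_test_function_approx[OF \<Omega> K f]) blast+
  have \<psi>1: "C_k 1 (\<psi> n)" for n using test_functionsD(2)[OF K'(4)] .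
  show ?thesis
  proof (rule that[OF K'(4)])
    show "(\<lambda>n. L2_norm (lborel_on \<Omega>) (\<lambda>x. \<psi> n x - f x)) \<longlonglongrightarrow> 0"
      using K K' by (intro L2_tendsto_of_uniform[of \<psi> f K'] f C1_continuous[OF \<psi>1]) auto
    fix e :: 'a assume e: "e \<in> Basis"
    show "(\<lambda>n. L2_norm (lborel_on \<Omega>) (\<lambda>x. partial_deriv e (\<psi> n) x - partial_deriv e f x)) \<longlonglongrightarrow> 0"
    proof (rule L2_tendsto_of_uniform[OF _ _ K'(1)])
      show "continuous_on UNIV (partial_deriv e (\<psi> n))" for n using \<psi>1 e by (simp add: C1_iff)
      show "continuous_on UNIV (partial_deriv e f)" using C1 e by (simp add: C1_iff)
      show "partial_deriv e (\<psi> n) x = 0" if "x \<notin> K'" for n x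
        by (rule partial_deriv_eq_0_outside[OF compact_imp_closed[OF K'(1)] K'(5) that])
      show "partial_deriv e f x = 0" if "x \<notin> K'" for x
        by (rule partial_deriv_eq_0_outside[OF compact_imp_closed[OF K'(1)] _ that]) (use K K' in auto)
    qed (rule K'(7)[OF C1 e])
  qed
qed

lemma integral_continuous_supported_eq_0:
  assumes g: "g \<in> L2 (lborel_on \<Omega>)" "!!\<psi>. \<psi> \<in> test_functions \<Omega> ==> (\<integral>p. g p * \<psi> p \<partial>lborel_on \<Omega>) = 0"
    and f: "continuous_on UNIV f" "supported_in \<Omega> f"
  shows "(\<integral>p. f p * g p \<partial>lborel_on \<Omega>) = 0"
proof -
  obtain K where K: "compact K" "K \<subseteq> \<Omega>" "!!x. x \<notin> K ==> f x = 0" using f(2) unfolding supported_in_def by blast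
  obtain K' \<psi> where K': "compact K'" "K' \<subseteq> \<Omega>" "K \<subseteq> K'" "!!n::nat. \<psi> n \<in> test_functions \<Omega>"
    "!!n x. x \<notin> K' ==> \<psi> n x = 0"
    "!!\<eta>. \<eta> > 0 ==> \<forall>\<^sub>F n in sequentially. \<forall>x. cmod (\<psi> n x - f x) <= \<eta>"
    by (rule ex_test_function_approx[OF \<Omega> K f(1)]) blast+
  have \<psi>c: "continuous_on UNIV (\<psi> n)" for n using C1_continuous[OF test_functionsD(2)[OF K'(4)]] .
  have lim: "(\<lambda>n. \<integral>p. \<psi> n p * g p \<partial>lborel_on \<Omega>) \<longlonglongrightarrow> (\<integral>p. f p * g p \<partial>lborel_on \<Omega>)"
  proof (rule tendsto_integral_mult[OF _ _ g(1)])
    show "\<psi> n \<in> L2 (lborel_on \<Omega>)" for n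
      by (intro supported_L2 \<psi>c supported_in_UNIV[OF test_functionsD(3)[OF K'(4)]])
    show "f \<in> L2 (lborel_on \<Omega>)" by (intro supported_L2 f(1) supported_in_UNIV[OF f(2)])
    show "(\<lambda>n. L2_norm (lborel_on \<Omega>) (\<lambda>x. \<psi> n x - f x)) \<longlonglongrightarrow> 0"
      using K K' by (intro L2_tendsto_of_uniform[of \<psi> f K'] f(1) \<psi>c) auto
  qed
  have "(\<integral>p. \<psi> n p * g p \<partial>lborel_on \<Omega>) = 0" for n
    using g(2)[OF K'(4)] by (simp add: mult.commute)
  then show ?thesis using LIMSEQ_unique[OF lim] tendsto_const[of 0] by simp
qed

lemma integral_compact_eq_0:
  assumes g: "g \<in> L2 (lborel_on \<Omega>)" "!!\<psi>. \<psi> \<in> test_functions \<Omega> ==> (\<integral>p. g p * \<psi> p \<partial>lborel_on \<Omega>) = 0"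
    and S: "compact S" "S \<subseteq> \<Omega>"
  shows "integrable (lborel_on \<Omega>) (\<lambda>p. indicator S p *\<^sub>R g p)" "(\<integral>p. indicator S p *\<^sub>R g p \<partial>lborel_on \<Omega>) = 0"
proof -
  have SM: "S \<in> sets (lborel_on \<Omega>)" using S by (auto simp: sets_restrict_space_iff compact_imp_closed)
  have gm [measurable]: "g \<in> borel_measurable (lborel_on \<Omega>)" using L2_measurable[OF g(1)] .
  have integrable_on: "integrable (lborel_on \<Omega>) (\<lambda>p. indicator L p *\<^sub>R g p)" if L: "compact L" "L \<subseteq> \<Omega>" for L
  proof -
    have LM: "L \<in> sets (lborel_on \<Omega>)" using L by (auto simp: sets_restrict_space_iff compact_imp_closed)
    have "emeasure (lborel_on \<Omega>) L < \<infinity>"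
      using L emeasure_bounded_finite[OF compact_imp_bounded[OF L(1)]]
      by (subst emeasure_restrict_space) auto
    then have "(\<lambda>p. indicator L p :: complex) \<in> L2 (lborel_on \<Omega>)"
    proof -
      assume fin: "emeasure (lborel_on \<Omega>) L < \<infinity>"
      have "(\<lambda>p. (cmod (indicator L p))\<^sup>2) = (indicator L :: 'a => real)" by (auto simp: indicator_def fun_eq_iff)
      then show ?thesis using LM fin by (simp add: L2_def integrable_real_indicator)
    qed
    from L2_mult_integrable[OF this g(1)] show ?thesis
      by (rule Bochner_Integration.integrable_cong[THEN iffD1, rotated 2]) (auto simp: indicator_def)
  qed
  show "integrable (lborel_on \<Omega>) (\<lambda>p. indicator S p *\<^sub>R g p)" by (rule integrable_on[OF S])
  show "(\<integral>p. indicator S p *\<^sub>R g p \<partial>lborel_on \<Omega>) = 0"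
  proof (cases "S = {}")
    case False
    obtain r where r: "r > 0" "(\<Union>x\<in>S. cball x r) \<subseteq> \<Omega>"
      using compact_subset_open_imp_cball_epsilon_subset[OF S(1) \<Omega> S(2)] by blast
    define L where "L = {x + y | x y. x \<in> S \<and> y \<in> cball 0 r}"
    have L: "compact L" unfolding L_def by (rule compact_sums[OF S(1) compact_cball])
    have L\<Omega>: "L \<subseteq> \<Omega>"
    proof
      fix x assume "x \<in> L"
      then obtain t y where "x = t + y" "t \<in> S" "y \<in> cball 0 r" unfolding L_def by blast
      then show "x \<in> \<Omega>" using r(2) by (force simp: dist_norm)
    qed
    obtain N where N: "1 / r < real N" using reals_Archimedean2 by blast
    define f where "f n x = max 0 (1 - real (N + n) * infdist x S)" for n x
    have f01: "0 <= f n x" "f n x <= 1" for n x by (auto simp: f_def infdist_nonneg)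
    have fL: "f n x = 0" if "x \<notin> L" for n x
    proof (rule ccontr)
      assume "f n x ~= 0"
      then have 1: "real (N + n) * infdist x S < 1" by (auto simp: f_def max_def split: if_splits)
      have "real N * infdist x S <= real (N + n) * infdist x S" by (intro mult_right_mono infdist_nonneg) auto
      then have "real N * infdist x S < real N * r" using 1 N r(1) by (simp add: field_simps)
      moreover have "real N > 0" using N r(1) by (metis divide_pos_pos less_trans zero_less_one)
      ultimately have "infdist x S < r" by simp
      moreover obtain t where "t \<in> S" "infdist x S = dist x t"
        using infdist_attains_inf[OF compact_imp_closed[OF S(1)] False] by blast
      ultimately have "x \<in> L" unfolding L_def
        by (intro CollectI, rule_tac exI[of _ t], rule_tac exI[of _ "x - t"]) (auto simp: dist_norm norm_minus_commute)
      then show False using that by simp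
    qed
    have fc: "continuous_on UNIV (\<lambda>x. complex_of_real (f n x))" for n
      unfolding f_def by (intro continuous_intros)
    have f0: "(\<integral>p. complex_of_real (f n p) * g p \<partial>lborel_on \<Omega>) = 0" for n
      by (rule integral_continuous_supported_eq_0[OF g fc]) (use L L\<Omega> fL in \<open>auto simp: supported_in_def\<close>)
    have lim: "(\<lambda>n. f n x) \<longlonglongrightarrow> indicator S x" for x
    proof (cases "x \<in> S")
      case True
      then show ?thesis by (simp add: f_def)
    next
      case x: False
      have pos: "infdist x S > 0"
        using x in_closed_iff_infdist_zero[OF compact_imp_closed[OF S(1)] False] infdist_nonneg[of x S] by force
      obtain M where M: "1 / infdist x S < real M" using reals_Archimedean2 by blast
      have "f n x = 0" if "n \<ge> M" for n
      proof -
        have "1 < real M * infdist x S" using M pos by (simp add: field_simps)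
        also have "... <= real (N + n) * infdist x S" using that pos by (intro mult_right_mono) auto
        finally show ?thesis by (simp add: f_def)
      qed
      then have "\<forall>\<^sub>F n in sequentially. f n x = 0" by (rule eventually_sequentiallyI)
      then show ?thesis using x by (simp add: tendsto_eventually)
    qed
    have conv: "(\<lambda>n. \<integral>p. complex_of_real (f n p) * g p \<partial>lborel_on \<Omega>) \<longlonglongrightarrow> (\<integral>p. indicator S p *\<^sub>R g p \<partial>lborel_on \<Omega>)"
    proof (rule integral_dominated_convergence)
      show "integrable (lborel_on \<Omega>) (\<lambda>p. norm (indicator L p *\<^sub>R g p))"
        by (intro integrable_norm integrable_on L L\<Omega>)
      show "(\<lambda>p. indicator S p *\<^sub>R g p) \<in> borel_measurable (lborel_on \<Omega>)" using SM by measurable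
      show "(\<lambda>p. complex_of_real (f n p) * g p) \<in> borel_measurable (lborel_on \<Omega>)" for n
        using borel_measurable_continuous_onI[OF fc[of n]]
        by (intro borel_measurable_times gm measurable_restrict_space1) simp
      show "AE p in lborel_on \<Omega>. (\<lambda>n. complex_of_real (f n p) * g p) \<longlonglongrightarrow> indicator S p *\<^sub>R g p"
        unfolding scaleR_conv_of_real by (intro AE_I2 tendsto_intros lim)
      show "AE p in lborel_on \<Omega>. norm (complex_of_real (f n p) * g p) <= norm (indicator L p *\<^sub>R g p)" for n
      proof (rule AE_I2)
        fix p
        show "norm (complex_of_real (f n p) * g p) <= norm (indicator L p *\<^sub>R g p)"
          using f01[of n p] fL[of p n] by (cases "p \<in> L") (auto simp: norm_mult mult_left_le_one_le)
      qed
    qed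
    show ?thesis using LIMSEQ_unique[OF conv[unfolded f0] tendsto_const] .
  qed simp
qed

lemma AE_nonpos_of_integral_compact:
  fixes h :: "'a => real"
  assumes [measurable]: "h \<in> borel_measurable (lborel_on \<Omega>)"
    and int: "!!S. compact S ==> S \<subseteq> \<Omega> ==> integrable (lborel_on \<Omega>) (\<lambda>p. indicator S p *\<^sub>R h p)"
    and zero: "!!S. compact S ==> S \<subseteq> \<Omega> ==> (\<integral>p. indicator S p *\<^sub>R h p \<partial>lborel_on \<Omega>) = 0"
  shows "AE p in lborel_on \<Omega>. h p <= 0"
proof -
  define B where "B = {p \<in> \<Omega>. h p > 0}"
  have "B = {p \<in> space (lborel_on \<Omega>). h p > 0}" by (simp add: B_def space_restrict_space)
  also have "... \<in> sets (lborel_on \<Omega>)" by measurable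
  finally have B: "B \<in> sets borel" by (simp add: sets_restrict_space_iff)
  obtain C N where CN: "fsigma C" "N \<in> null_sets lebesgue" "C \<union> N = B" "disjnt C N"
    using lebesgue_set_almost_fsigma[of B] B by auto
  obtain F :: "nat => 'a set" where F: "range F \<subseteq> Collect compact" "C = \<Union>(range F)"
    using CN(1) fsigma_Union_compact by metis
  have Fc: "compact (F n)" for n using F(1) by auto
  have "C \<in> sets borel" unfolding F(2) by (intro sets.countable_UN) (auto simp: Fc compact_imp_closed)
  moreover have "N = B - C" using CN by (auto simp: disjnt_def)
  ultimately have "N \<in> sets lborel" using B by simp
  then have N: "N \<in> null_sets lborel" using CN(2) by (simp add: null_sets_completion_iff)
  have "AE p in lborel_on \<Omega>. p \<notin> F n" for n
  proof -
    have F\<Omega>: "F n \<subseteq> \<Omega>" "!!p. p \<in> F n ==> h p > 0" using CN(3) F(2) by (auto simp: B_def)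
    have "AE p in lborel_on \<Omega>. indicator (F n) p *\<^sub>R h p = 0"
      using integral_nonneg_eq_0_iff_AE[OF int[OF Fc F\<Omega>(1)]] zero[OF Fc F\<Omega>(1)] F\<Omega>(2)
      by (auto simp: indicator_def less_imp_le)
    then show ?thesis by (rule AE_mp) (auto intro!: AE_I2 dest: F\<Omega>(2))
  qed
  then have "AE p in lborel_on \<Omega>. \<forall>n. p \<notin> F n" by (simp add: AE_all_countable)
  moreover have "AE p in lborel_on \<Omega>. p \<notin> N"
    using AE_not_in[OF N] by (subst AE_restrict_space_iff) auto
  ultimately have "AE p in lborel_on \<Omega>. (\<forall>n. p \<notin> F n) \<and> p \<notin> N" by (rule AE_conjI)
  then show ?thesis
  proof (rule AE_mp, intro AE_I2 impI)
    fix p assume "p \<in> space (lborel_on \<Omega>)" "(\<forall>n. p \<notin> F n) \<and> p \<notin> N"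
    then have "p \<in> \<Omega>" "p \<notin> B" using CN(3) F(2) by (auto simp: space_restrict_space)
    then show "h p <= 0" by (auto simp: B_def)
  qed
qed

text \<open>The fundamental lemma of the calculus of variations.\<close>

lemma AE_eq_0_of_test_functions:
  assumes g: "g \<in> L2 (lborel_on \<Omega>)" "!!\<psi>. \<psi> \<in> test_functions \<Omega> ==> (\<integral>p. g p * \<psi> p \<partial>lborel_on \<Omega>) = 0"
  shows "AE p in lborel_on \<Omega>. g p = 0"
proof -
  have gm [measurable]: "g \<in> borel_measurable (lborel_on \<Omega>)" using L2_measurable[OF g(1)] .
  have *: "AE p in lborel_on \<Omega>. \<rho> (g p) <= 0" if \<rho>: "bounded_linear \<rho>" for \<rho> :: "complex => real"
  proof (rule AE_nonpos_of_integral_compact)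
    show "(\<lambda>p. \<rho> (g p)) \<in> borel_measurable (lborel_on \<Omega>)"
      using measurable_compose[OF gm borel_measurable_continuous_onI[OF linear_continuous_on[OF \<rho>]]] .
    fix S :: "'a set" assume S: "compact S" "S \<subseteq> \<Omega>"
    have eq: "(\<lambda>p. indicator S p *\<^sub>R \<rho> (g p)) = (\<lambda>p. \<rho> (indicator S p *\<^sub>R g p))"
      using linear_scale[OF bounded_linear.linear[OF \<rho>]] by auto
    have ic: "integrable (lborel_on \<Omega>) (\<lambda>p. indicator S p *\<^sub>R g p)" "(\<integral>p. indicator S p *\<^sub>R g p \<partial>lborel_on \<Omega>) = 0"
      using integral_compact_eq_0[OF g(1) _ S] g(2) by blast+
    show "integrable (lborel_on \<Omega>) (\<lambda>p. indicator S p *\<^sub>R \<rho> (g p))"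
      unfolding eq by (rule integrable_bounded_linear[OF \<rho> ic(1)])
    show "(\<integral>p. indicator S p *\<^sub>R \<rho> (g p) \<partial>lborel_on \<Omega>) = 0"
      unfolding eq Bochner_Integration.integral_bounded_linear[OF \<rho> ic(1)] ic(2)
      by (rule linear_0[OF bounded_linear.linear[OF \<rho>]])
  qed
  have "AE p in lborel_on \<Omega>. Re (g p) <= 0 \<and> - Re (g p) <= 0 \<and> Im (g p) <= 0 \<and> - Im (g p) <= 0"
    by (intro AE_conjI * bounded_linear_Re bounded_linear_Im bounded_linear_minus)
  then show ?thesis by (rule AE_mp) (auto intro!: AE_I2 simp: complex_eq_iff)
qed

end

context
  fixes \<Omega> :: "'a::euclidean_space set"
  assumes \<Omega>: "open \<Omega>"
begin

abbreviation "L \<equiv> lborel_on \<Omega>"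

lemma test_L2: "\<psi> \<in> test_functions \<Omega> ==> \<psi> \<in> L2 L"
  using test_functionsD by (intro supported_L2[OF \<Omega>] C1_continuous supported_in_UNIV)

lemma C1_supported_L2:
  assumes "C_k 1 f" "supported_in \<Omega> f"
  shows "f \<in> L2 L" "e \<in> Basis ==> partial_deriv e f \<in> L2 L"
proof -
  show "f \<in> L2 L" using assms by (intro supported_L2[OF \<Omega>] C1_continuous supported_in_UNIV)
  show "partial_deriv e f \<in> L2 L" if "e \<in> Basis"
    using assms that by (intro supported_L2[OF \<Omega>] supported_in_UNIV[OF supported_in_partial_deriv]) (auto simp: C1_iff)
qed

lemma test_partial_L2: "\<psi> \<in> test_functions \<Omega> ==> e \<in> Basis ==> partial_deriv e \<psi> \<in> L2 L"
  using test_functionsD by (intro C1_supported_L2(2))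

lemma is_weak_partial_L2: "is_weak_partial \<Omega> e \<phi> g ==> g \<in> L2 L"
  by (simp add: is_weak_partial_def)

lemma is_weak_partial_unique:
  assumes "is_weak_partial \<Omega> e \<phi> g" "is_weak_partial \<Omega> e \<phi> h"
  shows "AE p in L. g p = h p"
proof -
  have gh: "g \<in> L2 L" "h \<in> L2 L" using assms is_weak_partial_L2 by auto
  have "AE p in L. g p - h p = 0"
  proof (rule AE_eq_0_of_test_functions[OF \<Omega> L2_diff[OF gh]])
    fix \<psi> assume \<psi>: "\<psi> \<in> test_functions \<Omega>"
    have "(\<integral>p. g p * \<psi> p \<partial>L) = (\<integral>p. h p * \<psi> p \<partial>L)"
      using assms \<psi> by (auto simp: is_weak_partial_def dest!: bspec)
    then show "(\<integral>p. (g p - h p) * \<psi> p \<partial>L) = 0"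
      using L2_mult_integrable[OF gh(1) test_L2[OF \<psi>]] L2_mult_integrable[OF gh(2) test_L2[OF \<psi>]]
      by (simp add: left_diff_distrib)
  qed
  then show ?thesis by simp
qed

text \<open>The weak derivative is chosen by the epsilon operator, so it is only known up to null sets.\<close>

lemma weak_partial_eqI: "is_weak_partial \<Omega> e \<phi> g ==> AE p in L. weak_partial \<Omega> e \<phi> p = g p"
  unfolding weak_partial_def by (rule is_weak_partial_unique[OF someI[of "is_weak_partial \<Omega> e \<phi>"]])

lemma is_weak_partial_weak_partial: "is_weak_partial \<Omega> e \<phi> g ==> is_weak_partial \<Omega> e \<phi> (weak_partial \<Omega> e \<phi>)"
  unfolding weak_partial_def by (rule someI[of "is_weak_partial \<Omega> e \<phi>"])

lemma is_weak_partial_add: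
  assumes e: "e \<in> Basis" and "\<phi> \<in> L2 L" "\<phi>' \<in> L2 L" "is_weak_partial \<Omega> e \<phi> g" "is_weak_partial \<Omega> e \<phi>' h"
  shows "is_weak_partial \<Omega> e (\<lambda>p. \<phi> p + \<phi>' p) (\<lambda>p. g p + h p)"
proof -
  have gh: "g \<in> L2 L" "h \<in> L2 L" using assms is_weak_partial_L2 by auto
  have "(\<integral>p. (\<phi> p + \<phi>' p) * partial_deriv e \<psi> p \<partial>L) = - (\<integral>p. (g p + h p) * \<psi> p \<partial>L)"
    if \<psi>: "\<psi> \<in> test_functions \<Omega>" for \<psi>
    using assms \<psi> L2_mult_integrable[OF _ test_partial_L2[OF \<psi> e]] L2_mult_integrable[OF _ test_L2[OF \<psi>]] gh
    by (simp add: distrib_right is_weak_partial_def)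
  then show ?thesis using L2_add[OF gh] by (simp add: is_weak_partial_def)
qed

lemma is_weak_partial_cmult:
  assumes "is_weak_partial \<Omega> e \<phi> g"
  shows "is_weak_partial \<Omega> e (\<lambda>p. c * \<phi> p) (\<lambda>p. c * g p)"
  using assms L2_cmult[of g L c] by (simp add: is_weak_partial_def mult.assoc)

lemma is_weak_partial_diff:
  assumes e: "e \<in> Basis" and "\<phi> \<in> L2 L" "\<phi>' \<in> L2 L" "is_weak_partial \<Omega> e \<phi> g" "is_weak_partial \<Omega> e \<phi>' h"
  shows "is_weak_partial \<Omega> e (\<lambda>p. \<phi> p - \<phi>' p) (\<lambda>p. g p - h p)"
  using is_weak_partial_add[OF e assms(2) L2_cmult[OF assms(3), of "-1"] assms(4) is_weak_partial_cmult[OF assms(5), of "-1"]]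
  by simp

lemma is_weak_partial_C1:
  assumes f: "C_k 1 f" "supported_in \<Omega> f" and e: "e \<in> Basis"
  shows "is_weak_partial \<Omega> e f (partial_deriv e f)"
proof -
  have "(\<integral>p. f p * partial_deriv e \<psi> p \<partial>L) = - (\<integral>p. partial_deriv e f p * \<psi> p \<partial>L)"
    if \<psi>: "\<psi> \<in> test_functions \<Omega>" for \<psi>
  proof -
    note \<psi>1 = test_functionsD(2)[OF \<psi>]
    have d: "f differentiable at p" "\<psi> differentiable at p" for p using f \<psi>1 by (auto simp: C1_iff)
    have eq: "partial_deriv e (\<lambda>p. f p * \<psi> p) = (\<lambda>p. f p * partial_deriv e \<psi> p + partial_deriv e f p * \<psi> p)"
      using d by (intro ext partial_deriv_mult)
    obtain K where K: "compact K" "K \<subseteq> \<Omega>" "!!x. x \<notin> K ==> f x = 0" using f(2) unfolding supported_in_def by blast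
    have "(\<integral>p. partial_deriv e (\<lambda>p. f p * \<psi> p) p \<partial>lborel) = 0"
    proof (rule integral_partial_deriv_eq_0[OF _ _ K(1)])
      show "continuous_on UNIV (partial_deriv e (\<lambda>p. f p * \<psi> p))"
        using C_k_mult[OF f(1) \<psi>1] e by (simp add: C1_iff)
    qed (use d K in \<open>auto intro: differentiable_mult\<close>)
    then have "(\<integral>p. f p * partial_deriv e \<psi> p + partial_deriv e f p * \<psi> p \<partial>L) = 0"
      unfolding eq using supported_in_outside[OF f(2)] supported_in_outside[OF test_functionsD(3)[OF \<psi>]]
      by (subst integral_on_supported[OF \<Omega>]) auto
    then show ?thesis
      using L2_mult_integrable[OF C1_supported_L2(1)[OF f] test_partial_L2[OF \<psi> e]]
        L2_mult_integrable[OF C1_supported_L2(2)[OF f e] test_L2[OF \<psi>]]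
      by (simp add: add_eq_0_iff)
  qed
  then show ?thesis using C1_supported_L2(2)[OF f e] by (simp add: is_weak_partial_def)
qed

text \<open>Both sides of the defining identity are continuous in \<open>L\<^sup>2\<close>.\<close>

lemma is_weak_partial_limit:
  assumes e: "e \<in> Basis" and X: "!!n. X n \<in> L2 L" "!!n. is_weak_partial \<Omega> e (X n) (Y n)"
    and f: "f \<in> L2 L" "(\<lambda>n. L2_norm L (\<lambda>p. X n p - f p)) \<longlonglongrightarrow> 0"
    and g: "g \<in> L2 L" "(\<lambda>n. L2_norm L (\<lambda>p. Y n p - g p)) \<longlonglongrightarrow> 0"
  shows "is_weak_partial \<Omega> e f g"
proof -
  have "(\<integral>p. f p * partial_deriv e \<psi> p \<partial>L) = - (\<integral>p. g p * \<psi> p \<partial>L)" if \<psi>: "\<psi> \<in> test_functions \<Omega>" for \<psi>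
  proof (rule LIMSEQ_unique)
    show "(\<lambda>n. \<integral>p. X n p * partial_deriv e \<psi> p \<partial>L) \<longlonglongrightarrow> (\<integral>p. f p * partial_deriv e \<psi> p \<partial>L)"
      by (rule tendsto_integral_mult[OF X(1) f(1) test_partial_L2[OF \<psi> e] f(2)])
    have "(\<lambda>n. - (\<integral>p. Y n p * \<psi> p \<partial>L)) \<longlonglongrightarrow> - (\<integral>p. g p * \<psi> p \<partial>L)"
      by (intro tendsto_minus tendsto_integral_mult[OF is_weak_partial_L2[OF X(2)] g(1) test_L2[OF \<psi>] g(2)])
    then show "(\<lambda>n. \<integral>p. X n p * partial_deriv e \<psi> p \<partial>L) \<longlonglongrightarrow> - (\<integral>p. g p * \<psi> p \<partial>L)"
      using X(2) \<psi> by (simp add: is_weak_partial_def)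
  qed
  then show ?thesis using g(1) by (simp add: is_weak_partial_def)
qed

subsection \<open>The space with zero boundary values\<close>

lemma H1_0_L2: "\<phi> \<in> H1_0 \<Omega> ==> \<phi> \<in> L2 L"
  by (simp add: H1_0_def H1_def)

lemma H1_0_weak_partial: "\<phi> \<in> H1_0 \<Omega> ==> e \<in> Basis ==> is_weak_partial \<Omega> e \<phi> (weak_partial \<Omega> e \<phi>)"
  using is_weak_partial_weak_partial by (auto simp: H1_0_def H1_def)

lemma H1_0_weak_partial_L2: "\<phi> \<in> H1_0 \<Omega> ==> e \<in> Basis ==> weak_partial \<Omega> e \<phi> \<in> L2 L"
  using H1_0_weak_partial is_weak_partial_L2 by blast

lemma L2_norm_weak_partial_diff:
  assumes e: "e \<in> Basis" and \<psi>: "\<psi> \<in> test_functions \<Omega>" and \<phi>: "\<phi> \<in> L2 L" "is_weak_partial \<Omega> e \<phi> g"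
  shows "L2_norm L (weak_partial \<Omega> e (\<lambda>p. \<psi> p - \<phi> p)) = L2_norm L (\<lambda>p. partial_deriv e \<psi> p - g p)"
proof -
  have w: "is_weak_partial \<Omega> e (\<lambda>p. \<psi> p - \<phi> p) (\<lambda>p. partial_deriv e \<psi> p - g p)"
    using test_functionsD[OF \<psi>] by (intro is_weak_partial_diff e test_L2 \<psi> \<phi> is_weak_partial_C1)
  show ?thesis
    by (intro L2_norm_cong_AE weak_partial_eqI[OF w] L2_measurable is_weak_partial_L2[OF w]
      is_weak_partial_L2[OF is_weak_partial_weak_partial[OF w]])
qed

lemma H1_0D:
  assumes \<phi>: "\<phi> \<in> H1_0 \<Omega>"
  obtains \<psi> where "!!n::nat. \<psi> n \<in> test_functions \<Omega>"
    "(\<lambda>n. L2_norm L (\<lambda>p. \<psi> n p - \<phi> p)) \<longlonglongrightarrow> 0"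
    "!!e. e \<in> Basis ==> (\<lambda>n. L2_norm L (\<lambda>p. partial_deriv e (\<psi> n) p - weak_partial \<Omega> e \<phi> p)) \<longlonglongrightarrow> 0"
proof -
  obtain \<psi> where \<psi>: "!!n. \<psi> n \<in> test_functions \<Omega>" "(\<lambda>n. H1_norm \<Omega> (\<lambda>p. \<psi> n p - \<phi> p)) \<longlonglongrightarrow> 0"
    using \<phi> by (auto simp: H1_0_def)
  show ?thesis
  proof (rule that[OF \<psi>(1)])
    show "(\<lambda>n. L2_norm L (\<lambda>p. \<psi> n p - \<phi> p)) \<longlonglongrightarrow> 0"
    proof (rule Lim_null_comparison[OF always_eventually \<psi>(2)], rule allI)
      fix n
      show "norm (L2_norm L (\<lambda>p. \<psi> n p - \<phi> p)) <= H1_norm \<Omega> (\<lambda>p. \<psi> n p - \<phi> p)"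
        unfolding H1_norm_def by (intro real_le_rsqrt) (simp add: sum_nonneg)
    qed
    fix e :: 'a assume e: "e \<in> Basis"
    show "(\<lambda>n. L2_norm L (\<lambda>p. partial_deriv e (\<psi> n) p - weak_partial \<Omega> e \<phi> p)) \<longlonglongrightarrow> 0"
    proof (rule Lim_null_comparison[OF always_eventually \<psi>(2)], rule allI)
      fix n
      let ?d = "\<lambda>p. \<psi> n p - \<phi> p"
      have "(L2_norm L (weak_partial \<Omega> e ?d))\<^sup>2 <= (\<Sum>e\<in>Basis. (L2_norm L (weak_partial \<Omega> e ?d))\<^sup>2)"
        using e by (intro member_le_sum) auto
      then have "L2_norm L (weak_partial \<Omega> e ?d) <= H1_norm \<Omega> ?d"
        unfolding H1_norm_def by (intro real_le_rsqrt) (simp add: add_increasing)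
      then show "norm (L2_norm L (\<lambda>p. partial_deriv e (\<psi> n) p - weak_partial \<Omega> e \<phi> p)) <= H1_norm \<Omega> ?d"
        using L2_norm_weak_partial_diff[OF e \<psi>(1) H1_0_L2[OF \<phi>] H1_0_weak_partial[OF \<phi> e]] by simp
    qed
  qed
qed

lemma H1_0I:
  assumes \<phi>: "\<phi> \<in> L2 L" and g: "!!e. e \<in> Basis ==> g e \<in> L2 L"
    and \<psi>: "!!n::nat. \<psi> n \<in> test_functions \<Omega>" "(\<lambda>n. L2_norm L (\<lambda>p. \<psi> n p - \<phi> p)) \<longlonglongrightarrow> 0"
    "!!e. e \<in> Basis ==> (\<lambda>n. L2_norm L (\<lambda>p. partial_deriv e (\<psi> n) p - g e p)) \<longlonglongrightarrow> 0"
  shows "\<phi> \<in> H1_0 \<Omega>" and "!!e. e \<in> Basis ==> is_weak_partial \<Omega> e \<phi> (g e)"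
proof -
  show w: "is_weak_partial \<Omega> e \<phi> (g e)" if e: "e \<in> Basis" for e
    using test_functionsD[OF \<psi>(1)]
    by (intro is_weak_partial_limit[OF e test_L2[OF \<psi>(1)] _ \<phi> \<psi>(2) g[OF e] \<psi>(3)[OF e]] is_weak_partial_C1 e)
  have "(\<lambda>n. H1_norm \<Omega> (\<lambda>p. \<psi> n p - \<phi> p)) \<longlonglongrightarrow> sqrt (0\<^sup>2 + (\<Sum>e\<in>(Basis::'a set). 0\<^sup>2))"
    unfolding H1_norm_def
  proof (intro tendsto_intros \<psi>(2))
    fix e :: 'a assume e: "e \<in> Basis"
    show "(\<lambda>n. L2_norm L (weak_partial \<Omega> e (\<lambda>p. \<psi> n p - \<phi> p))) \<longlonglongrightarrow> 0"
      unfolding L2_norm_weak_partial_diff[OF e \<psi>(1) \<phi> w[OF e]] by (rule \<psi>(3)[OF e])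
  qed
  then show "\<phi> \<in> H1_0 \<Omega>" using \<phi> w \<psi>(1) by (auto simp: H1_0_def H1_def)
qed

lemma C1_supported_H1_0:
  assumes "C_k 1 f" "supported_in \<Omega> f"
  shows "f \<in> H1_0 \<Omega>" and "e \<in> Basis ==> AE p in L. weak_partial \<Omega> e f p = partial_deriv e f p"
proof -
  obtain \<psi> where \<psi>: "!!n::nat. \<psi> n \<in> test_functions \<Omega>"
    "(\<lambda>n. L2_norm L (\<lambda>x. \<psi> n x - f x)) \<longlonglongrightarrow> 0"
    "!!e. e \<in> Basis ==> (\<lambda>n. L2_norm L (\<lambda>x. partial_deriv e (\<psi> n) x - partial_deriv e f x)) \<longlonglongrightarrow> 0"
    by (rule C1_approx[OF \<Omega> assms]) blast
  show "f \<in> H1_0 \<Omega>"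
    by (rule H1_0I(1)[where g = "\<lambda>e. partial_deriv e f", OF C1_supported_L2(1)[OF assms] C1_supported_L2(2)[OF assms] \<psi>])
  show "AE p in L. weak_partial \<Omega> e f p = partial_deriv e f p" if "e \<in> Basis"
    by (rule weak_partial_eqI[OF is_weak_partial_C1[OF assms that]])
qed

lemma test_H1_0: "\<psi> \<in> test_functions \<Omega> ==> \<psi> \<in> H1_0 \<Omega>"
  using C1_supported_H1_0(1) test_functionsD by blast

lemma H1_0_zero: "(\<lambda>p. 0) \<in> H1_0 \<Omega>"
  by (rule C1_supported_H1_0(1)) (auto simp: C_k_const supported_in_def intro: exI[of _ "{}"])

lemma H1_0_add:
  assumes "\<phi> \<in> H1_0 \<Omega>" "\<phi>' \<in> H1_0 \<Omega>"
  shows "(\<lambda>p. \<phi> p + \<phi>' p) \<in> H1_0 \<Omega>"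
    and "!!e. e \<in> Basis ==> AE p in L. weak_partial \<Omega> e (\<lambda>p. \<phi> p + \<phi>' p) p = weak_partial \<Omega> e \<phi> p + weak_partial \<Omega> e \<phi>' p"
proof -
  note l = H1_0_L2[OF assms(1)] H1_0_L2[OF assms(2)]
  note w = H1_0_weak_partial_L2[OF assms(1)] H1_0_weak_partial_L2[OF assms(2)]
  show "AE p in L. weak_partial \<Omega> e (\<lambda>p. \<phi> p + \<phi>' p) p = weak_partial \<Omega> e \<phi> p + weak_partial \<Omega> e \<phi>' p"
    if "e \<in> Basis" for e
    by (rule weak_partial_eqI[OF is_weak_partial_add[OF that l H1_0_weak_partial[OF assms(1) that] H1_0_weak_partial[OF assms(2) that]]])
  obtain \<psi> where \<psi>: "!!n::nat. \<psi> n \<in> test_functions \<Omega>"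
    "(\<lambda>n. L2_norm L (\<lambda>p. \<psi> n p - \<phi> p)) \<longlonglongrightarrow> 0"
    "!!e. e \<in> Basis ==> (\<lambda>n. L2_norm L (\<lambda>p. partial_deriv e (\<psi> n) p - weak_partial \<Omega> e \<phi> p)) \<longlonglongrightarrow> 0"
    by (rule H1_0D[OF assms(1)]) blast
  obtain \<theta> where \<theta>: "!!n::nat. \<theta> n \<in> test_functions \<Omega>"
    "(\<lambda>n. L2_norm L (\<lambda>p. \<theta> n p - \<phi>' p)) \<longlonglongrightarrow> 0"
    "!!e. e \<in> Basis ==> (\<lambda>n. L2_norm L (\<lambda>p. partial_deriv e (\<theta> n) p - weak_partial \<Omega> e \<phi>' p)) \<longlonglongrightarrow> 0"
    by (rule H1_0D[OF assms(2)]) blast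
  have lim: "(\<lambda>n. L2_norm L (\<lambda>p. X n p + Y n p - (f p + g p))) \<longlonglongrightarrow> 0"
    if "!!n. X n \<in> L2 L" "!!n. Y n \<in> L2 L" "f \<in> L2 L" "g \<in> L2 L"
      "(\<lambda>n. L2_norm L (\<lambda>p. X n p - f p)) \<longlonglongrightarrow> 0" "(\<lambda>n. L2_norm L (\<lambda>p. Y n p - g p)) \<longlonglongrightarrow> 0" for X Y f g
  proof (rule Lim_null_comparison[OF always_eventually tendsto_add_zero[OF that(5,6)]], rule allI)
    show "norm (L2_norm L (\<lambda>p. X n p + Y n p - (f p + g p))) <= L2_norm L (\<lambda>p. X n p - f p) + L2_norm L (\<lambda>p. Y n p - g p)" for n
      using L2_norm_triangle[OF L2_diff[OF that(1,3)] L2_diff[OF that(2,4)], of n n] by (simp add: algebra_simps)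
  qed
  have pd: "partial_deriv e (\<lambda>p. \<psi> n p + \<theta> n p) p = partial_deriv e (\<psi> n) p + partial_deriv e (\<theta> n) p" for e n p
  proof -
    have "\<psi> n differentiable at p" "\<theta> n differentiable at p"
      using test_functionsD(2)[OF \<psi>(1)] test_functionsD(2)[OF \<theta>(1)] by (auto simp: C1_iff)
    then show ?thesis unfolding partial_deriv_def[of e "\<psi> n"] partial_deriv_def[of e "\<theta> n"]
      by (intro partial_deriv_eq has_derivative_add) (auto simp: frechet_derivative_works[symmetric])
  qed
  show "(\<lambda>p. \<phi> p + \<phi>' p) \<in> H1_0 \<Omega>"
  proof (rule H1_0I(1)[where \<psi> = "\<lambda>n p. \<psi> n p + \<theta> n p" and g = "\<lambda>e p. weak_partial \<Omega> e \<phi> p + weak_partial \<Omega> e \<phi>' p"])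
    show "(\<lambda>n. L2_norm L (\<lambda>p. \<psi> n p + \<theta> n p - (\<phi> p + \<phi>' p))) \<longlonglongrightarrow> 0"
      by (intro lim test_L2 \<psi> \<theta> l)
    show "(\<lambda>n. L2_norm L (\<lambda>p. partial_deriv e (\<lambda>p. \<psi> n p + \<theta> n p) p - (weak_partial \<Omega> e \<phi> p + weak_partial \<Omega> e \<phi>' p))) \<longlonglongrightarrow> 0"
      if "e \<in> Basis" for e
      unfolding pd by (intro lim test_partial_L2 \<psi> \<theta> w that)
  qed (use l w in \<open>auto intro: L2_add test_functions_add \<psi>(1) \<theta>(1)\<close>)
qed

lemma H1_0_cmult:
  assumes \<phi>: "\<phi> \<in> H1_0 \<Omega>"
  shows "(\<lambda>p. c * \<phi> p) \<in> H1_0 \<Omega>"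
    and "!!e. e \<in> Basis ==> AE p in L. weak_partial \<Omega> e (\<lambda>p. c * \<phi> p) p = c * weak_partial \<Omega> e \<phi> p"
proof -
  show "AE p in L. weak_partial \<Omega> e (\<lambda>p. c * \<phi> p) p = c * weak_partial \<Omega> e \<phi> p" if "e \<in> Basis" for e
    by (rule weak_partial_eqI[OF is_weak_partial_cmult[OF H1_0_weak_partial[OF \<phi> that]]])
  obtain \<psi> where \<psi>: "!!n::nat. \<psi> n \<in> test_functions \<Omega>"
    "(\<lambda>n. L2_norm L (\<lambda>p. \<psi> n p - \<phi> p)) \<longlonglongrightarrow> 0"
    "!!e. e \<in> Basis ==> (\<lambda>n. L2_norm L (\<lambda>p. partial_deriv e (\<psi> n) p - weak_partial \<Omega> e \<phi> p)) \<longlonglongrightarrow> 0"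
    by (rule H1_0D[OF \<phi>]) blast
  have nrm: "L2_norm L (\<lambda>p. c * f p) = cmod c * L2_norm L f" for f
    by (simp add: L2_norm_def norm_mult power_mult_distrib real_sqrt_mult)
  have lim: "(\<lambda>n. L2_norm L (\<lambda>p. c * X n p - c * f p)) \<longlonglongrightarrow> 0"
    if "(\<lambda>n. L2_norm L (\<lambda>p. X n p - f p)) \<longlonglongrightarrow> 0" for X f
    using tendsto_mult_right_zero[OF that, of "cmod c"] by (simp add: nrm flip: right_diff_distrib)
  have pd: "partial_deriv e (\<lambda>p. c * \<psi> n p) p = c * partial_deriv e (\<psi> n) p" for e n p
    using test_functionsD(2)[OF \<psi>(1)[of n]]
    by (subst partial_deriv_mult) (auto simp: C1_iff partial_deriv_eq[OF has_derivative_const])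
  show "(\<lambda>p. c * \<phi> p) \<in> H1_0 \<Omega>"
  proof (rule H1_0I(1)[where \<psi> = "\<lambda>n p. c * \<psi> n p" and g = "\<lambda>e p. c * weak_partial \<Omega> e \<phi> p"])
    show "(\<lambda>n. L2_norm L (\<lambda>p. partial_deriv e (\<lambda>p. c * \<psi> n p) p - c * weak_partial \<Omega> e \<phi> p)) \<longlonglongrightarrow> 0"
      if "e \<in> Basis" for e unfolding pd by (intro lim \<psi> that)
  qed (use H1_0_L2[OF \<phi>] H1_0_weak_partial_L2[OF \<phi>] in \<open>auto intro!: L2_cmult test_functions_cmult \<psi>(1) lim \<psi>(2)\<close>)
qed

text \<open>Completeness: approximate the terms of a Cauchy sequence by test functions up to \<open>1/n\<close>.\<close>

lemma H1_0_complete: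
  assumes X: "!!n::nat. X n \<in> H1_0 \<Omega>"
    and Cau: "\<forall>e>0. \<exists>N. \<forall>m\<ge>N. \<forall>n\<ge>N. L2_norm L (\<lambda>p. X m p - X n p) < e"
    and Cau': "!!i. i \<in> Basis ==> \<forall>e>0. \<exists>N. \<forall>m\<ge>N. \<forall>n\<ge>N. L2_norm L (\<lambda>p. weak_partial \<Omega> i (X m) p - weak_partial \<Omega> i (X n) p) < e"
  shows "\<exists>\<phi>\<in>H1_0 \<Omega>. (\<lambda>n. L2_norm L (\<lambda>p. X n p - \<phi> p)) \<longlonglongrightarrow> 0 \<and>
    (\<forall>i\<in>Basis. (\<lambda>n. L2_norm L (\<lambda>p. weak_partial \<Omega> i (X n) p - weak_partial \<Omega> i \<phi> p)) \<longlonglongrightarrow> 0)"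
proof -
  note XL = H1_0_L2[OF X] and XW = H1_0_weak_partial_L2[OF X]
  have "\<exists>\<phi>\<in>L2 L. (\<lambda>n. L2_norm L (X n - \<phi>)) \<longlonglongrightarrow> 0"
    by (rule L2_complete[OF XL]) (use Cau in \<open>simp add: fun_diff_def\<close>)
  then obtain \<phi> where \<phi>: "\<phi> \<in> L2 L" "(\<lambda>n. L2_norm L (X n - \<phi>)) \<longlonglongrightarrow> 0" by blast
  have "\<forall>i\<in>Basis. \<exists>g\<in>L2 L. (\<lambda>n. L2_norm L (weak_partial \<Omega> i (X n) - g)) \<longlonglongrightarrow> 0"
  proof
    fix i :: 'a assume "i \<in> Basis"
    then show "\<exists>g\<in>L2 L. (\<lambda>n. L2_norm L (weak_partial \<Omega> i (X n) - g)) \<longlonglongrightarrow> 0"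
      by (intro L2_complete[OF XW]) (use Cau' in \<open>simp_all add: fun_diff_def\<close>)
  qed
  then obtain g where g: "!!i. i \<in> Basis ==> g i \<in> L2 L"
    "!!i. i \<in> Basis ==> (\<lambda>n. L2_norm L (weak_partial \<Omega> i (X n) - g i)) \<longlonglongrightarrow> 0" by metis
  have "\<exists>\<psi>\<in>test_functions \<Omega>. L2_norm L (\<lambda>p. \<psi> p - X n p) < 1 / real (Suc n) \<and>
      (\<forall>i\<in>Basis. L2_norm L (\<lambda>p. partial_deriv i \<psi> p - weak_partial \<Omega> i (X n) p) < 1 / real (Suc n))" for n
  proof -
    obtain \<psi> where \<psi>: "!!k::nat. \<psi> k \<in> test_functions \<Omega>"
      "(\<lambda>k. L2_norm L (\<lambda>p. \<psi> k p - X n p)) \<longlonglongrightarrow> 0"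
      "!!e. e \<in> Basis ==> (\<lambda>k. L2_norm L (\<lambda>p. partial_deriv e (\<psi> k) p - weak_partial \<Omega> e (X n) p)) \<longlonglongrightarrow> 0"
      by (rule H1_0D[OF X]) blast
    have "\<forall>\<^sub>F k in sequentially. L2_norm L (\<lambda>p. \<psi> k p - X n p) < 1 / real (Suc n) \<and>
      (\<forall>i\<in>Basis. L2_norm L (\<lambda>p. partial_deriv i (\<psi> k) p - weak_partial \<Omega> i (X n) p) < 1 / real (Suc n))"
      by (intro eventually_conj eventually_ball_finite ballI order_tendstoD(2)[OF \<psi>(2)] order_tendstoD(2)[OF \<psi>(3)]) auto
    then show ?thesis using \<psi>(1) eventually_happens'[OF sequentially_bot] by blast
  qed
  then obtain \<psi> where \<psi>: "!!n. \<psi> n \<in> test_functions \<Omega>" "!!n. L2_norm L (\<lambda>p. \<psi> n p - X n p) < 1 / real (Suc n)"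
    "!!n i. i \<in> Basis ==> L2_norm L (\<lambda>p. partial_deriv i (\<psi> n) p - weak_partial \<Omega> i (X n) p) < 1 / real (Suc n)" by metis
  have lim: "(\<lambda>n. L2_norm L (\<lambda>p. P n p - l p)) \<longlonglongrightarrow> 0"
    if "!!n. P n \<in> L2 L" "!!n. Q n \<in> L2 L" "l \<in> L2 L" "!!n. L2_norm L (\<lambda>p. P n p - Q n p) < 1 / real (Suc n)"
      "(\<lambda>n. L2_norm L (Q n - l)) \<longlonglongrightarrow> 0" for P Q l
  proof (rule Lim_null_comparison[OF always_eventually], rule allI)
    show "norm (L2_norm L (\<lambda>p. P n p - l p)) <= 1 / real (Suc n) + L2_norm L (Q n - l)" for n
      using L2_norm_triangle_diff3[OF that(1)[of n] that(2)[of n] that(3)] that(4)[of n] by (simp add: fun_diff_def)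
    show "(\<lambda>n. 1 / real (Suc n) + L2_norm L (Q n - l)) \<longlonglongrightarrow> 0"
      using tendsto_add[OF LIMSEQ_inverse_real_of_nat that(5)] by (simp add: inverse_eq_divide)
  qed
  have 1: "(\<lambda>n. L2_norm L (\<lambda>p. \<psi> n p - \<phi> p)) \<longlonglongrightarrow> 0"
    by (rule lim[OF test_L2[OF \<psi>(1)] XL \<phi>(1) \<psi>(2) \<phi>(2)])
  have 2: "(\<lambda>n. L2_norm L (\<lambda>p. partial_deriv i (\<psi> n) p - g i p)) \<longlonglongrightarrow> 0" if "i \<in> Basis" for i
    by (rule lim[OF test_partial_L2[OF \<psi>(1) that] XW[OF that] g(1)[OF that] \<psi>(3)[OF that] g(2)[OF that]])
  have H: "\<phi> \<in> H1_0 \<Omega>" by (rule H1_0I(1)[where g = g, OF \<phi>(1) g(1) \<psi>(1) 1 2])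
  have H2: "is_weak_partial \<Omega> i \<phi> (g i)" if "i \<in> Basis" for i
    by (rule H1_0I(2)[where g = g, OF \<phi>(1) g(1) \<psi>(1) 1 2 that])
  have wg: "L2_norm L (\<lambda>p. weak_partial \<Omega> i (X n) p - weak_partial \<Omega> i \<phi> p) = L2_norm L (weak_partial \<Omega> i (X n) - g i)"
    if i: "i \<in> Basis" for n i
  proof (rule L2_norm_cong_AE)
    show "(\<lambda>p. weak_partial \<Omega> i (X n) p - weak_partial \<Omega> i \<phi> p) \<in> borel_measurable L"
      using XW[OF i] H1_0_weak_partial_L2[OF H i] by (intro borel_measurable_diff L2_measurable) auto
    show "weak_partial \<Omega> i (X n) - g i \<in> borel_measurable L"
      unfolding fun_diff_def using XW[OF i] g(1)[OF i] by (intro borel_measurable_diff L2_measurable) auto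
    show "AE p in L. weak_partial \<Omega> i (X n) p - weak_partial \<Omega> i \<phi> p = (weak_partial \<Omega> i (X n) - g i) p"
      using weak_partial_eqI[OF H2[OF i]] by (rule AE_mp) (auto intro!: AE_I2)
  qed
  show ?thesis
    using H \<phi>(2) g(2) by (intro bexI[of _ \<phi>]) (auto simp: wg fun_diff_def)
qed

end

section \<open>The magnetic Dirichlet Laplacian as the operator of a closed form\<close>

locale bounded_potential =
  fixes \<Omega> :: "'a::euclidean_space set" and A :: "'a => 'a" and B :: real
  assumes \<Omega>: "open \<Omega>" and A_cont: "continuous_on UNIV A"
    and A_bound: "p \<in> \<Omega> ==> e \<in> Basis ==> \<bar>A p \<bullet> e\<bar> <= B" and B_nonneg: "B \<ge> 0"
begin

abbreviation L where "L \<equiv> lborel_on \<Omega>"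
abbreviation mp where "mp \<equiv> magnetic_partial \<Omega> A"
abbreviation wp where "wp \<equiv> weak_partial \<Omega>"

lemmas wp_L2 = H1_0_weak_partial_L2[OF \<Omega>]
lemmas D_L2 = H1_0_L2[OF \<Omega>]

lemma A_mult_L2:
  assumes "\<phi> \<in> L2 L" "e \<in> Basis"
  shows "(\<lambda>p. of_real (A p \<bullet> e) * \<phi> p) \<in> L2 L"
    and "(L2_norm L (\<lambda>p. of_real (A p \<bullet> e) * \<phi> p))\<^sup>2 <= B\<^sup>2 * (L2_norm L \<phi>)\<^sup>2"
proof -
  have bound: "(cmod (of_real (A p \<bullet> e) * \<phi> p))\<^sup>2 <= B\<^sup>2 * (cmod (\<phi> p))\<^sup>2" if "p \<in> space L" for p
  proof -
    have "\<bar>A p \<bullet> e\<bar> <= B" using that A_bound assms(2) by (simp add: space_restrict_space)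
    then have "(A p \<bullet> e)\<^sup>2 <= B\<^sup>2" by (metis abs_ge_zero power2_abs power_mono)
    then show ?thesis by (simp add: norm_mult power_mult_distrib mult_right_mono)
  qed
  have int: "integrable L (\<lambda>p. B\<^sup>2 * (cmod (\<phi> p))\<^sup>2)" using L2_integrable[OF assms(1)] by simp
  have m: "(\<lambda>p. complex_of_real (A p \<bullet> e)) \<in> borel_measurable L"
    by (intro measurable_restrict_space1, simp, intro borel_measurable_continuous_onI continuous_intros A_cont)
  show l: "(\<lambda>p. of_real (A p \<bullet> e) * \<phi> p) \<in> L2 L"
    by (rule L2_bound[OF borel_measurable_times[OF m L2_measurable[OF assms(1)]] int bound])
  show "(L2_norm L (\<lambda>p. of_real (A p \<bullet> e) * \<phi> p))\<^sup>2 <= B\<^sup>2 * (L2_norm L \<phi>)\<^sup>2"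
    unfolding L2_norm_sq integral_mult_right_zero[symmetric]
    by (rule integral_mono[OF L2_integrable[OF l] int bound])
qed

lemma mp_eq: "mp e \<phi> = (\<lambda>p. \<i> * wp e \<phi> p + of_real (A p \<bullet> e) * \<phi> p)"
  by (simp add: magnetic_partial_def fun_eq_iff)

lemma mp_L2: "\<phi> \<in> H1_0 \<Omega> ==> e \<in> Basis ==> mp e \<phi> \<in> L2 L"
  unfolding mp_eq by (intro L2_add L2_cmult wp_L2 A_mult_L2 D_L2)

lemma norm_diff_sq_le: "(norm (x - y))\<^sup>2 <= 2 * (norm x)\<^sup>2 + 2 * (norm (y::complex))\<^sup>2"
  using norm_add_sq_le[of x "-y"] by simp

lemma mp_wp_bounds:
  assumes \<phi>: "\<phi> \<in> H1_0 \<Omega>" and e: "e \<in> Basis"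
  shows "(L2_norm L (mp e \<phi>))\<^sup>2 <= 2 * (L2_norm L (wp e \<phi>))\<^sup>2 + 2 * B\<^sup>2 * (L2_norm L \<phi>)\<^sup>2"
    and "(L2_norm L (wp e \<phi>))\<^sup>2 <= 2 * (L2_norm L (mp e \<phi>))\<^sup>2 + 2 * B\<^sup>2 * (L2_norm L \<phi>)\<^sup>2"
proof -
  let ?a = "\<lambda>p. of_real (A p \<bullet> e) * \<phi> p"
  note l = L2_integrable[OF mp_L2[OF \<phi> e]] L2_integrable[OF wp_L2[OF \<phi> e]] L2_integrable[OF A_mult_L2(1)[OF D_L2[OF \<phi>] e]]
  have "(L2_norm L (mp e \<phi>))\<^sup>2 <= (\<integral>p. 2 * (cmod (wp e \<phi> p))\<^sup>2 + 2 * (cmod (?a p))\<^sup>2 \<partial>L)"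
    unfolding L2_norm_sq
  proof (rule integral_mono)
    show "(cmod (mp e \<phi> p))\<^sup>2 <= 2 * (cmod (wp e \<phi> p))\<^sup>2 + 2 * (cmod (?a p))\<^sup>2" for p
      using norm_add_sq_le[of "\<i> * wp e \<phi> p" "?a p"] by (simp add: mp_eq norm_mult)
  qed (use l in auto)
  also have "... = 2 * (L2_norm L (wp e \<phi>))\<^sup>2 + 2 * (L2_norm L ?a)\<^sup>2"
    unfolding L2_norm_sq using l by simp
  finally show "(L2_norm L (mp e \<phi>))\<^sup>2 <= 2 * (L2_norm L (wp e \<phi>))\<^sup>2 + 2 * B\<^sup>2 * (L2_norm L \<phi>)\<^sup>2"
    using A_mult_L2(2)[OF D_L2[OF \<phi>] e] by simp
  have "(L2_norm L (wp e \<phi>))\<^sup>2 <= (\<integral>p. 2 * (cmod (mp e \<phi> p))\<^sup>2 + 2 * (cmod (?a p))\<^sup>2 \<partial>L)"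
    unfolding L2_norm_sq
  proof (rule integral_mono)
    show "(cmod (wp e \<phi> p))\<^sup>2 <= 2 * (cmod (mp e \<phi> p))\<^sup>2 + 2 * (cmod (?a p))\<^sup>2" for p
      using norm_diff_sq_le[of "mp e \<phi> p" "?a p"] by (simp add: mp_eq norm_mult)
  qed (use l in auto)
  also have "... = 2 * (L2_norm L (mp e \<phi>))\<^sup>2 + 2 * (L2_norm L ?a)\<^sup>2"
    unfolding L2_norm_sq using l by simp
  finally show "(L2_norm L (wp e \<phi>))\<^sup>2 <= 2 * (L2_norm L (mp e \<phi>))\<^sup>2 + 2 * B\<^sup>2 * (L2_norm L \<phi>)\<^sup>2"
    using A_mult_L2(2)[OF D_L2[OF \<phi>] e] by simp
qed

lemma mp_add:
  assumes "\<phi> \<in> H1_0 \<Omega>" "\<psi> \<in> H1_0 \<Omega>" "e \<in> Basis"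
  shows "AE p in L. mp e (\<lambda>p. \<phi> p + \<psi> p) p = mp e \<phi> p + mp e \<psi> p"
  using H1_0_add(2)[OF \<Omega> assms] by (rule AE_mp) (auto intro!: AE_I2 simp: mp_eq algebra_simps)

lemma mp_cmult:
  assumes "\<phi> \<in> H1_0 \<Omega>" "e \<in> Basis"
  shows "AE p in L. mp e (\<lambda>p. c * \<phi> p) p = c * mp e \<phi> p"
  using H1_0_cmult(2)[OF \<Omega> assms, of c] by (rule AE_mp) (auto intro!: AE_I2 simp: mp_eq algebra_simps)

lemma form_eq:
  assumes "\<phi> \<in> H1_0 \<Omega>" "\<psi> \<in> H1_0 \<Omega>"
  shows "magnetic_form \<Omega> A \<phi> \<psi> = (\<Sum>e\<in>Basis. L2_inner L (mp e \<phi>) (mp e \<psi>))"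
  unfolding magnetic_form_def L2_inner_def
  using assms by (intro Bochner_Integration.integral_sum L2_inner_integrable mp_L2)

lemma L2_inner_cong_AE:
  assumes "AE p in L. f p = f' p" "AE p in L. g p = g' p" "f \<in> L2 L" "f' \<in> L2 L" "g \<in> L2 L" "g' \<in> L2 L"
  shows "L2_inner L f g = L2_inner L f' g'"
  unfolding L2_inner_def
proof (rule integral_cong_AE)
  show "AE p in L. f p * cnj (g p) = f' p * cnj (g' p)"
    using AE_conjI[OF assms(1,2)] by (rule AE_mp) (auto intro!: AE_I2)
qed (intro borel_measurable_integrable L2_inner_integrable assms)+

text \<open>The weak gradient differs from the magnetic one by a field term of norm at most \<open>B \<parallel>\<phi>\<parallel>\<close>; this constant
  absorbs it, so that the form norm controls that of \<open>H\<^sup>1\<close>.\<close>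

definition shift :: real where "shift = B\<^sup>2 + 1"

definition mform :: "('a => complex) => ('a => complex) => complex" where
  "mform \<phi> \<psi> = magnetic_form \<Omega> A \<phi> \<psi> + of_real shift * L2_inner L \<phi> \<psi>"

lemma form_self_Re: "0 <= Re (magnetic_form \<Omega> A \<phi> \<phi>)"
  by (simp add: magnetic_form_diagonal magnetic_quadratic_form_def sum_nonneg)

lemma semi_inner_mform: "semi_inner cscale (H1_0 \<Omega>) mform"
proof -
  interpret vector_space "cscale :: complex => ('a => complex) => _" by (rule vector_space_cscale)
  show ?thesis
  proof unfold_locales
    show "0 \<in> H1_0 \<Omega>" using H1_0_zero[OF \<Omega>] by (simp add: zero_fun_def)
    show add: "\<phi> + \<psi> \<in> H1_0 \<Omega>" if "\<phi> \<in> H1_0 \<Omega>" "\<psi> \<in> H1_0 \<Omega>" for \<phi> \<psi>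
      using H1_0_add(1)[OF \<Omega> that] by (simp add: plus_fun_def)
    show scale: "cscale c \<phi> \<in> H1_0 \<Omega>" if "\<phi> \<in> H1_0 \<Omega>" for c \<phi>
      using H1_0_cmult(1)[OF \<Omega> that] by (simp add: cscale_def)
    show "mform (\<phi> + \<psi>) \<theta> = mform \<phi> \<theta> + mform \<psi> \<theta>"
      if "\<phi> \<in> H1_0 \<Omega>" "\<psi> \<in> H1_0 \<Omega>" "\<theta> \<in> H1_0 \<Omega>" for \<phi> \<psi> \<theta>
    proof -
      have "L2_inner L (mp e (\<phi> + \<psi>)) (mp e \<theta>) = L2_inner L (mp e \<phi>) (mp e \<theta>) + L2_inner L (mp e \<psi>) (mp e \<theta>)"
        if e: "e \<in> Basis" for e
      proof -
        have "L2_inner L (mp e (\<phi> + \<psi>)) (mp e \<theta>) = L2_inner L (mp e \<phi> + mp e \<psi>) (mp e \<theta>)"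
          using mp_add[OF \<open>\<phi> \<in> H1_0 \<Omega>\<close> \<open>\<psi> \<in> H1_0 \<Omega>\<close> e] \<open>\<phi> \<in> H1_0 \<Omega>\<close> \<open>\<psi> \<in> H1_0 \<Omega>\<close> \<open>\<theta> \<in> H1_0 \<Omega>\<close> e
          by (intro L2_inner_cong_AE mp_L2 add L2.V_add) (auto simp: plus_fun_def)
        then show ?thesis using that e mp_L2 \<open>\<phi> \<in> H1_0 \<Omega>\<close> \<open>\<psi> \<in> H1_0 \<Omega>\<close> \<open>\<theta> \<in> H1_0 \<Omega>\<close> by (simp add: L2.ip_add_left)
      qed
      then show ?thesis using that add
        by (simp add: mform_def form_eq L2.ip_add_left D_L2 sum.distrib distrib_left)
    qed
    show "mform (cscale c \<phi>) \<psi> = c * mform \<phi> \<psi>" if "\<phi> \<in> H1_0 \<Omega>" "\<psi> \<in> H1_0 \<Omega>" for c \<phi> \<psi>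
    proof -
      have "L2_inner L (mp e (cscale c \<phi>)) (mp e \<psi>) = c * L2_inner L (mp e \<phi>) (mp e \<psi>)" if e: "e \<in> Basis" for e
      proof -
        have "L2_inner L (mp e (cscale c \<phi>)) (mp e \<psi>) = L2_inner L (cscale c (mp e \<phi>)) (mp e \<psi>)"
          using mp_cmult[OF \<open>\<phi> \<in> H1_0 \<Omega>\<close> e, of c] \<open>\<phi> \<in> H1_0 \<Omega>\<close> \<open>\<psi> \<in> H1_0 \<Omega>\<close> e
          by (intro L2_inner_cong_AE mp_L2 scale L2.V_scale) (auto simp: cscale_def)
        then show ?thesis using e mp_L2 \<open>\<phi> \<in> H1_0 \<Omega>\<close> \<open>\<psi> \<in> H1_0 \<Omega>\<close> by (simp add: L2.ip_scale_left)
      qed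
      then show ?thesis using that scale
        by (simp add: mform_def form_eq L2.ip_scale_left D_L2 sum_distrib_left distrib_left)
    qed
    show "mform \<phi> \<psi> = cnj (mform \<psi> \<phi>)" if "\<phi> \<in> H1_0 \<Omega>" "\<psi> \<in> H1_0 \<Omega>" for \<phi> \<psi>
      using that L2.ip_commute[of "mp _ \<phi>" L "mp _ \<psi>"] L2.ip_commute[of \<phi> L \<psi>] mp_L2
      by (simp add: mform_def form_eq D_L2 flip: cnj_sum)
    show "0 <= Re (mform \<phi> \<phi>)" for \<phi>
      using form_self_Re[of \<phi>] by (simp add: mform_def L2_inner_self shift_def)
  qed
qed

sublocale D: semi_inner cscale "H1_0 \<Omega>" mform
  by (rule semi_inner_mform)

lemma D_nrm_sq:
  assumes "\<phi> \<in> H1_0 \<Omega>"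
  shows "(D.nrm \<phi>)\<^sup>2 = (\<Sum>e\<in>Basis. (L2_norm L (mp e \<phi>))\<^sup>2) + (B\<^sup>2 + 1) * (L2_norm L \<phi>)\<^sup>2"
  using assms by (simp add: D.nrm_sq mform_def form_eq L2_inner_self L2_norm_sq shift_def)

lemma L2_le_D: "\<phi> \<in> H1_0 \<Omega> ==> L2_norm L \<phi> <= D.nrm \<phi>"
proof (rule power2_le_imp_le)
  assume "\<phi> \<in> H1_0 \<Omega>"
  then show "(L2_norm L \<phi>)\<^sup>2 <= (D.nrm \<phi>)\<^sup>2"
    by (simp add: D_nrm_sq sum_nonneg distrib_right add_increasing)
qed simp

lemma wp_le_D:
  assumes "\<phi> \<in> H1_0 \<Omega>" "e \<in> Basis"
  shows "L2_norm L (wp e \<phi>) <= 2 * D.nrm \<phi>"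
proof (rule power2_le_imp_le)
  have "(L2_norm L (mp e \<phi>))\<^sup>2 <= (\<Sum>e\<in>Basis. (L2_norm L (mp e \<phi>))\<^sup>2)"
    using assms(2) by (intro member_le_sum) auto
  moreover have "0 <= (L2_norm L \<phi>)\<^sup>2" "0 <= (L2_norm L (mp e \<phi>))\<^sup>2" "0 <= B\<^sup>2 * (L2_norm L \<phi>)\<^sup>2" by auto
  moreover have "(2 * D.nrm \<phi>)\<^sup>2 = 4 * (D.nrm \<phi>)\<^sup>2" by (simp add: power_mult_distrib)
  ultimately show "(L2_norm L (wp e \<phi>))\<^sup>2 <= (2 * D.nrm \<phi>)\<^sup>2"
    using mp_wp_bounds(2)[OF assms] D_nrm_sq[OF assms(1)] unfolding distrib_right mult.assoc by linarith
qed simp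

lemma D_nrm_sq_le:
  assumes "\<phi> \<in> H1_0 \<Omega>"
  shows "(D.nrm \<phi>)\<^sup>2 <= 2 * (\<Sum>e\<in>Basis. (L2_norm L (wp e \<phi>))\<^sup>2) + (2 * B\<^sup>2 * real DIM('a) + B\<^sup>2 + 1) * (L2_norm L \<phi>)\<^sup>2"
proof -
  have "(\<Sum>e\<in>Basis. (L2_norm L (mp e \<phi>))\<^sup>2) <= (\<Sum>e\<in>Basis. 2 * (L2_norm L (wp e \<phi>))\<^sup>2 + 2 * B\<^sup>2 * (L2_norm L \<phi>)\<^sup>2)"
    by (intro sum_mono mp_wp_bounds(1) assms)
  then show ?thesis by (simp add: D_nrm_sq[OF assms] sum.distrib sum_distrib_left algebra_simps)
qed

lemma H1_0_diff:
  assumes "\<phi> \<in> H1_0 \<Omega>" "\<psi> \<in> H1_0 \<Omega>"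
  shows "!!e. e \<in> Basis ==> L2_norm L (wp e (\<phi> - \<psi>)) = L2_norm L (\<lambda>p. wp e \<phi> p - wp e \<psi> p)"
proof (rule L2_norm_cong_AE)
  fix e :: 'a assume e: "e \<in> Basis"
  show "AE p in L. wp e (\<phi> - \<psi>) p = wp e \<phi> p - wp e \<psi> p"
    unfolding fun_diff_def
    by (intro weak_partial_eqI[OF \<Omega>] is_weak_partial_diff[OF \<Omega> e] H1_0_weak_partial[OF \<Omega>] D_L2 assms e)
  show "wp e (\<phi> - \<psi>) \<in> borel_measurable L" using assms e by (intro L2_measurable wp_L2 D.V_diff)
  show "(\<lambda>p. wp e \<phi> p - wp e \<psi> p) \<in> borel_measurable L" using assms e by (intro L2_measurable L2_diff wp_L2)
qed

lemma D_tendsto: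
  assumes X: "!!n::nat. X n \<in> H1_0 \<Omega>" and \<phi>: "\<phi> \<in> H1_0 \<Omega>"
    and lim: "(\<lambda>n. L2_norm L (\<lambda>p. X n p - \<phi> p)) \<longlonglongrightarrow> 0"
      "!!e. e \<in> Basis ==> (\<lambda>n. L2_norm L (\<lambda>p. wp e (X n) p - wp e \<phi> p)) \<longlonglongrightarrow> 0"
  shows "(\<lambda>n. D.nrm (X n - \<phi>)) \<longlonglongrightarrow> 0"
proof -
  let ?C = "2 * B\<^sup>2 * real DIM('a) + B\<^sup>2 + 1"
  have "(\<lambda>n. 2 * (\<Sum>e\<in>Basis. (L2_norm L (\<lambda>p. wp e (X n) p - wp e \<phi> p))\<^sup>2) + ?C * (L2_norm L (\<lambda>p. X n p - \<phi> p))\<^sup>2)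
      \<longlonglongrightarrow> 2 * (\<Sum>e\<in>(Basis::'a set). 0\<^sup>2) + ?C * 0\<^sup>2"
    by (intro tendsto_intros lim)
  then have "(\<lambda>n. 2 * (\<Sum>e\<in>Basis. (L2_norm L (\<lambda>p. wp e (X n) p - wp e \<phi> p))\<^sup>2) + ?C * (L2_norm L (\<lambda>p. X n p - \<phi> p))\<^sup>2) \<longlonglongrightarrow> 0"
    by simp
  then have "(\<lambda>n. (D.nrm (X n - \<phi>))\<^sup>2) \<longlonglongrightarrow> 0"
  proof (rule Lim_null_comparison[rotated], intro always_eventually allI)
    fix n
    show "norm ((D.nrm (X n - \<phi>))\<^sup>2)
      <= 2 * (\<Sum>e\<in>Basis. (L2_norm L (\<lambda>p. wp e (X n) p - wp e \<phi> p))\<^sup>2) + ?C * (L2_norm L (\<lambda>p. X n p - \<phi> p))\<^sup>2"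
      using D_nrm_sq_le[OF D.V_diff[OF X \<phi>], of n] by (simp add: H1_0_diff[OF X \<phi>]) (simp add: fun_diff_def)
  qed
  from tendsto_real_sqrt[OF this] show ?thesis by simp
qed

lemma complete_D: "D.complete_space"
  unfolding D.complete_space_def
proof (intro allI impI, elim conjE)
  fix X assume X: "\<forall>n::nat. X n \<in> H1_0 \<Omega>" and Cau: "\<forall>e>0. \<exists>N. \<forall>m\<ge>N. \<forall>n\<ge>N. D.nrm (X m - X n) < e"
  have XD: "X m - X n \<in> H1_0 \<Omega>" for m n using X by simp
  have 1: "\<forall>e>0. \<exists>N. \<forall>m\<ge>N. \<forall>n\<ge>N. L2_norm L (\<lambda>p. X m p - X n p) < e"
    using Cau L2_le_D[OF XD] unfolding fun_diff_def by (meson le_less_trans)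
  have 2: "\<forall>e>0. \<exists>N. \<forall>m\<ge>N. \<forall>n\<ge>N. L2_norm L (\<lambda>p. wp i (X m) p - wp i (X n) p) < e" if i: "i \<in> Basis" for i
  proof (intro allI impI)
    fix e :: real assume "e > 0"
    then obtain N where N: "\<forall>m\<ge>N. \<forall>n\<ge>N. D.nrm (X m - X n) < e / 2" using Cau half_gt_zero by blast
    have "L2_norm L (\<lambda>p. wp i (X m) p - wp i (X n) p) < e" if "m \<ge> N" "n \<ge> N" for m n
      using wp_le_D[OF XD i, of m n] N that H1_0_diff[of "X m" "X n" i] X i by force
    then show "\<exists>N. \<forall>m\<ge>N. \<forall>n\<ge>N. L2_norm L (\<lambda>p. wp i (X m) p - wp i (X n) p) < e" by blast
  qed
  have "\<exists>\<phi>\<in>H1_0 \<Omega>. (\<lambda>n. L2_norm L (\<lambda>p. X n p - \<phi> p)) \<longlonglongrightarrow> 0 \<and>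
    (\<forall>i\<in>Basis. (\<lambda>n. L2_norm L (\<lambda>p. wp i (X n) p - wp i \<phi> p)) \<longlonglongrightarrow> 0)"
    by (rule H1_0_complete[OF \<Omega> _ 1 2]) (use X in auto)
  then show "\<exists>l\<in>H1_0 \<Omega>. (\<lambda>n. D.nrm (X n - l)) \<longlonglongrightarrow> 0"
    using D_tendsto X by blast
qed

sublocale closed_form cscale "L2 L" "L2_inner L" "H1_0 \<Omega>" mform "magnetic_form \<Omega> A" shift
proof unfold_locales
  show "semi_inner.complete_space (L2 L) (L2_inner L)" by (rule complete_space_L2)
qed (auto simp: complete_D D_L2 nrm_L2_inner L2_le_D mform_def)

abbreviation hn where "hn \<equiv> semi_inner.nrm (L2_inner L)"

lemma T_eq: "T = magnetic_laplacian \<Omega> A"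
  by (simp add: T_def magnetic_laplacian_def form_operator_def)

lemma nrm_eq_0_iff_AE:
  assumes "f \<in> L2 L" "g \<in> L2 L"
  shows "hn (f - g) = 0 \<longleftrightarrow> (AE p in L. f p = g p)"
  using L2_norm_eq_0_iff[OF L2_diff[OF assms]] by (simp add: nrm_L2_inner fun_diff_def)

lemma regular_iff: "regular z \<longleftrightarrow> z \<in> resolvent_set L (magnetic_laplacian \<Omega> A)"
proof -
  have 1: "hn (g - cscale z \<phi> - f) = 0 \<longleftrightarrow> (AE p in L. g p - z * \<phi> p = f p)"
    if "(\<phi>, g) \<in> T" "f \<in> L2 L" for \<phi> g f
  proof -
    have "\<phi> \<in> L2 L" "g \<in> L2 L" using T_D[OF that(1)] T_H[OF that(1)] D_L2 by auto
    then show ?thesis using nrm_eq_0_iff_AE[of "g - cscale z \<phi>" f] that(2) by simp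
  qed
  have 2: "g - cscale z \<phi> = (\<lambda>p. g p - z * \<phi> p)" for g \<phi> by (simp add: fun_eq_iff)
  show ?thesis
    unfolding regular_def resolvent_set_def mem_Collect_eq T_eq[symmetric]
    using 1 by (intro arg_cong2[of _ _ _ _ "(\<and>)"] ball_cong bex_cong refl) (auto simp: nrm_L2_inner 2)
qed

lemma eigenspace_iff: "\<phi> \<in> eigenspace L (magnetic_laplacian \<Omega> A) (of_real \<kappa>) \<longleftrightarrow> eigenvector \<kappa> \<phi>"
proof -
  have "hn (g - cscale (of_real \<kappa>) \<phi>) = 0 \<longleftrightarrow> (AE p in L. g p = of_real \<kappa> * \<phi> p)" if "(\<phi>, g) \<in> T" for g
  proof -
    have "\<phi> \<in> L2 L" "g \<in> L2 L" using T_D[OF that(1)] T_H[OF that(1)] D_L2 by auto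
    then show ?thesis using nrm_eq_0_iff_AE[of g "cscale (of_real \<kappa>) \<phi>"] by simp
  qed
  then show ?thesis by (auto simp: eigenspace_def eigenvector_def T_eq[symmetric])
qed

lemma essential_spectrum_subset:
  assumes bound: "!!\<mu>. \<mu> < \<Lambda> ==> \<exists>(J :: 'j set) b. finite J \<and> (\<forall>j\<in>J. b j \<in> L2 L) \<and>
    (\<forall>x\<in>H1_0 \<Omega>. \<mu> * (L2_norm L x)\<^sup>2 <= Re (magnetic_form \<Omega> A x x) + (\<Sum>j\<in>J. (cmod (L2_inner L x (b j)))\<^sup>2))"
  shows "essential_spectrum L (magnetic_laplacian \<Omega> A) \<subseteq> of_real ` {\<Lambda>..}"
proof
  let ?T = "magnetic_laplacian \<Omega> A"
  have spec: "z \<in> spectrum L ?T \<longleftrightarrow> \<not> regular z" for z by (simp add: spectrum_def regular_iff)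
  fix z assume z: "z \<in> essential_spectrum L ?T"
  then have zs: "z \<in> spectrum L ?T" and zd: "z \<notin> discrete_spectrum L ?T" by (auto simp: essential_spectrum_def)
  have real: "\<exists>\<kappa>. y = of_real \<kappa>" if "y \<in> spectrum L ?T" for y
    using that regular_nonreal[of y] spec complex_is_Real_iff by (metis Reals_cases)
  obtain \<kappa> where \<kappa>: "z = of_real \<kappa>" using real[OF zs] by blast
  have "\<kappa> \<ge> \<Lambda>"
  proof (rule ccontr)
    assume "\<not> \<kappa> \<ge> \<Lambda>"
    define \<mu> where "\<mu> = (\<kappa> + \<Lambda>) / 2"
    have \<mu>: "\<kappa> < \<mu>" "\<mu> < \<Lambda>" using \<open>\<not> \<kappa> \<ge> \<Lambda>\<close> by (auto simp: \<mu>_def)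
    obtain J :: "'j set" and b where J: "finite J" "\<forall>j\<in>J. b j \<in> L2 L"
      "\<forall>x\<in>H1_0 \<Omega>. \<mu> * (L2_norm L x)\<^sup>2 <= Re (magnetic_form \<Omega> A x x) + (\<Sum>j\<in>J. (cmod (L2_inner L x (b j)))\<^sup>2)"
      using bound[OF \<mu>(2)] by blast
    interpret F: finite_rank_bound cscale "L2 L" "L2_inner L" "H1_0 \<Omega>" mform "magnetic_form \<Omega> A" shift \<mu> J b
      by unfold_locales (use J in \<open>auto simp: nrm_L2_inner\<close>)
    define E where "E = {\<kappa>. \<kappa> < \<mu> \<and> (\<exists>\<phi>. eigenvector \<kappa> \<phi> \<and> hn \<phi> ~= 0)}"
    have E: "finite E" unfolding E_def by (rule F.finite_eigenvalues_below)
    have inE: "\<nu> \<in> E" if "complex_of_real \<nu> \<in> spectrum L ?T" "\<nu> < \<mu>" for \<nu>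
      using that F.regular_below[of \<nu>] spec by (auto simp: E_def)
    obtain d where d: "d > 0" "\<forall>x\<in>complex_of_real ` E. x ~= z --> d <= dist z x"
      using finite_set_avoid[of "complex_of_real ` E" z] E by auto
    have "z isolated_in spectrum L ?T"
      unfolding isolated_in_dist_Ex_iff
    proof (intro conjI zs exI[of _ "min d (\<mu> - \<kappa>)"] ballI impI)
      show "min d (\<mu> - \<kappa>) > 0" using d \<mu> by simp
      fix y assume y: "y \<in> spectrum L ?T" "dist z y < min d (\<mu> - \<kappa>)"
      obtain \<nu> where \<nu>: "y = of_real \<nu>" using real[OF y(1)] by blast
      have "dist z y = \<bar>\<kappa> - \<nu>\<bar>" unfolding \<kappa> \<nu> dist_norm by (metis norm_of_real of_real_diff)
      then have "\<nu> < \<mu>" using y(2) by linarith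
      then show "y = z" using inE[of \<nu>] y d(2) \<nu> by force
    qed
    moreover have "is_eigenvalue L ?T z"
    proof -
      obtain \<phi> where \<phi>: "eigenvector \<kappa> \<phi>" "hn \<phi> ~= 0"
        using inE[of \<kappa>] zs \<mu>(1) \<kappa> by (auto simp: E_def)
      have "\<phi> \<in> L2 L" using \<phi>(1) T_D D_L2 by (auto simp: eigenvector_def)
      then have "\<not> (AE p in L. \<phi> p = 0)" using \<phi>(2) L2_norm_eq_0_iff[of \<phi> L] by (simp add: nrm_L2_inner)
      then show ?thesis unfolding is_eigenvalue_def \<kappa> using \<phi>(1) eigenspace_iff by blast
    qed
    moreover have "finite_multiplicity L ?T z"
    proof -
      obtain C where C: "finite C" "\<forall>x\<in>C. eigenvector \<kappa> x"
        "\<forall>\<phi>. eigenvector \<kappa> \<phi> --> (\<exists>a. hn (\<phi> - (\<Sum>x\<in>C. cscale (a x) x)) = 0)"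
        using F.finite_multiplicity_below[OF \<mu>(1)] by blast
      have ev_L2: "\<phi> \<in> L2 L" if "eigenvector \<kappa> \<phi>" for \<phi> using that T_D D_L2 by (auto simp: eigenvector_def)
      have "\<exists>c. AE p in L. \<phi> p = (\<Sum>b\<in>C. c b * b p)" if \<phi>: "eigenvector \<kappa> \<phi>" for \<phi>
      proof -
        obtain a where a: "hn (\<phi> - (\<Sum>x\<in>C. cscale (a x) x)) = 0" using C(3) \<phi> by blast
        have "(\<Sum>x\<in>C. cscale (a x) x) \<in> L2 L" using C(2) ev_L2 by (intro L2.V_sum) auto
        then have "AE p in L. \<phi> p = (\<Sum>x\<in>C. cscale (a x) x) p" using nrm_eq_0_iff_AE[OF ev_L2[OF \<phi>]] a by blast
        moreover have "(\<Sum>x\<in>C. cscale (a x) x) p = (\<Sum>b\<in>C. a b * b p)" for p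
          using C(1) by (induction C rule: finite_induct) auto
        ultimately show ?thesis by auto
      qed
      then show ?thesis unfolding finite_multiplicity_def \<kappa> using C(1,2)
        by (intro exI[of _ C]) (auto simp: eigenspace_iff)
    qed
    ultimately show False using zd by (simp add: discrete_spectrum_def)
  qed
  then show "z \<in> of_real ` {\<Lambda>..}" using \<kappa> by simp
qed

text \<open>A point of a half-line in the spectrum is not isolated, hence not in the discrete spectrum.\<close>

lemma essential_spectrum_superset:
  assumes "!!\<kappa>. \<kappa> \<ge> \<Lambda> ==> \<not> regular (of_real \<kappa>)"
  shows "of_real ` {\<Lambda>..} \<subseteq> essential_spectrum L (magnetic_laplacian \<Omega> A)"
proof
  let ?S = "spectrum L (magnetic_laplacian \<Omega> A)"
  have spec: "complex_of_real \<kappa> \<in> ?S" if "\<kappa> \<ge> \<Lambda>" for \<kappa>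
    using assms[OF that] by (simp add: spectrum_def regular_iff)
  fix z :: complex assume "z \<in> of_real ` {\<Lambda>..}"
  then obtain \<kappa> where \<kappa>: "\<kappa> \<ge> \<Lambda>" "z = of_real \<kappa>" by auto
  have "\<not> z isolated_in ?S"
  proof
    assume "z isolated_in ?S"
    then obtain e where e: "e > 0" "\<forall>y\<in>?S. dist z y < e --> y = z" by (auto simp: isolated_in_dist_Ex_iff)
    have "dist z (of_real (\<kappa> + e / 2)) < e" using e(1) by (simp add: \<kappa>(2) dist_norm)
    then show False using e spec[of "\<kappa> + e / 2"] \<kappa> by auto
  qed
  then show "z \<in> essential_spectrum L (magnetic_laplacian \<Omega> A)"
    using spec \<kappa> by (auto simp: essential_spectrum_def discrete_spectrum_def)
qed

subsection \<open>Reduction to test functions\<close>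

definition classical_mp :: "'a => ('a => complex) => 'a => complex" where
  "classical_mp e \<phi> p = \<i> * partial_deriv e \<phi> p + of_real (A p \<bullet> e) * \<phi> p"

lemma classical_mp:
  assumes "C_k 1 \<phi>" "supported_in \<Omega> \<phi>" "e \<in> Basis"
  shows "AE p in L. mp e \<phi> p = classical_mp e \<phi> p" "classical_mp e \<phi> \<in> L2 L"
proof -
  show "AE p in L. mp e \<phi> p = classical_mp e \<phi> p"
    using C1_supported_H1_0(2)[OF \<Omega> assms] by (rule AE_mp) (auto intro!: AE_I2 simp: mp_eq classical_mp_def)
  show "classical_mp e \<phi> \<in> L2 L" unfolding classical_mp_def[abs_def]
    by (intro L2_add L2_cmult A_mult_L2 C1_supported_L2[OF \<Omega>] assms)
qed

lemma form_classical:
  assumes "C_k 1 \<phi>" "supported_in \<Omega> \<phi>" "C_k 1 \<psi>" "supported_in \<Omega> \<psi>"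
  shows "magnetic_form \<Omega> A \<phi> \<psi> = (\<Sum>e\<in>Basis. L2_inner L (classical_mp e \<phi>) (classical_mp e \<psi>))"
proof -
  have H: "\<phi> \<in> H1_0 \<Omega>" "\<psi> \<in> H1_0 \<Omega>" using assms C1_supported_H1_0(1)[OF \<Omega>] by auto
  show ?thesis unfolding form_eq[OF H]
    by (intro sum.cong refl L2_inner_cong_AE classical_mp mp_L2 H assms)
qed

lemma test_dense:
  assumes \<phi>: "\<phi> \<in> H1_0 \<Omega>"
  obtains \<psi> where "!!n::nat. \<psi> n \<in> test_functions \<Omega>" "(\<lambda>n. D.nrm (\<psi> n - \<phi>)) \<longlonglongrightarrow> 0" "(\<lambda>n. hn (\<psi> n - \<phi>)) \<longlonglongrightarrow> 0"
proof -
  obtain \<psi> where \<psi>: "!!n::nat. \<psi> n \<in> test_functions \<Omega>"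
    "(\<lambda>n. L2_norm L (\<lambda>p. \<psi> n p - \<phi> p)) \<longlonglongrightarrow> 0"
    "!!e. e \<in> Basis ==> (\<lambda>n. L2_norm L (\<lambda>p. partial_deriv e (\<psi> n) p - wp e \<phi> p)) \<longlonglongrightarrow> 0"
    by (rule H1_0D[OF \<Omega> \<phi>]) blast
  have eq: "L2_norm L (\<lambda>p. wp e (\<psi> n) p - wp e \<phi> p) = L2_norm L (\<lambda>p. partial_deriv e (\<psi> n) p - wp e \<phi> p)" if e: "e \<in> Basis" for e n
  proof (rule L2_norm_cong_AE)
    show "AE p in L. wp e (\<psi> n) p - wp e \<phi> p = partial_deriv e (\<psi> n) p - wp e \<phi> p"
      using C1_supported_H1_0(2)[OF \<Omega> test_functionsD(2)[OF \<psi>(1)] test_functionsD(3)[OF \<psi>(1)] e]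
      by (rule AE_mp) (auto intro!: AE_I2)
  qed (intro L2_measurable L2_diff wp_L2 test_partial_L2[OF \<Omega>] test_H1_0[OF \<Omega>] \<psi>(1) \<phi> e)+
  show ?thesis
  proof (rule that[OF \<psi>(1)])
    show "(\<lambda>n. D.nrm (\<psi> n - \<phi>)) \<longlonglongrightarrow> 0"
      by (intro D_tendsto test_H1_0[OF \<Omega>] \<psi>(1,2) \<phi>) (simp add: eq \<psi>(3))
    show "(\<lambda>n. hn (\<psi> n - \<phi>)) \<longlonglongrightarrow> 0" using \<psi>(2) by (simp add: nrm_L2_inner fun_diff_def)
  qed
qed

text \<open>Both sides are continuous in the form norm, in which test functions are dense.\<close>

lemma finite_rank_bound_of_test:
  assumes b: "!!j. j \<in> J ==> b j \<in> L2 L"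
    and test: "!!\<psi>. \<psi> \<in> test_functions \<Omega> ==>
      \<mu> * (L2_norm L \<psi>)\<^sup>2 <= (\<Sum>e\<in>Basis. (L2_norm L (classical_mp e \<psi>))\<^sup>2) + (\<Sum>j\<in>J. (cmod (L2_inner L \<psi> (b j)))\<^sup>2)"
    and x: "x \<in> H1_0 \<Omega>"
  shows "\<mu> * (L2_norm L x)\<^sup>2 <= Re (magnetic_form \<Omega> A x x) + (\<Sum>j\<in>J. (cmod (L2_inner L x (b j)))\<^sup>2)"
proof -
  obtain \<psi> where \<psi>: "!!n::nat. \<psi> n \<in> test_functions \<Omega>" "(\<lambda>n. D.nrm (\<psi> n - x)) \<longlonglongrightarrow> 0" "(\<lambda>n. hn (\<psi> n - x)) \<longlonglongrightarrow> 0"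
    by (rule test_dense[OF x]) blast
  have H: "\<psi> n \<in> H1_0 \<Omega>" for n by (rule test_H1_0[OF \<Omega> \<psi>(1)])
  have form: "Re (magnetic_form \<Omega> A y y) = (D.nrm y)\<^sup>2 - shift * (hn y)\<^sup>2" if "y \<in> H1_0 \<Omega>" for y
    by (simp add: D.nrm_sq mform_def L2.nrm_sq)
  have "\<mu> * (hn (\<psi> n))\<^sup>2 <= (D.nrm (\<psi> n))\<^sup>2 - shift * (hn (\<psi> n))\<^sup>2 + (\<Sum>j\<in>J. (cmod (L2_inner L (\<psi> n) (b j)))\<^sup>2)" for n
  proof -
    have "Re (magnetic_form \<Omega> A (\<psi> n) (\<psi> n)) = (\<Sum>e\<in>Basis. (L2_norm L (classical_mp e (\<psi> n)))\<^sup>2)"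
      using test_functionsD[OF \<psi>(1)] by (simp add: form_classical L2_inner_self L2_norm_sq)
    then show ?thesis using test[OF \<psi>(1)] form[OF H] by (simp add: nrm_L2_inner)
  qed
  moreover have "(\<lambda>n. \<mu> * (hn (\<psi> n))\<^sup>2) \<longlonglongrightarrow> \<mu> * (hn x)\<^sup>2"
    by (intro tendsto_intros L2.tendsto_nrm \<psi>(3) D_L2 H x)
  moreover have "(\<lambda>n. (D.nrm (\<psi> n))\<^sup>2 - shift * (hn (\<psi> n))\<^sup>2 + (\<Sum>j\<in>J. (cmod (L2_inner L (\<psi> n) (b j)))\<^sup>2))
      \<longlonglongrightarrow> (D.nrm x)\<^sup>2 - shift * (hn x)\<^sup>2 + (\<Sum>j\<in>J. (cmod (L2_inner L x (b j)))\<^sup>2)"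
    by (intro tendsto_intros L2.tendsto_nrm D.tendsto_nrm L2.tendsto_ip \<psi>(2,3) D_L2 H x b)
  ultimately have "\<mu> * (hn x)\<^sup>2 <= (D.nrm x)\<^sup>2 - shift * (hn x)\<^sup>2 + (\<Sum>j\<in>J. (cmod (L2_inner L x (b j)))\<^sup>2)"
    by (intro LIMSEQ_le[of "\<lambda>n. \<mu> * (hn (\<psi> n))\<^sup>2"]) auto
  then show ?thesis using form[OF x] by (simp add: nrm_L2_inner)
qed

text \<open>For functions of class \<open>C\<^sup>1\<close> the weak derivatives in Weyl's criterion are classical ones.\<close>

lemma not_regular_of_test:
  assumes approx: "!!\<epsilon>. \<epsilon> > 0 ==> \<exists>\<phi>. C_k 1 \<phi> \<and> supported_in \<Omega> \<phi> \<and> L2_norm L \<phi> > 0 \<and>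
    (\<forall>\<psi>\<in>test_functions \<Omega>. cmod ((\<Sum>e\<in>Basis. L2_inner L (classical_mp e \<phi>) (classical_mp e \<psi>)) - of_real \<kappa> * L2_inner L \<phi> \<psi>)
      <= \<epsilon> * L2_norm L \<phi> * (L2_norm L \<psi> + (\<Sum>e\<in>Basis. L2_norm L (partial_deriv e \<psi>))))"
  shows "\<not> regular (of_real \<kappa>)"
proof (rule not_regularI)
  fix \<epsilon> :: real assume \<epsilon>: "\<epsilon> > 0"
  define K where "K = 1 + 2 * real DIM('a)"
  have K: "K > 0" by (simp add: K_def add_pos_nonneg)
  obtain \<phi> where \<phi>: "C_k 1 \<phi>" "supported_in \<Omega> \<phi>" "L2_norm L \<phi> > 0"
    and test: "!!\<psi>. \<psi> \<in> test_functions \<Omega> ==> cmod ((\<Sum>e\<in>Basis. L2_inner L (classical_mp e \<phi>) (classical_mp e \<psi>)) - of_real \<kappa> * L2_inner L \<phi> \<psi>)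
      <= \<epsilon> / K * L2_norm L \<phi> * (L2_norm L \<psi> + (\<Sum>e\<in>Basis. L2_norm L (partial_deriv e \<psi>)))"
    using approx[of "\<epsilon> / K"] \<epsilon> K by auto
  have \<phi>H: "\<phi> \<in> H1_0 \<Omega>" by (rule C1_supported_H1_0(1)[OF \<Omega> \<phi>(1,2)])
  have bound: "cmod (mform \<phi> \<psi> - of_real (shift + \<kappa>) * L2_inner L \<phi> \<psi>) <= \<epsilon> * L2_norm L \<phi> * D.nrm \<psi>"
    if \<psi>: "\<psi> \<in> test_functions \<Omega>" for \<psi>
  proof -
    note H = test_H1_0[OF \<Omega> \<psi>]
    have "L2_norm L (partial_deriv e \<psi>) = L2_norm L (wp e \<psi>)" if "e \<in> Basis" for e
      using C1_supported_H1_0(2)[OF \<Omega> test_functionsD(2,3)[OF \<psi>] that]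
      by (intro L2_norm_cong_AE[symmetric] L2_measurable wp_L2 H test_partial_L2[OF \<Omega> \<psi>] that)
    then have "(\<Sum>e\<in>Basis. L2_norm L (partial_deriv e \<psi>)) <= (\<Sum>e\<in>(Basis::'a set). 2 * D.nrm \<psi>)"
      by (intro sum_mono) (simp add: wp_le_D H)
    then have "L2_norm L \<psi> + (\<Sum>e\<in>Basis. L2_norm L (partial_deriv e \<psi>)) <= K * D.nrm \<psi>"
      using L2_le_D[OF H] by (simp add: K_def algebra_simps)
    then have "\<epsilon> / K * L2_norm L \<phi> * (L2_norm L \<psi> + (\<Sum>e\<in>Basis. L2_norm L (partial_deriv e \<psi>)))
      <= \<epsilon> / K * L2_norm L \<phi> * (K * D.nrm \<psi>)"
      using \<epsilon> K by (intro mult_left_mono) auto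
    also have "... = \<epsilon> * L2_norm L \<phi> * D.nrm \<psi>" using K by simp
    finally show ?thesis
      using test[OF \<psi>] form_classical[OF \<phi>(1,2) test_functionsD(2,3)[OF \<psi>]]
      by (simp add: mform_def algebra_simps)
  qed
  show "\<exists>\<phi>\<in>H1_0 \<Omega>. hn \<phi> > 0 \<and>
    (\<forall>\<psi>\<in>H1_0 \<Omega>. cmod (magnetic_form \<Omega> A \<phi> \<psi> - of_real \<kappa> * L2_inner L \<phi> \<psi>) <= \<epsilon> * hn \<phi> * D.nrm \<psi>)"
  proof (intro bexI[OF _ \<phi>H] conjI ballI)
    show "hn \<phi> > 0" using \<phi>(3) by (simp add: nrm_L2_inner)
    fix x assume x: "x \<in> H1_0 \<Omega>"
    obtain \<psi> where \<psi>: "!!n::nat. \<psi> n \<in> test_functions \<Omega>" "(\<lambda>n. D.nrm (\<psi> n - x)) \<longlonglongrightarrow> 0" "(\<lambda>n. hn (\<psi> n - x)) \<longlonglongrightarrow> 0"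
      by (rule test_dense[OF x]) blast
    have H: "\<psi> n \<in> H1_0 \<Omega>" for n by (rule test_H1_0[OF \<Omega> \<psi>(1)])
    have c: "mform \<phi> y = cnj (mform y \<phi>)" "L2_inner L \<phi> y = cnj (L2_inner L y \<phi>)" if "y \<in> H1_0 \<Omega>" for y
      using D.ip_commute[OF \<phi>H that] L2.ip_commute[OF D_L2[OF \<phi>H] D_L2[OF that]] .
    have "(\<lambda>n. cmod (mform \<phi> (\<psi> n) - of_real (shift + \<kappa>) * L2_inner L \<phi> (\<psi> n)))
        \<longlonglongrightarrow> cmod (mform \<phi> x - of_real (shift + \<kappa>) * L2_inner L \<phi> x)"
      unfolding c[OF H] c[OF x]
      by (intro tendsto_intros D.tendsto_ip L2.tendsto_ip \<psi>(2,3) D_L2 H x \<phi>H)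
    moreover have "(\<lambda>n. \<epsilon> * L2_norm L \<phi> * D.nrm (\<psi> n)) \<longlonglongrightarrow> \<epsilon> * L2_norm L \<phi> * D.nrm x"
      by (intro tendsto_intros D.tendsto_nrm \<psi>(2) H x)
    ultimately have "cmod (mform \<phi> x - of_real (shift + \<kappa>) * L2_inner L \<phi> x) <= \<epsilon> * L2_norm L \<phi> * D.nrm x"
      by (rule LIMSEQ_le) (use bound[OF \<psi>(1)] in blast)
    then show "cmod (magnetic_form \<Omega> A \<phi> x - of_real \<kappa> * L2_inner L \<phi> x) <= \<epsilon> * hn \<phi> * D.nrm x"
      by (simp add: mform_def nrm_L2_inner algebra_simps)
  qed
qed

end

section \<open>Change of variables in the plane\<close>

abbreviation D1 :: "(real \<times> real => 'b::real_normed_vector) => real \<times> real => 'b" where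
  "D1 \<equiv> partial_deriv (1, 0)"

abbreviation D2 :: "(real \<times> real => 'b::real_normed_vector) => real \<times> real => 'b" where
  "D2 \<equiv> partial_deriv (0, 1)"

lemma Basis_plane: "(Basis :: (real \<times> real) set) = {(1, 0), (0, 1)}"
  by (auto simp: Basis_prod_def)

lemma sum_Basis_plane: "(\<Sum>e\<in>(Basis :: (real \<times> real) set). f e) = f (1, 0) + f (0, 1)"
  by (simp add: Basis_plane)

definition to_vec :: "real \<times> real => real^2" where
  "to_vec p = (\<chi> i. if i = 1 then fst p else snd p)"

definition from_vec :: "real^2 => real \<times> real" where
  "from_vec v = (v $ 1, v $ 2)"

lemma from_to_vec [simp]: "from_vec (to_vec p) = p"
  by (simp add: from_vec_def to_vec_def)

lemma to_from_vec [simp]: "to_vec (from_vec v) = v"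
  by (simp add: from_vec_def to_vec_def vec_eq_iff forall_2)

lemma linear_vec: "linear to_vec" "linear from_vec"
  by (auto intro!: linearI simp: to_vec_def from_vec_def vec_eq_iff)

lemma bounded_linear_vec: "bounded_linear to_vec" "bounded_linear from_vec"
  using linear_vec linear_conv_bounded_linear by blast+

lemma measurable_vec [measurable]: "to_vec \<in> borel_measurable borel" "from_vec \<in> borel_measurable borel"
  by (intro borel_measurable_continuous_onI linear_continuous_on bounded_linear_vec)+

lemma emeasure_lborel_box_plane:
  "emeasure lborel (box (a::real \<times> real) b) = (if fst a <= fst b \<and> snd a <= snd b then ennreal ((fst b - fst a) * (snd b - snd a)) else 0)"
  by (auto simp: emeasure_lborel_box_eq Basis_plane inner_prod_def)

lemma lborel_to_vec: "lborel = distr lborel borel to_vec"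
proof (rule lborel_eqI)
  fix l u :: "real^2" assume le: "!!b. b \<in> Basis ==> l \<bullet> b <= u \<bullet> b"
  have le': "l $ 1 <= u $ 1" "l $ 2 <= u $ 2"
    using le[of "axis 1 1"] le[of "axis 2 1"] by (auto simp: inner_axis)
  have "to_vec -` box l u = box (from_vec l) (from_vec u)"
    by (auto simp: mem_box Basis_plane to_vec_def from_vec_def inner_prod_def Basis_vec_def inner_axis forall_2)
  then have "emeasure (distr lborel borel to_vec) (box l u) = emeasure lborel (box (from_vec l) (from_vec u))"
    by (subst emeasure_distr) auto
  also have "... = ennreal ((u $ 1 - l $ 1) * (u $ 2 - l $ 2))"
    unfolding emeasure_lborel_box_plane using le' by (simp add: from_vec_def)
  also have "(u $ 1 - l $ 1) * (u $ 2 - l $ 2) = (\<Prod>b\<in>Basis. (u - l) \<bullet> b)"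
  proof -
    have B: "(Basis :: (real^2) set) = {axis 1 1, axis 2 1}" by (auto simp: Basis_vec_def UNIV_2)
    have ne: "axis 1 (1::real) ~= (axis 2 1 :: real^2)" by (simp add: axis_eq_axis)
    show ?thesis by (subst B, subst prod.insert) (use ne in \<open>simp_all add: inner_axis\<close>)
  qed
  finally show "emeasure (distr lborel borel to_vec) (box l u) = ennreal (\<Prod>b\<in>Basis. (u - l) \<bullet> b)" .
qed simp

lemma emeasure_image_plane:
  fixes F :: "real \<times> real => real \<times> real"
  assumes X: "X \<in> sets borel" and FX: "F ` X \<in> sets borel" and inj: "inj_on F X"
    and der: "!!p. p \<in> X ==> (F has_derivative F' p) (at p)"
    and J: "!!p. p \<in> X ==> J p = \<bar>fst (F' p (1, 0)) * snd (F' p (0, 1)) - fst (F' p (0, 1)) * snd (F' p (1, 0))\<bar>"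
    and int: "integrable lborel (\<lambda>p. indicator X p * J p)"
  shows "emeasure lborel (F ` X) = (\<integral>\<^sup>+p. ennreal (indicator X p * J p) \<partial>lborel)"
proof -
  define f where "f = to_vec \<circ> F \<circ> from_vec"
  define f' where "f' v = to_vec \<circ> F' (from_vec v) \<circ> from_vec" for v
  let ?X = "from_vec -` X"
  have Xv: "?X \<in> sets borel" using measurable_sets[OF measurable_vec(2) X] by simp
  have derf: "(f has_derivative f' v) (at v within ?X)" if "v \<in> ?X" for v
  proof -
    have "(F has_derivative F' (from_vec v)) (at (from_vec v))" using der that by simp
    then have "(f has_derivative f' v) (at v)" unfolding f_def f'_def
      by (intro diff_chain_at bounded_linear_imp_has_derivative bounded_linear_vec) simp
    then show ?thesis by (rule has_derivative_at_withinI)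
  qed
  have injf: "inj_on f ?X"
  proof (rule inj_onI)
    fix v w assume "v \<in> ?X" "w \<in> ?X" "f v = f w"
    then have "F (from_vec v) = F (from_vec w)" unfolding f_def by (metis comp_apply from_to_vec)
    then have "from_vec v = from_vec w" using inj \<open>v \<in> ?X\<close> \<open>w \<in> ?X\<close> by (auto dest: inj_onD)
    then show "v = w" by (metis to_from_vec)
  qed
  have det: "\<bar>det (matrix (f' v))\<bar> = J (from_vec v)" if "v \<in> ?X" for v
  proof -
    have ax: "from_vec (axis 1 1) = (1, 0)" "from_vec (axis 2 1) = (0, 1)"
      by (auto simp: from_vec_def axis_def)
    show ?thesis using J that by (simp add: det_2 matrix_def f'_def ax to_vec_def mult.commute)
  qed
  have img: "f ` ?X = from_vec -` (F ` X)"
  proof (intro set_eqI iffI)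
    fix w assume "w \<in> from_vec -` (F ` X)"
    then obtain p where "p \<in> X" "from_vec w = F p" by auto
    then have "w = f (to_vec p)" "to_vec p \<in> ?X" unfolding f_def by (auto, metis to_from_vec)
    then show "w \<in> f ` ?X" by blast
  qed (auto simp: f_def)
  have J0: "0 <= indicator X p * J p" for p using J by (simp add: indicator_def)
  have intv: "integrable lborel (\<lambda>v. indicator X (from_vec v) * J (from_vec v))"
    unfolding lborel_to_vec using int by (subst integrable_distr_eq)
      (auto intro!: measurable_compose[OF measurable_vec(2) borel_measurable_integrable[OF int, simplified]])
  define m where "m = (\<integral>v. indicator X (from_vec v) * J (from_vec v) \<partial>lborel)"
  have m: "m = (\<integral>p. indicator X p * J p \<partial>lborel)"
    unfolding m_def lborel_to_vec by (subst integral_distr)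
      (auto intro!: measurable_compose[OF measurable_vec(2) borel_measurable_integrable[OF int, simplified]])
  have "((\<lambda>v. indicator X (from_vec v) * J (from_vec v)) has_integral m) UNIV"
    unfolding m_def by (rule has_integral_integral_lborel[OF intv])
  also have "(\<lambda>v. indicator X (from_vec v) * J (from_vec v)) = (\<lambda>v. if v \<in> ?X then \<bar>det (matrix (f' v))\<bar> else 0)"
    using det by (auto simp: fun_eq_iff)
  finally have "((\<lambda>v. \<bar>det (matrix (f' v))\<bar>) has_integral m) ?X"
    unfolding has_integral_restrict_UNIV .
  then have lm: "f ` ?X \<in> lmeasurable" "measure lebesgue (f ` ?X) = m"
    using has_measure_differentiable_image[of ?X f f' m] Xv derf injf by auto
  have "emeasure lborel (F ` X) = emeasure lborel (from_vec -` (F ` X))"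
  proof -
    have "from_vec -` (F ` X) \<in> sets borel" using measurable_sets[OF measurable_vec(2) FX] by simp
    then have "emeasure lborel (from_vec -` (F ` X)) = emeasure lborel (to_vec -` (from_vec -` (F ` X)))"
      by (subst lborel_to_vec) (simp add: emeasure_distr)
    also have "to_vec -` (from_vec -` (F ` X)) = F ` X" by auto
    finally show ?thesis ..
  qed
  also have "... = emeasure lebesgue (f ` ?X)"
    unfolding img using measurable_sets[OF measurable_vec(2) FX] by (simp add: emeasure_completion)
  also have "... = ennreal m" using emeasure_eq_measure2[OF lm(1)] lm(2) by simp
  also have "... = (\<integral>\<^sup>+p. ennreal (indicator X p * J p) \<partial>lborel)"
    unfolding m by (rule nn_integral_eq_integral[symmetric, OF int]) (simp add: J0)
  finally show ?thesis .
qed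

text \<open>The change of variables formula, as an identity between measures.\<close>

lemma lborel_on_image_eq_distr:
  fixes F :: "real \<times> real => real \<times> real"
  assumes S: "open S" and hom: "homeomorphism S \<Omega> F G" and \<Omega>: "open \<Omega>"
    and der: "!!p. p \<in> S ==> (F has_derivative F' p) (at p)"
    and J: "!!p. p \<in> S ==> J p = \<bar>fst (F' p (1, 0)) * snd (F' p (0, 1)) - fst (F' p (0, 1)) * snd (F' p (1, 0))\<bar>"
    and Jm: "J \<in> borel_measurable borel" and Jb: "!!p. p \<in> S ==> J p <= C"
  shows "lborel_on \<Omega> = distr (density (lborel_on S) (\<lambda>p. ennreal (J p))) (lborel_on \<Omega>) F" (is "_ = ?D")
proof (rule measure_eqI)
  have SB: "S \<in> sets borel" and \<Omega>B: "\<Omega> \<in> sets borel" using S \<Omega> by auto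
  have FS: "F ` S = \<Omega>" and GF: "!!p. p \<in> S ==> G (F p) = p" and FG: "!!q. q \<in> \<Omega> ==> F (G q) = q"
    and G\<Omega>: "!!q. q \<in> \<Omega> ==> G q \<in> S" and F\<Omega>: "!!p. p \<in> S ==> F p \<in> \<Omega>"
    and Fc: "continuous_on S F" and Gc: "continuous_on \<Omega> G"
    using hom unfolding homeomorphism_def by (auto dest: spec)
  have Fm: "F \<in> measurable (lborel_on S) (lborel_on \<Omega>)"
  proof (rule measurable_restrict_space2)
    show "F \<in> space (lborel_on S) \<rightarrow> \<Omega>" using F\<Omega> by (auto simp: space_restrict_space)
    have "F \<in> borel_measurable (restrict_space borel S)" by (rule borel_measurable_continuous_on_restrict[OF Fc])
    then show "F \<in> measurable (lborel_on S) lborel"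
      using measurable_cong_sets[OF sets_restrict_space_cong[OF sets_lborel, of S] sets_lborel] by auto
  qed
  show "sets (lborel_on \<Omega>) = sets ?D" by simp
  have J0: "0 <= J p" if "p \<in> S" for p using J[OF that] by simp
  have piece: "emeasure (lborel_on \<Omega>) (F ` X) = emeasure ?D (F ` X)"
    if X: "X \<in> sets borel" "X \<subseteq> S" "bounded X" for X
  proof -
    have "F ` X = \<Omega> \<inter> G -` X" using X(2) GF FG F\<Omega> G\<Omega> by (force simp: image_iff)
    moreover have "G -` X \<inter> \<Omega> \<in> sets borel"
      using measurable_sets[OF borel_measurable_continuous_on_restrict[OF Gc] X(1)] \<Omega>B
      by (auto simp: space_restrict_space sets_restrict_space_iff Int_commute)
    ultimately have FXB: "F ` X \<in> sets borel" by (simp add: Int_commute)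
    have F\<Omega>X: "F ` X \<subseteq> \<Omega>" using X(2) F\<Omega> by auto
    have int: "integrable lborel (\<lambda>p. indicator X p * J p)"
    proof (rule Bochner_Integration.integrable_bound)
      show "integrable lborel (\<lambda>p. indicator X p * C)"
        using X(1) emeasure_bounded_finite[OF X(3)] by simp
      show "(\<lambda>p. indicator X p * J p) \<in> borel_measurable lborel" using X(1) Jm by simp
      show "AE p in lborel. norm (indicator X p * J p) <= norm (indicator X p * C)"
      proof (rule AE_I2)
        fix p
        show "norm (indicator X p * J p) <= norm (indicator X p * C)"
          using J0[of p] Jb[of p] X(2) by (cases "p \<in> X") auto
      qed
    qed
    have "emeasure (lborel_on \<Omega>) (F ` X) = emeasure lborel (F ` X)"
      using \<Omega>B F\<Omega>X by (subst emeasure_restrict_space) auto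
    also have "... = (\<integral>\<^sup>+p. ennreal (indicator X p * J p) \<partial>lborel)"
    proof (rule emeasure_image_plane[OF X(1) FXB _ _ _ int, of F'])
      show "inj_on F X" using X(2) GF by (intro inj_on_inverseI[of X G]) auto
    qed (use X(2) in \<open>auto simp: subset_iff intro!: der J\<close>)
    also have "... = (\<integral>\<^sup>+p. ennreal (J p) * indicator X p \<partial>lborel_on S)"
      using X(2) SB by (subst nn_integral_restrict_space) (auto intro!: nn_integral_cong simp: indicator_def)
    also have "... = emeasure (density (lborel_on S) (\<lambda>p. ennreal (J p))) X"
      using Jm X SB by (subst emeasure_density) (auto simp: sets_restrict_space_iff intro!: measurable_restrict_space1)
    also have "... = emeasure ?D (F ` X)"
    proof -
      have "F -` (F ` X) \<inter> space (density (lborel_on S) (\<lambda>p. ennreal (J p))) = X"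
        using X(2) GF by (auto simp: space_restrict_space) (metis subsetD)
      then show ?thesis using Fm FXB F\<Omega>X \<Omega>B by (subst emeasure_distr) (auto simp: sets_restrict_space_iff)
    qed
    finally show ?thesis .
  qed
  fix B assume "B \<in> sets (lborel_on \<Omega>)"
  then have B: "B \<in> sets borel" "B \<subseteq> \<Omega>" using \<Omega>B by (auto simp: sets_restrict_space_iff)
  define X where "X n = (S \<inter> F -` B) \<inter> ball 0 (real n)" for n :: nat
  have SFB: "S \<inter> F -` B \<in> sets borel"
    using measurable_sets[OF borel_measurable_continuous_on_restrict[OF Fc] B(1)] SB
    by (auto simp: space_restrict_space sets_restrict_space_iff Int_commute)
  have XB: "X n \<in> sets borel" for n unfolding X_def using SFB by simp
  have FX: "F ` X n \<in> sets (lborel_on \<Omega>)" for n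
  proof -
    have "F ` X n = \<Omega> \<inter> G -` X n" using GF FG F\<Omega> G\<Omega> by (force simp: image_iff X_def)
    then show ?thesis
      using measurable_sets[OF borel_measurable_continuous_on_restrict[OF Gc] XB[of n]] \<Omega>B
      by (auto simp: space_restrict_space sets_restrict_space_iff Int_commute)
  qed
  have U: "(\<Union>n. F ` X n) = B"
  proof
    show "B \<subseteq> (\<Union>n. F ` X n)"
    proof
      fix q assume q: "q \<in> B"
      obtain n where "norm (G q) < real n" using reals_Archimedean2 by blast
      moreover have q': "q \<in> \<Omega>" using q B(2) by blast
      ultimately have "F (G q) \<in> F ` X n" using q G\<Omega>[OF q'] FG[OF q'] by (intro imageI) (simp add: X_def)
      then show "q \<in> (\<Union>n. F ` X n)" unfolding FG[OF q'] by blast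
    qed
  qed (auto simp: X_def)
  have inc: "incseq (\<lambda>n. F ` X n)" by (intro incseq_SucI image_mono) (auto simp: X_def)
  have rng: "range (\<lambda>n. F ` X n) \<subseteq> sets (lborel_on \<Omega>)" "range (\<lambda>n. F ` X n) \<subseteq> sets ?D" using FX by auto
  have "emeasure (lborel_on \<Omega>) B = (SUP n. emeasure (lborel_on \<Omega>) (F ` X n))"
    using SUP_emeasure_incseq[OF rng(1) inc] U by simp
  also have "... = (SUP n. emeasure ?D (F ` X n))"
    by (intro SUP_cong refl piece XB) (auto simp: X_def intro: bounded_subset[OF bounded_ball])
  also have "... = emeasure ?D B"
    using SUP_emeasure_incseq[OF rng(2) inc] U by simp
  finally show "emeasure (lborel_on \<Omega>) B = emeasure ?D B" .
qed

text \<open>Compactly supported \<open>C\<^sup>1\<close> functions can be transported along a \<open>C\<^sup>1\<close> homeomorphism of open sets.\<close>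

lemma C1_pullback:
  fixes f :: "'a::euclidean_space => 'b::euclidean_space" and v :: "'b => complex"
  assumes U: "open U" and hom: "homeomorphism U V f g"
    and der: "!!x. x \<in> U ==> (f has_derivative f' x) (at x)"
    and cont: "!!e. e \<in> Basis ==> continuous_on U (\<lambda>x. f' x e)"
    and v: "C_k 1 v" "supported_in V v"
  defines "w \<equiv> (\<lambda>x. if x \<in> U then v (f x) else 0)"
  shows "C_k 1 w" "supported_in U w"
    and "x \<in> U ==> partial_deriv e w x = (\<Sum>i\<in>Basis. (f' x e \<bullet> i) *\<^sub>R partial_deriv i v (f x))"
proof -
  obtain K where K: "compact K" "K \<subseteq> V" "!!y. y \<notin> K ==> v y = 0" using v(2) unfolding supported_in_def by blast
  have gf: "!!x. x \<in> U ==> g (f x) = x" and gV: "g ` V = U" and fU: "f ` U = V" and cg: "continuous_on V g" and cf: "continuous_on U f"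
    using hom unfolding homeomorphism_def by auto
  have gK: "compact (g ` K)" using compact_continuous_image[OF continuous_on_subset[OF cg K(2)] K(1)] .
  have gKU: "g ` K \<subseteq> U" using K(2) gV by auto
  have out: "w x = 0" if "x \<notin> g ` K" for x
  proof (cases "x \<in> U")
    case True
    then have "f x \<notin> K" using that gf by (metis image_eqI)
    then show ?thesis using K(3) by (simp add: w_def)
  qed (simp add: w_def)
  show "supported_in U w" unfolding supported_in_def using gK gKU out by blast
  have vd: "(v has_derivative frechet_derivative v (at y)) (at y)" for y
    using v(1) by (simp add: C1_iff frechet_derivative_works)
  have dU: "(w has_derivative (\<lambda>h. frechet_derivative v (at (f x)) (f' x h))) (at x)" if "x \<in> U" for x
  proof (rule has_derivative_transform_within_open[OF _ U that])
    show "((\<lambda>x. v (f x)) has_derivative (\<lambda>h. frechet_derivative v (at (f x)) (f' x h))) (at x)"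
      by (rule has_derivative_compose[OF der[OF that] vd])
  qed (simp add: w_def)
  have d0: "(w has_derivative (\<lambda>h. 0)) (at x)" if "x \<notin> g ` K" for x
    by (rule has_derivative_transform_within_open[of "\<lambda>_. 0" _ _ _ "- g ` K"])
       (use that out compact_imp_closed[OF gK] in auto)
  have expand: "frechet_derivative v (at y) h = (\<Sum>i\<in>Basis. (h \<bullet> i) *\<^sub>R partial_deriv i v y)" for y h
  proof -
    have lin: "linear (frechet_derivative v (at y))" using vd has_derivative_linear by blast
    have "frechet_derivative v (at y) h = frechet_derivative v (at y) (\<Sum>i\<in>Basis. (h \<bullet> i) *\<^sub>R i)"
      by (simp add: euclidean_representation)
    also have "... = (\<Sum>i\<in>Basis. (h \<bullet> i) *\<^sub>R frechet_derivative v (at y) i)"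
      by (simp add: linear_sum[OF lin] linear_scale[OF lin])
    finally show ?thesis by (simp add: partial_deriv_def)
  qed
  show pd: "partial_deriv e w x = (\<Sum>i\<in>Basis. (f' x e \<bullet> i) *\<^sub>R partial_deriv i v (f x))" if "x \<in> U" for e x
    by (simp add: partial_deriv_eq[OF dU[OF that]] expand)
  have diff: "w differentiable (at x)" for x
    using dU[of x] d0[of x] gKU by (cases "x \<in> U") (auto simp: differentiable_def)
  have "continuous_on UNIV (partial_deriv e w)" if e: "e \<in> Basis" for e
  proof -
    have "continuous_on U (\<lambda>x. \<Sum>i\<in>Basis. (f' x e \<bullet> i) *\<^sub>R partial_deriv i v (f x))"
    proof (intro continuous_intros cont e)
      fix i :: 'b assume "i \<in> Basis"
      then show "continuous_on U (\<lambda>x. partial_deriv i v (f x))"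
        using v(1) by (intro continuous_on_compose2[OF _ cf]) (auto simp: C1_iff)
    qed
    then have 1: "continuous_on U (partial_deriv e w)" by (rule continuous_on_eq) (simp add: pd)
    have 2: "continuous_on (- g ` K) (partial_deriv e w)"
      by (rule continuous_on_eq[of _ "\<lambda>_. 0"]) (simp_all add: partial_deriv_eq[OF d0])
    have "U \<union> - g ` K = UNIV" using gKU by auto
    then show ?thesis using continuous_on_open_Un[OF U _ 1 2] compact_imp_closed[OF gK] by (metis open_Compl)
  qed
  then show "C_k 1 w" using diff by (simp add: C1_iff)
qed

section \<open>Geometry of the curved strip\<close>

lemma smooth_real_deriv:
  fixes f :: "real => real"
  assumes "smooth f"
  shows "(f has_real_derivative deriv f x) (at x)" and "smooth (deriv f)" and "isCont f x"
proof -
  have d: "(f has_real_derivative deriv f x) (at x)" for x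
  proof -
    have "f differentiable (at x)" using smooth_imp_C1[OF assms] by (simp add: C1_iff)
    then show ?thesis using real_differentiableE DERIV_imp_deriv by metis
  qed
  then show "(f has_real_derivative deriv f x) (at x)" .
  then show "isCont f x" by (rule DERIV_isCont)
  have "partial_deriv 1 f = deriv f"
    using partial_deriv_eq[OF d[unfolded has_field_derivative_def]] by (simp add: fun_eq_iff)
  moreover have "C_k k (partial_deriv 1 f)" for k
    using assms by (auto simp: smooth_def dest: spec[of _ "Suc k"])
  ultimately show "smooth (deriv f)" by (simp add: smooth_def)
qed

text \<open>A unit-speed curve whose curvature is bounded by \<open>\<beta> / (1 + s\<^sup>2)\<close> turns by at most \<open>1/2\<close> beyond some
  parameter \<open>N\<^sub>0\<close>, so its component along the tangent at \<open>N\<^sub>0\<close> grows at least like \<open>s / 2\<close>.\<close>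

lemma curve_to_infinity:
  fixes x y tx ty g :: "real => real"
  assumes der: "!!s. (x has_real_derivative tx s) (at s)" "!!s. (y has_real_derivative ty s) (at s)"
      "!!s. (tx has_real_derivative g s * ty s) (at s)" "!!s. (ty has_real_derivative - g s * tx s) (at s)"
    and unit: "!!s. (tx s)\<^sup>2 + (ty s)\<^sup>2 = 1" and decay: "!!s. \<bar>g s\<bar> <= \<beta> / (1 + s\<^sup>2)"
  shows "\<exists>N\<ge>0. \<forall>s\<ge>N. R <= norm (x s, y s)"
proof -
  have \<beta>: "0 <= \<beta>" using decay[of 0] abs_ge_zero[of "g 0"] by simp
  have "((\<lambda>s. \<beta> * (pi / 2 - arctan s)) \<longlongrightarrow> \<beta> * (pi / 2 - pi / 2)) at_top"
    by (intro tendsto_intros tendsto_arctan_at_top)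
  then have "\<forall>\<^sub>F s in at_top. \<beta> * (pi / 2 - arctan s) < 1 / 2" by (intro order_tendstoD(2)) auto
  then obtain N0 where N0: "\<beta> * (pi / 2 - arctan N0) < 1 / 2" unfolding eventually_at_top_linorder by blast
  define X Y where "X = tx N0" and "Y = ty N0"
  have XY: "X\<^sup>2 + Y\<^sup>2 = 1" using unit by (simp add: X_def Y_def)
  have cs: "\<bar>p * X + r * Y\<bar> <= norm (p, r)" for p r
  proof -
    have "(p * X + r * Y)\<^sup>2 <= p\<^sup>2 + r\<^sup>2"
    proof -
      have "p\<^sup>2 + r\<^sup>2 = (p\<^sup>2 + r\<^sup>2) * (X\<^sup>2 + Y\<^sup>2)" using XY by simp
      also have "... = (p * X + r * Y)\<^sup>2 + (p * Y - r * X)\<^sup>2" by (simp add: power2_eq_square algebra_simps)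
      finally show ?thesis by simp
    qed
    then have "sqrt ((p * X + r * Y)\<^sup>2) <= sqrt (p\<^sup>2 + r\<^sup>2)" by (rule real_sqrt_le_mono)
    then show ?thesis by (simp add: norm_Pair)
  qed
  have tangent: "1 / 2 <= tx s * X + ty s * Y" if "s \<ge> N0" for s
  proof -
    let ?P = "\<lambda>s. tx s * X + ty s * Y + \<beta> * arctan s"
    have "?P N0 <= ?P s"
    proof (rule DERIV_nonneg_imp_nondecreasing[OF that], intro exI conjI)
      fix r
      show "(?P has_real_derivative g r * ty r * X + (- g r * tx r) * Y + \<beta> / (1 + r\<^sup>2)) (at r)"
        by (auto intro!: derivative_eq_intros der simp: divide_simps)
      have "\<bar>g r * (ty r * X + (- tx r) * Y)\<bar> <= \<beta> / (1 + r\<^sup>2) * 1"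
        unfolding abs_mult
      proof (rule mult_mono[OF decay])
        show "\<bar>ty r * X + (- tx r) * Y\<bar> <= 1"
          using cs[of "ty r" "- tx r"] unit[of r] by (simp add: norm_Pair add.commute)
      qed (use \<beta> in \<open>auto intro!: divide_nonneg_nonneg add_nonneg_nonneg\<close>)
      then show "0 <= g r * ty r * X + (- g r * tx r) * Y + \<beta> / (1 + r\<^sup>2)"
        by (simp add: algebra_simps abs_le_iff)
    qed
    moreover have "tx N0 * X + ty N0 * Y = 1" using XY by (simp add: X_def Y_def power2_eq_square)
    moreover have "\<beta> * arctan s <= \<beta> * (pi / 2)" using \<beta> arctan_ubound[of s] by (intro mult_left_mono) auto
    ultimately show ?thesis using N0 by (simp add: algebra_simps)
  qed
  define q where "q = x N0 * X + y N0 * Y - N0 / 2"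
  have grow: "q + s / 2 <= norm (x s, y s)" if "s \<ge> N0" for s
  proof -
    let ?Q = "\<lambda>s. x s * X + y s * Y - s / 2"
    have "?Q N0 <= ?Q s"
    proof (rule DERIV_nonneg_imp_nondecreasing[OF that], intro exI conjI)
      fix r assume "N0 <= r" "r <= s"
      show "(?Q has_real_derivative tx r * X + ty r * Y - 1 / 2) (at r)"
        by (auto intro!: derivative_eq_intros der)
      show "0 <= tx r * X + ty r * Y - 1 / 2" using tangent[OF \<open>N0 <= r\<close>] by simp
    qed
    then show ?thesis using cs[of "x s" "y s"] by (simp add: q_def)
  qed
  have "R <= norm (x s, y s)" if "s \<ge> max 0 (max N0 (2 * (R - q)))" for s
    using grow[of s] that by simp
  then show ?thesis by (intro exI[of _ "max 0 (max N0 (2 * (R - q)))"]) auto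
qed

locale strip =
  fixes a b :: "real => real" and d \<beta> :: real
  assumes d_pos: "d > 0"
    and a_smooth: "smooth a" and b_smooth: "smooth b"
    and arc_length: "!!s. (deriv a s)\<^sup>2 + (deriv b s)\<^sup>2 = 1"
    and thin: "!!s. d * \<bar>curvature a b s\<bar> < 1"
    and injective: "inj_on (strip_map a b) (UNIV \<times> {0<..<d})"
    and curvature_decay: "!!s. \<bar>curvature a b s\<bar> <= \<beta> / (1 + s\<^sup>2)"
begin

abbreviation \<gamma> where "\<gamma> \<equiv> curvature a b"
abbreviation a' where "a' \<equiv> deriv a"
abbreviation b' where "b' \<equiv> deriv b"

definition S :: "(real \<times> real) set" where "S = UNIV \<times> {0<..<d}"
definition \<Omega> :: "(real \<times> real) set" where "\<Omega> = curved_strip a b d"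
definition F :: "real \<times> real => real \<times> real" where "F = strip_map a b"
definition G :: "real \<times> real => real \<times> real" where "G = inv_into S F"

text \<open>The Jacobian of the parametrization, which is also the stretching factor in the direction of \<open>s\<close>.\<close>

definition J :: "real \<times> real => real" where "J p = 1 + snd p * \<gamma> (fst p)"

lemma F_eq: "F p = (a (fst p) - snd p * b' (fst p), b (fst p) + snd p * a' (fst p))"
  by (simp add: F_def strip_map_def split_beta)

lemma \<Omega>_eq: "\<Omega> = F ` S"
  by (simp add: \<Omega>_def F_def S_def curved_strip_def)

lemma mem_S: "p \<in> S \<longleftrightarrow> 0 < snd p \<and> snd p < d"
  by (cases p) (auto simp: S_def)

lemma open_S: "open S"
  unfolding S_def by (intro open_Times) auto

lemma derivs:
  "(a has_real_derivative a' s) (at s)" "(b has_real_derivative b' s) (at s)"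
  "(a' has_real_derivative \<gamma> s * b' s) (at s)" "(b' has_real_derivative - \<gamma> s * a' s) (at s)"
proof -
  show ab: "(a has_real_derivative a' s) (at s)" "(b has_real_derivative b' s) (at s)"
    using smooth_real_deriv a_smooth b_smooth by auto
  have 2: "(a' has_real_derivative deriv a' s) (at s)" "(b' has_real_derivative deriv b' s) (at s)"
    using smooth_real_deriv a_smooth b_smooth by auto
  have "((\<lambda>s. (a' s)\<^sup>2 + (b' s)\<^sup>2) has_real_derivative 2 * a' s * deriv a' s + 2 * b' s * deriv b' s) (at s)"
    by (auto intro!: derivative_eq_intros 2)
  moreover have "((\<lambda>s. (a' s)\<^sup>2 + (b' s)\<^sup>2) has_real_derivative 0) (at s)"
    by (simp add: arc_length)
  ultimately have "2 * a' s * deriv a' s + 2 * b' s * deriv b' s = 0" by (rule DERIV_unique)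
  then have o: "a' s * deriv a' s = - (b' s * deriv b' s)" by simp
  have "\<gamma> s * b' s = ((a' s)\<^sup>2 + (b' s)\<^sup>2) * deriv a' s"
    using o by (simp add: curvature_def power2_eq_square algebra_simps)
  then have "\<gamma> s * b' s = deriv a' s" by (simp add: arc_length)
  then show "(a' has_real_derivative \<gamma> s * b' s) (at s)" using 2 by simp
  have "- \<gamma> s * a' s = ((a' s)\<^sup>2 + (b' s)\<^sup>2) * deriv b' s"
    using arg_cong[OF o, of "\<lambda>x. b' s * x"] by (simp add: curvature_def power2_eq_square algebra_simps)
  then have "- \<gamma> s * a' s = deriv b' s" by (simp add: arc_length)
  then show "(b' has_real_derivative - \<gamma> s * a' s) (at s)" using 2 by simp
qed

lemma continuous_curve:
  "continuous_on UNIV a" "continuous_on UNIV b" "continuous_on UNIV a'" "continuous_on UNIV b'" "continuous_on UNIV \<gamma>"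
proof -
  have c: "continuous_on UNIV f" if "smooth f" for f :: "real => real"
    using smooth_real_deriv(3)[OF that] by (simp add: continuous_at_imp_continuous_on)
  note s = a_smooth b_smooth smooth_real_deriv(2)[OF a_smooth] smooth_real_deriv(2)[OF b_smooth]
  show "continuous_on UNIV a" "continuous_on UNIV b" "continuous_on UNIV a'" "continuous_on UNIV b'"
    using s c by auto
  have "continuous_on UNIV (deriv a')" "continuous_on UNIV (deriv b')"
    using s(3,4) smooth_real_deriv(2) c by auto
  then show "continuous_on UNIV \<gamma>"
    unfolding curvature_def[abs_def] using s c by (intro continuous_intros) auto
qed

lemma continuous_fst: "continuous_on UNIV f ==> continuous_on X (\<lambda>p::real \<times> real. f (fst p) :: real)"
  by (rule continuous_on_compose2[of UNIV f]) (auto intro: continuous_intros)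

lemmas continuous_curve_fst = continuous_curve[THEN continuous_fst]

lemma continuous_F: "continuous_on X F"
  unfolding F_eq[abs_def] by (intro continuous_intros continuous_curve_fst)

lemma continuous_J: "continuous_on X J"
  unfolding J_def[abs_def] by (intro continuous_intros continuous_curve_fst)

definition F' :: "real \<times> real => real \<times> real => real \<times> real" where
  "F' p h = (fst h * J p * a' (fst p) - snd h * b' (fst p), fst h * J p * b' (fst p) + snd h * a' (fst p))"

lemma F_derivative: "(F has_derivative F' p) (at p)"
proof -
  have comp: "((\<lambda>q::real \<times> real. f (fst q)) has_derivative (\<lambda>h. D * fst h)) (at p)"
    if "(f has_real_derivative D) (at (fst p))" for f D
    using has_derivative_compose[OF has_derivative_fst[OF has_derivative_ident] that[unfolded has_field_derivative_def]]
    by simp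
  note c = comp[OF derivs(1)] comp[OF derivs(2)] comp[OF derivs(3)] comp[OF derivs(4)]
  show ?thesis unfolding F_eq[abs_def]
    by (rule has_derivative_eq_rhs) (auto intro!: derivative_eq_intros c simp: F'_def[abs_def] J_def algebra_simps fun_eq_iff)
qed

lemma abs_u_\<gamma>: "p \<in> S ==> \<bar>snd p * \<gamma> (fst p)\<bar> <= d * \<bar>\<gamma> (fst p)\<bar>"
  by (simp add: mem_S abs_mult mult_right_mono)

lemma J_pos: "p \<in> S ==> 0 < J p" and J_less_2: "p \<in> S ==> J p < 2"
  using abs_u_\<gamma>[of p] thin[of "fst p"] by (auto simp: J_def abs_le_iff)

lemma homeomorphism_F: "homeomorphism S \<Omega> F G"
  unfolding \<Omega>_eq homeomorphism_def G_def
  using injective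
  by (auto simp: F_def[symmetric] S_def[symmetric] continuous_F image_image inv_into_f_f f_inv_into_f
      intro!: continuous_on_inverse_open[OF open_S continuous_F])

lemma open_\<Omega>: "open \<Omega>"
  unfolding \<Omega>_eq using injective by (intro invariance_of_domain continuous_F open_S) (simp add: F_def S_def)

lemma GF: "p \<in> S ==> G (F p) = p" and FG: "q \<in> \<Omega> ==> F (G q) = q"
  and G_S: "q \<in> \<Omega> ==> G q \<in> S" and F_\<Omega>: "p \<in> S ==> F p \<in> \<Omega>" and continuous_G: "continuous_on \<Omega> G"
  using homeomorphism_F unfolding homeomorphism_def by auto

lemma Jacobian: "p \<in> S ==> J p = \<bar>fst (F' p (1, 0)) * snd (F' p (0, 1)) - fst (F' p (0, 1)) * snd (F' p (1, 0))\<bar>"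
proof -
  assume p: "p \<in> S"
  have "fst (F' p (1, 0)) * snd (F' p (0, 1)) - fst (F' p (0, 1)) * snd (F' p (1, 0))
    = J p * ((a' (fst p))\<^sup>2 + (b' (fst p))\<^sup>2)"
    by (simp add: F'_def power2_eq_square algebra_simps)
  then show ?thesis using J_pos[OF p] by (simp add: arc_length)
qed

lemma J_measurable: "J \<in> borel_measurable borel"
  using continuous_J by (rule borel_measurable_continuous_onI)

text \<open>All integrals over the strip are computed in the coordinates \<open>(s, u)\<close> through this identity.\<close>

lemma lborel_\<Omega>: "lborel_on \<Omega> = distr (density (lborel_on S) (\<lambda>p. ennreal (J p))) (lborel_on \<Omega>) F"
  using lborel_on_image_eq_distr[OF open_S homeomorphism_F open_\<Omega> F_derivative Jacobian J_measurable, of 2] J_less_2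
  by (simp add: less_imp_le)

lemma S_borel [simp]: "S \<in> sets borel" and \<Omega>_borel' [simp]: "\<Omega> \<in> sets borel"
  using open_S open_\<Omega> by auto

lemma F_measurable: "F \<in> measurable (density (lborel_on S) (\<lambda>p. ennreal (J p))) (lborel_on \<Omega>)"
proof -
  have "F \<in> measurable (lborel_on S) (lborel_on \<Omega>)"
    using borel_measurable_continuous_onI[OF continuous_F] F_\<Omega>
    by (intro measurable_restrict_space3) auto
  then show ?thesis by simp
qed

lemma integral_\<Omega>:
  fixes f :: "real \<times> real => 'b::{banach, second_countable_topology}"
  assumes f: "f \<in> borel_measurable (lborel_on \<Omega>)"
  shows "(\<integral>q. f q \<partial>lborel_on \<Omega>) = (\<integral>p. J p *\<^sub>R f (F p) \<partial>lborel_on S)"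
    and "integrable (lborel_on \<Omega>) f \<longleftrightarrow> integrable (lborel_on S) (\<lambda>p. J p *\<^sub>R f (F p))"
proof -
  have Jm: "J \<in> borel_measurable (lborel_on S)" using J_measurable by (intro measurable_restrict_space1) simp
  have J0: "AE p in lborel_on S. 0 <= J p" using J_pos by (auto intro!: AE_I2 simp: space_restrict_space less_imp_le)
  have fF: "(\<lambda>p. f (F p)) \<in> borel_measurable (lborel_on S)"
    using measurable_compose[OF F_measurable f] by simp
  show "(\<integral>q. f q \<partial>lborel_on \<Omega>) = (\<integral>p. J p *\<^sub>R f (F p) \<partial>lborel_on S)"
    by (subst lborel_\<Omega>, subst integral_distr[OF F_measurable f], subst integral_density[OF fF Jm J0]) simp
  show "integrable (lborel_on \<Omega>) f \<longleftrightarrow> integrable (lborel_on S) (\<lambda>p. J p *\<^sub>R f (F p))"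
    by (subst lborel_\<Omega>, subst integrable_distr_eq[OF F_measurable f], subst integrable_density[OF fF Jm J0]) simp
qed

subsection \<open>Transport of functions\<close>

definition pull :: "(real \<times> real => complex) => real \<times> real => complex" where
  "pull \<psi> = (\<lambda>p. if p \<in> S then \<psi> (F p) else 0)"

definition push :: "(real \<times> real => complex) => real \<times> real => complex" where
  "push v = (\<lambda>q. if q \<in> \<Omega> then v (G q) else 0)"

lemma pull_S: "p \<in> S ==> pull \<psi> p = \<psi> (F p)"
  by (simp add: pull_def)

lemma pull_push: "supported_in S v ==> pull (push v) = v"
  using supported_in_outside[of S v] by (auto simp: pull_def push_def fun_eq_iff GF F_\<Omega>)

lemma pull_C1:
  assumes "C_k 1 \<psi>" "supported_in \<Omega> \<psi>"
  shows "C_k 1 (pull \<psi>)" "supported_in S (pull \<psi>)"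
    and "p \<in> S ==> D1 (pull \<psi>) p =
      of_real (J p) * (of_real (a' (fst p)) * D1 \<psi> (F p) + of_real (b' (fst p)) * D2 \<psi> (F p))"
    and "p \<in> S ==> D2 (pull \<psi>) p =
      of_real (a' (fst p)) * D2 \<psi> (F p) - of_real (b' (fst p)) * D1 \<psi> (F p)"
proof -
  have cont: "continuous_on S (\<lambda>p. F' p e)" for e
    unfolding F'_def by (intro continuous_intros continuous_curve_fst continuous_J)
  note P = C1_pullback[OF open_S homeomorphism_F F_derivative cont assms]
  show "C_k 1 (pull \<psi>)" "supported_in S (pull \<psi>)" unfolding pull_def by (rule P)+
  show "p \<in> S ==> D1 (pull \<psi>) p =
      of_real (J p) * (of_real (a' (fst p)) * D1 \<psi> (F p) + of_real (b' (fst p)) * D2 \<psi> (F p))"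
    unfolding pull_def by (simp add: P(3) sum_Basis_plane F'_def scaleR_conv_of_real algebra_simps)
  show "p \<in> S ==> D2 (pull \<psi>) p =
      of_real (a' (fst p)) * D2 \<psi> (F p) - of_real (b' (fst p)) * D1 \<psi> (F p)"
    unfolding pull_def by (simp add: P(3) sum_Basis_plane F'_def scaleR_conv_of_real algebra_simps)
qed

lemma homeomorphism_G: "homeomorphism \<Omega> S G F"
  using homeomorphism_F homeomorphism_symD by blast

definition G' :: "real \<times> real => real \<times> real => real \<times> real" where
  "G' q h = (let p = G q in ((fst h * a' (fst p) + snd h * b' (fst p)) / J p, snd h * a' (fst p) - fst h * b' (fst p)))"

lemma G_derivative: "q \<in> \<Omega> ==> (G has_derivative G' q) (at q)"
proof (rule has_derivative_inverse_basic[OF F_derivative _ _ _ open_\<Omega>])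
  assume q: "q \<in> \<Omega>"
  note J = J_pos[OF G_S[OF q]]
  show "bounded_linear (G' q)" unfolding linear_conv_bounded_linear[symmetric]
    by (rule linearI) (auto simp: G'_def Let_def add_divide_distrib algebra_simps)
  show "G' q \<circ> F' (G q) = id"
  proof
    fix h :: "real \<times> real"
    let ?A = "a' (fst (G q))" and ?B = "b' (fst (G q))"
    have u: "?A * ?A + ?B * ?B = 1" using arc_length by (simp add: power2_eq_square)
    have "(fst h * J (G q) * ?A - snd h * ?B) * ?A + (fst h * J (G q) * ?B + snd h * ?A) * ?B = fst h * J (G q) * (?A * ?A + ?B * ?B)"
      by (simp add: algebra_simps)
    moreover have "(fst h * J (G q) * ?B + snd h * ?A) * ?A - (fst h * J (G q) * ?A - snd h * ?B) * ?B = snd h * (?A * ?A + ?B * ?B)"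
      by (simp add: algebra_simps)
    ultimately show "(G' q \<circ> F' (G q)) h = id h" using J u by (simp add: G'_def F'_def Let_def)
  qed
  show "continuous (at q) G" using continuous_G open_\<Omega> q by (simp add: continuous_on_eq_continuous_at)
qed (auto simp: FG)

lemma push_C1:
  assumes "C_k 1 v" "supported_in S v"
  shows "C_k 1 (push v)" "supported_in \<Omega> (push v)"
proof -
  have G2: "continuous_on \<Omega> (\<lambda>q. f (fst (G q)) :: real)" if "continuous_on UNIV f" for f
    by (rule continuous_on_compose2[OF continuous_fst[OF that, of UNIV] continuous_G]) auto
  have "continuous_on \<Omega> (\<lambda>q. G' q e)" for e
    unfolding G'_def Let_def
    using J_pos G_S by (intro continuous_intros G2 continuous_curve continuous_on_compose2[OF continuous_J[of UNIV] continuous_G])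
      (auto simp: less_imp_neq[symmetric])
  note P = C1_pullback[OF open_\<Omega> homeomorphism_G G_derivative this assms]
  show "C_k 1 (push v)" "supported_in \<Omega> (push v)" unfolding push_def by (rule P; assumption)+
qed

text \<open>The frame of tangent and normal is orthonormal, so in the coordinates \<open>(s, u)\<close> the gradient only picks
  up the factor \<open>1 / J\<close> in the direction of \<open>s\<close>.\<close>

lemma gradient_inner:
  assumes "C_k 1 \<phi>" "supported_in \<Omega> \<phi>" "C_k 1 \<psi>" "supported_in \<Omega> \<psi>" and p: "p \<in> S"
  shows "D1 \<phi> (F p) * cnj (D1 \<psi> (F p)) + D2 \<phi> (F p) * cnj (D2 \<psi> (F p))
    = D1 (pull \<phi>) p * cnj (D1 (pull \<psi>) p) / (of_real (J p))\<^sup>2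
      + D2 (pull \<phi>) p * cnj (D2 (pull \<psi>) p)"
proof -
  let ?A = "complex_of_real (a' (fst p))" and ?B = "complex_of_real (b' (fst p))"
  have "?A * ?A + ?B * ?B = of_real ((a' (fst p))\<^sup>2 + (b' (fst p))\<^sup>2)" by (simp add: power2_eq_square)
  then have u: "?A * ?A + ?B * ?B = 1" by (simp add: arc_length)
  have rot: "(?A * x + ?B * y) * (?A * x' + ?B * y') + (?A * y - ?B * x) * (?A * y' - ?B * x') = x * x' + y * y'" for x y x' y'
  proof -
    have "(?A * x + ?B * y) * (?A * x' + ?B * y') + (?A * y - ?B * x) * (?A * y' - ?B * x')
      = (?A * ?A + ?B * ?B) * (x * x' + y * y')" by (simp add: algebra_simps)
    then show ?thesis by (simp add: u)
  qed
  have J: "complex_of_real (J p) ~= 0" using J_pos[OF p] by simp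
  show ?thesis
    unfolding pull_C1(3,4)[OF assms(1,2) p] pull_C1(3,4)[OF assms(3,4) p]
    using J rot[of "D1 \<phi> (F p)" "D2 \<phi> (F p)"
        "cnj (D1 \<psi> (F p))" "cnj (D2 \<psi> (F p))"]
    by (simp add: power2_eq_square)
qed

subsection \<open>Behaviour at infinity\<close>

lemma \<gamma>_small: "\<eta> > 0 ==> \<exists>N\<ge>0. \<forall>s. \<bar>s\<bar> \<ge> N --> d * \<bar>\<gamma> s\<bar> <= \<eta>"
proof -
  assume \<eta>: "\<eta> > 0"
  have \<beta>: "0 <= \<beta>" using curvature_decay[of 0] abs_ge_zero[of "\<gamma> 0"] by simp
  define N where "N = d * \<beta> / \<eta>"
  have N: "N \<ge> 0" using d_pos \<beta> \<eta> by (simp add: N_def)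
  have "d * \<bar>\<gamma> s\<bar> <= \<eta>" if "\<bar>s\<bar> \<ge> N" for s
  proof -
    have "1 + s\<^sup>2 \<ge> \<bar>s\<bar>"
      using zero_le_power2[of "\<bar>s\<bar> - 1"] by (simp add: power2_eq_square algebra_simps)
    then have "\<eta> * \<bar>s\<bar> <= \<eta> * (1 + s\<^sup>2)" using \<eta> by (intro mult_left_mono) auto
    moreover have "d * \<beta> <= \<eta> * \<bar>s\<bar>" using that \<eta> by (simp add: N_def field_simps)
    ultimately have "d * \<beta> <= \<eta> * (1 + s\<^sup>2)" by linarith
    moreover have "d * \<bar>\<gamma> s\<bar> <= d * (\<beta> / (1 + s\<^sup>2))" using curvature_decay d_pos by (intro mult_left_mono) auto
    moreover have "1 + s\<^sup>2 > 0" by (simp add: add_pos_nonneg)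
    ultimately show ?thesis by (smt (verit) divide_le_eq times_divide_eq_right)
  qed
  then show ?thesis using N by blast
qed

lemma J_near_1: "\<eta> > 0 ==> \<exists>N\<ge>0. \<forall>p\<in>S. \<bar>fst p\<bar> \<ge> N --> \<bar>J p - 1\<bar> <= \<eta>"
  using \<gamma>_small[of \<eta>] abs_u_\<gamma> unfolding J_def by (metis add_diff_cancel_left' order_trans)

text \<open>Far out \<open>J\<close> is close to \<open>1\<close>; on the remaining compact set of parameters, \<open>d |\<gamma>| < 1\<close> is attained with a gap.\<close>

lemma J_lower_bound: "\<exists>j>0. \<forall>p\<in>S. j <= J p"
proof -
  obtain N where N: "N \<ge> 0" "\<forall>s. \<bar>s\<bar> \<ge> N --> d * \<bar>\<gamma> s\<bar> <= 1/2" using \<gamma>_small[of "1/2"] by auto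
  have "continuous_on {-N..N} (\<lambda>s. d * \<bar>\<gamma> s\<bar>)"
    by (intro continuous_intros continuous_on_subset[OF continuous_curve(5)]) auto
  then obtain t where t: "\<forall>s\<in>{-N..N}. d * \<bar>\<gamma> s\<bar> <= d * \<bar>\<gamma> t\<bar>"
    using continuous_attains_sup[of "{-N..N}" "\<lambda>s. d * \<bar>\<gamma> s\<bar>"] N(1) by auto
  have "min (1/2) (1 - d * \<bar>\<gamma> t\<bar>) <= J p" if "p \<in> S" for p
  proof (cases "\<bar>fst p\<bar> \<ge> N")
    case True
    then show ?thesis using N(2) abs_u_\<gamma>[OF that] by (auto simp: J_def abs_le_iff)
  next
    case False
    then have "d * \<bar>\<gamma> (fst p)\<bar> <= d * \<bar>\<gamma> t\<bar>" using bspec[OF t, of "fst p"] by (auto simp: abs_less_iff not_le)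
    then show ?thesis using abs_u_\<gamma>[OF that] by (auto simp: J_def abs_le_iff)
  qed
  then show ?thesis using thin[of t] by (intro exI[of _ "min (1/2) (1 - d * \<bar>\<gamma> t\<bar>)"]) auto
qed

lemma F_to_infinity: "\<exists>N\<ge>0. \<forall>p\<in>S. \<bar>fst p\<bar> \<ge> N --> R <= norm (F p)"
proof -
  obtain N1 where N1: "N1 \<ge> 0" "\<forall>s\<ge>N1. R + d <= norm (a s, b s)"
    using curve_to_infinity[OF derivs arc_length curvature_decay] by blast
  have refl: "((\<lambda>s. f (- s)) has_real_derivative - D (- s)) (at s)"
    if "!!s. (f has_real_derivative D s) (at s)" for f D s
    using DERIV_chain2[OF that[of "- s"] DERIV_minus[OF DERIV_ident]] by simp
  have "\<exists>N\<ge>0. \<forall>s\<ge>N. R + d <= norm (a (- s), b (- s))"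
  proof (rule curve_to_infinity[where tx = "\<lambda>s. - a' (- s)" and ty = "\<lambda>s. - b' (- s)" and g = "\<lambda>s. - \<gamma> (- s)"])
    show "((\<lambda>s. - a' (- s)) has_real_derivative - \<gamma> (- s) * - b' (- s)) (at s)"
         "((\<lambda>s. - b' (- s)) has_real_derivative - (- \<gamma> (- s)) * - a' (- s)) (at s)" for s
      using DERIV_minus[OF refl[OF derivs(3), of s]] DERIV_minus[OF refl[OF derivs(4), of s]] by simp_all
    show "\<bar>- \<gamma> (- s)\<bar> <= \<beta> / (1 + s\<^sup>2)" for s using curvature_decay[of "-s"] by simp
  qed (use refl[OF derivs(1)] refl[OF derivs(2)] arc_length in auto)
  then obtain N2 where N2: "N2 \<ge> 0" "\<forall>s\<ge>N2. R + d <= norm (a (- s), b (- s))" by blast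
  have "R <= norm (F p)" if p: "p \<in> S" "\<bar>fst p\<bar> \<ge> max N1 N2" for p
  proof -
    have "R + d <= norm (a (fst p), b (fst p))"
    proof (cases "fst p \<ge> 0")
      case False
      then show ?thesis using N2(2)[rule_format, of "- fst p"] p(2) by simp
    qed (use N1 p(2) in auto)
    moreover have "norm (- snd p * b' (fst p), snd p * a' (fst p)) <= d"
    proof -
      have "(- snd p * b' (fst p))\<^sup>2 + (snd p * a' (fst p))\<^sup>2 = (snd p)\<^sup>2 * ((a' (fst p))\<^sup>2 + (b' (fst p))\<^sup>2)"
        by (simp add: power2_eq_square algebra_simps)
      then show ?thesis using p(1) by (simp add: norm_Pair arc_length mem_S)
    qed
    moreover have "F p - (- snd p * b' (fst p), snd p * a' (fst p)) = (a (fst p), b (fst p))"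
      by (simp add: F_eq)
    ultimately show ?thesis using norm_triangle_ineq4[of "F p" "(- snd p * b' (fst p), snd p * a' (fst p))"] by simp
  qed
  then show ?thesis using N1(1) by (intro exI[of _ "max N1 N2"]) auto
qed

end

section \<open>Poincare inequalities\<close>

text \<open>Expansion of the square: the mean is the best constant approximation.\<close>

lemma integral_norm_diff_mean:
  fixes f :: "real => complex"
  assumes f: "continuous_on {x0..x0 + r} f" and r: "r > 0"
  shows "integral {x0..x0 + r} (\<lambda>x. (cmod (f x - integral {x0..x0 + r} f / of_real r))\<^sup>2)
    = integral {x0..x0 + r} (\<lambda>x. (cmod (f x))\<^sup>2) - (cmod (integral {x0..x0 + r} f))\<^sup>2 / r"
proof -
  let ?I = "{x0..x0 + r}"
  define m where "m = integral ?I f / of_real r"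
  have int: "(f has_integral integral ?I f) ?I"
    using integrable_continuous_real[OF f] by (simp add: integrable_integral)
  have int2: "((\<lambda>x. (cmod (f x))\<^sup>2) has_integral integral ?I (\<lambda>x. (cmod (f x))\<^sup>2)) ?I"
    by (intro integrable_integral integrable_continuous_real continuous_intros f)
  have re: "((\<lambda>x. Re (cnj m * f x)) has_integral Re (cnj m * integral ?I f)) ?I"
    using has_integral_linear[OF has_integral_mult_right[OF int, of "cnj m"] bounded_linear_Re] by (simp add: o_def)
  have c: "((\<lambda>x. (cmod m)\<^sup>2) has_integral r * (cmod m)\<^sup>2) ?I"
    using has_integral_const_real[of "(cmod m)\<^sup>2" x0 "x0 + r"] r by simp
  have eq: "(\<lambda>x. (cmod (f x - m))\<^sup>2) = (\<lambda>x. (cmod (f x))\<^sup>2 - 2 * Re (cnj m * f x) + (cmod m)\<^sup>2)"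
    unfolding cmod_power2 by (rule ext) (simp add: power2_eq_square algebra_simps)
  have main: "((\<lambda>x. (cmod (f x - m))\<^sup>2) has_integral
      integral ?I (\<lambda>x. (cmod (f x))\<^sup>2) - 2 * Re (cnj m * integral ?I f) + r * (cmod m)\<^sup>2) ?I"
    unfolding eq by (intro has_integral_add has_integral_diff int2 c has_integral_mult_right[OF re])
  have "Re (cnj m * integral ?I f) = r * (cmod m)\<^sup>2"
  proof -
    have "integral ?I f = of_real r * m" using r by (simp add: m_def)
    then have "cnj m * integral ?I f = of_real (r * (cmod m)\<^sup>2)"
      by (simp add: mult_ac mult_cnj_self)
    then show ?thesis by simp
  qed
  moreover have "r * (cmod m)\<^sup>2 = (cmod (integral ?I f))\<^sup>2 / r"
    using r by (simp add: m_def norm_divide power_divide power2_eq_square)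
  ultimately show ?thesis unfolding m_def[symmetric] integral_unique[OF main] by simp
qed

lemma Cauchy_Schwarz_interval:
  fixes f :: "real => complex"
  assumes f: "continuous_on {x0..x0 + r} f" and r: "r > 0"
  shows "(cmod (integral {x0..x0 + r} f))\<^sup>2 <= r * integral {x0..x0 + r} (\<lambda>x. (cmod (f x))\<^sup>2)"
proof -
  have "0 <= integral {x0..x0 + r} (\<lambda>x. (cmod (f x))\<^sup>2) - (cmod (integral {x0..x0 + r} f))\<^sup>2 / r"
    unfolding integral_norm_diff_mean[OF assms, symmetric]
    by (intro integral_nonneg integrable_continuous_real continuous_intros f) auto
  then show ?thesis using r by (simp add: field_simps)
qed

lemma Poincare_interval:
  fixes f f' :: "real => complex"
  assumes der: "!!x. x \<in> {x0..x0 + r} ==> (f has_vector_derivative f' x) (at x within {x0..x0 + r})"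
    and f': "continuous_on {x0..x0 + r} f'" and r: "r > 0"
  shows "integral {x0..x0 + r} (\<lambda>x. (cmod (f x))\<^sup>2)
    <= (cmod (integral {x0..x0 + r} f))\<^sup>2 / r + r\<^sup>2 * integral {x0..x0 + r} (\<lambda>x. (cmod (f' x))\<^sup>2)"
proof -
  let ?I = "{x0..x0 + r}"
  have f: "continuous_on ?I f" unfolding continuous_on_eq_continuous_within
    by (intro ballI has_vector_derivative_continuous[OF der])
  define K where "K = integral ?I (\<lambda>x. cmod (f' x))"
  have nf': "(\<lambda>x. cmod (f' x)) integrable_on {p..q}" if "{p..q} \<subseteq> ?I" for p q
    by (intro integrable_continuous_real continuous_intros continuous_on_subset[OF f' that])
  have K0: "K \<ge> 0" unfolding K_def by (intro integral_nonneg nf') auto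
  have osc0: "cmod (f q - f p) <= K" if "p \<in> ?I" "q \<in> ?I" "p <= q" for p q
  proof -
    have sub: "{p..q} \<subseteq> ?I" using that by auto
    have "(f' has_integral (f q - f p)) {p..q}"
    proof (rule fundamental_theorem_of_calculus[OF that(3)])
      show "(f has_vector_derivative f' x) (at x within {p..q})" if "x \<in> {p..q}" for x
        using der[of x] sub that by (blast intro: has_vector_derivative_within_subset)
    qed
    then have "f q - f p = integral {p..q} f'" by (simp add: integral_unique)
    also have "cmod ... <= integral {p..q} (\<lambda>x. cmod (f' x))"
      by (intro integral_norm_bound_integral nf' sub integrable_continuous_real continuous_on_subset[OF f' sub]) auto
    also have "... <= K" unfolding K_def by (intro integral_subset_le sub nf') auto
    finally show ?thesis .
  qed
  have osc: "cmod (f q - f p) <= K" if "p \<in> ?I" "q \<in> ?I" for p q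
    using osc0[of p q] osc0[of q p] that by (cases "p <= q") (auto simp: norm_minus_commute)
  define m where "m = integral ?I f / of_real r"
  have mean: "cmod (f x - m) <= K" if x: "x \<in> ?I" for x
  proof -
    have "((\<lambda>y. f x - f y) has_integral of_real r * f x - integral ?I f) ?I"
      using has_integral_diff[OF has_integral_const_real[of "f x" x0 "x0 + r"] integrable_integral[OF integrable_continuous_real[OF f]]] r
      by (simp add: scaleR_conv_of_real)
    then have "of_real r * (f x - m) = integral ?I (\<lambda>y. f x - f y)" using r by (simp add: m_def algebra_simps integral_unique)
    also have "cmod ... <= integral ?I (\<lambda>y. K)"
      by (intro integral_norm_bound_integral integrable_continuous_real continuous_intros f) (use osc x in auto)
    also have "... = r * K" using r by simp
    finally have "r * cmod (f x - m) <= r * K" using r by (simp add: norm_mult)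
    then show ?thesis using r by simp
  qed
  have "integral ?I (\<lambda>x. (cmod (f x - m))\<^sup>2) <= integral ?I (\<lambda>x. K\<^sup>2)"
    by (intro integral_le integrable_continuous_real continuous_intros f power_mono mean) auto
  also have "... = r * K\<^sup>2" using r by simp
  also have "... <= r * (r * integral ?I (\<lambda>x. (cmod (f' x))\<^sup>2))"
  proof -
    have "(cmod (integral ?I (\<lambda>x. of_real (cmod (f' x)) :: complex)))\<^sup>2 <= r * integral ?I (\<lambda>x. (cmod (of_real (cmod (f' x)) :: complex))\<^sup>2)"
      by (intro Cauchy_Schwarz_interval continuous_intros f' r)
    moreover have "integral ?I (\<lambda>x. of_real (cmod (f' x)) :: complex) = of_real K"
      unfolding K_def by (intro integral_unique has_integral_of_real integrable_integral nf') auto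
    ultimately have "K\<^sup>2 <= r * integral ?I (\<lambda>x. (cmod (f' x))\<^sup>2)" by simp
    then show ?thesis using r by (intro mult_left_mono) auto
  qed
  finally show ?thesis
    using integral_norm_diff_mean[OF f r] by (simp add: m_def power2_eq_square mult.assoc)
qed

text \<open>On a rectangle, apply the inequality in the first variable, then to the means
  \<open>V(u) = \<integral> w(s, u) ds\<close> in the second.\<close>

lemma Poincare_rectangle:
  fixes w :: "real \<times> real => complex" and s0 u0 r t :: real
  assumes w: "C_k 1 w" and r: "r > 0" and t: "t > 0"
  defines "Q \<equiv> cbox (s0, u0) (s0 + r, u0 + t)"
  shows "integral Q (\<lambda>p. (cmod (w p))\<^sup>2) <= (cmod (integral Q w))\<^sup>2 / (r * t)
    + r\<^sup>2 * integral Q (\<lambda>p. (cmod (D1 w p))\<^sup>2) + t\<^sup>2 * integral Q (\<lambda>p. (cmod (D2 w p))\<^sup>2)"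
proof -
  let ?s = "{s0..s0 + r}" and ?u = "{u0..u0 + t}"
  let ?ws = "D1 w" and ?wu = "D2 w"
  have wc: "continuous_on X w" and wsc: "continuous_on X ?ws" and wuc: "continuous_on X ?wu" for X
    using C1_continuous[OF w] w by (auto simp: C1_iff Basis_plane intro: continuous_on_subset)
  have slice: "continuous_on X (\<lambda>s. g (s, u))" if "!!Y. continuous_on Y g" for g :: "real \<times> real => complex" and X u
    by (rule continuous_on_compose2[OF that[of UNIV]]) (auto intro!: continuous_intros)
  have slice': "continuous_on X (\<lambda>u. g (s, u))" if "!!Y. continuous_on Y g" for g :: "real \<times> real => complex" and X s
    by (rule continuous_on_compose2[OF that[of UNIV]]) (auto intro!: continuous_intros)
  have ders: "((\<lambda>s. w (s, u)) has_vector_derivative ?ws (s, u)) (at s within X)"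
    and deru: "((\<lambda>u. w (s, u)) has_vector_derivative ?wu (s, u)) (at u within X)" for s u X
  proof -
    have D: "(w has_derivative frechet_derivative w (at (s, u))) (at (s, u))"
      using w by (simp add: C1_iff frechet_derivative_works)
    note lin = has_derivative_linear[OF D]
    have "((\<lambda>s. w (s, u)) has_derivative (\<lambda>h. frechet_derivative w (at (s, u)) (h, 0))) (at s)"
      using D by (rule has_derivative_compose[rotated]) (auto intro!: derivative_eq_intros)
    moreover have "frechet_derivative w (at (s, u)) (h, 0) = h *\<^sub>R ?ws (s, u)" for h
      using linear_scale[OF lin, of h "(1, 0)"] by (simp add: partial_deriv_def)
    ultimately show "((\<lambda>s. w (s, u)) has_vector_derivative ?ws (s, u)) (at s within X)"
      by (simp add: has_vector_derivative_def has_derivative_at_withinI)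
    have "((\<lambda>u. w (s, u)) has_derivative (\<lambda>h. frechet_derivative w (at (s, u)) (0, h))) (at u)"
      using D by (rule has_derivative_compose[rotated]) (auto intro!: derivative_eq_intros)
    moreover have "frechet_derivative w (at (s, u)) (0, h) = h *\<^sub>R ?wu (s, u)" for h
      using linear_scale[OF lin, of h "(0, 1)"] by (simp add: partial_deriv_def)
    ultimately show "((\<lambda>u. w (s, u)) has_vector_derivative ?wu (s, u)) (at u within X)"
      by (simp add: has_vector_derivative_def has_derivative_at_withinI)
  qed
  define V where "V u = integral ?s (\<lambda>s. w (s, u))" for u
  define V' where "V' u = integral ?s (\<lambda>s. ?wu (s, u))" for u
  have param: "continuous_on X (\<lambda>u. integral ?s (\<lambda>s. g (s, u)))" if "!!Y. continuous_on Y g"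
    for g :: "real \<times> real => 'b::banach" and X
    unfolding cbox_interval[symmetric]
    by (rule integral_continuous_on_param) (auto simp: split_beta intro!: continuous_on_compose2[OF that[of UNIV]] continuous_intros)
  have V: "(V has_vector_derivative V' u) (at u within ?u)" if "u \<in> ?u" for u
    unfolding V_def[abs_def] V'_def cbox_interval[symmetric]
  proof (rule leibniz_rule_vector_derivative[OF _ _ _ that, unfolded cbox_interval[symmetric]])
    show "continuous_on (cbox u0 (u0 + t) \<times> cbox s0 (s0 + r)) (\<lambda>(u, s). ?wu (s, u))"
      unfolding split_beta by (rule continuous_on_compose2[OF wuc[of UNIV]]) (auto intro!: continuous_intros)
  qed (auto intro!: deru integrable_continuous_real slice wc)
  have fub: "integral Q g = integral ?u (\<lambda>u. integral ?s (\<lambda>s. g (s, u)))" if "!!Y. continuous_on Y g"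
    for g :: "real \<times> real => 'b::euclidean_space"
  proof -
    have "integral Q g = integral ?s (\<lambda>s. integral ?u (\<lambda>u. g (s, u)))"
      unfolding Q_def using integral_prod_continuous[OF that, of s0 u0 "s0 + r" "u0 + t"] by (simp add: cbox_interval)
    also have "... = integral ?u (\<lambda>u. integral ?s (\<lambda>s. g (s, u)))"
      using integral_swap_continuous[of s0 u0 "s0 + r" "u0 + t" "\<lambda>s u. g (s, u)"] that by (simp add: cbox_interval)
    finally show ?thesis .
  qed
  have sq: "continuous_on Y (\<lambda>p. (cmod (g p))\<^sup>2)" if "!!Y. continuous_on Y g" for g :: "real \<times> real => complex" and Y
    by (intro continuous_intros that)
  have "integral Q (\<lambda>p. (cmod (w p))\<^sup>2) = integral ?u (\<lambda>u. integral ?s (\<lambda>s. (cmod (w (s, u)))\<^sup>2))"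
    by (rule fub[OF sq[OF wc]])
  also have "... <= integral ?u (\<lambda>u. (cmod (V u))\<^sup>2 / r + r\<^sup>2 * integral ?s (\<lambda>s. (cmod (?ws (s, u)))\<^sup>2))"
    unfolding V_def
    by (intro integral_le integrable_continuous_real continuous_intros param sq wc wsc
      Poincare_interval[OF ders slice[OF wsc] r]) (use r in auto)
  also have "... = integral ?u (\<lambda>u. (cmod (V u))\<^sup>2) / r + r\<^sup>2 * integral Q (\<lambda>p. (cmod (?ws p))\<^sup>2)"
    unfolding fub[OF sq[OF wsc]] V_def
    by (subst integral_add) (auto intro!: integrable_continuous_real continuous_intros param sq wc wsc simp: r less_imp_neq[symmetric])
  also have "integral ?u (\<lambda>u. (cmod (V u))\<^sup>2) <= (cmod (integral ?u V))\<^sup>2 / t + t\<^sup>2 * integral ?u (\<lambda>u. (cmod (V' u))\<^sup>2)"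
    unfolding V'_def by (rule Poincare_interval[OF V[unfolded V'_def] param[OF wuc] t])
  also have "integral ?u (\<lambda>u. (cmod (V' u))\<^sup>2) <= integral ?u (\<lambda>u. r * integral ?s (\<lambda>s. (cmod (?wu (s, u)))\<^sup>2))"
    unfolding V'_def by (intro integral_le integrable_continuous_real continuous_intros param sq wuc
      Cauchy_Schwarz_interval slice r)
  also have "... = r * integral Q (\<lambda>p. (cmod (?wu p))\<^sup>2)" by (simp add: fub[OF sq[OF wuc]])
  also have "integral ?u V = integral Q w" unfolding V_def by (rule fub[OF wc, symmetric])
  finally have "integral Q (\<lambda>p. (cmod (w p))\<^sup>2) \<le>
    ((cmod (integral Q w))\<^sup>2 / t + t\<^sup>2 * (r * integral Q (\<lambda>p. (cmod (?wu p))\<^sup>2))) / r + r\<^sup>2 * integral Q (\<lambda>p. (cmod (?ws p))\<^sup>2)"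
    using r t by (simp add: divide_right_mono mult_left_mono)
  also have "... = (cmod (integral Q w))\<^sup>2 / (r * t) + t\<^sup>2 * integral Q (\<lambda>p. (cmod (?wu p))\<^sup>2) + r\<^sup>2 * integral Q (\<lambda>p. (cmod (?ws p))\<^sup>2)"
    using r t by (simp add: add_divide_distrib mult.commute)
  finally show ?thesis by simp
qed

text \<open>For \<open>c(u) = (\<pi> / d) cot (\<pi> u / d)\<close>, which satisfies \<open>c' + c\<^sup>2 = - (\<pi> / d)\<^sup>2\<close>, expanding \<open>|f' - c f|\<^sup>2 \<ge> 0\<close> gives
  \<open>|f'|\<^sup>2 - (\<pi> / d)\<^sup>2 |f|\<^sup>2 \<ge> (c |f|\<^sup>2)'\<close>.\<close>

lemma Dirichlet_interval:
  fixes f f' :: "real => complex"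
  assumes der: "!!x. (f has_vector_derivative f' x) (at x)" and f': "continuous_on UNIV f'"
    and \<epsilon>: "0 < \<epsilon>" "2 * \<epsilon> < d" and zero: "!!x. x < 2 * \<epsilon> \<or> x > d - 2 * \<epsilon> ==> f x = 0"
  shows "(pi / d)\<^sup>2 * integral {0..d} (\<lambda>x. (cmod (f x))\<^sup>2) <= integral {0..d} (\<lambda>x. (cmod (f' x))\<^sup>2)"
proof -
  let ?I = "{\<epsilon>..d - \<epsilon>}"
  have d: "d > 0" using \<epsilon> by simp
  have fc: "continuous_on X f" for X
    by (intro continuous_at_imp_continuous_on ballI has_vector_derivative_continuous[OF der])
  have f'c: "continuous_on X f'" for X by (rule continuous_on_subset[OF f']) simp
  define c where "c x = pi / d * cot (pi / d * x)" for x
  have sin: "sin (pi / d * x) > 0" if "x \<in> ?I" for x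
    using that \<epsilon> d by (intro sin_gt_zero) (auto simp: field_simps)
  have c': "(c has_real_derivative - (pi / d)\<^sup>2 - (c x)\<^sup>2) (at x)" if x: "x \<in> ?I" for x
  proof -
    let ?s = "sin (pi / d * x)"
    have "(c has_real_derivative pi / d * (- inverse (?s\<^sup>2) * (pi / d))) (at x)"
      unfolding c_def[abs_def] using sin[OF x] by (auto intro!: derivative_eq_intros DERIV_cot[THEN DERIV_chain2])
    moreover have "inverse (?s\<^sup>2) = 1 + (cot (pi / d * x))\<^sup>2"
    proof -
      have "1 + (cot (pi / d * x))\<^sup>2 = (?s\<^sup>2 + (cos (pi / d * x))\<^sup>2) / ?s\<^sup>2"
        using sin[OF x] unfolding cot_def power_divide add_divide_distrib by simp
      also have "?s\<^sup>2 + (cos (pi / d * x))\<^sup>2 = 1" by (rule sin_cos_squared_add)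
      finally show ?thesis unfolding inverse_eq_divide by (rule sym)
    qed
    ultimately show ?thesis by (simp add: c_def power2_eq_square algebra_simps add_divide_distrib)
  qed
  define g where "g x = c x * (cmod (f x))\<^sup>2" for x
  define g' where "g' x = (- (pi / d)\<^sup>2 - (c x)\<^sup>2) * (cmod (f x))\<^sup>2 + c x * (2 * (f x \<bullet> f' x))" for x
  have g': "(g has_vector_derivative g' x) (at x within ?I)" if x: "x \<in> ?I" for x
  proof -
    have "((\<lambda>x. f x \<bullet> f x) has_derivative (\<lambda>h. f x \<bullet> (h *\<^sub>R f' x) + (h *\<^sub>R f' x) \<bullet> f x)) (at x)"
      using der[of x] unfolding has_vector_derivative_def by (intro has_derivative_inner)
    moreover have "(\<lambda>h. f x \<bullet> (h *\<^sub>R f' x) + (h *\<^sub>R f' x) \<bullet> f x) = (*) (2 * (f x \<bullet> f' x))"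
      by (rule ext) (simp add: inner_commute[of "f' x" "f x"])
    ultimately have 1: "((\<lambda>x. (cmod (f x))\<^sup>2) has_real_derivative 2 * (f x \<bullet> f' x)) (at x)"
      unfolding has_field_derivative_def power2_norm_eq_inner by simp
    have "(g has_real_derivative g' x) (at x)"
      unfolding g_def[abs_def] g'_def using DERIV_mult[OF c'[OF x] 1] by (simp add: mult.commute add.commute)
    then show ?thesis
      by (simp add: has_real_derivative_iff_has_vector_derivative has_vector_derivative_at_within)
  qed
  have "(g' has_integral (g (d - \<epsilon>) - g \<epsilon>)) ?I"
    by (rule fundamental_theorem_of_calculus[OF _ g']) (use \<epsilon> in auto)
  moreover have "g (d - \<epsilon>) = 0" "g \<epsilon> = 0" using zero[of \<epsilon>] zero[of "d - \<epsilon>"] \<epsilon> by (auto simp: g_def)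
  ultimately have Ig': "(g' has_integral 0) ?I" by simp
  have pt: "(pi / d)\<^sup>2 * (cmod (f x))\<^sup>2 + g' x <= (cmod (f' x))\<^sup>2" for x
  proof -
    have "0 <= (cmod (f' x - c x *\<^sub>R f x))\<^sup>2" by simp
    also have "... = (cmod (f' x))\<^sup>2 - 2 * c x * (f x \<bullet> f' x) + (c x)\<^sup>2 * (cmod (f x))\<^sup>2"
      unfolding power2_norm_eq_inner
      by (simp add: inner_diff_left inner_diff_right inner_commute power2_eq_square algebra_simps)
    finally show ?thesis by (simp add: g'_def algebra_simps)
  qed
  have "(pi / d)\<^sup>2 * integral ?I (\<lambda>x. (cmod (f x))\<^sup>2) + 0 <= integral ?I (\<lambda>x. (cmod (f' x))\<^sup>2)"
  proof (rule has_integral_le[OF has_integral_add[OF has_integral_mult_right[OF integrable_integral] Ig'] integrable_integral])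
    show "(\<lambda>x. (cmod (f x))\<^sup>2) integrable_on ?I" "(\<lambda>x. (cmod (f' x))\<^sup>2) integrable_on ?I"
      by (intro integrable_continuous_real continuous_intros fc f'c)+
  qed (rule pt)
  moreover have "integral {0..d} (\<lambda>x. (cmod (h x))\<^sup>2) = integral ?I (\<lambda>x. (cmod (h x))\<^sup>2)"
    if h: "!!x. x \<notin> ?I ==> h x = 0" for h :: "real => complex"
  proof -
    have "(\<lambda>x. if x \<in> {0..d} then (cmod (h x))\<^sup>2 else 0) = (\<lambda>x. if x \<in> ?I then (cmod (h x))\<^sup>2 else 0)"
      using h \<epsilon> by (fastforce simp: fun_eq_iff)
    then show ?thesis
      using Henstock_Kurzweil_Integration.integral_restrict_UNIV[of "{0..d}" "\<lambda>x. (cmod (h x))\<^sup>2"]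
        Henstock_Kurzweil_Integration.integral_restrict_UNIV[of ?I "\<lambda>x. (cmod (h x))\<^sup>2"] by metis
  qed
  moreover have "f' x = 0" if "x \<notin> ?I" for x
  proof -
    have "(f has_vector_derivative 0) (at x)"
    proof (rule has_vector_derivative_transform_within_open[OF has_vector_derivative_const[of 0], where S = "- {2 * \<epsilon>..d - 2 * \<epsilon>}"])
      show "x \<in> - {2 * \<epsilon>..d - 2 * \<epsilon>}" using that \<epsilon> by auto
    qed (use zero in auto)
    then show ?thesis using vector_derivative_unique_at[OF der] by blast
  qed
  moreover have "f x = 0" if "x \<notin> ?I" for x using that zero[of x] \<epsilon> by auto
  ultimately show ?thesis by simp
qed

lemma integral_subdivide:
  fixes g :: "real => 'b::banach"
  assumes g: "!!X. continuous_on X g" and r: "r \<ge> 0"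
  shows "integral {x0..x0 + real m * r} g = (\<Sum>i<m. integral {x0 + real i * r..x0 + real i * r + r} g)"
proof (induction m)
  case (Suc m)
  have "integral {x0..x0 + real m * r} g + integral {x0 + real m * r..x0 + real (Suc m) * r} g = integral {x0..x0 + real (Suc m) * r} g"
    using r by (intro Henstock_Kurzweil_Integration.integral_combine integrable_continuous_real g) (auto simp: algebra_simps)
  then show ?case using Suc by (simp add: algebra_simps)
qed simp

text \<open>The quantitative form of the compactness of the embedding of \<open>H\<^sup>1\<close> into \<open>L\<^sup>2\<close>: up to a small multiple of
  the Dirichlet integral, the \<open>L\<^sup>2\<close> norm is controlled by finitely many means.\<close>

lemma Rellich_rectangle:
  fixes N d \<epsilon> :: real
  assumes N: "N > 0" and d: "d > 0" and \<epsilon>: "\<epsilon> > 0"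
  obtains I :: "(nat \<times> nat) set" and Q :: "nat \<times> nat => (real \<times> real) set" and \<kappa> :: real
  where "finite I" "\<kappa> \<ge> 0" "!!i. i \<in> I ==> \<exists>x y. Q i = cbox x y"
    "!!w :: real \<times> real => complex. C_k 1 w ==>
      integral (cbox (-N, 0) (N, d)) (\<lambda>p. (cmod (w p))\<^sup>2) <= \<kappa> * (\<Sum>i\<in>I. (cmod (integral (Q i) w))\<^sup>2)
        + \<epsilon> * (integral (cbox (-N, 0) (N, d)) (\<lambda>p. (cmod (D1 w p))\<^sup>2)
             + integral (cbox (-N, 0) (N, d)) (\<lambda>p. (cmod (D2 w p))\<^sup>2))"
proof -
  obtain m :: nat where m: "max 1 (max (2 * N / sqrt \<epsilon>) (d / sqrt \<epsilon>)) < real m" using reals_Archimedean2 by blast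
  have m0: "real m > 0" using m by simp
  define r t where "r = 2 * N / real m" and "t = d / real m"
  have rt: "r > 0" "t > 0" using N d m0 by (auto simp: r_def t_def)
  have sq\<epsilon>: "sqrt \<epsilon> > 0" using \<epsilon> by simp
  have "2 * N < real m * sqrt \<epsilon>" "d < real m * sqrt \<epsilon>"
    using m sq\<epsilon> by (auto simp: pos_divide_less_eq)
  then have "r <= sqrt \<epsilon>" "t <= sqrt \<epsilon>"
    using m0 by (auto simp: r_def t_def pos_divide_le_eq mult.commute)
  then have "r\<^sup>2 <= (sqrt \<epsilon>)\<^sup>2" "t\<^sup>2 <= (sqrt \<epsilon>)\<^sup>2" using rt by (auto intro!: power_mono)
  then have small: "r\<^sup>2 <= \<epsilon>" "t\<^sup>2 <= \<epsilon>" using \<epsilon> by auto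
  define Q :: "nat \<times> nat => (real \<times> real) set" where
    "Q i = cbox (-N + real (fst i) * r, 0 + real (snd i) * t) (-N + real (fst i) * r + r, 0 + real (snd i) * t + t)" for i
  define I :: "(nat \<times> nat) set" where "I = {..<m} \<times> {..<m}"
  let ?R = "cbox (-N, 0) (N, d)"
  have split: "integral ?R g = (\<Sum>i\<in>I. integral (Q i) g)" if g: "!!X. continuous_on X g" for g :: "real \<times> real => real"
  proof -
    have sl: "continuous_on X (\<lambda>u. g (s, u))" for X s
      by (rule continuous_on_compose2[OF g[of UNIV]]) (auto intro!: continuous_intros)
    have par: "continuous_on X (\<lambda>s. integral {p..q} (\<lambda>u. g (s, u)))" for X p q
      unfolding cbox_interval[symmetric]
      by (rule integral_continuous_on_param) (auto simp: split_beta intro!: continuous_on_compose2[OF g[of UNIV]] continuous_intros)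
    have cell: "integral (Q (i, j)) g = integral {-N + real i * r..-N + real i * r + r}
        (\<lambda>s. integral {0 + real j * t..0 + real j * t + t} (\<lambda>u. g (s, u)))" for i j
      unfolding Q_def using integral_prod_continuous[OF g, of "-N + real i * r" "0 + real j * t" "-N + real i * r + r" "0 + real j * t + t"]
      by (simp add: cbox_interval)
    have ends: "N = -N + real m * r" "d = 0 + real m * t" using m0 by (auto simp: r_def t_def)
    have "integral ?R g = integral {-N..N} (\<lambda>s. integral {0..d} (\<lambda>u. g (s, u)))"
      using integral_prod_continuous[OF g, of "-N" 0 N d] by (simp add: cbox_interval)
    also have "... = integral {-N..-N + real m * r} (\<lambda>s. integral {0..0 + real m * t} (\<lambda>u. g (s, u)))"
      unfolding ends(1)[symmetric] ends(2)[symmetric] ..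
    also have "... = (\<Sum>i<m. integral {-N + real i * r..-N + real i * r + r} (\<lambda>s. integral {0..0 + real m * t} (\<lambda>u. g (s, u))))"
      using rt by (intro integral_subdivide par) auto
    also have "... = (\<Sum>i<m. integral {-N + real i * r..-N + real i * r + r}
        (\<lambda>s. \<Sum>j<m. integral {0 + real j * t..0 + real j * t + t} (\<lambda>u. g (s, u))))"
      using rt by (subst integral_subdivide[OF sl]) auto
    also have "... = (\<Sum>i<m. \<Sum>j<m. integral (Q (i, j)) g)"
      unfolding cell by (intro sum.cong refl integral_sum integrable_continuous_real par) auto
    finally show ?thesis by (simp add: I_def sum.cartesian_product)
  qed
  have "integral ?R (\<lambda>p. (cmod (w p))\<^sup>2) <= 1 / (r * t) * (\<Sum>i\<in>I. (cmod (integral (Q i) w))\<^sup>2)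
        + \<epsilon> * (integral ?R (\<lambda>p. (cmod (D1 w p))\<^sup>2) + integral ?R (\<lambda>p. (cmod (D2 w p))\<^sup>2))"
    if w: "C_k 1 w" for w :: "real \<times> real => complex"
  proof -
    have c: "continuous_on X w" "continuous_on X (D1 w)" "continuous_on X (D2 w)" for X
      using C1_continuous[OF w] w by (auto simp: C1_iff Basis_plane intro: continuous_on_subset)
    have sp: "integral ?R (\<lambda>p. (cmod (g p))\<^sup>2) = (\<Sum>i\<in>I. integral (Q i) (\<lambda>p. (cmod (g p))\<^sup>2))"
      if "!!X. continuous_on X g" for g :: "real \<times> real => complex"
      by (intro split continuous_intros that)
    have nn: "0 <= integral (Q i) (\<lambda>p. (cmod (g p))\<^sup>2)" if "!!X. continuous_on X g" for g :: "real \<times> real => complex" and i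
      unfolding Q_def by (intro integral_nonneg integrable_continuous continuous_intros that) auto
    have "integral ?R (\<lambda>p. (cmod (w p))\<^sup>2) = (\<Sum>i\<in>I. integral (Q i) (\<lambda>p. (cmod (w p))\<^sup>2))" by (rule sp[OF c(1)])
    also have "... <= (\<Sum>i\<in>I. 1 / (r * t) * (cmod (integral (Q i) w))\<^sup>2
        + \<epsilon> * (integral (Q i) (\<lambda>p. (cmod (D1 w p))\<^sup>2) + integral (Q i) (\<lambda>p. (cmod (D2 w p))\<^sup>2)))"
    proof (rule sum_mono)
      fix i
      have "r\<^sup>2 * integral (Q i) (\<lambda>p. (cmod (D1 w p))\<^sup>2) <= \<epsilon> * integral (Q i) (\<lambda>p. (cmod (D1 w p))\<^sup>2)"
        "t\<^sup>2 * integral (Q i) (\<lambda>p. (cmod (D2 w p))\<^sup>2) <= \<epsilon> * integral (Q i) (\<lambda>p. (cmod (D2 w p))\<^sup>2)"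
        by (rule mult_right_mono[OF small(1) nn[OF c(2)]], rule mult_right_mono[OF small(2) nn[OF c(3)]])
      then show "integral (Q i) (\<lambda>p. (cmod (w p))\<^sup>2) <= 1 / (r * t) * (cmod (integral (Q i) w))\<^sup>2
        + \<epsilon> * (integral (Q i) (\<lambda>p. (cmod (D1 w p))\<^sup>2) + integral (Q i) (\<lambda>p. (cmod (D2 w p))\<^sup>2))"
        using Poincare_rectangle[OF w rt, of "-N + real (fst i) * r" "0 + real (snd i) * t"]
        unfolding Q_def[symmetric] by (simp add: distrib_left)
    qed
    also have "... = 1 / (r * t) * (\<Sum>i\<in>I. (cmod (integral (Q i) w))\<^sup>2)
        + \<epsilon> * (integral ?R (\<lambda>p. (cmod (D1 w p))\<^sup>2) + integral ?R (\<lambda>p. (cmod (D2 w p))\<^sup>2))"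
      by (simp add: sp[OF c(2)] sp[OF c(3)] sum.distrib sum_distrib_left distrib_left sum_divide_distrib)
    finally show ?thesis .
  qed
  then show ?thesis
    by (intro that[of I "1 / (r * t)" Q]) (use rt in \<open>auto simp: I_def Q_def\<close>)
qed

section \<open>The spectrum below the threshold\<close>

locale magnetic_strip = strip a b d \<beta> + bounded_potential "strip.\<Omega> a b d" A B
  for a b :: "real => real" and d \<beta> :: real and A :: "real \<times> real => real \<times> real" and B :: real +
  assumes A_small: "\<eta> > 0 ==> \<exists>N\<ge>0. \<forall>p\<in>S. \<bar>fst p\<bar> \<ge> N --> (\<forall>e\<in>Basis. \<bar>A (F p) \<bullet> e\<bar> <= \<eta>)"
begin

text \<open>The magnetic term is split off at the price of a factor \<open>1 - \<delta>\<close> in front of the gradient.\<close>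

lemma norm_add_sq_ge:
  fixes x y :: complex
  assumes "0 < \<delta>"
  shows "(1 - \<delta>) * (cmod x)\<^sup>2 - 1 / \<delta> * (cmod y)\<^sup>2 <= (cmod (x + y))\<^sup>2"
proof -
  have 1: "(cmod x - cmod y)\<^sup>2 <= (cmod (x + y))\<^sup>2"
    using norm_triangle_ineq3[of x "-y"] by (metis abs_ge_zero diff_minus_eq_add norm_minus_cancel power2_abs power_mono)
  have "0 <= (\<delta> * cmod x - cmod y)\<^sup>2 / \<delta>" using assms by simp
  also have "... = \<delta> * (cmod x)\<^sup>2 - 2 * cmod x * cmod y + (cmod y)\<^sup>2 / \<delta>"
    using assms by (simp add: power2_eq_square field_simps)
  finally have 2: "2 * cmod x * cmod y <= \<delta> * (cmod x)\<^sup>2 + (cmod y)\<^sup>2 / \<delta>" by simp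
  have "(1 - \<delta>) * (cmod x)\<^sup>2 - 1 / \<delta> * (cmod y)\<^sup>2 <= (cmod x)\<^sup>2 - 2 * cmod x * cmod y"
    using 2 by (simp add: algebra_simps)
  also have "... <= (cmod x - cmod y)\<^sup>2" by (simp add: power2_diff)
  finally show ?thesis using 1 by simp
qed

lemma gradient_norm:
  assumes "C_k 1 \<psi>" "supported_in \<Omega> \<psi>" "p \<in> S"
  shows "(cmod (D1 \<psi> (F p)))\<^sup>2 + (cmod (D2 \<psi> (F p)))\<^sup>2
    = (cmod (D1 (pull \<psi>) p))\<^sup>2 / (J p)\<^sup>2 + (cmod (D2 (pull \<psi>) p))\<^sup>2"
proof -
  have "complex_of_real ((cmod (D1 \<psi> (F p)))\<^sup>2 + (cmod (D2 \<psi> (F p)))\<^sup>2)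
    = complex_of_real ((cmod (D1 (pull \<psi>) p))\<^sup>2 / (J p)\<^sup>2 + (cmod (D2 (pull \<psi>) p))\<^sup>2)"
    using gradient_inner[OF assms(1,2,1,2,3)] by (simp add: mult_cnj_self)
  then show ?thesis by (simp only: of_real_eq_iff)
qed

text \<open>A continuous lower bound, in the coordinates \<open>(s, u)\<close>, for the density of the form minus \<open>\<mu>\<close>. The coefficient
  of \<open>|w\<^sub>s|\<^sup>2\<close> uses \<open>J < 2\<close>.\<close>

definition lower_density :: "real => real => (real \<times> real => complex) => real \<times> real => real" where
  "lower_density \<delta> \<mu> w p = (1 - \<delta>) / 2 * (cmod (D1 w p))\<^sup>2
    + (1 - \<delta>) * J p * (cmod (D2 w p))\<^sup>2
    - J p * (1 / \<delta> * ((A (F p) \<bullet> (1, 0))\<^sup>2 + (A (F p) \<bullet> (0, 1))\<^sup>2) + \<mu>) * (cmod (w p))\<^sup>2"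

lemma lower_density_le:
  assumes \<psi>: "C_k 1 \<psi>" "supported_in \<Omega> \<psi>" and p: "p \<in> S" and \<delta>: "0 < \<delta>" "\<delta> < 1"
  shows "lower_density \<delta> \<mu> (pull \<psi>) p
    <= J p * ((\<Sum>e\<in>Basis. (cmod (classical_mp e \<psi> (F p)))\<^sup>2) - \<mu> * (cmod (\<psi> (F p)))\<^sup>2)"
proof -
  let ?x = "D1 \<psi> (F p)" and ?y = "D2 \<psi> (F p)" and ?z = "\<psi> (F p)"
  let ?ws = "(cmod (D1 (pull \<psi>) p))\<^sup>2" and ?wu = "(cmod (D2 (pull \<psi>) p))\<^sup>2"
  let ?a1 = "A (F p) \<bullet> (1, 0)" and ?a2 = "A (F p) \<bullet> (0, 1)"
  have J: "0 < J p" "J p < 2" using J_pos[OF p] J_less_2[OF p] .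
  have mp: "(1 - \<delta>) * (cmod (partial_deriv e \<psi> (F p)))\<^sup>2 - 1 / \<delta> * ((A (F p) \<bullet> e)\<^sup>2 * (cmod ?z)\<^sup>2) <= (cmod (classical_mp e \<psi> (F p)))\<^sup>2" for e
    using norm_add_sq_ge[OF \<delta>(1), of "\<i> * partial_deriv e \<psi> (F p)" "of_real (A (F p) \<bullet> e) * ?z"]
    by (simp add: classical_mp_def norm_mult power_mult_distrib)
  have "(1 - \<delta>) * (?ws / (J p)\<^sup>2 + ?wu) - 1 / \<delta> * (?a1\<^sup>2 + ?a2\<^sup>2) * (cmod ?z)\<^sup>2
      <= (\<Sum>e\<in>Basis. (cmod (classical_mp e \<psi> (F p)))\<^sup>2)"
    using mp[of "(1, 0)"] mp[of "(0, 1)"] unfolding gradient_norm[OF \<psi> p, symmetric]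
    by (simp add: sum_Basis_plane algebra_simps add_divide_distrib)
  then have "J p * ((1 - \<delta>) * (?ws / (J p)\<^sup>2 + ?wu) - 1 / \<delta> * (?a1\<^sup>2 + ?a2\<^sup>2) * (cmod ?z)\<^sup>2 - \<mu> * (cmod ?z)\<^sup>2)
      <= J p * ((\<Sum>e\<in>Basis. (cmod (classical_mp e \<psi> (F p)))\<^sup>2) - \<mu> * (cmod ?z)\<^sup>2)"
    using J by (intro mult_left_mono) auto
  moreover have "J p * ((1 - \<delta>) * (?ws / (J p)\<^sup>2)) \<ge> (1 - \<delta>) / 2 * ?ws"
  proof -
    have "J p * ((1 - \<delta>) * (?ws / (J p)\<^sup>2)) = (1 - \<delta>) * ?ws * (1 / J p)" using J by (simp add: power2_eq_square)
    moreover have "1 / 2 <= 1 / J p" using J by (simp add: field_simps)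
    then have "(1 - \<delta>) * ?ws * (1 / 2) <= (1 - \<delta>) * ?ws * (1 / J p)" using \<delta> by (intro mult_left_mono) auto
    ultimately show ?thesis by simp
  qed
  moreover have alg: "j * ((1 - \<delta>) * (X + U) - k * c * Z - \<mu> * Z) = j * ((1 - \<delta>) * X) + (1 - \<delta>) * j * U - j * (k * c + \<mu>) * Z"
    for j X U k c Z :: real by (simp add: algebra_simps)
  ultimately show ?thesis unfolding lower_density_def pull_S[OF p]
    using alg[of "J p" "?ws / (J p)\<^sup>2" ?wu "1 / \<delta>" "?a1\<^sup>2 + ?a2\<^sup>2" "(cmod ?z)\<^sup>2"] by linarith
qed

lemma lower_density_outside:
  assumes "closed K" "!!x. x \<notin> K ==> w x = 0" "p \<notin> K"
  shows "lower_density \<delta> \<mu> w p = 0"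
  using assms partial_deriv_eq_0_outside[OF assms(1), of w p] by (simp add: lower_density_def)

lemma continuous_lower_density:
  assumes "C_k 1 w"
  shows "continuous_on X (lower_density \<delta> \<mu> w)"
proof -
  have c: "continuous_on X w" "continuous_on X (D1 w)" "continuous_on X (D2 w)"
    using C1_continuous[OF assms] assms by (auto simp: C1_iff Basis_plane intro: continuous_on_subset)
  have AF: "continuous_on X (\<lambda>p. A (F p))" by (rule continuous_on_compose2[OF A_cont continuous_F]) auto
  show ?thesis unfolding lower_density_def[abs_def] by (intro continuous_intros c AF continuous_J)
qed

lemma integral_lower_density_le:
  assumes \<psi>: "\<psi> \<in> test_functions \<Omega>" and \<delta>: "0 < \<delta>" "\<delta> < 1"
  shows "(\<integral>p. lower_density \<delta> \<mu> (pull \<psi>) p \<partial>lborel) + \<mu> * (L2_norm L \<psi>)\<^sup>2 <= (\<Sum>e\<in>Basis. (L2_norm L (classical_mp e \<psi>))\<^sup>2)"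
proof -
  note C = test_functionsD(2,3)[OF \<psi>]
  let ?f = "\<lambda>q. (\<Sum>e\<in>Basis. (cmod (classical_mp e \<psi> q))\<^sup>2) - \<mu> * (cmod (\<psi> q))\<^sup>2"
  have int1: "integrable L (\<lambda>q. (cmod (classical_mp e \<psi> q))\<^sup>2)" if "e \<in> Basis" for e
    by (rule L2_integrable[OF classical_mp(2)[OF C that]])
  have int2: "integrable L (\<lambda>q. (cmod (\<psi> q))\<^sup>2)" by (rule L2_integrable[OF test_L2[OF open_\<Omega> \<psi>]])
  have int: "integrable L ?f" using int1 int2 by (intro Bochner_Integration.integrable_diff Bochner_Integration.integrable_sum) auto
  have "(\<integral>q. ?f q \<partial>L) = (\<Sum>e\<in>Basis. (L2_norm L (classical_mp e \<psi>))\<^sup>2) - \<mu> * (L2_norm L \<psi>)\<^sup>2"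
    unfolding L2_norm_sq using int1 int2
    by (subst Bochner_Integration.integral_diff) (auto intro!: Bochner_Integration.integrable_sum simp: Bochner_Integration.integral_sum)
  moreover have "(\<integral>q. ?f q \<partial>L) = (\<integral>p. J p *\<^sub>R ?f (F p) \<partial>lborel_on S)" "integrable (lborel_on S) (\<lambda>p. J p *\<^sub>R ?f (F p))"
    using integral_\<Omega>[OF borel_measurable_integrable[OF int]] int by simp_all
  moreover have "(\<integral>p. lower_density \<delta> \<mu> (pull \<psi>) p \<partial>lborel_on S) <= (\<integral>p. J p *\<^sub>R ?f (F p) \<partial>lborel_on S)"
  proof (rule integral_mono[OF _ calculation(3)])
    obtain K where K: "compact K" "K \<subseteq> S" "!!x. x \<notin> K ==> pull \<psi> x = 0" using pull_C1(2)[OF C] unfolding supported_in_def by blast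
    have z: "lower_density \<delta> \<mu> (pull \<psi>) p = 0" if "p \<notin> K" for p
      by (rule lower_density_outside[OF compact_imp_closed[OF K(1)] K(3) that])
    have "integrable lborel (lower_density \<delta> \<mu> (pull \<psi>))"
      by (rule integrable_compact_support[OF continuous_lower_density[OF pull_C1(1)[OF C]] K(1) z])
    then have "integrable lborel (\<lambda>p. indicator S p *\<^sub>R lower_density \<delta> \<mu> (pull \<psi>) p)"
      by (intro integrable_mult_indicator) auto
    then show "integrable (lborel_on S) (lower_density \<delta> \<mu> (pull \<psi>))" by (subst integrable_restrict_space) auto
    show "lower_density \<delta> \<mu> (pull \<psi>) p <= J p *\<^sub>R ?f (F p)" if "p \<in> space (lborel_on S)" for p
      using lower_density_le[OF C _ \<delta>, of p \<mu>] that by (simp add: space_restrict_space)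
  qed
  moreover have "(\<integral>p. lower_density \<delta> \<mu> (pull \<psi>) p \<partial>lborel_on S) = (\<integral>p. lower_density \<delta> \<mu> (pull \<psi>) p \<partial>lborel)"
  proof (rule integral_on_supported[OF open_S])
    obtain K where K: "compact K" "K \<subseteq> S" "!!x. x \<notin> K ==> pull \<psi> x = 0" using pull_C1(2)[OF C] unfolding supported_in_def by blast
    fix p assume "p \<notin> S"
    then show "lower_density \<delta> \<mu> (pull \<psi>) p = 0"
      using K(2) by (intro lower_density_outside[OF compact_imp_closed[OF K(1)] K(3)]) auto
  qed
  ultimately show ?thesis by linarith
qed

lemma supported_in_S_margin:
  assumes K: "compact K" "K \<subseteq> S"
  shows "\<exists>\<epsilon>>0. 2 * \<epsilon> < d \<and> (\<forall>p\<in>K. 2 * \<epsilon> <= snd p \<and> snd p <= d - 2 * \<epsilon>)"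
proof (cases "K = {}")
  case True
  then show ?thesis using d_pos by (intro exI[of _ "d / 4"]) auto
next
  case False
  have cont: "continuous_on K (\<lambda>p. min (snd p) (d - snd p))" by (intro continuous_intros)
  obtain q where q: "q \<in> K" "\<forall>p\<in>K. min (snd q) (d - snd q) <= min (snd p) (d - snd p)"
    using continuous_attains_inf[OF K(1) False cont] by blast
  define m where "m = min (snd q) (d - snd q)"
  have m: "m > 0" "m < d" using q(1) K(2) mem_S[of q] by (auto simp: m_def)
  have "2 * (m / 2) <= snd p \<and> snd p <= d - 2 * (m / 2)" if "p \<in> K" for p using q(2) that by (auto simp: m_def)
  then show ?thesis using m by (intro exI[of _ "m / 2"]) auto
qed

text \<open>Far out the density is at least \<open>(1 - \<delta>)\<^sup>2 |w\<^sub>u|\<^sup>2 - (1 + \<delta>) (\<mu> + \<delta>) |w|\<^sup>2\<close>, so \<open>gap\<close> reduces the claim to the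
  Dirichlet inequality on the fibre.\<close>

lemma fibre_nonneg:
  assumes w: "C_k 1 w" "supported_in S w" and \<delta>: "0 < \<delta>" "\<delta> < 1" and \<mu>: "\<mu> > 0"
    and gap: "(1 + \<delta>) * (\<mu> + \<delta>) <= (1 - \<delta>) * (1 - \<delta>) * (pi / d)\<^sup>2"
    and J1: "!!u. (s, u) \<in> S ==> \<bar>J (s, u) - 1\<bar> <= \<delta>"
    and A1: "!!u. (s, u) \<in> S ==> \<bar>A (F (s, u)) \<bullet> (1, 0)\<bar> <= \<delta> / 2 \<and> \<bar>A (F (s, u)) \<bullet> (0, 1)\<bar> <= \<delta> / 2"
  shows "0 <= integral {0..d} (\<lambda>u. lower_density \<delta> \<mu> w (s, u))"
proof -
  obtain K where K: "compact K" "K \<subseteq> S" "!!x. x \<notin> K ==> w x = 0" using w(2) unfolding supported_in_def by blast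
  obtain \<epsilon> where \<epsilon>: "\<epsilon> > 0" "2 * \<epsilon> < d" "\<forall>p\<in>K. 2 * \<epsilon> <= snd p \<and> snd p <= d - 2 * \<epsilon>"
    using supported_in_S_margin[OF K(1,2)] by blast
  let ?wu = "D2 w"
  have c: "continuous_on X w" "continuous_on X ?wu" for X
    using C1_continuous[OF w(1)] w(1) by (auto simp: C1_iff Basis_plane intro: continuous_on_subset)
  have sl: "continuous_on X (\<lambda>u. g (s, u))" if "!!Y. continuous_on Y g" for g :: "real \<times> real => 'b::topological_space" and X
    by (rule continuous_on_compose2[OF that[of UNIV]]) (auto intro!: continuous_intros)
  have der: "((\<lambda>u. w (s, u)) has_vector_derivative ?wu (s, u)) (at u)" for u
  proof -
    have D: "(w has_derivative frechet_derivative w (at (s, u))) (at (s, u))"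
      using w(1) by (simp add: C1_iff frechet_derivative_works)
    have "((\<lambda>u. w (s, u)) has_derivative (\<lambda>h. frechet_derivative w (at (s, u)) (0, h))) (at u)"
      using D by (rule has_derivative_compose[rotated]) (auto intro!: derivative_eq_intros)
    moreover have "frechet_derivative w (at (s, u)) (0, h) = h *\<^sub>R ?wu (s, u)" for h
      using linear_scale[OF has_derivative_linear[OF D], of h "(0, 1)"] by (simp add: partial_deriv_def)
    ultimately show ?thesis by (simp add: has_vector_derivative_def)
  qed
  have Dir: "(pi / d)\<^sup>2 * integral {0..d} (\<lambda>u. (cmod (w (s, u)))\<^sup>2) <= integral {0..d} (\<lambda>u. (cmod (?wu (s, u)))\<^sup>2)"
    by (rule Dirichlet_interval[OF der sl[OF c(2)] \<epsilon>(1,2)]) (use \<epsilon>(3) K(3) in force)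
  have pt: "(1 - \<delta>) * (1 - \<delta>) * (cmod (?wu (s, u)))\<^sup>2 - (1 + \<delta>) * (\<mu> + \<delta>) * (cmod (w (s, u)))\<^sup>2 <= lower_density \<delta> \<mu> w (s, u)" for u
  proof (cases "(s, u) \<in> S")
    case True
    let ?a1 = "A (F (s, u)) \<bullet> (1, 0)" and ?a2 = "A (F (s, u)) \<bullet> (0, 1)"
    have J: "1 - \<delta> <= J (s, u)" "J (s, u) <= 1 + \<delta>" using J1[OF True] by (auto simp: abs_le_iff)
    have "?a1\<^sup>2 <= (\<delta> / 2)\<^sup>2" "?a2\<^sup>2 <= (\<delta> / 2)\<^sup>2"
      using A1[OF True] \<delta> by (auto intro: abs_le_square_iff[THEN iffD1])
    then have "1 / \<delta> * (?a1\<^sup>2 + ?a2\<^sup>2) <= 1 / \<delta> * ((\<delta> / 2)\<^sup>2 + (\<delta> / 2)\<^sup>2)" using \<delta> by (intro mult_left_mono) auto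
    also have "... <= \<delta>" using \<delta> by (simp add: power2_eq_square)
    finally have "1 / \<delta> * (?a1\<^sup>2 + ?a2\<^sup>2) + \<mu> <= \<mu> + \<delta>" by simp
    then have "J (s, u) * (1 / \<delta> * (?a1\<^sup>2 + ?a2\<^sup>2) + \<mu>) <= (1 + \<delta>) * (\<mu> + \<delta>)"
      using J \<delta> \<mu> by (intro mult_mono add_nonneg_nonneg mult_nonneg_nonneg) auto
    then have "J (s, u) * (1 / \<delta> * (?a1\<^sup>2 + ?a2\<^sup>2) + \<mu>) * (cmod (w (s, u)))\<^sup>2 <= (1 + \<delta>) * (\<mu> + \<delta>) * (cmod (w (s, u)))\<^sup>2"
      by (intro mult_right_mono) auto
    moreover have "(1 - \<delta>) * (1 - \<delta>) * (cmod (?wu (s, u)))\<^sup>2 <= (1 - \<delta>) * J (s, u) * (cmod (?wu (s, u)))\<^sup>2"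
      using J \<delta> by (intro mult_right_mono mult_left_mono) auto
    moreover have "0 <= (1 - \<delta>) / 2 * (cmod (D1 w (s, u)))\<^sup>2" using \<delta> by simp
    ultimately show ?thesis unfolding lower_density_def by linarith
  next
    case False
    then have "(s, u) \<notin> K" using K(2) by blast
    then show ?thesis
      using K(3) partial_deriv_eq_0_outside[OF compact_imp_closed[OF K(1)] K(3)] lower_density_outside[OF compact_imp_closed[OF K(1)] K(3)]
      by simp
  qed
  have "0 <= (1 - \<delta>) * (1 - \<delta>) * integral {0..d} (\<lambda>u. (cmod (?wu (s, u)))\<^sup>2) - (1 + \<delta>) * (\<mu> + \<delta>) * integral {0..d} (\<lambda>u. (cmod (w (s, u)))\<^sup>2)"
  proof -
    let ?W = "integral {0..d} (\<lambda>u. (cmod (w (s, u)))\<^sup>2)"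
    have "?W \<ge> 0" by (intro integral_nonneg integrable_continuous_real continuous_intros sl c) auto
    then have "(1 + \<delta>) * (\<mu> + \<delta>) * ?W <= (1 - \<delta>) * (1 - \<delta>) * (pi / d)\<^sup>2 * ?W" using gap by (intro mult_right_mono)
    also have "... = (1 - \<delta>) * (1 - \<delta>) * ((pi / d)\<^sup>2 * ?W)" by simp
    also have "... <= (1 - \<delta>) * (1 - \<delta>) * integral {0..d} (\<lambda>u. (cmod (?wu (s, u)))\<^sup>2)"
      using Dir \<delta> by (intro mult_left_mono) auto
    finally show ?thesis by simp
  qed
  also have "... = integral {0..d} (\<lambda>u. (1 - \<delta>) * (1 - \<delta>) * (cmod (?wu (s, u)))\<^sup>2 - (1 + \<delta>) * (\<mu> + \<delta>) * (cmod (w (s, u)))\<^sup>2)"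
    by (subst Henstock_Kurzweil_Integration.integral_diff) (auto intro!: integrable_continuous_real continuous_intros sl c)
  also have "... <= integral {0..d} (\<lambda>u. lower_density \<delta> \<mu> w (s, u))"
    by (intro integral_le integrable_continuous_real continuous_intros sl c continuous_lower_density w pt)
  finally show ?thesis .
qed

end

context magnetic_strip
begin

text \<open>The inequality is strict at \<open>\<delta> = 0\<close>.\<close>

lemma exists_gap:
  assumes "\<mu> < (pi / d)\<^sup>2"
  shows "\<exists>\<delta>. 0 < \<delta> \<and> \<delta> < 1 \<and> (1 + \<delta>) * (\<mu> + \<delta>) <= (1 - \<delta>) * (1 - \<delta>) * (pi / d)\<^sup>2"
proof -
  let ?f = "\<lambda>\<delta>::real. (1 - \<delta>) * (1 - \<delta>) * (pi / d)\<^sup>2 - (1 + \<delta>) * (\<mu> + \<delta>)"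
  have "(?f \<longlongrightarrow> ?f 0) (at_right 0)" by (intro tendsto_intros)
  then have "eventually (\<lambda>\<delta>. 0 < ?f \<delta>) (at_right 0)" using assms by (intro order_tendstoD) auto
  moreover have "eventually (\<lambda>\<delta>::real. 0 < \<delta> \<and> \<delta> < 1) (at_right 0)"
    by (rule eventually_at_rightI[of 0 1]) auto
  ultimately have "eventually (\<lambda>\<delta>. 0 < ?f \<delta> \<and> 0 < \<delta> \<and> \<delta> < 1) (at_right 0)" by eventually_elim auto
  then obtain \<delta> where "0 < ?f \<delta>" "0 < \<delta>" "\<delta> < 1" using eventually_happens'[OF trivial_limit_at_right_real] by blast
  then show ?thesis by (intro exI[of _ \<delta>]) simp
qed

text \<open>The fibres beyond \<open>\<plusminus>N\<close> contribute nonnegative amounts.\<close>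

lemma integral_lower_density_truncate:
  assumes w: "C_k 1 w" "supported_in S w" and \<delta>: "0 < \<delta>" "\<delta> < 1" and \<mu>: "\<mu> > 0" and N: "N \<ge> 0"
    and gap: "(1 + \<delta>) * (\<mu> + \<delta>) <= (1 - \<delta>) * (1 - \<delta>) * (pi / d)\<^sup>2"
    and J1: "!!p. p \<in> S ==> \<bar>fst p\<bar> \<ge> N ==> \<bar>J p - 1\<bar> <= \<delta>"
    and A1: "!!p e. p \<in> S ==> \<bar>fst p\<bar> \<ge> N ==> e \<in> Basis ==> \<bar>A (F p) \<bullet> e\<bar> <= \<delta> / 2"
  shows "integral (cbox (-N, 0) (N, d)) (lower_density \<delta> \<mu> w) <= (\<integral>p. lower_density \<delta> \<mu> w p \<partial>lborel)"
proof -
  let ?h = "lower_density \<delta> \<mu> w"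
  let ?H = "\<lambda>s. integral {0..d} (\<lambda>u. ?h (s, u))"
  obtain K where K: "compact K" "K \<subseteq> S" "!!x. x \<notin> K ==> w x = 0" using w(2) unfolding supported_in_def by blast
  obtain R where R: "!!p. p \<in> K ==> norm p <= R" using compact_imp_bounded[OF K(1)] unfolding bounded_iff by blast
  define M where "M = max N R"
  have M: "M \<ge> N" by (simp add: M_def)
  have KM: "K \<subseteq> cbox (-M, 0) (M, d)"
  proof
    fix p assume p: "p \<in> K"
    have "\<bar>fst p\<bar> <= M" using R[OF p] norm_fst_le[of "fst p" "snd p"] by (simp add: M_def)
    then show "p \<in> cbox (-M, 0) (M, d)" using K(2) p mem_S[of p] by (cases p) (auto simp: cbox_Pair_eq)
  qed
  have h: "continuous_on X ?h" for X by (rule continuous_lower_density[OF w(1)])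
  have zero: "?h p = 0" if "p \<notin> K" for p by (rule lower_density_outside[OF compact_imp_closed[OF K(1)] K(3) that])
  have H: "?H integrable_on {p..q}" for p q
  proof -
    have "continuous_on {p..q} ?H"
      unfolding cbox_interval[symmetric]
      by (rule integral_continuous_on_param) (auto simp: split_beta intro!: continuous_on_compose2[OF h[of UNIV]] continuous_intros)
    then show ?thesis by (rule integrable_continuous_real)
  qed
  have box: "integral (cbox (-X, 0) (X, d)) ?h = integral {-X..X} ?H" for X
    using integral_prod_continuous[OF h, of "-X" 0 X d] by (simp add: cbox_interval)
  have nonneg: "0 <= ?H s" if "\<bar>s\<bar> \<ge> N" for s
    by (rule fibre_nonneg[OF w \<delta> \<mu> gap]) (use that J1 A1 in \<open>auto simp: Basis_plane\<close>)
  have nn: "0 <= integral {-M..-N} ?H" "0 <= integral {N..M} ?H"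
    by (intro integral_nonneg H nonneg; use N in auto)+
  have "(\<integral>p. ?h p \<partial>lborel) = integral (cbox (-M, 0) (M, d)) ?h"
    by (rule integral_cbox_eq_lborel[symmetric, OF h]) (use zero KM in blast)
  also have "... = integral {-M..-N} ?H + (integral {-N..N} ?H + integral {N..M} ?H)"
    unfolding box using M N by (simp add: Henstock_Kurzweil_Integration.integral_combine H)
  finally show ?thesis unfolding box using nn by linarith
qed

lemma lower_density_ge:
  assumes w: "supported_in S w" and \<delta>: "0 < \<delta>" "\<delta> < 1" and \<mu>: "\<mu> > 0" and j: "0 < j" "!!p. p \<in> S ==> j <= J p"
  shows "(1 - \<delta>) * min (1 / 2) j * ((cmod (D1 w p))\<^sup>2 + (cmod (D2 w p))\<^sup>2)
    - 2 * (1 / \<delta> * (2 * B\<^sup>2) + \<mu>) * (cmod (w p))\<^sup>2 <= lower_density \<delta> \<mu> w p"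
proof (cases "p \<in> S")
  case True
  let ?a1 = "A (F p) \<bullet> (1, 0)" and ?a2 = "A (F p) \<bullet> (0, 1)"
  let ?ws = "(cmod (D1 w p))\<^sup>2" and ?wu = "(cmod (D2 w p))\<^sup>2"
  have "?a1\<^sup>2 <= B\<^sup>2" "?a2\<^sup>2 <= B\<^sup>2"
    using A_bound[of "F p"] F_\<Omega>[OF True] B_nonneg unfolding abs_le_square_iff[symmetric] by (auto simp: Basis_plane \<Omega>_def)
  then have "J p * (1 / \<delta> * (?a1\<^sup>2 + ?a2\<^sup>2) + \<mu>) <= 2 * (1 / \<delta> * (2 * B\<^sup>2) + \<mu>)"
    using J_pos[OF True] J_less_2[OF True] \<delta> \<mu> by (intro mult_mono add_mono mult_left_mono add_nonneg_nonneg mult_nonneg_nonneg) auto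
  then have "J p * (1 / \<delta> * (?a1\<^sup>2 + ?a2\<^sup>2) + \<mu>) * (cmod (w p))\<^sup>2 <= 2 * (1 / \<delta> * (2 * B\<^sup>2) + \<mu>) * (cmod (w p))\<^sup>2"
    by (intro mult_right_mono) auto
  moreover have "(1 - \<delta>) * min (1 / 2) j * ?ws <= (1 - \<delta>) / 2 * ?ws"
    using \<delta> mult_left_mono[of "min (1 / 2) j" "1 / 2" "1 - \<delta>"] by (intro mult_right_mono) auto
  moreover have "(1 - \<delta>) * min (1 / 2) j * ?wu <= (1 - \<delta>) * J p * ?wu"
    using \<delta> j(2)[OF True] by (intro mult_right_mono mult_left_mono) auto
  ultimately show ?thesis unfolding lower_density_def distrib_left by linarith
next
  case False
  obtain K where K: "compact K" "K \<subseteq> S" "!!x. x \<notin> K ==> w x = 0" using w unfolding supported_in_def by blast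
  have "p \<notin> K" using False K(2) by blast
  then show ?thesis
    using K(3) partial_deriv_eq_0_outside[OF compact_imp_closed[OF K(1)] K(3)] lower_density_outside[OF compact_imp_closed[OF K(1)] K(3)]
    by simp
qed

text \<open>The function on the strip whose product with \<open>\<psi>\<close> is \<open>r\<close> times the integral of \<open>\<psi>\<close> over the cell \<open>Q\<close> in the
  coordinates \<open>(s, u)\<close>; dividing by \<open>J\<close> cancels the Jacobian.\<close>

definition cell_function :: "real => (real \<times> real) set => real \<times> real => complex" where
  "cell_function r Q q = (if G q \<in> Q then of_real (r / J (G q)) else 0)"

lemma cell_function:
  assumes Q: "Q = cbox x y"
  shows "cell_function r Q \<in> L2 L"
    and "C_k 1 \<psi> ==> supported_in \<Omega> \<psi> ==> L2_inner L \<psi> (cell_function r Q) = of_real r * integral Q (pull \<psi>)"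
proof -
  have Qb: "Q \<in> sets borel" using Q by simp
  have GM: "G \<in> borel_measurable L"
    using borel_measurable_continuous_on_restrict[OF continuous_G] by (simp add: measurable_def space_restrict_space sets_restrict_space)
  have meas: "cell_function r Q \<in> borel_measurable L"
  proof -
    have "(\<lambda>p. if p \<in> Q then complex_of_real (r / J p) else 0) \<in> borel_measurable borel"
      using J_measurable Qb by measurable
    from measurable_compose[OF GM this] show ?thesis by (simp add: cell_function_def[abs_def])
  qed
  have on_S: "cell_function r Q (F p) = (if p \<in> Q then of_real (r / J p) else 0)" if "p \<in> S" for p
    by (simp add: cell_function_def GF[OF that])
  obtain j where j: "j > 0" "!!p. p \<in> S ==> j <= J p" using J_lower_bound by blast
  have sq: "(\<lambda>q. (cmod (cell_function r Q q))\<^sup>2) \<in> borel_measurable L" using meas by measurable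
  have "integrable (lborel_on S) (\<lambda>p. J p *\<^sub>R (cmod (cell_function r Q (F p)))\<^sup>2)"
  proof (rule Bochner_Integration.integrable_bound)
    have "integrable lborel (\<lambda>p. indicator Q p *\<^sub>R (r\<^sup>2 / j))"
      using Q by (intro borel_integrable_compact) auto
    then have "integrable lborel (\<lambda>p. indicator S p *\<^sub>R (indicator Q p *\<^sub>R (r\<^sup>2 / j)))"
      by (rule integrable_mult_indicator[rotated]) simp
    then show "integrable (lborel_on S) (\<lambda>p. indicator Q p *\<^sub>R (r\<^sup>2 / j))" by (subst integrable_restrict_space) auto
    have "J \<in> borel_measurable (lborel_on S)" using J_measurable by (intro measurable_restrict_space1) simp
    moreover have "(\<lambda>p. (cmod (cell_function r Q (F p)))\<^sup>2) \<in> borel_measurable (lborel_on S)"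
      using measurable_compose[OF F_measurable sq] by simp
    ultimately show "(\<lambda>p. J p *\<^sub>R (cmod (cell_function r Q (F p)))\<^sup>2) \<in> borel_measurable (lborel_on S)" by measurable
    show "AE p in lborel_on S. norm (J p *\<^sub>R (cmod (cell_function r Q (F p)))\<^sup>2) <= norm (indicator Q p *\<^sub>R (r\<^sup>2 / j))"
    proof (rule AE_I2)
      fix p assume "p \<in> space (lborel_on S)"
      then have p: "p \<in> S" by (simp add: space_restrict_space)
      have "J p * (r / J p)\<^sup>2 = r\<^sup>2 / J p" using J_pos[OF p] by (simp add: power2_eq_square)
      also have "... <= r\<^sup>2 / j" using j p by (intro divide_left_mono) (auto intro!: mult_pos_pos J_pos)
      finally have *: "J p * (r / J p)\<^sup>2 <= r\<^sup>2 / j" .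
      have "0 <= J p * (r / J p)\<^sup>2" using J_pos[OF p] by simp
      have e: "J p *\<^sub>R (cmod (cell_function r Q (F p)))\<^sup>2 = (if p \<in> Q then J p * (r / J p)\<^sup>2 else 0)"
        by (cases "p \<in> Q") (simp_all only: on_S[OF p] if_True if_False norm_of_real power2_abs real_scaleR_def norm_zero zero_power2 mult_zero_right)
      show "norm (J p *\<^sub>R (cmod (cell_function r Q (F p)))\<^sup>2) <= norm (indicator Q p *\<^sub>R (r\<^sup>2 / j))"
      proof (cases "p \<in> Q")
        case True
        then show ?thesis
          unfolding e using * \<open>0 <= J p * (r / J p)\<^sup>2\<close> by (simp only: if_True indicator_simps(1) scaleR_one real_norm_def)
      qed (simp only: e if_False norm_zero norm_ge_zero)
    qed
  qed
  then have "integrable L (\<lambda>q. (cmod (cell_function r Q q))\<^sup>2)" using integral_\<Omega>(2)[OF sq[unfolded \<Omega>_def[symmetric]]] by (simp add: \<Omega>_def)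
  then show "cell_function r Q \<in> L2 L" using meas by (simp add: L2_def)
  assume \<psi>: "C_k 1 \<psi>" "supported_in \<Omega> \<psi>"
  note P = pull_C1(1,2)[OF \<psi>]
  obtain K where K: "compact K" "K \<subseteq> S" "!!x. x \<notin> K ==> pull \<psi> x = 0" using P(2) unfolding supported_in_def by blast
  have "(\<lambda>q. \<psi> q * cnj (cell_function r Q q)) \<in> borel_measurable L"
    using L2_inner_integrable[OF C1_supported_L2(1)[OF open_\<Omega> \<psi>] \<open>cell_function r Q \<in> L2 L\<close>[folded \<Omega>_def]]
    by (simp add: \<Omega>_def borel_measurable_integrable)
  then have "L2_inner L \<psi> (cell_function r Q) = (\<integral>p. J p *\<^sub>R (\<psi> (F p) * cnj (cell_function r Q (F p))) \<partial>lborel_on S)"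
    unfolding L2_inner_def by (rule integral_\<Omega>(1))
  also have "... = (\<integral>p. of_real r * (indicator Q p *\<^sub>R pull \<psi> p) \<partial>lborel_on S)"
  proof (rule Bochner_Integration.integral_cong[OF refl])
    fix p assume "p \<in> space (lborel_on S)"
    then have p: "p \<in> S" by (simp add: space_restrict_space)
    show "J p *\<^sub>R (\<psi> (F p) * cnj (cell_function r Q (F p))) = of_real r * (indicator Q p *\<^sub>R pull \<psi> p)"
      unfolding on_S[OF p] pull_S[OF p] using J_pos[OF p] by (simp add: scaleR_conv_of_real indicator_def)
  qed
  also have "... = (\<integral>p. of_real r * (indicator Q p *\<^sub>R pull \<psi> p) \<partial>lborel)"
    using K by (intro integral_on_supported[OF open_S]) auto
  also have "... = of_real r * (\<integral>p. indicator Q p *\<^sub>R pull \<psi> p \<partial>lborel)" by (rule integral_mult_right_zero)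
  also have "(\<integral>p. indicator Q p *\<^sub>R pull \<psi> p \<partial>lborel) = integral Q (pull \<psi>)"
  proof -
    have "set_integrable lborel Q (pull \<psi>)"
      unfolding set_integrable_def using C1_continuous[OF P(1)] Q
      by (intro borel_integrable_compact) (auto intro: continuous_on_subset)
    from set_borel_integral_eq_integral(2)[OF this] show ?thesis by (simp add: set_lebesgue_integral_def)
  qed
  finally show "L2_inner L \<psi> (cell_function r Q) = of_real r * integral Q (pull \<psi>)" .
qed

text \<open>The cells are chosen so small that the term \<open>C \<parallel>w\<parallel>\<^sup>2\<close> lost on the bounded rectangle is absorbed by the
  Dirichlet integral, except for the cell means. These are products with the cell functions.\<close>

lemma finite_rank_bound_below_threshold:
  assumes \<mu>: "\<mu> < (pi / d)\<^sup>2"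
  shows "\<exists>(I :: (nat \<times> nat) set) g. finite I \<and> (\<forall>i\<in>I. g i \<in> L2 L) \<and>
    (\<forall>x\<in>H1_0 \<Omega>. \<mu> * (L2_norm L x)\<^sup>2 <= Re (magnetic_form \<Omega> A x x) + (\<Sum>i\<in>I. (cmod (L2_inner L x (g i)))\<^sup>2))"
proof (cases "\<mu> <= 0")
  case True
  have "\<mu> * (L2_norm L x)\<^sup>2 <= Re (magnetic_form \<Omega> A x x) + (\<Sum>i\<in>({} :: (nat \<times> nat) set). (cmod (L2_inner L x (undefined i)))\<^sup>2)"
    if "x \<in> H1_0 \<Omega>" for x
  proof (rule finite_rank_bound_of_test[unfolded \<Omega>_def[symmetric], OF _ _ that])
    fix \<psi> :: "real \<times> real => complex"
    have "\<mu> * (L2_norm L \<psi>)\<^sup>2 <= 0" using True by (simp add: mult_nonpos_nonneg)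
    moreover have "0 <= (\<Sum>e\<in>Basis. (L2_norm L (classical_mp e \<psi>))\<^sup>2)" by (intro sum_nonneg) auto
    ultimately show "\<mu> * (L2_norm L \<psi>)\<^sup>2 <= (\<Sum>e\<in>Basis. (L2_norm L (classical_mp e \<psi>))\<^sup>2)
      + (\<Sum>i\<in>({} :: (nat \<times> nat) set). (cmod (L2_inner L \<psi> (undefined i)))\<^sup>2)" by simp
  qed auto
  then show ?thesis by (intro exI[of _ "{}"] exI[of _ undefined]) auto
next
  case False
  then have \<mu>0: "\<mu> > 0" by simp
  obtain \<delta> where \<delta>: "0 < \<delta>" "\<delta> < 1" and gap: "(1 + \<delta>) * (\<mu> + \<delta>) <= (1 - \<delta>) * (1 - \<delta>) * (pi / d)\<^sup>2"
    using exists_gap[OF \<mu>] by blast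
  obtain N1 where N1: "\<forall>p\<in>S. \<bar>fst p\<bar> \<ge> N1 --> \<bar>J p - 1\<bar> <= \<delta>" using J_near_1[OF \<delta>(1)] by blast
  obtain N2 where N2: "\<forall>p\<in>S. \<bar>fst p\<bar> \<ge> N2 --> (\<forall>e\<in>Basis. \<bar>A (F p) \<bullet> e\<bar> <= \<delta> / 2)"
    using A_small[of "\<delta> / 2"] \<delta> by auto
  define N where "N = max 1 (max N1 N2)"
  have N: "N > 0" by (simp add: N_def)
  obtain j where j: "j > 0" "!!p. p \<in> S ==> j <= J p" using J_lower_bound by blast
  define c where "c = (1 - \<delta>) * min (1 / 2) j"
  define C where "C = 2 * (1 / \<delta> * (2 * B\<^sup>2) + \<mu>)"
  have c: "c > 0" using \<delta> j by (auto simp: c_def)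
  have C: "C > 0" using \<delta> \<mu>0 by (auto simp: C_def intro!: add_nonneg_pos)
  obtain I :: "(nat \<times> nat) set" and Q \<kappa> where IQ: "finite I" "\<kappa> \<ge> 0" "!!i. i \<in> I ==> \<exists>x y. Q i = cbox x y"
    and Rellich: "!!w :: real \<times> real => complex. C_k 1 w ==>
      integral (cbox (-N, 0) (N, d)) (\<lambda>p. (cmod (w p))\<^sup>2) <= \<kappa> * (\<Sum>i\<in>I. (cmod (integral (Q i) w))\<^sup>2)
        + c / C * (integral (cbox (-N, 0) (N, d)) (\<lambda>p. (cmod (D1 w p))\<^sup>2)
             + integral (cbox (-N, 0) (N, d)) (\<lambda>p. (cmod (D2 w p))\<^sup>2))"
    by (rule Rellich_rectangle[OF N d_pos, of "c / C"]) (use c C in auto)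
  define g where "g i = cell_function (sqrt (C * \<kappa>)) (Q i)" for i
  have g: "g i \<in> L2 L" if "i \<in> I" for i using IQ(3)[OF that] cell_function(1) by (auto simp: g_def)
  have test: "\<mu> * (L2_norm L \<psi>)\<^sup>2 <= (\<Sum>e\<in>Basis. (L2_norm L (classical_mp e \<psi>))\<^sup>2) + (\<Sum>i\<in>I. (cmod (L2_inner L \<psi> (g i)))\<^sup>2)"
    if \<psi>: "\<psi> \<in> test_functions \<Omega>" for \<psi>
  proof -
    define w where "w = pull \<psi>"
    have w: "C_k 1 w" "supported_in S w" unfolding w_def using pull_C1(1,2)[OF test_functionsD(2,3)[OF \<psi>]] by auto
    let ?R = "cbox (-N, 0) (N, d)"
    let ?W = "integral ?R (\<lambda>p. (cmod (w p))\<^sup>2)"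
    let ?D = "integral ?R (\<lambda>p. (cmod (D1 w p))\<^sup>2) + integral ?R (\<lambda>p. (cmod (D2 w p))\<^sup>2)"
    have co: "continuous_on X w" "continuous_on X (D1 w)" "continuous_on X (D2 w)" for X
      using C1_continuous[OF w(1)] w(1) by (auto simp: C1_iff Basis_plane intro: continuous_on_subset)
    have int: "(\<lambda>p. (cmod (D1 w p))\<^sup>2) integrable_on ?R" "(\<lambda>p. (cmod (D2 w p))\<^sup>2) integrable_on ?R"
      by (intro integrable_continuous continuous_intros co)+
    have "c * ?D - C * ?W = integral ?R (\<lambda>p. c * ((cmod (D1 w p))\<^sup>2 + (cmod (D2 w p))\<^sup>2) - C * (cmod (w p))\<^sup>2)"
      by (subst Henstock_Kurzweil_Integration.integral_diff)
        (auto intro!: integrable_continuous continuous_intros co simp: Henstock_Kurzweil_Integration.integral_add[OF int])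
    also have "... <= integral ?R (lower_density \<delta> \<mu> w)"
      using lower_density_ge[OF w(2) \<delta> \<mu>0 j] unfolding c_def C_def
      by (intro integral_le integrable_continuous continuous_intros co continuous_lower_density w)
    also have "... <= (\<integral>p. lower_density \<delta> \<mu> w p \<partial>lborel)"
      by (rule integral_lower_density_truncate[OF w \<delta> \<mu>0 less_imp_le[OF N] gap]) (use N1 N2 in \<open>auto simp: N_def\<close>)
    also have "... <= (\<Sum>e\<in>Basis. (L2_norm L (classical_mp e \<psi>))\<^sup>2) - \<mu> * (L2_norm L \<psi>)\<^sup>2"
      using integral_lower_density_le[OF \<psi> \<delta>, of \<mu>] unfolding w_def by linarith
    finally have 1: "\<mu> * (L2_norm L \<psi>)\<^sup>2 <= (\<Sum>e\<in>Basis. (L2_norm L (classical_mp e \<psi>))\<^sup>2) + (C * ?W - c * ?D)" by linarith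
    have "C * ?W <= C * (\<kappa> * (\<Sum>i\<in>I. (cmod (integral (Q i) w))\<^sup>2) + c / C * ?D)"
      using Rellich[OF w(1)] C by (intro mult_left_mono) auto
    also have "... = C * \<kappa> * (\<Sum>i\<in>I. (cmod (integral (Q i) w))\<^sup>2) + c * ?D" using C by (simp add: distrib_left)
    also have "C * \<kappa> * (\<Sum>i\<in>I. (cmod (integral (Q i) w))\<^sup>2) = (\<Sum>i\<in>I. (cmod (L2_inner L \<psi> (g i)))\<^sup>2)"
      unfolding sum_distrib_left
    proof (rule sum.cong[OF refl])
      fix i assume i: "i \<in> I"
      obtain x y where "Q i = cbox x y" using IQ(3)[OF i] by blast
      then have "L2_inner L \<psi> (g i) = of_real (sqrt (C * \<kappa>)) * integral (Q i) w"
        unfolding g_def w_def using cell_function(2) test_functionsD(2,3)[OF \<psi>] by blast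
      moreover have "C * \<kappa> \<ge> 0" using C IQ(2) by simp
      ultimately show "C * \<kappa> * (cmod (integral (Q i) w))\<^sup>2 = (cmod (L2_inner L \<psi> (g i)))\<^sup>2"
        by (simp only: norm_mult power_mult_distrib norm_of_real power2_abs real_sqrt_pow2)
    qed
    finally show ?thesis using 1 by linarith
  qed
  have "\<mu> * (L2_norm L x)\<^sup>2 <= Re (magnetic_form \<Omega> A x x) + (\<Sum>i\<in>I. (cmod (L2_inner L x (g i)))\<^sup>2)" if "x \<in> H1_0 \<Omega>" for x
    by (rule finite_rank_bound_of_test[OF g test that])
  then show ?thesis using IQ(1) g by blast
qed

end

section \<open>Cutoff profiles\<close>

lemma square_pos_part_derivative: "((\<lambda>t::real. (max 0 t)\<^sup>2) has_real_derivative 2 * max 0 t) (at t)"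
proof -
  consider "t < 0" | "t > 0" | "t = 0" by linarith
  then show ?thesis
  proof cases
    case 1
    have "((\<lambda>t::real. 0) has_real_derivative 0) (at t)" by simp
    then have "((\<lambda>t::real. (max 0 t)\<^sup>2) has_real_derivative 0) (at t)"
      by (rule has_field_derivative_transform_within_open[of _ _ _ "{..<0}"]) (use 1 in auto)
    then show ?thesis using 1 by simp
  next
    case 2
    have "((\<lambda>t::real. t\<^sup>2) has_real_derivative 2 * t) (at t)" by (auto intro!: derivative_eq_intros)
    then have "((\<lambda>t::real. (max 0 t)\<^sup>2) has_real_derivative 2 * t) (at t)"
      by (rule has_field_derivative_transform_within_open[of _ _ _ "{0<..}"]) (use 2 in auto)
    then show ?thesis using 2 by simp
  next
    case 3
    have "((\<lambda>h::real. max 0 h) \<longlongrightarrow> max 0 0) (at 0)" by (intro tendsto_intros)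
    moreover have "\<forall>\<^sub>F h in at (0::real). max 0 h = ((max 0 (0 + h))\<^sup>2 - (max 0 0)\<^sup>2) / h"
      by (rule eventually_mono[OF eventually_neq_at_within[of 0]]) (auto simp: max_def power2_eq_square)
    ultimately have "((\<lambda>h::real. ((max 0 (0 + h))\<^sup>2 - (max 0 0)\<^sup>2) / h) \<longlongrightarrow> max 0 0) (at 0)"
      by (rule Lim_transform_eventually)
    then show ?thesis using 3 by (simp add: DERIV_def)
  qed
qed

text \<open>The cutoff \<open>(1 - ((s - c) / n)\<^sup>2)\<^sub>+\<^sup>2\<close>.\<close>

lemma longitudinal_profile:
  fixes c n :: real
  assumes n: "n > 0"
  obtains \<theta> \<theta>' :: "real => real" where
    "!!s. (\<theta> has_real_derivative \<theta>' s) (at s)" "continuous_on UNIV \<theta>'" "!!s. 0 <= \<theta> s \<and> \<theta> s <= 1" "!!s. \<bar>\<theta>' s\<bar> <= 4 / n"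
    "!!s. \<bar>s - c\<bar> \<ge> n ==> \<theta> s = 0 \<and> \<theta>' s = 0" "n / 4 <= integral {c - n..c + n} (\<lambda>s. (\<theta> s)\<^sup>2)"
proof -
  define r where "r s = max 0 (1 - ((s - c) / n)\<^sup>2)" for s
  define \<theta> where "\<theta> s = (r s)\<^sup>2" for s
  define \<theta>' where "\<theta>' s = 2 * r s * (- 2 * ((s - c) / n) / n)" for s
  have "(\<theta> has_real_derivative \<theta>' s) (at s)" for s
  proof -
    have "((\<lambda>s. 1 - ((s - c) / n)\<^sup>2) has_real_derivative (- 2 * ((s - c) / n) / n)) (at s)"
      using n by (auto intro!: derivative_eq_intros simp: field_simps power2_eq_square power4_eq_xxxx)
    from DERIV_chain2[OF square_pos_part_derivative this] show ?thesis by (simp add: \<theta>_def[abs_def] \<theta>'_def r_def)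
  qed
  moreover have cr: "continuous_on X r" for X unfolding r_def[abs_def] using n by (intro continuous_intros) auto
  then have "continuous_on UNIV \<theta>'" unfolding \<theta>'_def[abs_def] using n by (intro continuous_intros) auto
  moreover have r: "0 <= r s" "r s <= 1" for s by (auto simp: r_def)
  then have "0 <= \<theta> s \<and> \<theta> s <= 1" for s by (simp add: \<theta>_def power_le_one)
  moreover have out: "r s = 0" if "\<bar>s - c\<bar> \<ge> n" for s
  proof -
    have "1 <= \<bar>(s - c) / n\<bar>" using that n by (simp add: abs_divide)
    then have "1 <= ((s - c) / n)\<^sup>2" using one_le_power[of "\<bar>(s - c) / n\<bar>" 2] by (simp only: power2_abs)
    then show ?thesis by (simp add: r_def)
  qed
  moreover have "\<bar>\<theta>' s\<bar> <= 4 / n" for s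
  proof (cases "\<bar>s - c\<bar> \<ge> n")
    case False
    then have "\<bar>(s - c) / n\<bar> <= 1" using n by (simp add: abs_divide)
    then have "r s * \<bar>(s - c) / n\<bar> <= 1 * 1" using r by (intro mult_mono) auto
    then have "4 * (r s * \<bar>(s - c) / n\<bar>) / n <= 4 * 1 / n" using n by (intro divide_right_mono mult_left_mono) auto
    moreover have "\<bar>\<theta>' s\<bar> = 4 * (r s * \<bar>(s - c) / n\<bar>) / n"
    proof -
      have "\<bar>2 * R * (- 2 * X / n)\<bar> = 4 * (R * \<bar>X\<bar>) / n" if "R \<ge> 0" for R X :: real
        using that n by (simp add: abs_mult abs_divide)
      from this[OF r(1)] show ?thesis unfolding \<theta>'_def .
    qed
    ultimately show ?thesis by simp
  qed (use out n in \<open>auto simp: \<theta>'_def\<close>)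
  moreover have "n / 4 <= integral {c - n..c + n} (\<lambda>s. (\<theta> s)\<^sup>2)"
  proof -
    have c\<theta>: "continuous_on X \<theta>" for X unfolding \<theta>_def[abs_def] by (intro continuous_intros cr)
    have "1 / 4 <= (\<theta> s)\<^sup>2" if "s \<in> {c - n / 2..c + n / 2}" for s
    proof -
      have "c - n / 2 <= s" "s <= c + n / 2" using that by auto
      then have "\<bar>s - c\<bar> <= n / 2" by linarith
      then have "\<bar>(s - c) / n\<bar> <= 1 / 2" using n by (simp add: abs_divide pos_divide_le_eq)
      then have "((s - c) / n)\<^sup>2 <= (1 / 2)\<^sup>2" by (metis abs_ge_zero power2_abs power_mono)
      then have "((s - c) / n)\<^sup>2 <= 1 / 4" by (simp only: power_one_over) simp
      then have "3 / 4 <= r s" unfolding r_def by (intro order_trans[OF _ max.cobounded2]) linarith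
      then have "(3 / 4)\<^sup>2 <= \<theta> s" unfolding \<theta>_def by (intro power_mono) auto
      then have "((3 / 4)\<^sup>2)\<^sup>2 <= (\<theta> s)\<^sup>2" by (intro power_mono) auto
      then show ?thesis by (simp add: power2_eq_square)
    qed
    then have "integral {c - n / 2..c + n / 2} (\<lambda>s. 1 / 4) <= integral {c - n / 2..c + n / 2} (\<lambda>s. (\<theta> s)\<^sup>2)"
      by (intro integral_le integrable_continuous_real continuous_intros c\<theta>)
    also have "... <= integral {c - n..c + n} (\<lambda>s. (\<theta> s)\<^sup>2)"
      using n by (intro integral_subset_le integrable_continuous_real continuous_intros c\<theta>) auto
    finally show ?thesis using n by simp
  qed
  ultimately show ?thesis using that[of \<theta> \<theta>'] by (simp add: \<theta>_def \<theta>'_def)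
qed

text \<open>The first Dirichlet mode on \<open>[0, d]\<close>, extended by zero.\<close>

definition arch :: "real => real => real" where
  "arch d u = sin (pi / d * min d (max 0 u))"

text \<open>Vanishes where the mode is below \<open>\<rho>\<close>. The maximum in the denominator leaves the value unchanged and keeps the
  quotient continuous.\<close>

definition ratio :: "real => real => real => real" where
  "ratio d \<rho> u = max 0 (arch d u - \<rho>) / max \<rho> (arch d u)"

text \<open>This is \<open>(y - \<rho>)\<^sub>+\<^sup>2 / y\<close> for the mode \<open>y\<close>: of class \<open>C\<^sup>1\<close> although the mode has corners at the end points, and
  supported where \<open>y \<ge> \<rho>\<close>.\<close>

definition trim :: "real => real => real => real" where
  "trim d \<rho> u = (ratio d \<rho> u)\<^sup>2 * max \<rho> (arch d u)"

definition trim' :: "real => real => real => real" where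
  "trim' d \<rho> u = (2 * ratio d \<rho> u - (ratio d \<rho> u)\<^sup>2) * (pi / d * cos (pi / d * u))"

lemma transverse_profile_family:
  fixes d \<rho> :: real
  assumes d: "d > 0" and \<rho>: "0 < \<rho>" "\<rho> <= 1"
  shows "(trim d \<rho> has_real_derivative trim' d \<rho> u) (at u)" "continuous_on X (trim' d \<rho>)" "continuous_on X (trim d \<rho>)"
    "trim d \<rho> u ~= 0 ==> \<rho> * d / pi <= u \<and> u <= d - \<rho> * d / pi" "0 <= trim d \<rho> u \<and> trim d \<rho> u <= 1" "\<bar>trim' d \<rho> u\<bar> <= pi / d"
proof -
  let ?m = "pi / d"
  have m: "?m > 0" using d by simp
  have y_in: "arch d u = sin (?m * u)" if "0 <= u" "u <= d" for u using that by (simp add: arch_def)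
  have y_out: "arch d u = 0" if "\<not> (0 < u \<and> u < d)" for u
    using that d by (cases "u <= 0") (auto simp: arch_def min_def max_def)
  have y_pos: "arch d u > 0" if "0 < u" "u < d" for u
    using that d y_in[of u] by (auto intro!: sin_gt_zero simp: field_simps)
  have y0: "0 <= arch d u" for u using y_pos[of u] y_out[of u] by (cases "0 < u \<and> u < d") (auto intro: less_imp_le)
  have y1: "arch d u <= 1" for u by (simp add: arch_def)
  have cy: "continuous_on X (arch d)" for X unfolding arch_def[abs_def] by (intro continuous_intros)
  have mx: "max \<rho> (arch d u) > 0" for u using \<rho> by simp
  have cT: "continuous_on X (ratio d \<rho>)" for X unfolding ratio_def[abs_def] using mx by (intro continuous_intros cy) (metis less_irrefl)
  show "continuous_on X (trim' d \<rho>)" "continuous_on X (trim d \<rho>)" unfolding trim_def[abs_def] trim'_def[abs_def] by (intro continuous_intros cT cy)+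
  have T0: "ratio d \<rho> u = 0" if "arch d u <= \<rho>" for u using that by (simp add: ratio_def)
  have T: "0 <= ratio d \<rho> u" "ratio d \<rho> u <= 1" for u using \<rho> by (auto simp: ratio_def divide_le_eq max_def)
  have "(ratio d \<rho> u)\<^sup>2 <= 1" using T[of u] by (simp add: power_le_one)
  then have "(ratio d \<rho> u)\<^sup>2 * max \<rho> (arch d u) <= 1 * 1" using mx[of u] y1[of u] \<rho> by (intro mult_mono) auto
  then show "0 <= trim d \<rho> u \<and> trim d \<rho> u <= 1" using mx[of u] by (simp add: trim_def)
  have "\<bar>2 * ratio d \<rho> u - (ratio d \<rho> u)\<^sup>2\<bar> <= 1"
  proof -
    have "(ratio d \<rho> u)\<^sup>2 <= ratio d \<rho> u" using T[of u] by (simp add: power2_eq_square mult_left_le)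
    moreover have "0 <= (1 - ratio d \<rho> u)\<^sup>2" by simp
    then have "2 * ratio d \<rho> u - (ratio d \<rho> u)\<^sup>2 <= 1" by (simp add: power2_diff)
    ultimately show ?thesis using T[of u] by simp
  qed
  then have "\<bar>2 * ratio d \<rho> u - (ratio d \<rho> u)\<^sup>2\<bar> * (?m * \<bar>cos (?m * u)\<bar>) <= 1 * (?m * 1)"
    using m by (intro mult_mono mult_left_mono) (use d in \<open>auto intro!: divide_nonneg_pos mult_nonneg_nonneg\<close>)
  then show "\<bar>trim' d \<rho> u\<bar> <= pi / d" using d by (simp add: trim'_def abs_mult abs_of_pos[OF d])
  show "\<rho> * d / pi <= u \<and> u <= d - \<rho> * d / pi" if "trim d \<rho> u ~= 0"
  proof -
    have yr: "arch d u > \<rho>" using that T0[of u] by (force simp: trim_def)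
    then have u: "0 < u" "u < d" using y_out[of u] \<rho> by force+
    have "arch d u <= ?m * u" using y_in[of u] u sin_x_le_x[of "?m * u"] m by simp
    then have 1: "\<rho> <= ?m * u" using yr by simp
    have "sin (?m * u) = sin (?m * (d - u))"
      using d sin_pi_minus[of "?m * u"] by (simp add: right_diff_distrib)
    then have "arch d u <= ?m * (d - u)" using y_in[of u] u sin_x_le_x[of "?m * (d - u)"] m by simp
    then have "\<rho> <= ?m * (d - u)" using yr by simp
    with 1 have "\<rho> * d <= u * pi" "\<rho> * d <= (d - u) * pi"
      by (simp_all add: pos_le_divide_eq[OF d] mult.commute)
    then have "\<rho> * d / pi <= u" "\<rho> * d / pi <= d - u" by (simp_all only: pos_divide_le_eq[OF pi_gt_zero])
    then show ?thesis by simp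
  qed
  show "(trim d \<rho> has_real_derivative trim' d \<rho> u) (at u)"
  proof (cases "0 < u \<and> u < d")
    case True
    let ?s = "sin (?m * u)"
    have s: "?s > 0" using y_pos[of u] y_in[of u] True by simp
    have dsin: "((\<lambda>u. sin (?m * u) - \<rho>) has_real_derivative (?m * cos (?m * u))) (at u)"
      using d by (auto intro!: derivative_eq_intros)
    have num: "((\<lambda>u. (max 0 (sin (?m * u) - \<rho>))\<^sup>2) has_real_derivative 2 * max 0 (?s - \<rho>) * (?m * cos (?m * u))) (at u)"
      by (rule DERIV_chain2[OF square_pos_part_derivative dsin])
    have den: "((\<lambda>u. sin (?m * u)) has_real_derivative (?m * cos (?m * u))) (at u)" using d by (auto intro!: derivative_eq_intros)
    have "((\<lambda>u. (max 0 (sin (?m * u) - \<rho>))\<^sup>2 / sin (?m * u)) has_real_derivative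
        (2 * max 0 (?s - \<rho>) * (?m * cos (?m * u)) * ?s - (max 0 (?s - \<rho>))\<^sup>2 * (?m * cos (?m * u))) / (?s * ?s)) (at u)"
      using DERIV_divide[OF num den] s by simp
    moreover have "(2 * max 0 (?s - \<rho>) * (?m * cos (?m * u)) * ?s - (max 0 (?s - \<rho>))\<^sup>2 * (?m * cos (?m * u))) / (?s * ?s) = trim' d \<rho> u"
    proof (cases "?s <= \<rho>")
      case True
      then show ?thesis using y_in[of u] \<open>0 < u \<and> u < d\<close> T0[of u] by (simp add: trim'_def)
    next
      case False
      then have T: "ratio d \<rho> u = (?s - \<rho>) / ?s" and max0: "max 0 (?s - \<rho>) = ?s - \<rho>"
        using y_in[of u] \<open>0 < u \<and> u < d\<close> by (simp_all add: ratio_def)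
      have "(2 * w * k * q - w\<^sup>2 * k) / (q * q) = (2 * (w / q) - (w / q)\<^sup>2) * k" if "q > 0" for w k q :: real
        using that by (simp add: field_simps power2_eq_square)
      from this[OF s] show ?thesis unfolding max0 trim'_def T .
    qed
    ultimately have *: "((\<lambda>u. (max 0 (sin (?m * u) - \<rho>))\<^sup>2 / sin (?m * u)) has_real_derivative trim' d \<rho> u) (at u)" by simp
    show ?thesis
    proof (rule has_field_derivative_transform_within_open[OF *, of "{0<..<d}"])
      fix v assume "v \<in> {0<..<d}"
      then have v: "arch d v = sin (?m * v)" "arch d v > 0" using y_in[of v] y_pos[of v] by auto
      show "(max 0 (sin (?m * v) - \<rho>))\<^sup>2 / sin (?m * v) = trim d \<rho> v"
        using v by (cases "arch d v <= \<rho>") (auto simp: trim_def ratio_def power2_eq_square field_simps)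
    qed (use True in auto)
  next
    case False
    have op: "open {v. arch d v < \<rho>}" using cy by (intro open_Collect_less continuous_on_const) auto
    have "((\<lambda>u::real. 0::real) has_real_derivative 0) (at u)" by simp
    then have "(trim d \<rho> has_real_derivative 0) (at u)"
      by (rule has_field_derivative_transform_within_open[OF _ op]) (use y_out[OF False] \<rho> T0 in \<open>auto simp: trim_def\<close>)
    moreover have "trim' d \<rho> u = 0" using T0[of u] y_out[OF False] \<rho> by (simp add: trim'_def)
    ultimately show ?thesis by simp
  qed
qed

lemma integral_sin_square:
  fixes d :: real
  assumes "d > 0"
  shows "integral {0..d} (\<lambda>u. (sin (pi / d * u))\<^sup>2) = d / 2"
proof -
  have deriv: "((\<lambda>u. u / 2 - C * (sin (m * u) * cos (m * u))) has_real_derivative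
      1 / 2 - C * (m * (cos (m * x))\<^sup>2 - m * (sin (m * x))\<^sup>2)) (at x within X)" for C m x :: real and X
    by (auto intro!: derivative_eq_intros simp: power2_eq_square algebra_simps)
  have "((\<lambda>u. (sin (pi / d * u))\<^sup>2) has_integral
      (d / 2 - d / (2 * pi) * (sin (pi / d * d) * cos (pi / d * d)) - (0 / 2 - d / (2 * pi) * (sin (pi / d * 0) * cos (pi / d * 0))))) {0..d}"
  proof (rule fundamental_theorem_of_calculus)
    fix x assume "x \<in> {0..d}"
    have "((\<lambda>u. u / 2 - d / (2 * pi) * (sin (pi / d * u) * cos (pi / d * u))) has_real_derivative
      1 / 2 - d / (2 * pi) * (pi / d * (cos (pi / d * x))\<^sup>2 - pi / d * (sin (pi / d * x))\<^sup>2)) (at x within {0..d})"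
      by (rule deriv)
    moreover have "1 / 2 - d / (2 * pi) * (pi / d * (cos (pi / d * x))\<^sup>2 - pi / d * (sin (pi / d * x))\<^sup>2) = (sin (pi / d * x))\<^sup>2"
    proof -
      have "d / (2 * pi) * (pi / d * (cos (pi / d * x))\<^sup>2 - pi / d * (sin (pi / d * x))\<^sup>2)
        = (d / (2 * pi) * (pi / d)) * ((cos (pi / d * x))\<^sup>2 - (sin (pi / d * x))\<^sup>2)" by (simp only: right_diff_distrib mult.assoc)
      also have "d / (2 * pi) * (pi / d) = 1 / 2" using assms by simp
      finally have half: "d / (2 * pi) * (pi / d * (cos (pi / d * x))\<^sup>2 - pi / d * (sin (pi / d * x))\<^sup>2)
        = 1 / 2 * ((cos (pi / d * x))\<^sup>2 - (sin (pi / d * x))\<^sup>2)" .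
      show ?thesis unfolding half by (simp add: cos_squared_eq field_simps)
    qed
    ultimately show "((\<lambda>u. u / 2 - d / (2 * pi) * (sin (pi / d * u) * cos (pi / d * u))) has_vector_derivative (sin (pi / d * x))\<^sup>2) (at x within {0..d})"
      by (simp add: has_real_derivative_iff_has_vector_derivative)
  qed (use assms in simp)
  then show ?thesis using assms by (simp add: integral_unique)
qed

text \<open>As \<open>\<rho>\<close> tends to zero, the trimmed modes and their derivatives converge boundedly to the mode and its derivative
  in the open interval, so dominated convergence applies.\<close>

lemma transverse_profile:
  fixes d \<epsilon> :: real
  assumes d: "d > 0" and \<epsilon>: "\<epsilon> > 0"
  obtains z z' :: "real => real" where
    "!!u. (z has_real_derivative z' u) (at u)" "continuous_on UNIV z'"
    "\<exists>r>0. \<forall>u. z u ~= 0 --> r <= u \<and> u <= d - r" "!!u. 0 <= z u \<and> z u <= 1" "!!u. \<bar>z' u\<bar> <= pi / d"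
    "integral {0..d} (\<lambda>u. (\<bar>z' u - pi / d * cos (pi / d * u)\<bar> + (pi / d)\<^sup>2 * \<bar>sin (pi / d * u) - z u\<bar>)\<^sup>2) <= \<epsilon>"
    "d / 4 <= integral {0..d} (\<lambda>u. (z u)\<^sup>2)"
proof -
  define \<rho> where "\<rho> n = 1 / real (Suc n)" for n
  have \<rho>: "0 < \<rho> n" "\<rho> n <= 1" for n by (auto simp: \<rho>_def)
  have \<rho>0: "\<rho> \<longlonglongrightarrow> 0" unfolding \<rho>_def[abs_def] by (rule lim_1_over_n[THEN LIMSEQ_Suc])
  define z z' where "z n = trim d (\<rho> n)" and "z' n = trim' d (\<rho> n)" for n
  note fam = transverse_profile_family[OF d \<rho>, folded z_def z'_def]
  define e where "e n u = (\<bar>z' n u - pi / d * cos (pi / d * u)\<bar> + (pi / d)\<^sup>2 * \<bar>sin (pi / d * u) - z n u\<bar>)\<^sup>2" for n u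
  have lim: "(\<lambda>n. z n u) \<longlonglongrightarrow> sin (pi / d * u)" "(\<lambda>n. z' n u) \<longlonglongrightarrow> pi / d * cos (pi / d * u)" if u: "0 < u" "u < d" for u
  proof -
    have y: "arch d u = sin (pi / d * u)" "arch d u > 0" using u d by (auto simp: arch_def field_simps intro!: sin_gt_zero)
    have mx: "(\<lambda>n. max (\<rho> n) (arch d u)) \<longlonglongrightarrow> max 0 (arch d u)" by (intro tendsto_intros \<rho>0)
    moreover have "(\<lambda>n. max 0 (arch d u - \<rho> n)) \<longlonglongrightarrow> max 0 (arch d u - 0)" by (intro tendsto_intros \<rho>0)
    ultimately have "(\<lambda>n. ratio d (\<rho> n) u) \<longlonglongrightarrow> max 0 (arch d u - 0) / max 0 (arch d u)"
      unfolding ratio_def using y by (intro tendsto_divide) auto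
    then have T: "(\<lambda>n. ratio d (\<rho> n) u) \<longlonglongrightarrow> 1" using y by simp
    have "(\<lambda>n. z n u) \<longlonglongrightarrow> 1\<^sup>2 * max 0 (arch d u)" unfolding z_def trim_def by (intro tendsto_intros T mx)
    then show "(\<lambda>n. z n u) \<longlonglongrightarrow> sin (pi / d * u)" using y by simp
    have "(\<lambda>n. z' n u) \<longlonglongrightarrow> (2 * 1 - 1\<^sup>2) * (pi / d * cos (pi / d * u))" unfolding z'_def trim'_def by (intro tendsto_intros T)
    then show "(\<lambda>n. z' n u) \<longlonglongrightarrow> pi / d * cos (pi / d * u)" by simp
  qed
  have int: "f integrable_on {0<..<d}" if "continuous_on {0..d} f" for f :: "real => real"
    using integrable_continuous_real[OF that] by (simp add: integrable_on_Icc_iff_Ioo)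
  have e_cont: "continuous_on X (e n)" for X n
    unfolding e_def[abs_def] by (intro continuous_intros fam)
  have "(\<lambda>n. integral {0<..<d} (e n)) \<longlonglongrightarrow> integral {0<..<d} (\<lambda>u. 0)"
  proof (rule dominated_convergence(2)[where h = "\<lambda>u. (2 * (pi / d) + (pi / d)\<^sup>2 * 2)\<^sup>2"])
    show "e n integrable_on {0<..<d}" for n by (intro int e_cont)
    show "(\<lambda>u. (2 * (pi / d) + (pi / d)\<^sup>2 * 2)\<^sup>2) integrable_on {0<..<d}" by (intro int continuous_intros)
    show "norm (e n u) <= (2 * (pi / d) + (pi / d)\<^sup>2 * 2)\<^sup>2" for n u
    proof -
      have "\<bar>pi / d * cos (pi / d * u)\<bar> <= pi / d * 1" unfolding abs_mult using d by (intro mult_mono) auto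
      then have "\<bar>z' n u - pi / d * cos (pi / d * u)\<bar> <= 2 * (pi / d)" using fam(6)[of n u] by linarith
      moreover have "\<bar>sin (pi / d * u) - z n u\<bar> <= 2" using fam(5)[of n u] abs_sin_le_one[of "pi / d * u"] by linarith
      ultimately show ?thesis unfolding e_def by (simp only: real_norm_def abs_power2) (intro power_mono add_mono mult_left_mono; simp)
    qed
    show "(\<lambda>n. e n u) \<longlonglongrightarrow> 0" if "u \<in> {0<..<d}" for u
    proof -
      have "(\<lambda>n. e n u) \<longlonglongrightarrow> (\<bar>pi / d * cos (pi / d * u) - pi / d * cos (pi / d * u)\<bar> + (pi / d)\<^sup>2 * \<bar>sin (pi / d * u) - sin (pi / d * u)\<bar>)\<^sup>2"
        unfolding e_def using that by (intro tendsto_intros lim) auto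
      then show ?thesis by simp
    qed
  qed
  then have 1: "\<forall>\<^sub>F n in sequentially. integral {0<..<d} (e n) < \<epsilon>" using \<epsilon> by (intro order_tendstoD) auto
  have "(\<lambda>n. integral {0<..<d} (\<lambda>u. (z n u)\<^sup>2)) \<longlonglongrightarrow> integral {0<..<d} (\<lambda>u. (sin (pi / d * u))\<^sup>2)"
  proof (rule dominated_convergence(2)[where h = "\<lambda>u. 1"])
    show "(\<lambda>u. (z n u)\<^sup>2) integrable_on {0<..<d}" for n by (intro int continuous_intros fam)
    show "norm ((z n u)\<^sup>2) <= 1" for n u using fam(5)[of n u] by (simp add: power_le_one)
    show "(\<lambda>n. (z n u)\<^sup>2) \<longlonglongrightarrow> (sin (pi / d * u))\<^sup>2" if "u \<in> {0<..<d}" for u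
      using that by (intro tendsto_power lim) auto
  qed (intro int continuous_intros)
  then have 2: "\<forall>\<^sub>F n in sequentially. d / 4 < integral {0<..<d} (\<lambda>u. (z n u)\<^sup>2)"
    using integral_sin_square[OF d] d by (intro order_tendstoD(1)) (auto simp: integral_open_interval_real)
  obtain n where n: "integral {0<..<d} (e n) < \<epsilon>" "d / 4 < integral {0<..<d} (\<lambda>u. (z n u)\<^sup>2)"
    using eventually_happens'[OF sequentially_bot eventually_conj[OF 1 2]] by blast
  show ?thesis
  proof (rule that[of "z n" "z' n"])
    show "\<exists>r>0. \<forall>u. z n u ~= 0 --> r <= u \<and> u <= d - r"
      using fam(4)[of n] \<rho>(1)[of n] d by (intro exI[of _ "\<rho> n * d / pi"]) auto
    show "integral {0..d} (\<lambda>u. (\<bar>z' n u - pi / d * cos (pi / d * u)\<bar> + (pi / d)\<^sup>2 * \<bar>sin (pi / d * u) - z n u\<bar>)\<^sup>2) <= \<epsilon>"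
      using n(1) unfolding e_def[abs_def] by (simp add: integral_open_interval_real)
    show "d / 4 <= integral {0..d} (\<lambda>u. (z n u)\<^sup>2)" using n(2) by (simp add: integral_open_interval_real)
  qed (use fam in blast)+
qed

section \<open>Singular sequences above the threshold\<close>

lemma C1_separated:
  fixes E E' :: "real => complex" and z z' :: "real => real"
  assumes E: "!!s. (E has_vector_derivative E' s) (at s)" "continuous_on UNIV E'"
    and z: "!!u. (z has_real_derivative z' u) (at u)" "continuous_on UNIV z'"
  defines "f \<equiv> \<lambda>p :: real \<times> real. E (fst p) * of_real (z (snd p))"
  shows "C_k 1 f" "D1 f = (\<lambda>p. E' (fst p) * of_real (z (snd p)))"
    "D2 f = (\<lambda>p. E (fst p) * of_real (z' (snd p)))"
proof -
  have D: "(f has_derivative (\<lambda>h. E (fst p) * (snd h *\<^sub>R of_real (z' (snd p))) + (fst h *\<^sub>R E' (fst p)) * of_real (z (snd p)))) (at p)" for p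
  proof -
    have 1: "((\<lambda>p::real \<times> real. E (fst p)) has_derivative (\<lambda>h. fst h *\<^sub>R E' (fst p))) (at p)"
      using has_derivative_compose[OF has_derivative_fst[OF has_derivative_ident], of E _ p UNIV] E(1)[of "fst p"]
      by (simp add: has_vector_derivative_def)
    have "((\<lambda>u. complex_of_real (z u)) has_vector_derivative of_real (z' (snd p))) (at (snd p))"
      by (rule has_vector_derivative_of_real[OF z(1)])
    then have 2: "((\<lambda>p::real \<times> real. complex_of_real (z (snd p))) has_derivative (\<lambda>h. snd h *\<^sub>R of_real (z' (snd p)))) (at p)"
      using has_derivative_compose[OF has_derivative_snd[OF has_derivative_ident], of "\<lambda>u. complex_of_real (z u)" _ p UNIV]
      by (simp add: has_vector_derivative_def)
    show ?thesis unfolding f_def by (rule has_derivative_mult[OF 1 2])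
  qed
  show p: "D1 f = (\<lambda>p. E' (fst p) * of_real (z (snd p)))"
    "D2 f = (\<lambda>p. E (fst p) * of_real (z' (snd p)))"
    by (rule ext, subst partial_deriv_eq[OF D], simp)+
  have cE: "continuous_on UNIV E" using E(1) has_vector_derivative_continuous continuous_at_imp_continuous_on by blast
  have cz: "continuous_on UNIV z" using z(1) DERIV_continuous continuous_at_imp_continuous_on by blast
  have "continuous_on UNIV (D1 f)" "continuous_on UNIV (D2 f)"
    unfolding p
    by (intro continuous_intros continuous_on_compose2[OF E(2)] continuous_on_compose2[OF z(2)] continuous_on_compose2[OF cE]
        continuous_on_compose2[OF cz] subset_UNIV)+
  then show "C_k 1 f" using D unfolding C1_iff by (auto simp: Basis_plane differentiable_def)
qed

lemma C1_cnj:
  assumes "C_k 1 w"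
  shows "C_k 1 (\<lambda>p. cnj (w p))" "partial_deriv e (\<lambda>p. cnj (w p)) p = cnj (partial_deriv e w p)"
proof -
  have D: "((\<lambda>p. cnj (w p)) has_derivative (\<lambda>h. cnj (frechet_derivative w (at p) h))) (at p)" for p
    using assms by (intro has_derivative_cnj) (simp add: C1_iff frechet_derivative_works)
  show eq: "partial_deriv e (\<lambda>p. cnj (w p)) p = cnj (partial_deriv e w p)" for e p
    by (simp add: partial_deriv_eq[OF D]) (simp add: partial_deriv_def)
  have "continuous_on UNIV (partial_deriv e (\<lambda>p. cnj (w p)))" if "e \<in> Basis" for e
    unfolding eq[abs_def] using assms that by (intro continuous_intros) (simp add: C1_iff)
  then show "C_k 1 (\<lambda>p. cnj (w p))" using D unfolding C1_iff by (auto simp: differentiable_def)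
qed

lemma integral_by_parts_compact:
  fixes f w :: "'a::euclidean_space => complex"
  assumes f: "C_k 1 f" and w: "C_k 1 w" and K: "compact K" "!!x. x \<notin> K ==> w x = 0" and e: "e \<in> Basis"
  shows "integrable lborel (\<lambda>p. partial_deriv e f p * cnj (w p) + f p * cnj (partial_deriv e w p))"
    and "(\<integral>p. partial_deriv e f p * cnj (w p) + f p * cnj (partial_deriv e w p) \<partial>lborel) = 0"
proof -
  let ?F = "\<lambda>p. f p * cnj (w p)"
  have d: "f differentiable (at p)" "(\<lambda>p. cnj (w p)) differentiable (at p)" for p
    using f C1_cnj(1)[OF w] by (auto simp: C1_iff)
  have pd: "partial_deriv e ?F = (\<lambda>p. partial_deriv e f p * cnj (w p) + f p * cnj (partial_deriv e w p))"
    by (rule ext) (simp add: partial_deriv_mult[OF d] C1_cnj(2)[OF w])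
  have F: "C_k 1 ?F" by (rule C_k_mult[OF f C1_cnj(1)[OF w]])
  then have c: "continuous_on UNIV (partial_deriv e ?F)" using e by (simp add: C1_iff)
  have z: "?F x = 0" if "x \<notin> K" for x using K(2)[OF that] by simp
  show "integrable lborel (\<lambda>p. partial_deriv e f p * cnj (w p) + f p * cnj (partial_deriv e w p))"
    unfolding pd[symmetric]
    by (rule integrable_compact_support[OF c K(1) partial_deriv_eq_0_outside[OF compact_imp_closed[OF K(1)] z]])
  show "(\<integral>p. partial_deriv e f p * cnj (w p) + f p * cnj (partial_deriv e w p) \<partial>lborel) = 0"
    using integral_partial_deriv_eq_0[OF _ c K(1) z] F unfolding pd[symmetric] by (simp add: C1_iff)
qed

lemma integral_mult_norm_le:
  assumes "(\<lambda>p. complex_of_real (g p)) \<in> L2 M" "w \<in> L2 M" "!!p. g p \<ge> 0"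
  shows "(\<integral>p. g p * cmod (w p) \<partial>M) <= L2_norm M (\<lambda>p. of_real (g p)) * L2_norm M w"
    and "integrable M (\<lambda>p. g p * cmod (w p))"
proof -
  have w: "(\<lambda>p. complex_of_real (cmod (w p))) \<in> L2 M" using assms(2) by (auto simp: L2_def)
  have eq: "(\<lambda>p. complex_of_real (g p) * complex_of_real (cmod (w p))) = (\<lambda>p. complex_of_real (g p * cmod (w p)))" by simp
  show "integrable M (\<lambda>p. g p * cmod (w p))"
    using L2_mult_integrable[OF assms(1) w] unfolding eq complex_of_real_integrable_eq .
  have "cmod (\<integral>p. complex_of_real (g p * cmod (w p)) \<partial>M) <= L2_norm M (\<lambda>p. of_real (g p)) * L2_norm M (\<lambda>p. of_real (cmod (w p)))"
    using integral_norm_mult_le[OF assms(1) w] by simp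
  moreover have "L2_norm M (\<lambda>p. of_real (cmod (w p))) = L2_norm M w" by (simp add: L2_norm_def)
  ultimately show "(\<integral>p. g p * cmod (w p) \<partial>M) <= L2_norm M (\<lambda>p. of_real (g p)) * L2_norm M w"
    unfolding integral_complex_of_real by simp
qed

context strip
begin

lemma L2_rectangle_profile:
  fixes h :: "real => real" and c n :: real
  assumes h: "continuous_on UNIV h" and n: "n > 0"
  defines "g \<equiv> \<lambda>p :: real \<times> real. if \<bar>fst p - c\<bar> < n then h (snd p) else 0"
  shows "(\<lambda>p. complex_of_real (g p)) \<in> L2 (lborel_on S)"
    and "(L2_norm (lborel_on S) (\<lambda>p. of_real (g p)))\<^sup>2 <= 2 * n * integral {0..d} (\<lambda>u. (h u)\<^sup>2)"
proof -
  let ?R = "cbox (c - n, 0) (c + n, d)"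
  let ?b = "\<lambda>p :: real \<times> real. indicator ?R p *\<^sub>R (h (snd p))\<^sup>2"
  have hm: "h \<in> borel_measurable borel" using h by (rule borel_measurable_continuous_onI)
  have hc: "continuous_on X (\<lambda>p :: real \<times> real. (h (snd p))\<^sup>2)" for X
    by (intro continuous_intros continuous_on_compose2[OF h]) auto
  have "(\<lambda>p :: real \<times> real. complex_of_real (g p)) \<in> borel_measurable (borel \<Otimes>\<^sub>M borel)"
    unfolding g_def using hm by measurable
  then have gm: "(\<lambda>p. complex_of_real (g p)) \<in> borel_measurable (lborel_on S)"
    by (intro measurable_restrict_space1) (simp add: borel_prod)
  have bi: "integrable lborel ?b" by (rule borel_integrable_compact) (auto intro: hc)
  have bi': "integrable lborel (\<lambda>p. indicator S p *\<^sub>R ?b p)" by (rule integrable_mult_indicator[rotated, OF bi]) simp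
  then have biS: "integrable (lborel_on S) ?b" by (subst integrable_restrict_space) auto
  have le: "(cmod (complex_of_real (g p)))\<^sup>2 <= ?b p" if "p \<in> space (lborel_on S)" for p
    using that n by (cases p) (auto simp: g_def space_restrict_space mem_S cbox_Pair_eq indicator_def)
  show gL: "(\<lambda>p. complex_of_real (g p)) \<in> L2 (lborel_on S)" by (rule L2_bound[OF gm biS le])
  have "(L2_norm (lborel_on S) (\<lambda>p. of_real (g p)))\<^sup>2 <= (\<integral>p. ?b p \<partial>lborel_on S)"
    unfolding L2_norm_sq by (rule integral_mono[OF L2_integrable[OF gL] biS le])
  also have "... = (\<integral>p. indicator S p *\<^sub>R ?b p \<partial>lborel)" by (subst integral_restrict_space) auto
  also have "... <= (\<integral>p. ?b p \<partial>lborel)" by (rule integral_mono[OF bi' bi]) (simp add: indicator_def)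
  also have "... = integral ?R (\<lambda>p. (h (snd p))\<^sup>2)"
    using set_borel_integral_eq_integral(2)[of ?R "\<lambda>p. (h (snd p))\<^sup>2"] bi
    by (simp add: set_integrable_def set_lebesgue_integral_def)
  also have "... = 2 * n * integral {0..d} (\<lambda>u. (h u)\<^sup>2)"
    using integral_prod_continuous[OF hc, of "c - n" 0 "c + n" d] n by (simp add: cbox_interval)
  finally show "(L2_norm (lborel_on S) (\<lambda>p. of_real (g p)))\<^sup>2 <= 2 * n * integral {0..d} (\<lambda>u. (h u)\<^sup>2)" .
qed

text \<open>Pointwise estimates against the Jacobian become estimates between the norms on the two sides.\<close>

lemma norm_transfer:
  assumes h: "h \<in> L2 (lborel_on S)" and r: "integrable (lborel_on \<Omega>) r"
    and le: "!!p. p \<in> S ==> (cmod (h p))\<^sup>2 <= C * (J p * r (F p))"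
  shows "(L2_norm (lborel_on S) h)\<^sup>2 <= C * (\<integral>q. r q \<partial>lborel_on \<Omega>)"
proof -
  note tr = integral_\<Omega>[OF borel_measurable_integrable[OF r]]
  have "integrable (lborel_on S) (\<lambda>p. J p * r (F p))" using tr(2) r by simp
  then have "(\<integral>p. (cmod (h p))\<^sup>2 \<partial>lborel_on S) <= (\<integral>p. C * (J p * r (F p)) \<partial>lborel_on S)"
    using le by (intro integral_mono L2_integrable[OF h]) (auto simp: space_restrict_space)
  then show ?thesis unfolding L2_norm_sq tr(1) by simp
qed

end

context magnetic_strip
begin

lemma pull_norms:
  assumes \<psi>: "C_k 1 \<psi>" "supported_in \<Omega> \<psi>" and j: "j > 0" "!!p. p \<in> S ==> j <= J p"
  shows "L2_norm (lborel_on S) (pull \<psi>) + L2_norm (lborel_on S) (D1 (pull \<psi>)) + L2_norm (lborel_on S) (D2 (pull \<psi>))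
    <= (2 + 1 / sqrt j) * (L2_norm L \<psi> + (\<Sum>e\<in>Basis. L2_norm L (partial_deriv e \<psi>)))"
proof -
  let ?x = "D1 \<psi>" and ?y = "D2 \<psi>" and ?M = "lborel_on S"
  let ?ws = "D1 (pull \<psi>)" and ?wu = "D2 (pull \<psi>)"
  let ?g = "L2_norm L ?x + L2_norm L ?y"
  note w = pull_C1(1,2)[OF \<psi>]
  have wL: "pull \<psi> \<in> L2 ?M" "?ws \<in> L2 ?M" "?wu \<in> L2 ?M" using C1_supported_L2[OF open_S w] by (auto simp: Basis_plane)
  have \<psi>L: "\<psi> \<in> L2 L" "?x \<in> L2 L" "?y \<in> L2 L" using C1_supported_L2[OF open_\<Omega> \<psi>] by (auto simp: Basis_plane)
  note nn = L2_norm_def real_sqrt_ge_zero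
  have n0: "0 <= L2_norm M f" for M :: "(real \<times> real) measure" and f by (simp add: L2_norm_def)
  have grad: "(\<integral>q. (cmod (?x q))\<^sup>2 + (cmod (?y q))\<^sup>2 \<partial>L) <= ?g\<^sup>2"
    using n0[of L ?x] n0[of L ?y] by (simp add: Bochner_Integration.integral_add L2_integrable \<psi>L L2_norm_sq[symmetric] power2_sum)
  have gi: "integrable L (\<lambda>q. (cmod (?x q))\<^sup>2 + (cmod (?y q))\<^sup>2)" by (intro Bochner_Integration.integrable_add L2_integrable \<psi>L)
  have "(L2_norm ?M (pull \<psi>))\<^sup>2 <= 1 / j * (\<integral>q. (cmod (\<psi> q))\<^sup>2 \<partial>L)"
  proof (rule norm_transfer[OF wL(1) L2_integrable[OF \<psi>L(1)]])
    fix p assume p: "p \<in> S"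
    have "j * (cmod (\<psi> (F p)))\<^sup>2 <= J p * (cmod (\<psi> (F p)))\<^sup>2" using j(2)[OF p] by (intro mult_right_mono) auto
    then show "(cmod (pull \<psi> p))\<^sup>2 <= 1 / j * (J p * (cmod (\<psi> (F p)))\<^sup>2)" using j(1) by (simp add: pull_S[OF p] pos_le_divide_eq mult.commute)
  qed
  also have "... = (1 / sqrt j * L2_norm L \<psi>)\<^sup>2" using j(1) by (simp add: L2_norm_sq power_mult_distrib power_divide)
  finally have 1: "L2_norm ?M (pull \<psi>) <= 1 / sqrt j * L2_norm L \<psi>"
    by (rule power2_le_imp_le) (use j(1) n0[of L \<psi>] in simp)
  have "(L2_norm ?M ?ws)\<^sup>2 <= 2 * (\<integral>q. (cmod (?x q))\<^sup>2 + (cmod (?y q))\<^sup>2 \<partial>L)"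
  proof (rule norm_transfer[OF wL(2) gi])
    fix p assume p: "p \<in> S"
    have J: "0 < J p" "J p < 2" using J_pos[OF p] J_less_2[OF p] .
    have "(cmod (?ws p))\<^sup>2 = (J p)\<^sup>2 * ((cmod (?ws p))\<^sup>2 / (J p)\<^sup>2)" using J by simp
    also have "... <= (J p)\<^sup>2 * ((cmod (?x (F p)))\<^sup>2 + (cmod (?y (F p)))\<^sup>2)"
      unfolding gradient_norm[OF \<psi> p] by (intro mult_left_mono) auto
    also have "... = J p * (J p * ((cmod (?x (F p)))\<^sup>2 + (cmod (?y (F p)))\<^sup>2))" by (simp add: power2_eq_square)
    also have "... <= 2 * (J p * ((cmod (?x (F p)))\<^sup>2 + (cmod (?y (F p)))\<^sup>2))" using J by (intro mult_right_mono) auto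
    finally show "(cmod (?ws p))\<^sup>2 <= 2 * (J p * ((cmod (?x (F p)))\<^sup>2 + (cmod (?y (F p)))\<^sup>2))" .
  qed
  also have "... <= 2 * ?g\<^sup>2" using grad by simp
  also have "... <= (2 * ?g)\<^sup>2" unfolding power_mult_distrib by (rule mult_right_mono) auto
  finally have 2: "L2_norm ?M ?ws <= 2 * ?g" by (rule power2_le_imp_le) (use n0[of L ?x] n0[of L ?y] in simp)
  have "(L2_norm ?M ?wu)\<^sup>2 <= 1 / j * (\<integral>q. (cmod (?x q))\<^sup>2 + (cmod (?y q))\<^sup>2 \<partial>L)"
  proof (rule norm_transfer[OF wL(3) gi])
    fix p assume p: "p \<in> S"
    have "j * (cmod (?wu p))\<^sup>2 <= J p * ((cmod (?x (F p)))\<^sup>2 + (cmod (?y (F p)))\<^sup>2)"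
      unfolding gradient_norm[OF \<psi> p] using j(1) j(2)[OF p] by (intro mult_mono) auto
    then show "(cmod (?wu p))\<^sup>2 <= 1 / j * (J p * ((cmod (?x (F p)))\<^sup>2 + (cmod (?y (F p)))\<^sup>2))"
      using j(1) by (simp add: pos_le_divide_eq mult.commute)
  qed
  also have "... <= 1 / j * ?g\<^sup>2" using grad j(1) by (intro mult_left_mono) auto
  also have "... = (1 / sqrt j * ?g)\<^sup>2" using j(1) by (simp add: power_mult_distrib power_divide)
  finally have 3: "L2_norm ?M ?wu <= 1 / sqrt j * ?g" by (rule power2_le_imp_le) (use j(1) n0[of L ?x] n0[of L ?y] in simp)
  have "1 / sqrt j * L2_norm L \<psi> + 2 * ?g + 1 / sqrt j * ?g <= (2 + 1 / sqrt j) * (L2_norm L \<psi> + ?g)"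
    using n0[of L \<psi>] by (simp add: distrib_left distrib_right)
  then show ?thesis using 1 2 3 by (simp add: sum_Basis_plane)
qed

end

context magnetic_strip
begin

lemma partial_deriv_le_pull:
  assumes \<psi>: "C_k 1 \<psi>" "supported_in \<Omega> \<psi>" and p: "p \<in> S" and J: "1 / 2 <= J p" and e: "e \<in> Basis"
  shows "cmod (partial_deriv e \<psi> (F p)) <= 2 * cmod (D1 (pull \<psi>) p) + cmod (D2 (pull \<psi>) p)"
proof (rule power2_le_imp_le)
  let ?ws = "cmod (D1 (pull \<psi>) p)" and ?wu = "cmod (D2 (pull \<psi>) p)"
  have "(cmod (partial_deriv e \<psi> (F p)))\<^sup>2 <= (cmod (D1 \<psi> (F p)))\<^sup>2 + (cmod (D2 \<psi> (F p)))\<^sup>2"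
    using e by (auto simp: Basis_plane)
  also have "... = (?ws / J p)\<^sup>2 + ?wu\<^sup>2" by (simp only: gradient_norm[OF \<psi> p] power_divide)
  also have "... <= (2 * ?ws)\<^sup>2 + ?wu\<^sup>2"
  proof -
    have "1 / J p <= 2" using J by (simp add: pos_divide_le_eq)
    then have "?ws * (1 / J p) <= ?ws * 2" by (intro mult_left_mono) auto
    then have "(?ws / J p)\<^sup>2 <= (2 * ?ws)\<^sup>2" using J by (intro power_mono) auto
    then show ?thesis by simp
  qed
  also have "... <= (2 * ?ws + ?wu)\<^sup>2" by (simp add: power2_sum)
  finally show "(cmod (partial_deriv e \<psi> (F p)))\<^sup>2 <= (2 * ?ws + ?wu)\<^sup>2" .
qed simp

text \<open>Compared with the straight strip without field, curvature contributes the factors \<open>1 / J - 1\<close> and \<open>J - 1\<close>, and the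
  field the cross terms \<open>T\<close>. The constant \<open>12\<close> collects the bounds \<open>J <= 3/2\<close> and \<open>1 / J <= 2\<close>.\<close>

lemma form_density_near_flat:
  assumes \<phi>: "C_k 1 \<phi>" "supported_in \<Omega> \<phi>" and \<psi>: "C_k 1 \<psi>" "supported_in \<Omega> \<psi>" and p: "p \<in> S"
    and \<eta>: "0 <= \<eta>" "\<eta> <= 1 / 2" and J1: "\<bar>J p - 1\<bar> <= \<eta>" and A1: "!!e. e \<in> Basis ==> \<bar>A (F p) \<bullet> e\<bar> <= \<eta>"
    and V: "cmod (pull \<phi> p) <= V" "cmod (D1 (pull \<phi>) p) <= V" "cmod (D2 (pull \<phi>) p) <= V"
    and \<kappa>: "\<kappa> \<ge> 0"
  shows "cmod (J p *\<^sub>R ((\<Sum>e\<in>Basis. classical_mp e \<phi> (F p) * cnj (classical_mp e \<psi> (F p))) - of_real \<kappa> * (\<phi> (F p) * cnj (\<psi> (F p))))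
      - (D1 (pull \<phi>) p * cnj (D1 (pull \<psi>) p)
        + D2 (pull \<phi>) p * cnj (D2 (pull \<psi>) p) - of_real \<kappa> * (pull \<phi> p * cnj (pull \<psi> p))))
    <= (12 + \<kappa>) * \<eta> * V * (cmod (pull \<psi> p) + cmod (D1 (pull \<psi>) p) + cmod (D2 (pull \<psi>) p))"
proof -
  define j where "j = J p"
  have j: "1 / 2 <= j" "j <= 3 / 2" "\<bar>j - 1\<bar> <= \<eta>" using J1 \<eta> by (auto simp: j_def abs_le_iff)
  have j0: "complex_of_real j ~= 0" using j by simp
  define v vs vu where "v = pull \<phi> p" and "vs = D1 (pull \<phi>) p" and "vu = D2 (pull \<phi>) p"
  define w ws wu where "w = pull \<psi> p" and "ws = D1 (pull \<psi>) p" and "wu = D2 (pull \<psi>) p"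
  have vw: "\<phi> (F p) = v" "\<psi> (F p) = w" by (simp_all add: v_def w_def pull_S[OF p])
  have V': "cmod v <= V" "cmod vs <= V" "cmod vu <= V" and V0: "V \<ge> 0"
    using V order_trans[OF norm_ge_zero V(1)] by (auto simp: v_def vs_def vu_def)
  define T where "T e = \<i> * of_real (A (F p) \<bullet> e) * partial_deriv e \<phi> (F p) * cnj w
    - \<i> * of_real (A (F p) \<bullet> e) * v * cnj (partial_deriv e \<psi> (F p)) + (of_real (A (F p) \<bullet> e))\<^sup>2 * v * cnj w" for e
  have mp: "classical_mp e \<phi> (F p) * cnj (classical_mp e \<psi> (F p)) = partial_deriv e \<phi> (F p) * cnj (partial_deriv e \<psi> (F p)) + T e" for e
    by (simp add: classical_mp_def T_def vw algebra_simps power2_eq_square)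
  have Te: "cmod (T e) <= \<eta> * V * (4 * cmod w + 2 * cmod ws + cmod wu)" if e: "e \<in> Basis" for e
  proof -
    let ?a = "\<bar>A (F p) \<bullet> e\<bar>"
    have a: "?a <= \<eta>" "0 <= ?a" using A1[OF e] by auto
    have "cmod (partial_deriv e \<phi> (F p)) <= 2 * cmod vs + cmod vu"
      unfolding vs_def vu_def by (rule partial_deriv_le_pull[OF \<phi> p _ e]) (use j in \<open>simp add: j_def\<close>)
    then have x: "cmod (partial_deriv e \<phi> (F p)) <= 3 * V" using V' by linarith
    have y: "cmod (partial_deriv e \<psi> (F p)) <= 2 * cmod ws + cmod wu"
      unfolding ws_def wu_def by (rule partial_deriv_le_pull[OF \<psi> p _ e]) (use j in \<open>simp add: j_def\<close>)
    have "cmod (T e) <= ?a * cmod (partial_deriv e \<phi> (F p)) * cmod w + ?a * cmod v * cmod (partial_deriv e \<psi> (F p)) + ?a\<^sup>2 * cmod v * cmod w"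
      unfolding T_def
      by (rule order_trans[OF norm_triangle_ineq] order_trans[OF add_right_mono[OF norm_triangle_ineq4]])+ (simp add: norm_mult norm_power)
    also have "... <= \<eta> * (3 * V) * cmod w + \<eta> * V * (2 * cmod ws + cmod wu) + (\<eta> * 1) * V * cmod w"
      unfolding power2_eq_square using a x y V' V0 \<eta> by (intro add_mono mult_mono mult_nonneg_nonneg) auto
    also have "... = \<eta> * V * (4 * cmod w + 2 * cmod ws + cmod wu)" by (simp add: algebra_simps)
    finally show ?thesis .
  qed
  have "cmod (\<Sum>e\<in>Basis. T e) <= (\<Sum>e\<in>(Basis :: (real \<times> real) set). \<eta> * V * (4 * cmod w + 2 * cmod ws + cmod wu))"
    by (rule sum_norm_le) (rule Te)
  then have T: "cmod (\<Sum>e\<in>Basis. T e) <= 2 * (\<eta> * V * (4 * cmod w + 2 * cmod ws + cmod wu))" by (simp add: sum_Basis_plane)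
  have grad: "(\<Sum>e\<in>Basis. partial_deriv e \<phi> (F p) * cnj (partial_deriv e \<psi> (F p))) = vs * cnj ws / (of_real j)\<^sup>2 + vu * cnj wu"
    using gradient_inner[OF \<phi> \<psi> p] by (simp add: sum_Basis_plane vs_def vu_def ws_def wu_def j_def)
  have alg: "j *\<^sub>R (vs * cnj ws / (of_real j)\<^sup>2 + vu * cnj wu + X - of_real \<kappa> * (v * cnj w)) - (vs * cnj ws + vu * cnj wu - of_real \<kappa> * (v * cnj w))
    = of_real (1 / j - 1) * (vs * cnj ws) + of_real (j - 1) * (vu * cnj wu) + (of_real j * X - of_real (\<kappa> * (j - 1)) * (v * cnj w))" for X
  proof -
    have "complex_of_real j * (vs * cnj ws / (of_real j)\<^sup>2) = of_real (1 / j) * (vs * cnj ws)"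
      using j0 by (simp add: power2_eq_square)
    then show ?thesis by (simp add: scaleR_conv_of_real algebra_simps)
  qed
  have j': "\<bar>1 / j - 1\<bar> <= 2 * \<eta>"
  proof -
    have "\<bar>1 / j - 1\<bar> = \<bar>j - 1\<bar> * (1 / j)" using j by (simp add: abs_if field_simps)
    also have "... <= \<eta> * 2" using j \<eta> by (intro mult_mono) (auto simp: pos_divide_le_eq)
    finally show ?thesis by simp
  qed
  have "cmod (of_real (1 / j - 1) * (vs * cnj ws) + of_real (j - 1) * (vu * cnj wu) + (of_real j * (\<Sum>e\<in>Basis. T e) - of_real (\<kappa> * (j - 1)) * (v * cnj w)))
    <= \<bar>1 / j - 1\<bar> * (cmod vs * cmod ws) + \<bar>j - 1\<bar> * (cmod vu * cmod wu) + (\<bar>j\<bar> * cmod (\<Sum>e\<in>Basis. T e) + \<bar>\<kappa> * (j - 1)\<bar> * (cmod v * cmod w))"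
    by (intro order_trans[OF norm_triangle_ineq] add_mono order_trans[OF norm_triangle_ineq4]) (simp_all only: norm_mult norm_of_real complex_mod_cnj order_refl)
  also have "... <= 2 * \<eta> * (V * cmod ws) + \<eta> * (V * cmod wu) + (3 / 2 * (2 * (\<eta> * V * (4 * cmod w + 2 * cmod ws + cmod wu))) + \<kappa> * \<eta> * (V * cmod w))"
    using j j' T V' V0 \<eta> \<kappa> by (intro add_mono mult_mono mult_nonneg_nonneg) (auto simp: abs_mult intro!: mult_left_mono)
  also have "... <= (12 + \<kappa>) * \<eta> * V * (cmod w + cmod ws + cmod wu)"
  proof -
    have "0 <= (4 + \<kappa>) * (\<eta> * V * cmod ws)" "0 <= (8 + \<kappa>) * (\<eta> * V * cmod wu)" using \<eta> V0 \<kappa> by auto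
    then show ?thesis by (simp add: algebra_simps)
  qed
  finally show ?thesis
    unfolding vw mp sum.distrib grad v_def[symmetric] w_def[symmetric] vs_def[symmetric] vu_def[symmetric] ws_def[symmetric] wu_def[symmetric]
      j_def[symmetric] alg .
qed

text \<open>For the wave packet \<open>v = E(s) z(u)\<close> with \<open>E = e\<^sup>i\<^sup>k\<^sup>s \<theta>\<close>, the density of the form minus \<open>\<kappa>\<close> is compared with the
  divergence \<open>Z = \<partial>\<^sub>s (\<i> k v w*) + \<partial>\<^sub>u (E m cos(m u) w*)\<close>, where \<open>w*\<close> is the conjugate of \<open>w\<close>; it integrates to zero.
  Using the derivative of the untrimmed mode in \<open>Z\<close> avoids the second derivative of \<open>z\<close>, which is large near the
  boundary. What remains is bounded by \<open>g (|w| + |w\<^sub>s| + |w\<^sub>u|)\<close>, and \<open>g\<close> is small in \<open>L\<^sup>2\<close> compared with \<open>v\<close>.\<close>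

lemma not_regular_above_threshold:
  assumes \<kappa>: "(pi / d)\<^sup>2 <= \<kappa>"
  shows "\<not> regular (of_real \<kappa>)"
proof (rule not_regular_of_test[folded \<Omega>_def])
  fix \<epsilon> :: real assume \<epsilon>: "\<epsilon> > 0"
  obtain j where j: "j > 0" "!!p. p \<in> S ==> j <= J p" using J_lower_bound by blast
  define m k where "m = pi / d" and "k = sqrt (\<kappa> - m\<^sup>2)"
  have m: "m > 0" using d_pos by (simp add: m_def)
  have k: "k \<ge> 0" "\<kappa> = k\<^sup>2 + m\<^sup>2" "\<kappa> \<ge> 0" using \<kappa> by (auto simp: k_def m_def intro: order_trans[OF zero_le_power2])
  define V where "V = k + 5 + m"
  \<comment> \<open>The constant of \<open>pull_norms\<close>; the next choices make \<open>\<parallel>g\<parallel> C <= \<epsilon> \<parallel>\<phi>\<parallel>\<close>.\<close>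
  define C where "C = 2 + 1 / sqrt j"
  define \<epsilon>1 where "\<epsilon>1 = \<epsilon>\<^sup>2 * j * d / (128 * C\<^sup>2)"
  define \<alpha> where "\<alpha> = sqrt (\<epsilon>1 / d)"
  define \<eta> where "\<eta> = min (1 / 2) (\<alpha> / (2 * V * (12 + \<kappa>)))"
  define n where "n = max 1 (8 * (1 + k) / \<alpha>)"
  have V: "V > 0" using m k by (simp add: V_def)
  have C: "C > 0" using j by (simp add: C_def add_pos_pos)
  have \<epsilon>1: "\<epsilon>1 > 0" using \<epsilon> j d_pos C by (simp add: \<epsilon>1_def)
  have \<alpha>: "\<alpha> > 0" "\<alpha>\<^sup>2 * d = \<epsilon>1" using \<epsilon>1 d_pos by (auto simp: \<alpha>_def)
  have pos: "2 * V * (12 + \<kappa>) > 0" using V k(3) by simp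
  have "\<alpha> / (2 * V * (12 + \<kappa>)) > 0" using \<alpha>(1) pos by (rule divide_pos_pos)
  then have \<eta>: "\<eta> > 0" "\<eta> <= 1 / 2" unfolding \<eta>_def by linarith+
  have n: "n > 0" "4 / n <= 4" by (auto simp: n_def pos_divide_le_eq)
  have \<eta>\<alpha>: "(12 + \<kappa>) * \<eta> * V <= \<alpha> / 2"
  proof -
    have "\<eta> <= \<alpha> / (2 * V * (12 + \<kappa>))" by (simp add: \<eta>_def)
    then have "\<eta> * (2 * V * (12 + \<kappa>)) <= \<alpha>" using pos by (simp only: pos_le_divide_eq)
    then show ?thesis by (simp add: mult.assoc mult.commute mult.left_commute)
  qed
  have n\<alpha>: "4 / n * (1 + k) <= \<alpha> / 2"
  proof -
    have "8 * (1 + k) / \<alpha> <= n" by (simp add: n_def)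
    then have "8 * (1 + k) <= n * \<alpha>" using \<alpha> by (simp add: pos_divide_le_eq)
    then show ?thesis using n by (simp add: pos_divide_le_eq mult.commute)
  qed
  obtain N1 where N1: "N1 \<ge> 0" "\<forall>p\<in>S. \<bar>fst p\<bar> \<ge> N1 --> \<bar>J p - 1\<bar> <= \<eta>" using J_near_1[OF \<eta>(1)] by blast
  obtain N2 where N2: "N2 \<ge> 0" "\<forall>p\<in>S. \<bar>fst p\<bar> \<ge> N2 --> (\<forall>e\<in>Basis. \<bar>A (F p) \<bullet> e\<bar> <= \<eta>)" using A_small[OF \<eta>(1)] by blast
  \<comment> \<open>The interval \<open>]c - n, c + n[\<close> lies beyond \<open>N1\<close> and \<open>N2\<close>.\<close>
  define c where "c = max N1 N2 + n"
  obtain \<theta> \<theta>' where \<theta>: "!!s. (\<theta> has_real_derivative \<theta>' s) (at s)" "continuous_on UNIV \<theta>'" "!!s. 0 <= \<theta> s \<and> \<theta> s <= 1" "!!s. \<bar>\<theta>' s\<bar> <= 4 / n"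
    "!!s. \<bar>s - c\<bar> \<ge> n ==> \<theta> s = 0 \<and> \<theta>' s = 0" "n / 4 <= integral {c - n..c + n} (\<lambda>s. (\<theta> s)\<^sup>2)"
    by (rule longitudinal_profile[OF n(1), of c]) blast
  obtain z z' where z: "!!u. (z has_real_derivative z' u) (at u)" "continuous_on UNIV z'"
    "\<exists>r>0. \<forall>u. z u ~= 0 --> r <= u \<and> u <= d - r" "!!u. 0 <= z u \<and> z u <= 1" "!!u. \<bar>z' u\<bar> <= m"
    "integral {0..d} (\<lambda>u. (\<bar>z' u - m * cos (m * u)\<bar> + m\<^sup>2 * \<bar>sin (m * u) - z u\<bar>)\<^sup>2) <= \<epsilon>1"
    "d / 4 <= integral {0..d} (\<lambda>u. (z u)\<^sup>2)"
    unfolding m_def by (rule transverse_profile[OF d_pos \<epsilon>1]) blast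
  have c\<theta>: "continuous_on Y \<theta>" "continuous_on Y \<theta>'" for Y
    by (simp_all add: continuous_at_imp_continuous_on DERIV_isCont[OF \<theta>(1)] continuous_on_subset[OF \<theta>(2) subset_UNIV])
  have cz: "continuous_on Y z" "continuous_on Y z'" for Y
    by (simp_all add: continuous_at_imp_continuous_on DERIV_isCont[OF z(1)] continuous_on_subset[OF z(2) subset_UNIV])
  define X where "X s = exp (s *\<^sub>R (\<i> * complex_of_real k))" for s :: real
  have X1: "cmod (X s) = 1" for s by (simp add: X_def)
  have dX: "(X has_vector_derivative X s * (\<i> * of_real k)) (at s)" for s
    unfolding X_def by (rule exp_scaleR_has_vector_derivative_right)
  have cX: "continuous_on Y X" for Y unfolding X_def[abs_def] by (intro continuous_intros)
  define E E' where "E s = X s * of_real (\<theta> s)" and "E' s = X s * of_real (\<theta>' s) + X s * (\<i> * of_real k) * of_real (\<theta> s)" for s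
  have E: "(E has_vector_derivative E' s) (at s)" for s
    unfolding E_def[abs_def] E'_def by (intro has_vector_derivative_mult dX has_vector_derivative_of_real \<theta>(1))
  have E'c: "continuous_on UNIV E'" unfolding E'_def[abs_def] by (intro continuous_intros cX c\<theta>)
  define v where "v = (\<lambda>p :: real \<times> real. E (fst p) * of_real (z (snd p)))"
  note v = C1_separated[OF E E'c z(1,2), folded v_def]
  define f1 where "f1 = (\<lambda>p :: real \<times> real. (\<i> * of_real k * E (fst p)) * of_real (z (snd p)))"
  have f1: "C_k 1 f1" "D1 f1 = (\<lambda>p. \<i> * of_real k * E' (fst p) * of_real (z (snd p)))"
    unfolding f1_def
    by (rule C1_separated[OF has_vector_derivative_mult_right[OF E] _ z(1,2)], intro continuous_intros E'c)+
  define f2 where "f2 = (\<lambda>p :: real \<times> real. E (fst p) * of_real (m * cos (m * snd p)))"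
  have dcos: "((\<lambda>u. m * cos (m * u)) has_real_derivative - (m\<^sup>2 * sin (m * u))) (at u)" for u
    by (auto intro!: derivative_eq_intros simp: power2_eq_square)
  have ccos: "continuous_on UNIV (\<lambda>u. - (m\<^sup>2 * sin (m * u)))" by (intro continuous_intros)
  note f2 = C1_separated[OF E E'c dcos ccos, folded f2_def]
  obtain r where r: "r > 0" "!!u. z u ~= 0 ==> r <= u \<and> u <= d - r" using z(3) by blast
  have vS: "supported_in S v"
    unfolding supported_in_def
  proof (intro exI conjI allI impI)
    show "compact (cbox (c - n, r) (c + n, d - r))" by (rule compact_cbox)
    show "cbox (c - n, r) (c + n, d - r) \<subseteq> S" using r(1) by (auto simp: mem_S cbox_Pair_eq)
    fix p assume p: "p \<notin> cbox (c - n, r) (c + n, d - r)"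
    show "v p = 0"
    proof (rule ccontr)
      assume "v p ~= 0"
      then have "\<theta> (fst p) ~= 0" "z (snd p) ~= 0" by (auto simp: v_def E_def)
      then have "\<bar>fst p - c\<bar> < n" "r <= snd p \<and> snd p <= d - r" using \<theta>(5)[of "fst p"] r(2) by force+
      then show False using p by (cases p) (auto simp: cbox_Pair_eq abs_less_iff)
    qed
  qed
  define \<phi> where "\<phi> = push v"
  have \<phi>: "C_k 1 \<phi>" "supported_in \<Omega> \<phi>" unfolding \<phi>_def by (rule push_C1[OF v(1) vS])+
  have pull_\<phi>: "pull \<phi> = v" unfolding \<phi>_def by (rule pull_push[OF vS])
  have E1: "cmod (E s) <= 1" for s using \<theta>(3)[of s] by (simp add: E_def norm_mult X1)
  have E'1: "cmod (E' s) <= 4 + k" for s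
  proof -
    have "cmod (E' s) <= \<bar>\<theta>' s\<bar> + k * \<bar>\<theta> s\<bar>"
      unfolding E'_def by (rule order_trans[OF norm_triangle_ineq]) (use k in \<open>simp add: norm_mult X1\<close>)
    also have "... <= 4 + k * 1" using \<theta>(3)[of s] \<theta>(4)[of s] n k by (intro add_mono mult_left_mono) auto
    finally show ?thesis by simp
  qed
  have vV: "cmod (v p) <= V" "cmod (D1 v p) <= V" "cmod (D2 v p) <= V" for p
  proof -
    have "cmod (E (fst p)) * \<bar>z (snd p)\<bar> <= 1 * 1" "cmod (E' (fst p)) * \<bar>z (snd p)\<bar> <= (4 + k) * 1" "cmod (E (fst p)) * \<bar>z' (snd p)\<bar> <= 1 * m"
      using E1[of "fst p"] E'1[of "fst p"] z(4,5)[of "snd p"] k by (intro mult_mono; auto)+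
    then show "cmod (v p) <= V" "cmod (D1 v p) <= V" "cmod (D2 v p) <= V"
      unfolding v(2,3) using k m by (simp_all add: v_def norm_mult V_def)
  qed
  define h where "h u = \<alpha> + (\<bar>z' u - m * cos (m * u)\<bar> + m\<^sup>2 * \<bar>sin (m * u) - z u\<bar>)" for u
  have hc: "continuous_on Y h" for Y unfolding h_def[abs_def] by (intro continuous_intros cz)
  define g where "g p = (if \<bar>fst p - c\<bar> < n then h (snd p) else 0)" for p :: "real \<times> real"
  have g0: "g p \<ge> 0" for p using \<alpha> by (simp add: g_def h_def)
  note gL = L2_rectangle_profile[OF hc n(1), of c, folded g_def]
  have g_norm: "(L2_norm (lborel_on S) (\<lambda>p. of_real (g p)))\<^sup>2 <= 8 * n * \<epsilon>1"
  proof -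
    let ?e = "\<lambda>u. \<bar>z' u - m * cos (m * u)\<bar> + m\<^sup>2 * \<bar>sin (m * u) - z u\<bar>"
    have sq: "(\<alpha> + y)\<^sup>2 <= 2 * \<alpha>\<^sup>2 + 2 * y\<^sup>2" for y
      using zero_le_power2[of "\<alpha> - y"] by (simp add: power2_sum power2_diff)
    have ei: "(\<lambda>u. 2 * (?e u)\<^sup>2) integrable_on {0..d}" by (intro integrable_continuous_real continuous_intros cz)
    have "integral {0..d} (\<lambda>u. (h u)\<^sup>2) <= integral {0..d} (\<lambda>u. 2 * \<alpha>\<^sup>2 + 2 * (?e u)\<^sup>2)"
      unfolding h_def by (intro integral_le integrable_continuous_real continuous_intros cz sq)
    also have "... = integral {0..d} (\<lambda>u. 2 * \<alpha>\<^sup>2) + integral {0..d} (\<lambda>u. 2 * (?e u)\<^sup>2)"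
      by (rule Henstock_Kurzweil_Integration.integral_add[OF _ ei]) (intro integrable_continuous_real continuous_intros)
    also have "... = 2 * (\<alpha>\<^sup>2 * d) + 2 * integral {0..d} (\<lambda>u. (?e u)\<^sup>2)" using d_pos by simp
    also have "... <= 4 * \<epsilon>1" using z(6) \<alpha>(2) by simp
    finally have "2 * n * integral {0..d} (\<lambda>u. (h u)\<^sup>2) <= 2 * n * (4 * \<epsilon>1)" using n by (intro mult_left_mono) auto
    from order_trans[OF gL(2) this] show ?thesis by (simp add: mult_ac)
  qed
  have \<phi>_norm: "n * d / 16 <= 1 / j * (L2_norm L \<phi>)\<^sup>2"
  proof -
    have vL: "v \<in> L2 (lborel_on S)" by (rule C1_supported_L2(1)[OF open_S v(1) vS])
    have "n * d / 16 <= integral {c - n..c + n} (\<lambda>s. (\<theta> s)\<^sup>2) * integral {0..d} (\<lambda>u. (z u)\<^sup>2)"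
      using mult_mono[OF \<theta>(6) z(7)] n d_pos by (simp add: order_trans[OF _ \<theta>(6)])
    also have "... = integral (cbox (c - n, 0) (c + n, d)) (\<lambda>p. (\<theta> (fst p))\<^sup>2 * (z (snd p))\<^sup>2)"
    proof -
      have "continuous_on (cbox (c - n, 0) (c + n, d)) (\<lambda>p. (\<theta> (fst p))\<^sup>2 * (z (snd p))\<^sup>2)"
        by (intro continuous_intros continuous_on_compose2[OF c\<theta>(1)[of UNIV]] continuous_on_compose2[OF cz(1)[of UNIV]]) auto
      from integral_prod_continuous[OF this] show ?thesis by (simp add: cbox_interval)
    qed
    also have "... = integral (cbox (c - n, 0) (c + n, d)) (\<lambda>p. (cmod (v p))\<^sup>2)"
      by (simp add: v_def E_def norm_mult X1 power_mult_distrib)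
    also have "... = (\<integral>p. (cmod (v p))\<^sup>2 \<partial>lborel)"
    proof (rule integral_cbox_eq_lborel)
      show "continuous_on UNIV (\<lambda>p. (cmod (v p))\<^sup>2)" by (intro continuous_intros C1_continuous v)
      show "(cmod (v p))\<^sup>2 = 0" if "p \<notin> cbox (c - n, 0) (c + n, d)" for p
      proof (rule ccontr)
        assume "(cmod (v p))\<^sup>2 ~= 0"
        then have "\<theta> (fst p) ~= 0" "z (snd p) ~= 0" by (auto simp: v_def E_def)
        then have "\<bar>fst p - c\<bar> < n" "r <= snd p \<and> snd p <= d - r" using \<theta>(5)[of "fst p"] r(2) by force+
        then show False using that r(1) by (cases p) (auto simp: cbox_Pair_eq abs_less_iff)
      qed
    qed
    also have "... = (L2_norm (lborel_on S) v)\<^sup>2"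
      unfolding L2_norm_sq by (rule integral_on_supported[OF open_S, symmetric]) (simp add: supported_in_outside[OF vS])
    also have "... <= 1 / j * (\<integral>q. (cmod (\<phi> q))\<^sup>2 \<partial>L)"
    proof (rule norm_transfer[OF vL L2_integrable[OF C1_supported_L2(1)[OF open_\<Omega> \<phi>]]])
      fix p assume p: "p \<in> S"
      have "j * (cmod (\<phi> (F p)))\<^sup>2 <= J p * (cmod (\<phi> (F p)))\<^sup>2" using j(2)[OF p] by (intro mult_right_mono) auto
      then show "(cmod (v p))\<^sup>2 <= 1 / j * (J p * (cmod (\<phi> (F p)))\<^sup>2)"
        using j(1) by (simp add: pull_\<phi>[symmetric] pull_S[OF p] pos_le_divide_eq mult.commute)
    qed
    finally show ?thesis by (simp add: L2_norm_sq)
  qed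
  have n0: "0 <= L2_norm M f" for M :: "(real \<times> real) measure" and f by (simp add: L2_norm_def)
  have \<phi>pos: "L2_norm L \<phi> > 0"
  proof (rule ccontr)
    assume "\<not> L2_norm L \<phi> > 0"
    then have "L2_norm L \<phi> = 0" using n0[of L \<phi>] by simp
    then show False using \<phi>_norm mult_pos_pos[OF n(1) d_pos] by simp
  qed
  have gC: "L2_norm (lborel_on S) (\<lambda>p. of_real (g p)) * C <= \<epsilon> * L2_norm L \<phi>"
  proof (rule power2_le_imp_le)
    have "(L2_norm (lborel_on S) (\<lambda>p. of_real (g p)) * C)\<^sup>2 <= 8 * n * \<epsilon>1 * C\<^sup>2"
      unfolding power_mult_distrib using g_norm by (intro mult_right_mono) auto
    also have "... = \<epsilon>\<^sup>2 * j * (n * d / 16)" using C by (simp add: \<epsilon>1_def)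
    also have "... <= \<epsilon>\<^sup>2 * j * (1 / j * (L2_norm L \<phi>)\<^sup>2)" using \<phi>_norm j by (intro mult_left_mono) auto
    also have "... = (\<epsilon> * L2_norm L \<phi>)\<^sup>2" using j by (simp add: power_mult_distrib)
    finally show "(L2_norm (lborel_on S) (\<lambda>p. of_real (g p)) * C)\<^sup>2 <= (\<epsilon> * L2_norm L \<phi>)\<^sup>2" .
  qed (use \<epsilon> n0[of L \<phi>] in simp)
  have main: "cmod ((\<Sum>e\<in>Basis. L2_inner L (classical_mp e \<phi>) (classical_mp e \<psi>)) - of_real \<kappa> * L2_inner L \<phi> \<psi>)
      <= \<epsilon> * L2_norm L \<phi> * (L2_norm L \<psi> + (\<Sum>e\<in>Basis. L2_norm L (partial_deriv e \<psi>)))"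
    if \<psi>t: "\<psi> \<in> test_functions \<Omega>" for \<psi>
  proof -
    note \<psi> = test_functionsD(2,3)[OF \<psi>t]
    define w ws wu where "w = pull \<psi>" and "ws = D1 w" and "wu = D2 w"
    have w: "C_k 1 w" "supported_in S w" unfolding w_def by (rule pull_C1(1,2)[OF \<psi>])+
    obtain K where K: "compact K" "K \<subseteq> S" "!!x. x \<notin> K ==> w x = 0" using w(2) unfolding supported_in_def by blast
    have wL: "w \<in> L2 (lborel_on S)" "ws \<in> L2 (lborel_on S)" "wu \<in> L2 (lborel_on S)"
      using C1_supported_L2[OF open_S w] by (auto simp: Basis_plane ws_def wu_def)
    define Z where "Z p = (D1 f1 p * cnj (w p) + f1 p * cnj (ws p)) + (D2 f2 p * cnj (w p) + f2 p * cnj (wu p))" for p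
    have Z: "integrable lborel Z" "(\<integral>p. Z p \<partial>lborel) = 0"
      using integral_by_parts_compact[OF f1(1) w(1) K(1,3), of "(1, 0)"] integral_by_parts_compact[OF f2(1) w(1) K(1,3), of "(0, 1)"]
      unfolding Z_def[abs_def] ws_def wu_def by (simp_all add: Basis_plane Bochner_Integration.integral_add)
    have Z_out: "Z p = 0" if "p \<notin> S" for p
    proof -
      have "p \<notin> K" using that K(2) by blast
      then show ?thesis using K(3) partial_deriv_eq_0_outside[OF compact_imp_closed[OF K(1)] K(3)] by (simp add: Z_def ws_def wu_def)
    qed
    have ZS: "integrable (lborel_on S) Z" "(\<integral>p. Z p \<partial>lborel_on S) = 0"
    proof -
      have "integrable lborel (\<lambda>p. indicator S p *\<^sub>R Z p)" by (rule integrable_mult_indicator[rotated, OF Z(1)]) simp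
      then show "integrable (lborel_on S) Z" by (subst integrable_restrict_space) auto
      show "(\<integral>p. Z p \<partial>lborel_on S) = 0" using integral_on_supported[OF open_S Z_out] Z(2) by simp
    qed
    define f where "f q = (\<Sum>e\<in>Basis. classical_mp e \<phi> q * cnj (classical_mp e \<psi> q)) - of_real \<kappa> * (\<phi> q * cnj (\<psi> q))" for q
    have int1: "integrable L (\<lambda>q. classical_mp e \<phi> q * cnj (classical_mp e \<psi> q))" if "e \<in> Basis" for e
      by (intro L2_inner_integrable classical_mp(2) \<phi> \<psi> that)
    have int2: "integrable L (\<lambda>q. \<phi> q * cnj (\<psi> q))"
      by (intro L2_inner_integrable C1_supported_L2(1) open_\<Omega> \<phi> \<psi>)
    have fi: "integrable L f"
      unfolding f_def[abs_def] using int1 int2 by (intro Bochner_Integration.integrable_diff Bochner_Integration.integrable_sum) auto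
    have f_int: "(\<integral>q. f q \<partial>L) = (\<Sum>e\<in>Basis. L2_inner L (classical_mp e \<phi>) (classical_mp e \<psi>)) - of_real \<kappa> * L2_inner L \<phi> \<psi>"
      unfolding f_def L2_inner_def using int1 int2
      by (subst Bochner_Integration.integral_diff) (auto intro!: Bochner_Integration.integrable_sum simp: Bochner_Integration.integral_sum)
    note fS = integral_\<Omega>[OF borel_measurable_integrable[OF fi]]
    have fSi: "integrable (lborel_on S) (\<lambda>p. J p *\<^sub>R f (F p))" using fS(2) fi by simp
    have bound: "cmod (J p *\<^sub>R f (F p) - Z p) <= g p * cmod (w p) + g p * cmod (ws p) + g p * cmod (wu p)" if p: "p \<in> S" for p
    proof (cases "\<bar>fst p - c\<bar> < n")
      case True
      let ?s = "fst p" and ?u = "snd p"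
      let ?W = "cmod (w p) + cmod (ws p) + cmod (wu p)"
      have far: "N1 <= \<bar>fst p\<bar>" "N2 <= \<bar>fst p\<bar>" using True unfolding c_def by linarith+
      define fl where "fl = D1 v p * cnj (ws p) + D2 v p * cnj (wu p) - of_real \<kappa> * (v p * cnj (w p))"
      have 1: "cmod (J p *\<^sub>R f (F p) - fl) <= (12 + \<kappa>) * \<eta> * V * ?W"
        unfolding f_def fl_def ws_def wu_def w_def pull_\<phi>[symmetric]
        by (rule form_density_near_flat[OF \<phi> \<psi> p _ \<eta>(2)]) (use \<eta> N1 N2 far p vV k(3) in \<open>auto simp: pull_\<phi>\<close>)
      define e1 where "e1 = X ?s * of_real (\<theta>' ?s) * of_real (z ?u)"
      have e1: "cmod e1 <= 4 / n"
      proof -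
        have "\<bar>\<theta>' ?s\<bar> * \<bar>z ?u\<bar> <= 4 / n * 1" using \<theta>(4)[of ?s] z(4)[of ?u] n by (intro mult_mono) auto
        then show ?thesis by (simp add: e1_def norm_mult X1)
      qed
      have "\<i> * \<i> = -1" by simp
      have fl: "fl - Z p = e1 * cnj (ws p) + E ?s * of_real (z' ?u - m * cos (m * ?u)) * cnj (wu p)
          + (E ?s * of_real (m\<^sup>2 * (sin (m * ?u) - z ?u)) - \<i> * of_real k * e1) * cnj (w p)"
        unfolding fl_def Z_def v(2,3) f1(2) f2(3) unfolding v_def f1_def f2_def k(2) e1_def E'_def E_def
        by (simp add: algebra_simps power2_eq_square)
      have "cmod (fl - Z p) <= cmod e1 * cmod (ws p) + cmod (E ?s) * \<bar>z' ?u - m * cos (m * ?u)\<bar> * cmod (wu p)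
          + (cmod (E ?s) * (m\<^sup>2 * \<bar>sin (m * ?u) - z ?u\<bar>) + k * cmod e1) * cmod (w p)"
      proof -
        have "cmod (E ?s * of_real (m\<^sup>2 * (sin (m * ?u) - z ?u)) - \<i> * of_real k * e1) <= cmod (E ?s) * (m\<^sup>2 * \<bar>sin (m * ?u) - z ?u\<bar>) + k * cmod e1"
          by (rule order_trans[OF norm_triangle_ineq4]) (use k in \<open>simp add: norm_mult norm_power abs_mult flip: of_real_diff\<close>)
        then have "cmod ((E ?s * of_real (m\<^sup>2 * (sin (m * ?u) - z ?u)) - \<i> * of_real k * e1) * cnj (w p))
          <= (cmod (E ?s) * (m\<^sup>2 * \<bar>sin (m * ?u) - z ?u\<bar>) + k * cmod e1) * cmod (w p)"
          unfolding norm_mult complex_mod_cnj by (rule mult_right_mono) simp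
        moreover have "cmod (e1 * cnj (ws p)) = cmod e1 * cmod (ws p)"
          "cmod (E ?s * of_real (z' ?u - m * cos (m * ?u)) * cnj (wu p)) = cmod (E ?s) * \<bar>z' ?u - m * cos (m * ?u)\<bar> * cmod (wu p)"
          by (simp_all only: norm_mult complex_mod_cnj norm_of_real)
        ultimately show ?thesis unfolding fl
          using norm_triangle_ineq[of "e1 * cnj (ws p) + E ?s * of_real (z' ?u - m * cos (m * ?u)) * cnj (wu p)"
              "(E ?s * of_real (m\<^sup>2 * (sin (m * ?u) - z ?u)) - \<i> * of_real k * e1) * cnj (w p)"]
            norm_triangle_ineq[of "e1 * cnj (ws p)" "E ?s * of_real (z' ?u - m * cos (m * ?u)) * cnj (wu p)"] by linarith
      qed
      also have "... <= (4 / n) * cmod (ws p) + 1 * \<bar>z' ?u - m * cos (m * ?u)\<bar> * cmod (wu p)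
          + (1 * (m\<^sup>2 * \<bar>sin (m * ?u) - z ?u\<bar>) + k * (4 / n)) * cmod (w p)"
        using e1 E1[of ?s] k by (intro add_mono mult_right_mono mult_left_mono) auto
      also have "... <= (h ?u - \<alpha> + 4 / n * (1 + k)) * ?W"
      proof -
        define q where "q = 4 / n"
        have "0 <= q" using n by (simp add: q_def)
        moreover have "q * y3 + 1 * x1 * y2 + (1 * x2 + k * q) * y1 <= (x1 + x2 + q * (1 + k)) * (y1 + y3 + y2)"
          if "0 <= x1" "0 <= x2" "0 <= y1" "0 <= y2" "0 <= y3" for x1 x2 y1 y2 y3
        proof -
          have "0 <= x1 * (y1 + y3) + x2 * (y2 + y3) + q * (y1 + y2) + q * k * (y2 + y3)" using that \<open>0 <= q\<close> k by simp
          then show ?thesis by (simp add: algebra_simps)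
        qed
        ultimately show ?thesis unfolding h_def q_def[symmetric] by simp
      qed
      finally have 2: "cmod (fl - Z p) <= (h ?u - \<alpha> + 4 / n * (1 + k)) * ?W" .
      have "cmod (J p *\<^sub>R f (F p) - Z p) <= cmod (J p *\<^sub>R f (F p) - fl) + cmod (fl - Z p)"
        using norm_triangle_ineq[of "J p *\<^sub>R f (F p) - fl" "fl - Z p"] by simp
      also have "... <= ((12 + \<kappa>) * \<eta> * V + (h ?u - \<alpha> + 4 / n * (1 + k))) * ?W" using 1 2 by (simp only: distrib_right[of _ _ ?W])
      also have "... <= h ?u * ?W"
      proof (rule mult_right_mono)
        show "(12 + \<kappa>) * \<eta> * V + (h ?u - \<alpha> + 4 / n * (1 + k)) <= h ?u" using \<eta>\<alpha> n\<alpha> by linarith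
      qed simp
      finally show ?thesis using True by (simp add: g_def distrib_left)
    next
      case False
      then have 0: "E (fst p) = 0" "E' (fst p) = 0" using \<theta>(5)[of "fst p"] by (auto simp: E_def E'_def)
      have "(cmod (D1 \<phi> (F p)))\<^sup>2 + (cmod (D2 \<phi> (F p)))\<^sup>2 = 0"
        unfolding gradient_norm[OF \<phi> p] pull_\<phi> v(2,3) by (simp add: 0)
      then have "D1 \<phi> (F p) = 0" "D2 \<phi> (F p) = 0" by (simp_all add: sum_power2_eq_zero_iff)
      moreover have "\<phi> (F p) = 0" using pull_S[OF p, of \<phi>] by (simp add: pull_\<phi> v_def 0)
      ultimately have "f (F p) = 0" by (simp add: f_def classical_mp_def sum_Basis_plane)
      moreover have "Z p = 0" unfolding Z_def f1(2) f2(3) by (simp add: f1_def f2_def 0)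
      ultimately show ?thesis using g0[of p] by simp
    qed
    note gw = integral_mult_norm_le[OF gL(1) _ g0]
    have gi: "integrable (lborel_on S) (\<lambda>p. g p * cmod (w p) + g p * cmod (ws p) + g p * cmod (wu p))"
      by (intro Bochner_Integration.integrable_add gw(2) wL)
    have "(\<integral>q. f q \<partial>L) = (\<integral>p. J p *\<^sub>R f (F p) - Z p \<partial>lborel_on S)"
      unfolding fS(1) using fSi ZS by (simp add: Bochner_Integration.integral_diff)
    also have "cmod ... <= (\<integral>p. g p * cmod (w p) + g p * cmod (ws p) + g p * cmod (wu p) \<partial>lborel_on S)"
      by (rule Bochner_Integration.integral_norm_bound_integral[OF Bochner_Integration.integrable_diff[OF fSi ZS(1)] gi])
        (use bound in \<open>simp add: space_restrict_space\<close>)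
    also have "... <= L2_norm (lborel_on S) (\<lambda>p. of_real (g p)) * (L2_norm (lborel_on S) w + L2_norm (lborel_on S) ws + L2_norm (lborel_on S) wu)"
      using gw(1)[OF wL(1)] gw(1)[OF wL(2)] gw(1)[OF wL(3)] by (simp add: Bochner_Integration.integral_add gw(2) wL distrib_left)
    also have "... <= L2_norm (lborel_on S) (\<lambda>p. of_real (g p)) * (C * (L2_norm L \<psi> + (\<Sum>e\<in>Basis. L2_norm L (partial_deriv e \<psi>))))"
      using pull_norms[OF \<psi> j] unfolding C_def w_def ws_def wu_def by (intro mult_left_mono n0) simp
    also have "... = L2_norm (lborel_on S) (\<lambda>p. of_real (g p)) * C * (L2_norm L \<psi> + (\<Sum>e\<in>Basis. L2_norm L (partial_deriv e \<psi>)))" by simp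
    also have "... <= \<epsilon> * L2_norm L \<phi> * (L2_norm L \<psi> + (\<Sum>e\<in>Basis. L2_norm L (partial_deriv e \<psi>)))"
      by (intro mult_right_mono[OF gC] add_nonneg_nonneg sum_nonneg n0)
    finally show ?thesis unfolding f_int .
  qed
  show "\<exists>\<phi>. C_k 1 \<phi> \<and> supported_in \<Omega> \<phi> \<and> L2_norm L \<phi> > 0 \<and>
    (\<forall>\<psi>\<in>test_functions \<Omega>. cmod ((\<Sum>e\<in>Basis. L2_inner L (classical_mp e \<phi>) (classical_mp e \<psi>)) - of_real \<kappa> * L2_inner L \<phi> \<psi>)
      <= \<epsilon> * L2_norm L \<phi> * (L2_norm L \<psi> + (\<Sum>e\<in>Basis. L2_norm L (partial_deriv e \<psi>))))"
    using \<phi> \<phi>pos main by blast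
qed

end

section \<open>The essential spectrum\<close>

context magnetic_strip
begin

lemma essential_spectrum_strip: "essential_spectrum L (magnetic_laplacian \<Omega> A) = of_real ` {(pi / d)\<^sup>2..}"
proof
  show "essential_spectrum L (magnetic_laplacian \<Omega> A) \<subseteq> of_real ` {(pi / d)\<^sup>2..}"
    by (rule essential_spectrum_subset[OF finite_rank_bound_below_threshold])
  show "of_real ` {(pi / d)\<^sup>2..} \<subseteq> essential_spectrum L (magnetic_laplacian \<Omega> A)"
    by (rule essential_spectrum_superset[OF not_regular_above_threshold])
qed

end

lemma (in strip) vector_field_small:
  fixes A :: "real \<times> real => real \<times> real"
  assumes decay: "!!e. e \<in> Basis ==> ((\<lambda>p. A p \<bullet> e) \<longlongrightarrow> 0) (inf at_infinity (principal \<Omega>))" and \<eta>: "\<eta> > 0"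
  shows "\<exists>N\<ge>0. \<forall>p\<in>S. \<bar>fst p\<bar> \<ge> N --> (\<forall>e\<in>Basis. \<bar>A (F p) \<bullet> e\<bar> <= \<eta>)"
proof -
  have "\<forall>\<^sub>F p in inf at_infinity (principal \<Omega>). \<forall>e\<in>Basis. dist (A p \<bullet> e) 0 < \<eta>"
    by (intro eventually_ball_finite ballI tendstoD[OF decay \<eta>]) auto
  then obtain R where R: "!!q. q \<in> \<Omega> ==> R <= norm q ==> \<forall>e\<in>Basis. dist (A q \<bullet> e) 0 < \<eta>"
    unfolding eventually_inf_principal eventually_at_infinity by blast
  obtain N where N: "N \<ge> 0" "\<forall>p\<in>S. \<bar>fst p\<bar> \<ge> N --> R <= norm (F p)" using F_to_infinity by blast
  have "\<bar>A (F p) \<bullet> e\<bar> <= \<eta>" if "p \<in> S" "\<bar>fst p\<bar> \<ge> N" "e \<in> Basis" for p e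
    using R[OF F_\<Omega>[OF that(1)]] N(2) that by (auto simp: dist_real_def intro: less_imp_le)
  then show ?thesis using N(1) by blast
qed

text \<open>Far out the field is at most \<open>1\<close>, and the rest of the strip lies in a compact set.\<close>

lemma (in strip) vector_field_bounded:
  fixes A :: "real \<times> real => real \<times> real"
  assumes decay: "!!e. e \<in> Basis ==> ((\<lambda>p. A p \<bullet> e) \<longlongrightarrow> 0) (inf at_infinity (principal \<Omega>))" and A: "continuous_on UNIV A"
  shows "\<exists>B\<ge>0. \<forall>q\<in>\<Omega>. \<forall>e\<in>Basis. \<bar>A q \<bullet> e\<bar> <= B"
proof -
  obtain N where N: "N \<ge> 0" "\<forall>p\<in>S. \<bar>fst p\<bar> \<ge> N --> (\<forall>e\<in>Basis. \<bar>A (F p) \<bullet> e\<bar> <= 1)"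
    using vector_field_small[OF decay zero_less_one] by blast
  have "continuous_on (cbox (-N, 0) (N, d)) (\<lambda>p. A (F p))" by (rule continuous_on_compose2[OF A continuous_F]) auto
  then have "bounded ((\<lambda>p. A (F p)) ` cbox (-N, 0) (N, d))" by (intro compact_imp_bounded compact_continuous_image compact_cbox)
  then obtain B where B: "!!p. p \<in> cbox (-N, 0) (N, d) ==> norm (A (F p)) <= B" unfolding bounded_iff by blast
  have "\<bar>A q \<bullet> e\<bar> <= max 1 B" if q: "q \<in> \<Omega>" and e: "e \<in> Basis" for q e
  proof (cases "\<bar>fst (G q)\<bar> \<ge> N")
    case True
    then show ?thesis using N(2) G_S[OF q] e FG[OF q] by force
  next
    case False
    then have "G q \<in> cbox (-N, 0) (N, d)" using G_S[OF q] by (cases "G q") (auto simp: mem_S cbox_Pair_eq)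
    then show ?thesis using B[of "G q"] Basis_le_norm[OF e, of "A q"] FG[OF q] by force
  qed
  then show ?thesis by (intro exI[of _ "max 1 B"]) auto
qed

theorem theorem3p3:
  fixes a b :: "real \<Rightarrow> real" and d \<beta> :: real and A :: "real \<times> real \<Rightarrow> real \<times> real"
  defines "\<Omega> \<equiv> curved_strip a b d"
  assumes d_pos: "d > 0"
    and a_smooth: "smooth a" and b_smooth: "smooth b"
    and arc_length: "\<And>s. (deriv a s)\<^sup>2 + (deriv b s)\<^sup>2 = 1"
    and thin: "\<And>s. d * \<bar>curvature a b s\<bar> < 1"
    and injective: "inj_on (strip_map a b) (UNIV \<times> {0<..<d})"
    and \<beta>_pos: "\<beta> > 0"
    and curvature_decay: "\<And>k s. k \<le> 3 \<Longrightarrow> \<bar>(deriv ^^ k) (curvature a b) s\<bar> \<le> \<beta> / (1 + s\<^sup>2)"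
    and A_C1: "C_k 1 A"
    and A_decay: "\<And>e. e \<in> Basis \<Longrightarrow> ((\<lambda>p. A p \<bullet> e) \<longlongrightarrow> 0) (inf at_infinity (principal \<Omega>))"
    and dA_decay: "\<And>e e'. e \<in> Basis \<Longrightarrow> e' \<in> Basis \<Longrightarrow>
      (partial_deriv e' (\<lambda>p. A p \<bullet> e) \<longlongrightarrow> 0) (inf at_infinity (principal \<Omega>))"
  shows "essential_spectrum (lborel_on \<Omega>) (magnetic_laplacian \<Omega> A) = of_real ` {pi\<^sup>2 / d\<^sup>2 ..}"
proof -
  interpret strip a b d \<beta>
    using curvature_decay[of 0] by (intro strip.intro d_pos a_smooth b_smooth arc_length thin injective) simp
  have strip_eq: "strip.\<Omega> a b d = curved_strip a b d" by (rule \<Omega>_def)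
  have A: "continuous_on UNIV A" by (rule C1_continuous[OF A_C1])
  note decay = A_decay[unfolded assms(1), folded strip_eq]
  obtain B where B: "B \<ge> 0" "\<And>q e. q \<in> strip.\<Omega> a b d \<Longrightarrow> e \<in> Basis \<Longrightarrow> \<bar>A q \<bullet> e\<bar> \<le> B"
    using vector_field_bounded[OF decay A] by blast
  interpret magnetic_strip a b d \<beta> A B
    by (intro magnetic_strip.intro magnetic_strip_axioms.intro bounded_potential.intro strip_axioms open_\<Omega> A B vector_field_small decay)
  show ?thesis unfolding assms(1) using essential_spectrum_strip unfolding strip_eq by (simp add: power_divide)
qed

end
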